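(* Let $\Omega\subset\mathbb{R}^N$, $N\ge2$, be a bounded domain with boundary $\Gamma$ of class $C^2$, and let $u,v\in C^2(\overline\Omega)$ both satisfy $\Delta u=\Delta v=N$ in $\Omega$. Set $\overline u=\max_{\overline\Omega}u=\max_\Gamma u$ and $P=\frac12|\nabla u|^2+(\overline u-u)$ on $\overline\Omega$. Then $$\int_\Omega(\overline u-u)\Delta P\,dx+\int_\Omega\langle(I-\nabla^2v)\nabla u,\nabla u\rangle\,dx=\int_\Gamma(\overline u-u)\langle\nabla^2u\,\nabla u,\nu\rangle\,dS_x+\frac12\int_\Gamma|\nabla u|^2(u_\nu+v_\nu)\,dS_x-\int_\Gamma\langle\nabla v,\nabla u\rangle u_\nu\,dS_x-\int_\Gamma(\overline u-u)u_\nu\,dS_x+N\int_\Gamma(\overline u-u)(u_\nu-v_\nu)\,dS_x.$$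
   Context: $\nu$ is the exterior unit normal to $\Gamma$, $w_\nu=\langle\nabla w,\nu\rangle$; $I$ is the $N\times N$ identity matrix and $\nabla^2$ the Hessian. Note $\Delta P=|\nabla^2u|^2-(\Delta u)^2/N$. *)

theory Defs
  imports "HOL-Analysis.Analysis"
begin

text \<open>delta-approximating Hausdorff content of dimension d, normalised by the volume
of the d-dimensional unit ball so that it agrees with surface area.\<close>
definition hausdorff_pre :: "nat \<Rightarrow> real \<Rightarrow> ('a::euclidean_space) set \<Rightarrow> ennreal" where
  "hausdorff_pre d \<delta> S =
     (INF C \<in> {C :: nat \<Rightarrow> 'a set. S \<subseteq> (\<Union>i. C i) \<and> (\<forall>i. bounded (C i) \<and> diameter (C i) \<le> \<delta>)}.
        (\<Sum>i. ennreal (unit_ball_vol (real d) * (diameter (C i) / 2) ^ d)))"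

definition hausdorff_outer :: "nat \<Rightarrow> ('a::euclidean_space) set \<Rightarrow> ennreal" where
  "hausdorff_outer d S = (SUP \<delta> \<in> {0<..}. hausdorff_pre d \<delta> S)"

definition hausdorff_measure :: "nat \<Rightarrow> ('a::euclidean_space) measure" where
  "hausdorff_measure d = measure_of UNIV (sets borel) (hausdorff_outer d)"

definition surface_integral :: "(real^'n) set \<Rightarrow> (real^'n \<Rightarrow> real) \<Rightarrow> real" where
  "surface_integral G f = (LINT x:G | hausdorff_measure (CARD('n) - 1). f x)"

definition C2_on :: "(real^'n) set \<Rightarrow> (real^'n \<Rightarrow> real) \<Rightarrow> (real^'n \<Rightarrow> real^'n)
                      \<Rightarrow> (real^'n \<Rightarrow> real^'n^'n) \<Rightarrow> bool" where
  "C2_on S f Df D2f \<longleftrightarrow>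
     (\<forall>x\<in>S. (f has_derivative (\<lambda>h. Df x \<bullet> h)) (at x)) \<and>
     (\<forall>x\<in>S. (Df has_derivative (\<lambda>h. D2f x *v h)) (at x)) \<and>
     continuous_on S D2f"

text \<open>u \<in> C^2(closure \<Omega>): u is C^2 in \<Omega> and u, its gradient Du and its Hessian D2u
extend continuously to closure \<Omega>; Du, D2u denote these extensions.\<close>
definition C2_closure :: "(real^'n) set \<Rightarrow> (real^'n \<Rightarrow> real) \<Rightarrow> (real^'n \<Rightarrow> real^'n)
                      \<Rightarrow> (real^'n \<Rightarrow> real^'n^'n) \<Rightarrow> bool" where
  "C2_closure \<Omega> f Df D2f \<longleftrightarrow>
     C2_on \<Omega> f Df D2f \<and> continuous_on (closure \<Omega>) f \<and>
     continuous_on (closure \<Omega>) Df \<and> continuous_on (closure \<Omega>) D2f"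

definition local_defining_function ::
  "(real^'n) set \<Rightarrow> real^'n \<Rightarrow> real \<Rightarrow> (real^'n \<Rightarrow> real) \<Rightarrow> (real^'n \<Rightarrow> real^'n) \<Rightarrow> bool" where
  "local_defining_function \<Omega> p r \<phi> D\<phi> \<longleftrightarrow>
     0 < r \<and> (\<exists>D2\<phi>. C2_on (ball p r) \<phi> D\<phi> D2\<phi>) \<and>
     (\<forall>x\<in>ball p r. D\<phi> x \<noteq> 0) \<and>
     (\<forall>x\<in>ball p r. x \<in> \<Omega> \<longleftrightarrow> \<phi> x < 0) \<and>
     (\<forall>x\<in>ball p r. x \<in> frontier \<Omega> \<longleftrightarrow> \<phi> x = 0)"

definition C2_boundary :: "(real^'n) set \<Rightarrow> bool" where
  "C2_boundary \<Omega> \<longleftrightarrow> (\<forall>p\<in>frontier \<Omega>. \<exists>r \<phi> D\<phi>. local_defining_function \<Omega> p r \<phi> D\<phi>)"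

definition exterior_unit_normal :: "(real^'n) set \<Rightarrow> (real^'n \<Rightarrow> real^'n) \<Rightarrow> bool" where
  "exterior_unit_normal \<Omega> \<nu> \<longleftrightarrow>
     (\<forall>p\<in>frontier \<Omega>. \<exists>r \<phi> D\<phi>. local_defining_function \<Omega> p r \<phi> D\<phi> \<and>
        (\<forall>x\<in>frontier \<Omega> \<inter> ball p r. \<nu> x = D\<phi> x /\<^sub>R norm (D\<phi> x)))"

definition partial_deriv :: "(real^'n \<Rightarrow> real) \<Rightarrow> 'n \<Rightarrow> real^'n \<Rightarrow> real" where
  "partial_deriv f i x = deriv (\<lambda>t. f (x + t *\<^sub>R axis i 1)) 0"

definition laplacian :: "(real^'n \<Rightarrow> real) \<Rightarrow> real^'n \<Rightarrow> real" where
  "laplacian f x = (\<Sum>i\<in>UNIV. partial_deriv (partial_deriv f i) i x)"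

end

(*
  With w = max u - u, the field
    F = w (D^2u Du - Du) + |Du|^2 (Du + Dv) / 2 - <Dv, Du> Du + N w (Du - Dv)
  has divergence w (Delta P) + <(I - D^2v) Du, Du>, so the identity is the divergence theorem for F.

  Delta P involves third derivatives of u.  They exist in the interior: Du is the
  average of itself over balls for a weight of class C^1, integration by parts expresses D^2u through
  Du and the gradient of the weight, and this expression can be differentiated once more.
  Up to the boundary F is only continuous, and div F is bounded.

  For the surface integral, the boundary near a point is projected along a transversal direction e,
  and the fundamental theorem of calculus on the lines parallel to e gives the divergence theorem
  with the flux measure of e.  The flux is additive in e, hence it equals (nu . e) times a surface
  measure that does not depend on e and whose density with respect to projection along the normal
  is one.  A Vitali covering argument and the isodiametric inequality, obtained from a
  symmetrization by difference sets, identify that measure with Hausdorff measure.  A partition of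
  unity globalizes.
*)
theory Submission
  imports Defs
begin

section \<open>Hausdorff measure\<close>

text \<open>The field is forced by cancellation. With w = max u - u one has Dw = -Du, and div (w DP)
  = w (Delta P) - <Du, D^2u Du> + |Du|^2. The Pohozaev-type terms |Du|^2 (Du + Dv) / 2 - <Dv, Du> Du
  contribute <D^2u Du, Du> - <D^2v Du, Du> + N |Du|^2 - N <Du, Dv>, and the last term of F removes
  the multiples of N, because Du - Dv is divergence free. The third derivatives of u may be
  unbounded near the boundary, but in div F they occur only through the gradient of the constant
  Delta u and vanish; hence the bound on div F. The two halves of the identification with Hausdorff
  measure have different sources. A lower bound must hold against coverings by arbitrary sets, hence
  the isodiametric inequality; an upper bound may choose its covering, hence balls from Vitali's
  lemma. Both are used only up to a factor that tends to one at small scales, so the turning of the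
  normal does no harm.\<close>

lemma metric_outer_measure_closed:
  fixes f :: "'a::metric_space set \<Rightarrow> ennreal"
  assumes oms: "outer_measure_space (Pow UNIV) f"
    and sep: "\<And>A B \<eta>. 0 < \<eta> \<Longrightarrow> (\<And>a b. a \<in> A \<Longrightarrow> b \<in> B \<Longrightarrow> \<eta> \<le> dist a b) \<Longrightarrow> f A + f B \<le> f (A \<union> B)"
    and F: "closed F"
  shows "F \<in> lambda_system UNIV (Pow UNIV) f"
proof -
  interpret sigma_algebra UNIV "Pow UNIV :: 'a set set" by (rule sigma_algebra_Pow)
  have pos: "positive (Pow UNIV) f" and inc: "increasing (Pow UNIV) f"
    and csa: "countably_subadditive (Pow UNIV) f"
    using oms by (auto simp: outer_measure_space_def)
  have mono: "f A \<le> f B" if "A \<subseteq> B" for A B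
    using inc that by (auto simp: increasing_def)
  have sa: "subadditive (Pow UNIV) f"
    by (rule countably_subadditive_subadditive[OF pos csa])
  have sub2: "f (A \<union> B) \<le> f A + f B" for A B
    using subadditiveD[OF sa, of A "B - A"] mono[of "B - A" B] by (auto intro: order_trans add_left_mono)
  \<comment> \<open>\<open>countably_subadditive\<close> speaks of disjoint families, so an
    arbitrary sequence is first made disjoint with \<open>disjointed\<close>.\<close>
  have subU: "f (\<Union>i. A i) \<le> (\<Sum>i. f (A i))" for A :: "nat \<Rightarrow> 'a set"
  proof -
    have "f (\<Union>i. A i) = f (\<Union>i. disjointed A i)"
      by (simp add: UN_disjointed_eq)
    also have "\<dots> \<le> (\<Sum>i. f (disjointed A i))"
      using csa[unfolded countably_subadditive_def, rule_format, of "disjointed A"]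
      by (auto simp: disjoint_family_disjointed)
    also have "\<dots> \<le> (\<Sum>i. f (A i))"
      by (intro suminf_le mono disjointed_subset) auto
    finally show ?thesis .
  qed
  show ?thesis
  proof (cases "F = {}")
    case True
    then show ?thesis using lambda_system_empty[OF pos] by simp
  next
    case False
    have main: "f (A \<inter> F) + f (A - F) \<le> f A" if fin: "f A < top" for A
    proof -
      define E where "E n = {x\<in>A. 1 / real (Suc n) \<le> infdist x F}" for n
      define D where "D n = {x\<in>A. 1 / real (Suc (Suc n)) \<le> infdist x F \<and> infdist x F < 1 / real (Suc n)}" for n
      have E_sub: "E n \<subseteq> A" "D n \<subseteq> A" for n by (auto simp: E_def D_def)
      have E_mono: "E n \<subseteq> E (Suc n)" for n
      proof -
        have "1 / real (Suc (Suc n)) \<le> 1 / real (Suc n)" by (simp add: field_simps)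
        then show ?thesis by (auto simp: E_def)
      qed
      \<comment> \<open>Points of \<open>E n\<close> have distance at least 1/(n+1) from
        \<open>F\<close>, points of \<open>D (Suc n)\<close> less than 1/(n+2). By the triangle
        inequality for \<open>infdist\<close> the two sets are positively separated, so
        \<open>sep\<close> applies. Neighbouring shells may touch, which is why the index jumps by
        two.\<close>
      have step: "f (E n) + f (D (Suc n)) \<le> f (E (Suc (Suc n)))" for n
      proof -
        have "f (E n) + f (D (Suc n)) \<le> f (E n \<union> D (Suc n))"
        proof (rule sep)
          have "1 / real (Suc (Suc n)) < 1 / real (Suc n)" by (rule divide_strict_left_mono) auto
          then show "0 < 1 / real (Suc n) - 1 / real (Suc (Suc n))" by simp
          fix a b assume "a \<in> E n" "b \<in> D (Suc n)"
          then have "1 / real (Suc n) \<le> infdist a F" "infdist b F < 1 / real (Suc (Suc n))"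
            by (auto simp: E_def D_def)
          moreover have "infdist a F \<le> infdist b F + dist a b"
            by (rule infdist_triangle)
          ultimately show "1 / real (Suc n) - 1 / real (Suc (Suc n)) \<le> dist a b" by linarith
        qed
        also have "\<dots> \<le> f (E (Suc (Suc n)))"
          using E_mono[of n] E_mono[of "Suc n"]
          by (intro mono) (auto simp: E_def D_def)
        finally show ?thesis .
      qed
      \<comment> \<open>Summing \<open>step\<close> telescopes the even and the odd shells
        separately, which leaves two terms on the right. Since \<open>f A\<close> is finite the
        shell values are summable, and their tails control what \<open>E n\<close> misses of
        \<open>A - F\<close>.\<close>
      have "(\<Sum>k<n. f (D (Suc k))) \<le> f (E n) + f (E (Suc n))" for n
      proof (induction n)
        case (Suc n)
        have "(\<Sum>k<Suc n. f (D (Suc k))) \<le> f (E n) + f (E (Suc n)) + f (D (Suc n))"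
          using Suc by (simp add: add_right_mono)
        also have "\<dots> \<le> f (E (Suc (Suc n))) + f (E (Suc n))"
          using step[of n] by (metis add.commute add.left_commute add_left_mono)
        finally show ?case by (simp add: add.commute)
      qed simp
      then have "(\<Sum>k<n. f (D (Suc k))) \<le> f A + f A" for n
        by (meson E_sub add_mono mono order_trans)
      then have "(\<Sum>k. f (D (Suc k))) \<le> f A + f A"
        by (intro suminf_le_const) auto
      then have finS: "(\<Sum>k. f (D (Suc k))) \<noteq> top"
        using fin by (auto simp: top_unique)
      have finD: "f (D n) < top" for n using mono[OF E_sub(2)] fin by (meson le_less_trans)
      define r where "r k = enn2real (f (D (Suc k)))" for k
      have r: "ennreal (r k) = f (D (Suc k))" "0 \<le> r k" for k
        using finD by (auto simp: r_def)
      have sr: "summable r"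
        using finS r by (intro summable_suminf_not_top) (auto simp: r)
      show ?thesis
      proof (rule ennreal_le_epsilon)
        fix e :: real assume e: "0 < e" 
        from suminf_exist_split[OF e sr] obtain n where n: "norm (\<Sum>i. r (i + n)) < e" by auto
        have "(\<Sum>k. f (D (Suc (k + n)))) = (\<Sum>k. ennreal (r (k + n)))" by (simp add: r)
        also have "\<dots> = ennreal (\<Sum>i. r (i + n))"
          using sr r(2) by (intro suminf_ennreal2) (auto simp: summable_iff_shift)
        also have "\<dots> \<le> ennreal e" using n by (intro ennreal_leI) auto
        finally have tail: "(\<Sum>k. f (D (Suc (k + n)))) \<le> ennreal e" .
        have "A - F \<subseteq> E (Suc n) \<union> (\<Union>k. D (Suc (k + n)))"
        proof
          fix x assume x: "x \<in> A - F"
          then have p: "0 < infdist x F"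
            using F False by (simp add: in_closed_iff_infdist_zero infdist_nonneg order_less_le)
          show "x \<in> E (Suc n) \<union> (\<Union>k. D (Suc (k + n)))"
          proof (cases "x \<in> E (Suc n)")
            case False
            obtain m where m: "1 / real (Suc m) < infdist x F"
              using p nat_approx_posE by blast
            \<comment> \<open>The least such index singles out the shell that contains
              \<open>x\<close>; one exists because \<open>F\<close> is closed and \<open>x\<close>
              lies outside it.\<close>
            define l where "l = (LEAST m. 1 / real (Suc m) \<le> infdist x F)"
            have l: "1 / real (Suc l) \<le> infdist x F"
              unfolding l_def by (rule LeastI[of _ m]) (use m in simp)
            have g: "Suc n < l"
            proof (rule ccontr)
              assume "\<not> Suc n < l"
              then have "1 / real (Suc (Suc n)) \<le> 1 / real (Suc l)" by (simp add: field_simps)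
              with l False x show False by (auto simp: E_def)
            qed
            then obtain j where j: "l = Suc (Suc (j + n))"
              by (metis add.commute add_Suc_right less_imp_Suc_add)
            have "\<not> 1 / real (Suc (Suc (j + n))) \<le> infdist x F"
              using not_less_Least[of "Suc (j + n)" "\<lambda>m. 1 / real (Suc m) \<le> infdist x F", folded l_def] j
              by simp
            with l j x have "x \<in> D (Suc (j + n))" by (auto simp: D_def)
            then show ?thesis by blast
          qed auto
        qed
        then have "f (A - F) \<le> f (E (Suc n) \<union> (\<Union>k. D (Suc (k + n))))" by (rule mono)
        also have "\<dots> \<le> f (E (Suc n)) + (\<Sum>k. f (D (Suc (k + n))))"
          using sub2 subU by (meson add_left_mono order_trans)
        also have "\<dots> \<le> f (E (Suc n)) + e" using tail by (rule add_left_mono)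
        finally have "f (A \<inter> F) + f (A - F) \<le> f (A \<inter> F) + f (E (Suc n)) + e"
          by (simp add: add.assoc add_left_mono)
        also have "f (A \<inter> F) + f (E (Suc n)) \<le> f (A \<inter> F \<union> E (Suc n))"
        proof (rule sep)
          show "0 < 1 / real (Suc (Suc n))" by simp
          fix a b assume "a \<in> A \<inter> F" "b \<in> E (Suc n)"
          then show "1 / real (Suc (Suc n)) \<le> dist a b"
            using infdist_le[of a F b] by (auto simp: E_def dist_commute intro: order_trans)
        qed
        also have "f (A \<inter> F \<union> E (Suc n)) \<le> f A" by (intro mono) (auto simp: E_def)
        finally show "f (A \<inter> F) + f (A - F) \<le> f A + ennreal e"
          by (simp add: add_right_mono)
      qed
    qed
    have "f (A \<inter> F) + f (A - F) = f A" for A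
    proof (rule antisym)
      show "f (A \<inter> F) + f (A - F) \<le> f A"
        using main[of A] by (cases "f A = top") (auto simp: top.not_eq_extremum)
      have "f A = f ((A \<inter> F) \<union> (A - F))" by (rule arg_cong[of _ _ f]) auto
      then show "f A \<le> f (A \<inter> F) + f (A - F)" using sub2 by simp
    qed
    then show ?thesis by (subst lambda_system_eq) auto
  qed
qed

text \<open>The value \<open>top\<close> on inadmissible sets turns coverings by sets of diameter at
  most \<delta> into unrestricted coverings, so that \<open>hausdorff_pre\<close> becomes an
  instance of \<open>outer_measure\<close>.\<close>

definition hausdorff_gauge :: "nat \<Rightarrow> real \<Rightarrow> ('a::euclidean_space) set \<Rightarrow> ennreal" where
  "hausdorff_gauge d \<delta> C =
     (if bounded C \<and> diameter C \<le> \<delta> then ennreal (unit_ball_vol (real d) * (diameter C / 2) ^ d) else top)"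

text \<open>The empty set has diameter 0, and \<open>0 ^ 0 = 1\<close> would give it positive
  content in dimension zero; hence the bound on \<open>d\<close> that runs through the
  section.\<close>

lemma positive_hausdorff_gauge:
  assumes "1 \<le> d" "0 < \<delta>" shows "positive (Pow UNIV) (hausdorff_gauge d \<delta>)"
  using assms by (auto simp: positive_def hausdorff_gauge_def)

lemma increasing_hausdorff_gauge: "increasing (Pow UNIV) (hausdorff_gauge d \<delta>)"
  unfolding increasing_def hausdorff_gauge_def
proof (intro ballI impI, goal_cases)
  case (1 x y)
  show ?case
  proof (cases "bounded y \<and> diameter y \<le> \<delta>")
    case True
    then have "bounded x" "diameter x \<le> diameter y" "0 \<le> diameter x"
      using 1 bounded_subset diameter_subset diameter_ge_0 by blast+
    with True show ?thesis
      by (auto intro!: ennreal_leI mult_left_mono power_mono unit_ball_vol_nonneg)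
  qed auto
qed

text \<open>\<open>outer_measure\<close> ranges over disjoint coverings,
  \<open>hausdorff_pre\<close> over arbitrary ones. Monotonicity of the gauge bridges this, and a
  covering with an inadmissible member costs \<open>top\<close> and does not affect the
  infimum.\<close>

lemma hausdorff_pre_eq_outer_measure:
  assumes "1 \<le> d" "0 < \<delta>"
  shows "hausdorff_pre d \<delta> S = outer_measure (Pow UNIV) (hausdorff_gauge d \<delta>) S"
proof (rule antisym)
  show "outer_measure (Pow UNIV) (hausdorff_gauge d \<delta>) S \<le> hausdorff_pre d \<delta> S"
    unfolding hausdorff_pre_def
  proof (rule INF_greatest, goal_cases)
    case (1 C)
    have "outer_measure (Pow UNIV) (hausdorff_gauge d \<delta>) S \<le> (\<Sum>i. hausdorff_gauge d \<delta> (C i))"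
      using 1 by (intro ring_of_sets.outer_measure_le[OF ring_of_sets_Pow] positive_hausdorff_gauge assms increasing_hausdorff_gauge)
        auto
    also have "\<dots> = (\<Sum>i. ennreal (unit_ball_vol (real d) * (diameter (C i) / 2) ^ d))"
      using 1 by (simp add: hausdorff_gauge_def)
    finally show ?case .
  qed
  show "hausdorff_pre d \<delta> S \<le> outer_measure (Pow UNIV) (hausdorff_gauge d \<delta>) S"
    unfolding outer_measure_def
  proof (rule INF_greatest, goal_cases)
    case (1 C)
    show ?case
    proof (cases "\<forall>i. bounded (C i) \<and> diameter (C i) \<le> \<delta>")
      case True
      then have "hausdorff_pre d \<delta> S \<le> (\<Sum>i. ennreal (unit_ball_vol (real d) * (diameter (C i) / 2) ^ d))"
        unfolding hausdorff_pre_def using 1 by (intro INF_lower) auto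
      also have "\<dots> = (\<Sum>i. hausdorff_gauge d \<delta> (C i))"
        using True by (simp add: hausdorff_gauge_def)
      finally show ?thesis .
    next
      case False
      then obtain i where "\<not> (bounded (C i) \<and> diameter (C i) \<le> \<delta>)" by blast
      then have "hausdorff_gauge d \<delta> (C i) = top" unfolding hausdorff_gauge_def by (rule if_not_P)
      moreover have "hausdorff_gauge d \<delta> (C i) \<le> (\<Sum>i. hausdorff_gauge d \<delta> (C i))"
        using sum_le_suminf[of "\<lambda>i. hausdorff_gauge d \<delta> (C i)" "{i}"] by auto
      ultimately show ?thesis by (simp add: top_unique)
    qed
  qed
qed

lemma outer_measure_space_hausdorff_pre:
  assumes "1 \<le> d" "0 < \<delta>"
  shows "outer_measure_space (Pow UNIV) (hausdorff_pre d \<delta> :: 'a::euclidean_space set \<Rightarrow> ennreal)"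
proof -
  have "hausdorff_pre d \<delta> = (outer_measure (Pow UNIV) (hausdorff_gauge d \<delta>) :: 'a set \<Rightarrow> ennreal)"
    using hausdorff_pre_eq_outer_measure[OF assms] by blast
  then show ?thesis
    using ring_of_sets.outer_measure_space_outer_measure[OF ring_of_sets_Pow
      positive_hausdorff_gauge[OF assms] increasing_hausdorff_gauge] by simp
qed

lemma hausdorff_pre_mono:
  assumes "A \<subseteq> B" shows "hausdorff_pre d \<delta> A \<le> hausdorff_pre d \<delta> B"
  unfolding hausdorff_pre_def by (rule INF_superset_mono) (use assms in auto)

lemma hausdorff_pre_antimono:
  assumes "\<delta> \<le> \<delta>'" shows "hausdorff_pre d \<delta>' A \<le> hausdorff_pre d \<delta> A"
  unfolding hausdorff_pre_def
proof (rule INF_superset_mono)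
  show "{C :: nat \<Rightarrow> 'a set. A \<subseteq> (\<Union>i. C i) \<and> (\<forall>i. bounded (C i) \<and> diameter (C i) \<le> \<delta>)}
     \<subseteq> {C. A \<subseteq> (\<Union>i. C i) \<and> (\<forall>i. bounded (C i) \<and> diameter (C i) \<le> \<delta>')}"
    using assms by (auto intro: order_trans)
qed auto

lemma hausdorff_pre_UN:
  assumes d: "1 \<le> d" "0 < \<delta>"
  shows "hausdorff_pre d \<delta> (\<Union>i. A i) \<le> (\<Sum>i. hausdorff_pre d \<delta> (A i))"
proof -
  have csa: "countably_subadditive (Pow UNIV) (hausdorff_pre d \<delta> :: 'a set \<Rightarrow> ennreal)"
    using outer_measure_space_hausdorff_pre[OF d] by (auto simp: outer_measure_space_def)
  have "hausdorff_pre d \<delta> (\<Union>i. A i) = hausdorff_pre d \<delta> (\<Union>i. disjointed A i)"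
    by (simp add: UN_disjointed_eq)
  also have "\<dots> \<le> (\<Sum>i. hausdorff_pre d \<delta> (disjointed A i))"
    using csa[unfolded countably_subadditive_def, rule_format, of "disjointed A"]
    by (auto simp: disjoint_family_disjointed)
  also have "\<dots> \<le> (\<Sum>i. hausdorff_pre d \<delta> (A i))"
    by (intro suminf_le hausdorff_pre_mono disjointed_subset) auto
  finally show ?thesis .
qed

lemma hausdorff_pre_empty: "1 \<le> d \<Longrightarrow> 0 < \<delta> \<Longrightarrow> hausdorff_pre d \<delta> {} = 0"
  using outer_measure_space_hausdorff_pre[of d \<delta>] by (auto simp: outer_measure_space_def positive_def)

lemma hausdorff_pre_Un:
  assumes d: "1 \<le> d" "0 < \<delta>"
  shows "hausdorff_pre d \<delta> (A \<union> B) \<le> hausdorff_pre d \<delta> A + hausdorff_pre d \<delta> B"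
proof -
  have "subadditive (Pow UNIV) (hausdorff_pre d \<delta> :: 'a set \<Rightarrow> ennreal)"
    using outer_measure_space_hausdorff_pre[OF d]
    by (intro ring_of_sets.countably_subadditive_subadditive[OF ring_of_sets_Pow])
      (auto simp: outer_measure_space_def)
  from subadditiveD[OF this, of A "B - A"]
  have "hausdorff_pre d \<delta> (A \<union> B) \<le> hausdorff_pre d \<delta> A + hausdorff_pre d \<delta> (B - A)" by auto
  also have "\<dots> \<le> hausdorff_pre d \<delta> A + hausdorff_pre d \<delta> B"
    by (intro add_left_mono hausdorff_pre_mono) auto
  finally show ?thesis .
qed

lemma hausdorff_pre_finite_UN:
  assumes d: "1 \<le> d" "0 < \<delta>" and "finite I"
  shows "hausdorff_pre d \<delta> (\<Union>i\<in>I. A i) \<le> (\<Sum>i\<in>I. hausdorff_pre d \<delta> (A i))"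
  using \<open>finite I\<close>
proof (induction I)
  case empty
  then show ?case using hausdorff_pre_empty[OF d] by simp
next
  case (insert x F)
  have "hausdorff_pre d \<delta> (\<Union>i\<in>insert x F. A i) \<le> hausdorff_pre d \<delta> (A x) + hausdorff_pre d \<delta> (\<Union>i\<in>F. A i)"
    using hausdorff_pre_Un[OF d] by simp
  also have "\<dots> \<le> hausdorff_pre d \<delta> (A x) + (\<Sum>i\<in>F. hausdorff_pre d \<delta> (A i))"
    using insert by (intro add_left_mono)
  finally show ?case using insert by simp
qed

lemma hausdorff_pre_le:
  assumes "1 \<le> d" "0 < \<delta>" "bounded C" "diameter C \<le> \<delta>"
  shows "hausdorff_pre d \<delta> C \<le> ennreal (unit_ball_vol (real d) * (diameter C / 2) ^ d)"
proof -
  define A :: "nat \<Rightarrow> 'a set" where "A i = (if i = 0 then C else {})" for i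
  have "hausdorff_pre d \<delta> C \<le> (\<Sum>i. ennreal (unit_ball_vol (real d) * (diameter (A i) / 2) ^ d))"
    unfolding hausdorff_pre_def using assms
    by (intro INF_lower) (auto simp: A_def split: if_splits)
  also have "\<dots> = (\<Sum>i\<in>{0}. ennreal (unit_ball_vol (real d) * (diameter (A i) / 2) ^ d))"
    using assms by (intro suminf_finite) (auto simp: A_def)
  finally show ?thesis by (simp add: A_def)
qed

lemma hausdorff_outer_mono: "A \<subseteq> B \<Longrightarrow> hausdorff_outer d A \<le> hausdorff_outer d B"
  unfolding hausdorff_outer_def by (intro SUP_mono) (auto intro: hausdorff_pre_mono)

lemma hausdorff_pre_le_outer: "0 < \<delta> \<Longrightarrow> hausdorff_pre d \<delta> A \<le> hausdorff_outer d A"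
  unfolding hausdorff_outer_def by (auto intro: SUP_upper)

lemma outer_measure_space_hausdorff_outer:
  assumes "1 \<le> d"
  shows "outer_measure_space (Pow UNIV) (hausdorff_outer d :: 'a::euclidean_space set \<Rightarrow> ennreal)"
  unfolding outer_measure_space_def
proof (intro conjI)
  show "positive (Pow UNIV) (hausdorff_outer d :: 'a set \<Rightarrow> ennreal)"
  proof -
    have "hausdorff_outer d ({} :: 'a set) \<le> 0"
      unfolding hausdorff_outer_def by (rule SUP_least) (simp add: hausdorff_pre_empty[OF assms])
    then show ?thesis by (auto simp: positive_def)
  qed
  show "increasing (Pow UNIV) (hausdorff_outer d :: 'a set \<Rightarrow> ennreal)"
    unfolding increasing_def by (auto intro: hausdorff_outer_mono)
  show "countably_subadditive (Pow UNIV) (hausdorff_outer d :: 'a set \<Rightarrow> ennreal)"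
    unfolding countably_subadditive_def
  proof (intro allI impI)
    fix A :: "nat \<Rightarrow> 'a set"
    show "hausdorff_outer d (\<Union>i. A i) \<le> (\<Sum>i. hausdorff_outer d (A i))"
      unfolding hausdorff_outer_def[of d "\<Union>i. A i"]
    proof (rule SUP_least)
      fix \<delta> :: real assume "\<delta> \<in> {0<..}"
      then have "hausdorff_pre d \<delta> (\<Union>i. A i) \<le> (\<Sum>i. hausdorff_pre d \<delta> (A i))"
        using assms by (intro hausdorff_pre_UN) auto
      also have "\<dots> \<le> (\<Sum>i. hausdorff_outer d (A i))"
        using \<open>\<delta> \<in> {0<..}\<close> by (intro suminf_le hausdorff_pre_le_outer) auto
      finally show "hausdorff_pre d \<delta> (\<Union>i. A i) \<le> (\<Sum>i. hausdorff_outer d (A i))" .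
    qed
  qed
qed

text \<open>A covering set of diameter below \<eta> cannot meet both \<open>A\<close> and
  \<open>B\<close>. Every fine covering of the union therefore splits into a covering of each, where
  discarded members are replaced by \<open>{}\<close> at no cost.\<close>

lemma hausdorff_outer_separated:
  assumes d: "1 \<le> d" and \<eta>: "0 < \<eta>" and sep: "\<And>a b. a \<in> A \<Longrightarrow> b \<in> B \<Longrightarrow> \<eta> \<le> dist a b"
  shows "hausdorff_outer d A + hausdorff_outer d B \<le> hausdorff_outer d (A \<union> B)"
proof -
  have pre: "hausdorff_pre d \<delta> A + hausdorff_pre d \<delta> B \<le> hausdorff_pre d \<delta> (A \<union> B)" if \<delta>: "0 < \<delta>" "\<delta> < \<eta>" for \<delta>
    unfolding hausdorff_pre_def[of d \<delta> "A \<union> B"]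
  proof (rule INF_greatest)
    fix C :: "nat \<Rightarrow> 'a set"
    assume C: "C \<in> {C. A \<union> B \<subseteq> (\<Union>i. C i) \<and> (\<forall>i. bounded (C i) \<and> diameter (C i) \<le> \<delta>)}"
    let ?g = "\<lambda>i. ennreal (unit_ball_vol (real d) * (diameter (C i) / 2) ^ d)"
    let ?CA = "\<lambda>i. if C i \<inter> A \<noteq> {} then C i else {}"
    let ?CB = "\<lambda>i. if C i \<inter> A = {} then C i else {}"
    let ?gA = "\<lambda>i. ennreal (unit_ball_vol (real d) * (diameter (?CA i) / 2) ^ d)"
    let ?gB = "\<lambda>i. ennreal (unit_ball_vol (real d) * (diameter (?CB i) / 2) ^ d)"
    have "A \<subseteq> (\<Union>i. ?CA i)" using C by fastforce
    then have 1: "hausdorff_pre d \<delta> A \<le> (\<Sum>i. ?gA i)"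
      unfolding hausdorff_pre_def using C \<delta> by (intro INF_lower) auto
    have "B \<subseteq> (\<Union>i. ?CB i)"
    proof
      fix b assume b: "b \<in> B"
      with C obtain i where i: "b \<in> C i" by auto
      have "C i \<inter> A = {}"
      proof (rule ccontr)
        assume "C i \<inter> A \<noteq> {}"
        then obtain a where a: "a \<in> C i" "a \<in> A" by auto
        have "dist a b \<le> diameter (C i)"
          using C a i by (intro diameter_bounded_bound) auto
        moreover have "\<eta> \<le> dist a b" using sep a b by auto
        moreover have "diameter (C i) \<le> \<delta>" using C by auto
        ultimately show False using \<delta> by auto
      qed
      with i show "b \<in> (\<Union>i. ?CB i)" by auto
    qed
    then have 2: "hausdorff_pre d \<delta> B \<le> (\<Sum>i. ?gB i)"
      unfolding hausdorff_pre_def using C \<delta> by (intro INF_lower) auto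
    have "(\<Sum>i. ?gA i) + (\<Sum>i. ?gB i) = (\<Sum>i. ?gA i + ?gB i)"
      by (rule suminf_add) auto
    also have "\<dots> = (\<Sum>i. ?g i)"
      using d by (intro suminf_cong) (auto simp: power_0_left)
    finally show "hausdorff_pre d \<delta> A + hausdorff_pre d \<delta> B \<le> (\<Sum>i. ?g i)"
      using add_mono[OF 1 2] by simp
  qed
  have "hausdorff_pre d \<delta> A + hausdorff_pre d \<delta>' B \<le> hausdorff_outer d (A \<union> B)"
    if "0 < \<delta>" "0 < \<delta>'" for \<delta> \<delta>'
  proof -
    define m where "m = min (min \<delta> \<delta>') (\<eta>/2)"
    have m: "0 < m" "m \<le> \<delta>" "m \<le> \<delta>'" "m < \<eta>" using that \<eta> by (auto simp: m_def)
    have "hausdorff_pre d \<delta> A + hausdorff_pre d \<delta>' B \<le> hausdorff_pre d m A + hausdorff_pre d m B"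
      using m by (intro add_mono hausdorff_pre_antimono) auto
    also have "\<dots> \<le> hausdorff_pre d m (A \<union> B)" using m pre by auto
    also have "\<dots> \<le> hausdorff_outer d (A \<union> B)" using m by (intro hausdorff_pre_le_outer)
    finally show ?thesis .
  qed
  then have "hausdorff_pre d \<delta> A + hausdorff_outer d B \<le> hausdorff_outer d (A \<union> B)" if "0 < \<delta>" for \<delta>
    unfolding hausdorff_outer_def[of d B] using that
    by (subst ennreal_SUP_add_right) (auto intro!: SUP_least simp del: SUP_const)
  then show ?thesis
    unfolding hausdorff_outer_def[of d A]
    by (subst ennreal_SUP_add_left[symmetric]) (auto intro!: SUP_least simp del: SUP_const)
qed

lemma measure_space_hausdorff_outer:
  assumes d: "1 \<le> d"
  shows "measure_space UNIV (sets borel) (hausdorff_outer d :: 'a::euclidean_space set \<Rightarrow> ennreal)"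
proof -
  let ?f = "hausdorff_outer d :: 'a set \<Rightarrow> ennreal"
  let ?L = "lambda_system UNIV (Pow UNIV) ?f"
  have ms: "measure_space UNIV ?L ?f"
    by (rule sigma_algebra.caratheodory_lemma[OF sigma_algebra_Pow outer_measure_space_hausdorff_outer[OF d]])
  then have sa: "sigma_algebra UNIV ?L" by (simp add: measure_space_def)
  have "F \<in> ?L" if "closed F" for F
    by (rule metric_outer_measure_closed[OF outer_measure_space_hausdorff_outer[OF d] hausdorff_outer_separated[OF d] that])
  then have "{S. closed S} \<subseteq> ?L" by blast
  then have "sigma_sets UNIV {S. closed S} \<subseteq> ?L"
    by (rule sigma_algebra.sigma_sets_subset[OF sa])
  then have "sets borel \<subseteq> ?L"
    by (simp add: borel_eq_closed)
  moreover have "sigma_algebra UNIV (sets borel :: 'a set set)"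
    by (metis sets.sigma_algebra_axioms space_borel)
  ultimately show ?thesis
    using measure_down[OF ms] by blast
qed

lemma sets_hausdorff_measure [simp, measurable_cong]:
  "sets (hausdorff_measure d :: 'a::euclidean_space measure) = sets borel"
proof -
  have "sigma_sets UNIV (sets borel :: 'a set set) = sets borel"
    by (metis sets.sigma_sets_eq space_borel)
  then show ?thesis
    unfolding hausdorff_measure_def by (subst sets_measure_of) auto
qed

text \<open>\<open>measure_of\<close> returns the given set function only if that function is
  countably additive on the sigma-algebra; for \<open>hausdorff_outer\<close> on Borel sets this is
  what the Caratheodory argument supplies.\<close>

lemma emeasure_hausdorff_measure:
  assumes d: "1 \<le> d" and S: "S \<in> sets borel"
  shows "emeasure (hausdorff_measure d) S = hausdorff_outer d S"
  unfolding hausdorff_measure_def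
proof (rule emeasure_measure_of_sigma)
  have ms: "measure_space UNIV (sets borel) (hausdorff_outer d :: 'a set \<Rightarrow> ennreal)"
    by (rule measure_space_hausdorff_outer[OF d])
  then show "sigma_algebra UNIV (sets borel :: 'a set set)"
    "positive (sets borel) (hausdorff_outer d :: 'a set \<Rightarrow> ennreal)"
    "countably_additive (sets borel) (hausdorff_outer d :: 'a set \<Rightarrow> ennreal)"
    by (auto simp: measure_space_def)
qed (use S in auto)

section \<open>Integration along parallel lines\<close>

definition slab :: "'a::euclidean_space \<Rightarrow> 'a set" where
  "slab e = {x. 0 \<le> x \<bullet> e \<and> x \<bullet> e \<le> e \<bullet> e}"

lemma slab_borel [measurable]: "slab e \<in> sets borel"
  unfolding slab_def by measurable

lemma closed_slab: "closed (slab e)"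
  unfolding slab_def
  by (intro closed_Collect_conj closed_Collect_le continuous_intros)

lemma emeasure_slab_line:
  fixes e x :: "'a::euclidean_space"
  assumes "e \<noteq> 0"
  shows "emeasure lborel {t. x - t *\<^sub>R e \<in> slab e} = 1"
proof -
  have p: "0 < e \<bullet> e" using assms by simp
  have "{t. x - t *\<^sub>R e \<in> slab e} = {(x \<bullet> e) / (e \<bullet> e) - 1 .. (x \<bullet> e) / (e \<bullet> e)}"
    using p by (auto simp: slab_def inner_diff_left field_simps)
  then show ?thesis by simp
qed

lemma nn_integral_lborel_shift:
  fixes f :: "'a::euclidean_space \<Rightarrow> ennreal"
  assumes [measurable]: "f \<in> borel_measurable borel"
  shows "(\<integral>\<^sup>+x. f (x + c) \<partial>lborel) = (\<integral>\<^sup>+x. f x \<partial>lborel)"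
proof -
  have "(\<integral>\<^sup>+x. f x \<partial>lborel) = (\<integral>\<^sup>+x. f x \<partial>distr lborel borel ((+) c))"
    by (simp add: lborel_distr_plus)
  also have "\<dots> = (\<integral>\<^sup>+x. f (c + x) \<partial>lborel)" by (rule nn_integral_distr) auto
  finally show ?thesis by (simp add: add.commute)
qed

lemma integral_lborel_shift:
  fixes f :: "'a::euclidean_space \<Rightarrow> real"
  assumes [measurable]: "f \<in> borel_measurable borel"
  shows "(\<integral>x. f (x + c) \<partial>lborel) = (\<integral>x. f x \<partial>lborel)"
proof -
  have "(\<integral>x. f x \<partial>lborel) = (\<integral>x. f x \<partial>distr lborel borel ((+) c))"
    by (simp add: lborel_distr_plus)
  also have "\<dots> = (\<integral>x. f (c + x) \<partial>lborel)" by (rule integral_distr) auto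
  finally show ?thesis by (simp add: add.commute)
qed

text \<open>A slab meets every line parallel to \<^term>\<open>e\<close> in a parameter interval of length one, so
  integrating over the slab is the same as integrating over the hyperplane orthogonal to
  \<^term>\<open>e\<close>, with weight \<^term>\<open>norm e\<close>.  This avoids a type for the hyperplane.\<close>

lemma nn_integral_lines:
  fixes f :: "'a::euclidean_space \<Rightarrow> ennreal"
  assumes f [measurable]: "f \<in> borel_measurable borel" and e: "e \<noteq> 0"
  shows "(\<integral>\<^sup>+x. f x \<partial>lborel) =
    (\<integral>\<^sup>+x. indicator (slab e) x * (\<integral>\<^sup>+t. f (x + t *\<^sub>R e) \<partial>lborel) \<partial>lborel)"
proof -
  interpret P: pair_sigma_finite "lborel :: 'a measure" "lborel :: real measure" ..
  have "(\<integral>\<^sup>+x. indicator (slab e) x * (\<integral>\<^sup>+t. f (x + t *\<^sub>R e) \<partial>lborel) \<partial>lborel)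
      = (\<integral>\<^sup>+x. (\<integral>\<^sup>+t. indicator (slab e) x * f (x + t *\<^sub>R e) \<partial>lborel) \<partial>lborel)"
    by (intro nn_integral_cong nn_integral_cmult[symmetric]) auto
  also have "\<dots> = (\<integral>\<^sup>+t. (\<integral>\<^sup>+x. indicator (slab e) x * f (x + t *\<^sub>R e) \<partial>lborel) \<partial>lborel)"
    by (rule lborel_pair.Fubini'[symmetric]) measurable
  also have "\<dots> = (\<integral>\<^sup>+t. (\<integral>\<^sup>+x. indicator (slab e) (x - t *\<^sub>R e) * f x \<partial>lborel) \<partial>lborel)"
  proof (rule nn_integral_cong)
    fix t :: real
    have "(\<integral>\<^sup>+x. indicator (slab e) (x + t *\<^sub>R e - t *\<^sub>R e) * f (x + t *\<^sub>R e) \<partial>lborel)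
        = (\<integral>\<^sup>+x. indicator (slab e) (x - t *\<^sub>R e) * f x \<partial>lborel)"
      by (rule nn_integral_lborel_shift) measurable
    then show "(\<integral>\<^sup>+x. indicator (slab e) x * f (x + t *\<^sub>R e) \<partial>lborel)
        = (\<integral>\<^sup>+x. indicator (slab e) (x - t *\<^sub>R e) * f x \<partial>lborel)" by simp
  qed
  also have "\<dots> = (\<integral>\<^sup>+x. (\<integral>\<^sup>+t. indicator (slab e) (x - t *\<^sub>R e) * f x \<partial>lborel) \<partial>lborel)"
    by (rule lborel_pair.Fubini') measurable
  also have "\<dots> = (\<integral>\<^sup>+x. f x \<partial>lborel)"
  proof (rule nn_integral_cong)
    fix x
    have m: "{t. x - t *\<^sub>R e \<in> slab e} \<in> sets borel" by measurable
    have "(\<integral>\<^sup>+t. indicator (slab e) (x - t *\<^sub>R e) * f x \<partial>lborel)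
        = (\<integral>\<^sup>+t. indicator {t. x - t *\<^sub>R e \<in> slab e} t * f x \<partial>lborel)"
      by (intro nn_integral_cong) (auto simp: indicator_def)
    also have "\<dots> = f x" using m emeasure_slab_line[OF e, of x]
      by (simp add: nn_integral_multc)
    finally show "(\<integral>\<^sup>+t. indicator (slab e) (x - t *\<^sub>R e) * f x \<partial>lborel) = f x" .
  qed
  finally show ?thesis by simp
qed

lemma emeasure_lines:
  assumes [measurable]: "A \<in> sets borel" and e: "e \<noteq> (0::'a::euclidean_space)"
  shows "emeasure lborel A =
    (\<integral>\<^sup>+x. indicator (slab e) x * emeasure lborel {t. x + t *\<^sub>R e \<in> A} \<partial>lborel)"
proof -
  have "emeasure lborel A = (\<integral>\<^sup>+x. indicator A x \<partial>lborel)" by simp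
  also have "\<dots> = (\<integral>\<^sup>+x. indicator (slab e) x * (\<integral>\<^sup>+t. indicator A (x + t *\<^sub>R e) \<partial>lborel) \<partial>lborel)"
    by (rule nn_integral_lines[OF _ e]) measurable
  also have "\<dots> = (\<integral>\<^sup>+x. indicator (slab e) x * emeasure lborel {t. x + t *\<^sub>R e \<in> A} \<partial>lborel)"
  proof (intro nn_integral_cong arg_cong2[where f="(*)"] refl)
    fix x
    have "{t. x + t *\<^sub>R e \<in> A} \<in> sets borel" by measurable
    then have "emeasure lborel {t. x + t *\<^sub>R e \<in> A} = (\<integral>\<^sup>+t. indicator {t. x + t *\<^sub>R e \<in> A} t \<partial>lborel)"
      by simp
    also have "\<dots> = (\<integral>\<^sup>+t. indicator A (x + t *\<^sub>R e) \<partial>lborel)"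
      by (intro nn_integral_cong) (auto simp: indicator_def)
    finally show "(\<integral>\<^sup>+t. indicator A (x + t *\<^sub>R e) \<partial>lborel) = emeasure lborel {t. x + t *\<^sub>R e \<in> A}" ..
  qed
  finally show ?thesis .
qed

lemma integral_lines:
  fixes f :: "'a::euclidean_space \<Rightarrow> real"
  assumes f: "integrable lborel f" and e: "e \<noteq> 0"
  shows "(\<integral>x. f x \<partial>lborel) =
    (\<integral>x. indicator (slab e) x * (\<integral>t. f (x + t *\<^sub>R e) \<partial>lborel) \<partial>lborel)"
proof -
  interpret P: pair_sigma_finite "lborel :: 'a measure" "lborel :: real measure" ..
  interpret Q: pair_sigma_finite "lborel :: real measure" "lborel :: 'a measure" ..
  have [measurable]: "f \<in> borel_measurable borel" using f by auto
  have fin: "(\<integral>\<^sup>+x. ennreal (norm (f x)) \<partial>lborel) < \<infinity>" using f by (auto simp: integrable_iff_bounded)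
  \<comment> \<open>Fubini is applied on both sides of the translation by
    \<open>t *\<^sub>R e\<close>, so joint integrability is needed before it (\<open>i1\<close>) and
    after it (\<open>i2\<close>).\<close>
  have i1: "integrable (lborel \<Otimes>\<^sub>M lborel) (\<lambda>(x, t). indicator (slab e) x * f (x + t *\<^sub>R e))"
  proof (rule integrableI_bounded)
    have "(\<integral>\<^sup>+z. ennreal (norm (case z of (x, t) \<Rightarrow> indicator (slab e) x * f (x + t *\<^sub>R e))) \<partial>(lborel \<Otimes>\<^sub>M lborel))
       = (\<integral>\<^sup>+x. (\<integral>\<^sup>+t. ennreal (norm (indicator (slab e) x * f (x + t *\<^sub>R e))) \<partial>lborel) \<partial>lborel)"
      by (subst lborel.nn_integral_fst[symmetric]) (auto simp: case_prod_unfold)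
    also have "\<dots> = (\<integral>\<^sup>+x. indicator (slab e) x * (\<integral>\<^sup>+t. ennreal (norm (f (x + t *\<^sub>R e))) \<partial>lborel) \<partial>lborel)"
      by (intro nn_integral_cong) (auto simp: indicator_def)
    also have "\<dots> = (\<integral>\<^sup>+x. ennreal (norm (f x)) \<partial>lborel)"
      by (rule nn_integral_lines[symmetric, OF _ e]) measurable
    finally show "(\<integral>\<^sup>+z. ennreal (norm (case z of (x, t) \<Rightarrow> indicator (slab e) x * f (x + t *\<^sub>R e))) \<partial>(lborel \<Otimes>\<^sub>M lborel)) < \<infinity>"
      using fin by simp
  qed measurable
  have il: "(\<integral>\<^sup>+t. indicator (slab e) (x - t *\<^sub>R e) \<partial>lborel) = 1" for x
  proof -
    have m: "{t. x - t *\<^sub>R e \<in> slab e} \<in> sets borel" by measurable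
    have "(\<integral>\<^sup>+t. indicator (slab e) (x - t *\<^sub>R e) \<partial>lborel) = (\<integral>\<^sup>+t. indicator {t. x - t *\<^sub>R e \<in> slab e} t \<partial>lborel)"
      by (intro nn_integral_cong) (auto simp: indicator_def)
    then show ?thesis using m emeasure_slab_line[OF e, of x] by simp
  qed
  have ir: "(\<integral>t. indicator (slab e) (x - t *\<^sub>R e) \<partial>lborel) = (1::real)" for x
  proof -
    have "(\<integral>\<^sup>+t. ennreal (indicator (slab e) (x - t *\<^sub>R e)) \<partial>lborel) = ennreal 1"
      using il[of x] by (simp add: ennreal_indicator)
    then show ?thesis by (subst integral_eq_nn_integral) auto
  qed
  have i2: "integrable (lborel \<Otimes>\<^sub>M lborel) (\<lambda>(x, t). indicator (slab e) (x - t *\<^sub>R e) * f x)"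
  proof (rule integrableI_bounded)
    have "(\<integral>\<^sup>+z. ennreal (norm (case z of (x, t) \<Rightarrow> indicator (slab e) (x - t *\<^sub>R e) * f x)) \<partial>(lborel \<Otimes>\<^sub>M lborel))
       = (\<integral>\<^sup>+x. (\<integral>\<^sup>+t. ennreal (norm (indicator (slab e) (x - t *\<^sub>R e) * f x)) \<partial>lborel) \<partial>lborel)"
      by (subst lborel.nn_integral_fst[symmetric]) (auto simp: case_prod_unfold)
    also have "\<dots> = (\<integral>\<^sup>+x. (\<integral>\<^sup>+t. indicator (slab e) (x - t *\<^sub>R e) * ennreal (norm (f x)) \<partial>lborel) \<partial>lborel)"
      by (intro nn_integral_cong) (auto simp: indicator_def)
    also have "\<dots> = (\<integral>\<^sup>+x. ennreal (norm (f x)) \<partial>lborel)"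
      by (intro nn_integral_cong) (simp add: nn_integral_multc il)
    finally show "(\<integral>\<^sup>+z. ennreal (norm (case z of (x, t) \<Rightarrow> indicator (slab e) (x - t *\<^sub>R e) * f x)) \<partial>(lborel \<Otimes>\<^sub>M lborel)) < \<infinity>"
      using fin by simp
  qed measurable
  have "(\<integral>x. indicator (slab e) x * (\<integral>t. f (x + t *\<^sub>R e) \<partial>lborel) \<partial>lborel)
      = (\<integral>x. (\<integral>t. indicator (slab e) x * f (x + t *\<^sub>R e) \<partial>lborel) \<partial>lborel)"
    by simp
  also have "\<dots> = (\<integral>t. (\<integral>x. indicator (slab e) x * f (x + t *\<^sub>R e) \<partial>lborel) \<partial>lborel)"
    by (rule lborel_pair.Fubini_integral[symmetric, OF i1])
  also have "\<dots> = (\<integral>t. (\<integral>x. indicator (slab e) (x - t *\<^sub>R e) * f x \<partial>lborel) \<partial>lborel)"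
  proof (rule Bochner_Integration.integral_cong[OF refl])
    fix t :: real
    have "(\<integral>x. indicator (slab e) (x + t *\<^sub>R e - t *\<^sub>R e) * f (x + t *\<^sub>R e) \<partial>lborel)
        = (\<integral>x. indicator (slab e) (x - t *\<^sub>R e) * f x \<partial>lborel)"
      by (rule integral_lborel_shift) measurable
    then show "(\<integral>x. indicator (slab e) x * f (x + t *\<^sub>R e) \<partial>lborel)
        = (\<integral>x. indicator (slab e) (x - t *\<^sub>R e) * f x \<partial>lborel)" by simp
  qed
  also have "\<dots> = (\<integral>x. (\<integral>t. indicator (slab e) (x - t *\<^sub>R e) * f x \<partial>lborel) \<partial>lborel)"
    by (rule lborel_pair.Fubini_integral[OF i2])
  also have "\<dots> = (\<integral>x. f x \<partial>lborel)" by (simp add: ir)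
  finally show ?thesis by simp
qed

section \<open>The isodiametric inequality for hyperplane sections\<close>

definition refl_along :: "'a::euclidean_space \<Rightarrow> 'a \<Rightarrow> 'a" where
  "refl_along e x = x - (2 * (x \<bullet> e)) *\<^sub>R e"

lemma linear_refl_along: "linear (refl_along e)"
  unfolding refl_along_def
  by (rule linearI) (auto simp: algebra_simps inner_add_left)

lemma refl_along_continuous [continuous_intros]:
  "continuous_on S f \<Longrightarrow> continuous_on S (\<lambda>x. refl_along e (f x))"
  unfolding refl_along_def by (intro continuous_intros)

lemma refl_along_borel [measurable]: "refl_along e \<in> borel_measurable borel"
  by (intro borel_measurable_continuous_onI continuous_intros)

lemma refl_along_refl_along: "norm e = 1 \<Longrightarrow> refl_along e (refl_along e x) = x"
  by (simp add: refl_along_def inner_diff_left norm_eq_1)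

lemma inner_refl_along: "norm e = 1 \<Longrightarrow> refl_along e x \<bullet> refl_along e y = x \<bullet> y"
  by (simp add: refl_along_def inner_diff_left inner_diff_right norm_eq_1 inner_commute algebra_simps)

lemma norm_refl_along: "norm e = 1 \<Longrightarrow> norm (refl_along e x) = norm x"
  by (simp add: norm_eq_sqrt_inner inner_refl_along)

lemma nn_integral_real_reflect:
  fixes f :: "real \<Rightarrow> ennreal"
  assumes [measurable]: "f \<in> borel_measurable borel"
  shows "(\<integral>\<^sup>+t. f (c - t) \<partial>lborel) = (\<integral>\<^sup>+t. f t \<partial>lborel)"
  using nn_integral_real_affine[of f "-1" c] by (simp add: assms)

text \<open>The reflection maps each line parallel to \<open>e\<close> to itself by
  \<open>t \<mapsto> c - t\<close>, so invariance of Lebesgue measure reduces to one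
  dimension.\<close>

lemma nn_integral_refl_along:
  fixes f :: "'a::euclidean_space \<Rightarrow> ennreal"
  assumes [measurable]: "f \<in> borel_measurable borel" and e: "norm e = 1"
  shows "(\<integral>\<^sup>+x. f (refl_along e x) \<partial>lborel) = (\<integral>\<^sup>+x. f x \<partial>lborel)"
proof -
  have e0: "e \<noteq> 0" using e by auto
  have "(\<integral>\<^sup>+x. f (refl_along e x) \<partial>lborel)
    = (\<integral>\<^sup>+x. indicator (slab e) x * (\<integral>\<^sup>+t. f (refl_along e (x + t *\<^sub>R e)) \<partial>lborel) \<partial>lborel)"
    by (rule nn_integral_lines[OF _ e0]) measurable
  also have "\<dots> = (\<integral>\<^sup>+x. indicator (slab e) x * (\<integral>\<^sup>+t. f (x + t *\<^sub>R e) \<partial>lborel) \<partial>lborel)"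
  proof (rule nn_integral_cong, rule arg_cong2[where f="(*)"], rule refl)
    fix x :: 'a
    have "refl_along e (x + t *\<^sub>R e) = x + (- 2 * (x \<bullet> e) - t) *\<^sub>R e" for t
      using e by (simp add: refl_along_def inner_add_left norm_eq_1 algebra_simps mult_2 flip: scaleR_add_left)
    then show "(\<integral>\<^sup>+t. f (refl_along e (x + t *\<^sub>R e)) \<partial>lborel) = (\<integral>\<^sup>+t. f (x + t *\<^sub>R e) \<partial>lborel)"
      using nn_integral_real_reflect[of "\<lambda>s. f (x + s *\<^sub>R e)" "- 2 * (x \<bullet> e)"] by simp
  qed
  also have "\<dots> = (\<integral>\<^sup>+x. f x \<partial>lborel)" by (rule nn_integral_lines[symmetric, OF _ e0]) measurable
  finally show ?thesis .
qed

definition orth_part :: "'a::euclidean_space \<Rightarrow> 'a \<Rightarrow> 'a" where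
  "orth_part n x = x - (x \<bullet> n) *\<^sub>R n"

lemma linear_orth_part: "linear (orth_part n)"
  unfolding orth_part_def by (rule linearI) (auto simp: algebra_simps inner_add_left)

lemma orth_part_continuous [continuous_intros]:
  "continuous_on S f \<Longrightarrow> continuous_on S (\<lambda>x. orth_part n (f x))"
  unfolding orth_part_def by (intro continuous_intros)

text \<open>For unit \<open>n\<close> the slab has thickness one, so the Lebesgue measure of the
  cylinder is the volume of its base, a ball of dimension \<open>DIM('a) - 1\<close>.\<close>

definition cylinder :: "'a::euclidean_space \<Rightarrow> 'a \<Rightarrow> real \<Rightarrow> 'a set" where
  "cylinder n c r = {x \<in> slab n. norm (orth_part n (x - c)) \<le> r}"

lemma cylinder_borel [measurable]: "cylinder n c r \<in> sets borel"
proof -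
  have "closed {x. norm (orth_part n (x - c)) \<le> r}"
    by (intro closed_Collect_le continuous_intros)
  then show ?thesis unfolding cylinder_def
    using slab_borel[of n] by (simp add: Collect_conj_eq borel_closed sets.Int Int_def[symmetric])
qed

text \<open>Lebesgue measure is a product over \<open>Basis\<close>; splitting off the coordinate
  \<open>b\<close> leaves a ball over the index set \<open>Basis - {b}\<close>, and
  \<open>emeasure_cball_aux\<close> computes ball volumes over any finite index set.\<close>

lemma emeasure_cylinder_Basis:
  fixes b :: "'a::euclidean_space"
  assumes b: "b \<in> Basis" and r: "0 < r"
  shows "emeasure lborel (cylinder b 0 r) = ennreal (unit_ball_vol (real (DIM('a) - 1)) * r ^ (DIM('a) - 1))"
proof -
  interpret product_sigma_finite "\<lambda>_ :: 'a. lborel :: real measure" ..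
  let ?I = "Basis - {b} :: 'a set"
  let ?s = "\<lambda>f. \<Sum>b\<in>Basis. f b *\<^sub>R b :: 'a"
  have ins: "insert b ?I = Basis" using b by auto
  have bb: "b \<bullet> b = 1" using b by simp
  have sb: "?s f \<bullet> b = f b" for f
    using b by simp
  have n: "norm (orth_part b (?s f)) = sqrt (\<Sum>i\<in>?I. (f i)\<^sup>2)" for f
  proof -
    have "orth_part b (?s f) \<bullet> i = (if i = b then 0 else f i)" if "i \<in> Basis" for i
      using that b by (auto simp: orth_part_def inner_diff_left sb inner_not_same_Basis)
    then have "norm (orth_part b (?s f)) = sqrt (\<Sum>i\<in>Basis. (if i = b then 0 else f i)\<^sup>2)"
      by (subst norm_eq_sqrt_inner, subst euclidean_inner) (simp add: power2_eq_square)
    also have "(\<Sum>i\<in>Basis. (if i = b then 0 else f i)\<^sup>2) = (\<Sum>i\<in>?I. (f i)\<^sup>2)"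
      using b by (subst sum.remove[of _ b]) auto
    finally show ?thesis .
  qed
  have cyl: "?s f \<in> cylinder b 0 r \<longleftrightarrow> f b \<in> {0..1} \<and> sqrt (\<Sum>i\<in>?I. (f i)\<^sup>2) \<le> r" for f
    by (auto simp: cylinder_def slab_def sb bb n)
  have [measurable]: "?s \<in> borel_measurable (Pi\<^sub>M Basis (\<lambda>_. lborel))"
    by measurable
  have "emeasure lborel (cylinder b 0 r) = (\<integral>\<^sup>+x. indicator (cylinder b 0 r) x \<partial>lborel)" by simp
  also have "\<dots> = (\<integral>\<^sup>+x. indicator (cylinder b 0 r) x \<partial>distr (Pi\<^sub>M Basis (\<lambda>_. lborel)) borel ?s)"
    by (simp only: lborel_eq[symmetric])
  also have "\<dots> = (\<integral>\<^sup>+f. indicator (cylinder b 0 r) (?s f) \<partial>Pi\<^sub>M Basis (\<lambda>_. lborel))"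
    by (rule nn_integral_distr) measurable
  also have "\<dots> = (\<integral>\<^sup>+f. indicator (cylinder b 0 r) (?s f) \<partial>Pi\<^sub>M (insert b ?I) (\<lambda>_. lborel))"
    by (simp only: ins)
  also have "\<dots> = (\<integral>\<^sup>+f. (\<integral>\<^sup>+y. indicator (cylinder b 0 r) (?s (f(b := y))) \<partial>lborel) \<partial>Pi\<^sub>M ?I (\<lambda>_. lborel))"
    by (rule product_nn_integral_insert) (auto simp: ins)
  also have "\<dots> = (\<integral>\<^sup>+f. indicator {f. sqrt (\<Sum>i\<in>?I. (f i)\<^sup>2) \<le> r} f \<partial>Pi\<^sub>M ?I (\<lambda>_. lborel))"
  proof (rule nn_integral_cong)
    fix f :: "'a \<Rightarrow> real"
    have "(\<Sum>i\<in>?I. ((f(b := y)) i)\<^sup>2) = (\<Sum>i\<in>?I. (f i)\<^sup>2)" for y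
      by (intro sum.cong) auto
    then have "indicator (cylinder b 0 r) (?s (f(b := y))) =
       (indicator {f. sqrt (\<Sum>i\<in>?I. (f i)\<^sup>2) \<le> r} f * indicator {0..1} y :: ennreal)" for y
      unfolding indicator_def using cyl[of "f(b := y)"] by auto
    then show "(\<integral>\<^sup>+y. indicator (cylinder b 0 r) (?s (f(b := y))) \<partial>lborel)
       = indicator {f. sqrt (\<Sum>i\<in>?I. (f i)\<^sup>2) \<le> r} f"
      by (simp add: nn_integral_cmult)
  qed
  also have "\<dots> = (\<integral>\<^sup>+f. indicator ({f. sqrt (\<Sum>i\<in>?I. (f i)\<^sup>2) \<le> r} \<inter> space (Pi\<^sub>M ?I (\<lambda>_. lborel))) f \<partial>Pi\<^sub>M ?I (\<lambda>_. lborel))"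
    by (intro nn_integral_cong) (auto simp: indicator_def)
  also have "\<dots> = emeasure (Pi\<^sub>M ?I (\<lambda>_. lborel)) ({f. sqrt (\<Sum>i\<in>?I. (f i)\<^sup>2) \<le> r} \<inter> space (Pi\<^sub>M ?I (\<lambda>_. lborel)))"
    by (rule nn_integral_indicator) measurable
  also have "\<dots> = ennreal (unit_ball_vol (real (card ?I)) * r ^ card ?I)"
    by (rule emeasure_cball_aux) (use r in auto)
  also have "card ?I = DIM('a) - 1" using b by (simp add: card_Diff_singleton)
  finally show ?thesis .
qed

text \<open>A translation removes the centre, and the reflection across the bisecting hyperplane of
  \<open>n\<close> and a basis vector \<open>b\<close> carries one cylinder to the other.\<close>

lemma emeasure_cylinder:
  fixes n :: "'a::euclidean_space"
  assumes n: "norm n = 1" and r: "0 < r"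
  shows "emeasure lborel (cylinder n c r) = ennreal (unit_ball_vol (real (DIM('a) - 1)) * r ^ (DIM('a) - 1))"
proof -
  let ?p = "orth_part n c"
  have pn: "?p \<bullet> n = 0" using n by (simp add: orth_part_def inner_diff_left norm_eq_1)
  have "x + ?p \<in> cylinder n c r \<longleftrightarrow> x \<in> cylinder n 0 r" for x
  proof -
    have "orth_part n (x + ?p - c) = orth_part n x"
      using n by (simp add: orth_part_def inner_diff_left inner_add_left norm_eq_1 algebra_simps)
    moreover have "(x + ?p) \<bullet> n = x \<bullet> n" using pn by (simp add: inner_add_left)
    ultimately show ?thesis by (simp add: cylinder_def slab_def)
  qed
  then have "indicator (cylinder n c r) (x + ?p) = (indicator (cylinder n 0 r) x :: ennreal)" for x
    by (simp add: indicator_def)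
  then have 1: "emeasure lborel (cylinder n c r) = emeasure lborel (cylinder n 0 r)"
    using nn_integral_lborel_shift[of "indicator (cylinder n c r)" ?p] by simp
  obtain b :: 'a where b: "b \<in> Basis" using nonempty_Basis by blast
  have "emeasure lborel (cylinder n 0 r) = emeasure lborel (cylinder b 0 r)"
  proof (cases "n = b")
    case False
    define e where "e = (n - b) /\<^sub>R norm (n - b)"
    have e: "norm e = 1" using False by (simp add: e_def)
    have nb: "norm (n - b) ^ 2 = 2 - 2 * (n \<bullet> b)"
      using n b by (simp add: power2_norm_eq_inner inner_diff_left inner_diff_right norm_eq_1 inner_commute)
    have pos: "norm (n - b) \<noteq> 0" using False by simp
    have "refl_along e b = b - (2 * (b \<bullet> (n - b)) / norm (n - b) ^ 2) *\<^sub>R (n - b)"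
      by (simp add: refl_along_def e_def power2_eq_square divide_inverse mult_ac)
    also have "2 * (b \<bullet> (n - b)) / norm (n - b) ^ 2 = - 1"
      using pos nb b by (simp add: inner_diff_right inner_commute field_simps)
    finally have eb: "refl_along e b = n" by simp
    have [simp]: "refl_along e x \<bullet> n = x \<bullet> b" for x
      using inner_refl_along[OF e, of x b] eb by simp
    have "orth_part n (refl_along e x) = refl_along e (orth_part b x)" for x
      by (simp add: orth_part_def linear_diff[OF linear_refl_along] linear_scale[OF linear_refl_along] eb)
    then have "refl_along e x \<in> cylinder n 0 r \<longleftrightarrow> x \<in> cylinder b 0 r" for x
      using n b by (simp add: cylinder_def slab_def norm_refl_along[OF e] norm_eq_1)
    then have "indicator (cylinder n 0 r) (refl_along e x) = (indicator (cylinder b 0 r) x :: ennreal)" for x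
      by (simp add: indicator_def)
    then show ?thesis
      using nn_integral_refl_along[of "indicator (cylinder n 0 r)" e] e by simp
  qed simp
  then show ?thesis using 1 emeasure_cylinder_Basis[OF b r] by simp
qed

text \<open>With \<open>l\<close> the least point of \<open>L\<close>, the set of all (s - l)/2 and
  the set of all (l - t)/2 lie on the two sides of 0 and share at most that point. Both are
  contained in the half difference set, and each has half the measure of \<open>L\<close>.\<close>

lemma emeasure_half_difference_set:
  fixes L :: "real set"
  assumes L: "compact L"
  shows "emeasure lborel L \<le> emeasure lborel ((\<lambda>(s, t). (s - t) / 2) ` (L \<times> L))"
proof (cases "L = {}")
  case False
  obtain l where lL: "l \<in> L" and lle: "\<And>x. x \<in> L \<Longrightarrow> l \<le> x"
    using compact_attains_inf[OF L False] by auto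
  let ?D = "(\<lambda>(s, t). (s - t) / 2) ` (L \<times> L)"
  let ?A = "(\<lambda>s. (1/2) *\<^sub>R s + (- l / 2)) ` L"
  let ?B = "(\<lambda>t. (-1/2) *\<^sub>R t + (l / 2)) ` L"
  have cA: "compact ?A" and cB: "compact ?B"
    by (intro compact_continuous_image L continuous_intros)+
  have cD: "compact ?D"
    by (auto simp: case_prod_unfold intro!: compact_continuous_image compact_Times L continuous_intros)
  have bor: "?A \<in> sets borel" "?B \<in> sets borel" "L \<in> sets borel" "?D \<in> sets borel"
    using cA cB cD L by (auto intro: borel_compact)
  have half: "emeasure lborel ?A = ennreal (1/2) * emeasure lborel L" "emeasure lborel ?B = ennreal (1/2) * emeasure lborel L"
    using emeasure_lebesgue_affine[of "1/2" "- l / 2" L] emeasure_lebesgue_affine[of "-1/2" "l / 2" L] bor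
    by (simp_all)
  have "?A \<inter> ?B \<subseteq> {0}"
    by (auto dest!: lle)
  then have z: "emeasure lborel (?A \<inter> ?B) = 0"
    by (metis emeasure_lborel_singleton emeasure_mono le_zero_eq sets_lborel borel_singleton sets.empty_sets)
  have "emeasure lborel ?A + emeasure lborel ?B = emeasure lborel (?A \<union> ?B) + emeasure lborel (?A \<inter> ?B)"
    using bor by (intro emeasure_Un_Int) auto
  also have "\<dots> = emeasure lborel (?A \<union> ?B)" using z by simp
  also have "\<dots> \<le> emeasure lborel ?D"
  proof (rule emeasure_mono)
    have "(1/2) *\<^sub>R s + (- l / 2) = (s - l) / 2" "(-1/2) *\<^sub>R s + (l / 2) = (l - s) / 2" for s
      by (auto simp: field_simps)
    then show "?A \<union> ?B \<subseteq> ?D" using lL by (auto simp: image_iff intro!: bexI)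
  qed (use bor in auto)
  finally have "emeasure lborel ?A + emeasure lborel ?B \<le> emeasure lborel ?D" .
  moreover have "emeasure lborel ?A + emeasure lborel ?B = emeasure lborel L"
  proof -
    have "ennreal (1/2) + ennreal (1/2) = 1" by (subst ennreal_plus[symmetric]) auto
    then show ?thesis by (simp only: half distrib_right[symmetric] mult_1)
  qed
  ultimately show ?thesis by simp
qed simp

text \<open>Replaces each section of \<^term>\<open>A\<close> along \<^term>\<open>e\<close> by half its difference set.  Unlike
  Steiner symmetrization this keeps compactness for free, and by one-dimensional
  Brunn--Minkowski it does not decrease volume.\<close>

definition symmetrize :: "'a::euclidean_space \<Rightarrow> 'a set \<Rightarrow> 'a set" where
  "symmetrize e A = (\<lambda>(p, q). (1/2) *\<^sub>R (p + refl_along e q)) `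
     {(p, q). p \<in> A \<and> q \<in> A \<and> orth_part e p = orth_part e q}"

lemma compact_symmetrize:
  assumes "compact A" shows "compact (symmetrize e A)"
proof -
  have "{(p, q). p \<in> A \<and> q \<in> A \<and> orth_part e p = orth_part e q}
      = (A \<times> A) \<inter> {z. orth_part e (fst z) = orth_part e (snd z)}" by auto
  moreover have "closed {z :: 'a \<times> 'a. orth_part e (fst z) = orth_part e (snd z)}"
    by (intro closed_Collect_eq continuous_intros)
  ultimately have "compact {(p, q). p \<in> A \<and> q \<in> A \<and> orth_part e p = orth_part e q}"
    using assms by (simp add: compact_Int_closed compact_Times)
  then show ?thesis unfolding symmetrize_def
    by (intro compact_continuous_image) (auto simp: case_prod_unfold intro!: continuous_intros)
qed

lemma emeasure_symmetrize:
  fixes A :: "'a::euclidean_space set"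
  assumes A: "compact A" and e: "norm e = 1"
  shows "emeasure lborel A \<le> emeasure lborel (symmetrize e A)"
proof -
  have e0: "e \<noteq> 0" using e by auto
  have ee: "e \<bullet> e = 1" using e by (simp add: norm_eq_1)
  have bor: "A \<in> sets borel" "symmetrize e A \<in> sets borel"
    using A compact_symmetrize by (auto intro: borel_compact)
  have "emeasure lborel {t. x + t *\<^sub>R e \<in> A} \<le> emeasure lborel {t. x + t *\<^sub>R e \<in> symmetrize e A}" for x
  proof -
    let ?L = "{t. x + t *\<^sub>R e \<in> A}" and ?c = "x \<bullet> e"
    have cl: "closed ?L"
      using continuous_closed_vimage[OF compact_imp_closed[OF A], of "\<lambda>t. x + t *\<^sub>R e"]
      by (auto simp: vimage_def intro!: continuous_intros)
    have "bounded ?L"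
    proof -
      have "?L \<subseteq> (\<lambda>y. (y - x) \<bullet> e) ` A"
        by (force simp: image_iff ee)
      moreover have "bounded ((\<lambda>y. (y - x) \<bullet> e) ` A)"
        by (intro compact_imp_bounded compact_continuous_image A continuous_intros)
      ultimately show ?thesis by (rule bounded_subset[rotated])
    qed
    then have cL: "compact ?L" using cl by (simp add: compact_eq_bounded_closed)
    let ?D = "(\<lambda>(s, t). (s - t) / 2) ` (?L \<times> ?L)"
    have cD: "compact ?D"
      by (auto simp: case_prod_unfold intro!: compact_continuous_image compact_Times cL continuous_intros)
    \<comment> \<open>Reflecting \<open>x + t *\<^sub>R e\<close> turns the parameter
      \<open>t\<close> into \<open>- 2 * ?c - t\<close>, so its midpoint with the point of parameter
      \<open>s\<close> has parameter \<open>(s - t) / 2 - ?c\<close>. The section of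
      \<open>symmetrize e A\<close> thus contains a translate of the half difference set.\<close>
    let ?E = "(\<lambda>t. 1 *\<^sub>R t + (- ?c)) ` ?D"
    have cE: "compact ?E" by (intro compact_continuous_image cD continuous_intros)
    have clS: "closed {t. x + t *\<^sub>R e \<in> symmetrize e A}"
      using continuous_closed_vimage[OF compact_imp_closed[OF compact_symmetrize[OF A]], of "\<lambda>t. x + t *\<^sub>R e"]
      by (auto simp: vimage_def intro!: continuous_intros)
    have "emeasure lborel ?L \<le> emeasure lborel ?D"
      by (rule emeasure_half_difference_set[OF cL])
    also have "\<dots> = emeasure lborel ?E"
      using emeasure_lebesgue_affine[of 1 "- ?c" ?D] cD cE by (simp add: borel_compact)
    also have "\<dots> \<le> emeasure lborel {t. x + t *\<^sub>R e \<in> symmetrize e A}"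
    proof (rule emeasure_mono)
      show "?E \<subseteq> {t. x + t *\<^sub>R e \<in> symmetrize e A}"
      proof clarify
        fix s t assume s: "x + s *\<^sub>R e \<in> A" and t: "x + t *\<^sub>R e \<in> A"
        have "orth_part e (x + s *\<^sub>R e) = orth_part e (x + t *\<^sub>R e)"
          by (simp add: orth_part_def inner_add_left ee algebra_simps)
        moreover have "x + (1 *\<^sub>R ((s - t) / 2) + (- ?c)) *\<^sub>R e = (1/2) *\<^sub>R ((x + s *\<^sub>R e) + refl_along e (x + t *\<^sub>R e))"
          by (rule euclidean_eqI) (simp add: refl_along_def inner_simps ee field_simps)
        ultimately show "x + (1 *\<^sub>R ((s - t) / 2) + (- ?c)) *\<^sub>R e \<in> symmetrize e A"
          unfolding symmetrize_def using s t by (intro image_eqI[of _ _ "(x + s *\<^sub>R e, x + t *\<^sub>R e)"]) auto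
      qed
    qed (use clS in \<open>simp add: borel_closed\<close>)
    finally show ?thesis .
  qed
  then show ?thesis
    unfolding emeasure_lines[OF bor(1) e0] emeasure_lines[OF bor(2) e0]
    by (intro nn_integral_mono mult_left_mono) auto
qed

lemma orth_part_refl_along_commute:
  assumes "e \<bullet> n = 0"
  shows "orth_part n (refl_along e x) = refl_along e (orth_part n x)"
  using assms by (simp add: orth_part_def refl_along_def inner_diff_left inner_commute[of n e])

lemma refl_along_commute:
  assumes "e \<bullet> b = 0"
  shows "refl_along b (refl_along e x) = refl_along e (refl_along b x)"
  using assms by (simp add: refl_along_def inner_diff_left inner_commute[of b e])

lemma symmetrize_slab:
  assumes "A \<subseteq> slab n" "e \<bullet> n = 0" shows "symmetrize e A \<subseteq> slab n"
proof -
  have "refl_along e q \<bullet> n = q \<bullet> n" for q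
    using assms(2) by (simp add: refl_along_def inner_diff_left)
  note r = this
  show ?thesis
  proof
    fix x assume "x \<in> symmetrize e A"
    then obtain p q where p: "p \<in> A" "q \<in> A" "x = (1/2) *\<^sub>R (p + refl_along e q)"
      by (auto simp: symmetrize_def)
    have "x \<bullet> n = (p \<bullet> n + q \<bullet> n) / 2" by (simp add: p inner_add_left r)
    moreover have "0 \<le> p \<bullet> n" "p \<bullet> n \<le> n \<bullet> n" "0 \<le> q \<bullet> n" "q \<bullet> n \<le> n \<bullet> n"
      using p assms(1) by (auto simp: slab_def)
    ultimately show "x \<in> slab n" by (auto simp: slab_def)
  qed
qed

text \<open>A difference of two points of \<open>symmetrize e A\<close> is the average of one
  difference from \<open>A\<close> and the reflection of another. The reflection is isometric and,
  as \<open>e\<close> is orthogonal to \<open>n\<close>, commutes with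
  \<open>orth_part n\<close>.\<close>

lemma symmetrize_diameter:
  assumes A: "\<And>x y. x \<in> A \<Longrightarrow> y \<in> A \<Longrightarrow> norm (orth_part n (x - y)) \<le> D"
    and e: "norm e = 1" "e \<bullet> n = 0"
    and xy: "x \<in> symmetrize e A" "y \<in> symmetrize e A"
  shows "norm (orth_part n (x - y)) \<le> D"
proof -
  obtain p q where p: "p \<in> A" "q \<in> A" "x = (1/2) *\<^sub>R (p + refl_along e q)"
    using xy(1) by (auto simp: symmetrize_def)
  obtain p' q' where p': "p' \<in> A" "q' \<in> A" "y = (1/2) *\<^sub>R (p' + refl_along e q')"
    using xy(2) by (auto simp: symmetrize_def)
  have "x - y = (1/2) *\<^sub>R ((p - p') + refl_along e (q - q'))"
    by (simp add: p p' linear_diff[OF linear_refl_along] algebra_simps)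
  then have "orth_part n (x - y) = (1/2) *\<^sub>R (orth_part n (p - p') + refl_along e (orth_part n (q - q')))"
    by (simp add: linear_scale[OF linear_orth_part] linear_add[OF linear_orth_part] orth_part_refl_along_commute[OF e(2)])
  then have "norm (orth_part n (x - y)) = norm (orth_part n (p - p') + refl_along e (orth_part n (q - q'))) / 2"
    by simp
  also have "\<dots> \<le> (norm (orth_part n (p - p')) + norm (orth_part n (q - q'))) / 2"
    using norm_triangle_ineq[of "orth_part n (p - p')" "refl_along e (orth_part n (q - q'))"]
    by (simp add: norm_refl_along[OF e(1)])
  also have "\<dots> \<le> D" using A[OF p(1) p'(1)] A[OF p(2) p'(2)] by simp
  finally show ?thesis .
qed

lemma symmetrize_symmetric:
  assumes e: "norm e = 1" and x: "x \<in> symmetrize e A"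
  shows "refl_along e x \<in> symmetrize e A"
proof -
  obtain p q where p: "p \<in> A" "q \<in> A" "orth_part e p = orth_part e q" "x = (1/2) *\<^sub>R (p + refl_along e q)"
    using x by (auto simp: symmetrize_def)
  have "refl_along e x = (1/2) *\<^sub>R (q + refl_along e p)"
    by (simp add: p linear_scale[OF linear_refl_along] linear_add[OF linear_refl_along] refl_along_refl_along[OF e] add.commute)
  then show ?thesis unfolding symmetrize_def using p by (intro image_eqI[of _ _ "(q, p)"]) auto
qed

text \<open>Reflections along orthogonal directions commute, so a later symmetrization preserves the
  symmetries already gained; one pass through an orthonormal family makes the set symmetric in all
  its directions.\<close>

lemma symmetrize_keeps_symmetry:
  assumes b: "e \<bullet> b = 0" and A: "\<And>x. x \<in> A \<Longrightarrow> refl_along b x \<in> A" and x: "x \<in> symmetrize e A"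
  shows "refl_along b x \<in> symmetrize e A"
proof -
  obtain p q where p: "p \<in> A" "q \<in> A" "orth_part e p = orth_part e q" "x = (1/2) *\<^sub>R (p + refl_along e q)"
    using x by (auto simp: symmetrize_def)
  have "refl_along b x = (1/2) *\<^sub>R (refl_along b p + refl_along e (refl_along b q))"
    by (simp add: p linear_scale[OF linear_refl_along] linear_add[OF linear_refl_along] refl_along_commute[OF b])
  moreover have "orth_part e (refl_along b p) = orth_part e (refl_along b q)"
    using p(3) b orth_part_refl_along_commute[of b e] by (simp add: inner_commute)
  ultimately show ?thesis unfolding symmetrize_def using p A
    by (intro image_eqI[of _ _ "(refl_along b p, refl_along b q)"]) auto
qed

lemma symmetrize_family:
  fixes A :: "'a::euclidean_space set"
  assumes A: "compact A" "A \<subseteq> slab n" "\<And>x y. x \<in> A \<Longrightarrow> y \<in> A \<Longrightarrow> norm (orth_part n (x - y)) \<le> D"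
    and B: "finite B" "pairwise orthogonal B" "\<And>b. b \<in> B \<Longrightarrow> norm b = 1" "\<And>b. b \<in> B \<Longrightarrow> b \<bullet> n = 0"
  shows "\<exists>A'. compact A' \<and> A' \<subseteq> slab n \<and> (\<forall>x\<in>A'. \<forall>y\<in>A'. norm (orth_part n (x - y)) \<le> D) \<and>
     emeasure lborel A \<le> emeasure lborel A' \<and> (\<forall>b\<in>B. \<forall>x\<in>A'. refl_along b x \<in> A')"
  using B
proof (induction B)
  case empty
  then show ?case using A by blast
next
  case (insert b B)
  then obtain A' where A': "compact A'" "A' \<subseteq> slab n" "\<And>x y. x \<in> A' \<Longrightarrow> y \<in> A' \<Longrightarrow> norm (orth_part n (x - y)) \<le> D"
     "emeasure lborel A \<le> emeasure lborel A'" "\<And>b x. b \<in> B \<Longrightarrow> x \<in> A' \<Longrightarrow> refl_along b x \<in> A'"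
    by (auto simp: pairwise_insert)
  have b: "norm b = 1" "b \<bullet> n = 0" using insert by auto
  have bc: "b \<bullet> c = 0" if "c \<in> B" for c
    using insert that by (auto simp: pairwise_insert orthogonal_def)
  show ?case
  proof (intro exI[of _ "symmetrize b A'"] conjI ballI)
    show "emeasure lborel A \<le> emeasure lborel (symmetrize b A')"
      using A'(4) emeasure_symmetrize[OF A'(1) b(1)] by (rule order_trans)
    fix c x assume "c \<in> insert b B" "x \<in> symmetrize b A'"
    then show "refl_along c x \<in> symmetrize b A'"
      using symmetrize_symmetric[OF b(1)] symmetrize_keeps_symmetry[OF bc A'(5)] by blast
  next
    show "compact (symmetrize b A')" by (rule compact_symmetrize[OF A'(1)])
    show "symmetrize b A' \<subseteq> slab n" by (rule symmetrize_slab[OF A'(2) b(2)])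
    fix x y assume "x \<in> symmetrize b A'" "y \<in> symmetrize b A'"
    then show "norm (orth_part n (x - y)) \<le> D"
      using symmetrize_diameter[of A' n D b x y] A'(3) b by blast
  qed
qed

text \<open>After symmetrization along an orthonormal basis of the hyperplane orthogonal to
  \<open>n\<close>, the set is invariant under
  \<open>x \<mapsto> x - 2 *\<^sub>R orth_part n x\<close>. A point and its image are
  \<open>2 * norm (orth_part n x)\<close> apart, so the whole set lies in a cylinder of radius
  \<open>D / 2\<close>.\<close>

theorem isodiametric_slab:
  fixes A :: "'a::euclidean_space set"
  assumes A: "compact A" "A \<subseteq> slab n" and D: "\<And>x y. x \<in> A \<Longrightarrow> y \<in> A \<Longrightarrow> norm (orth_part n (x - y)) \<le> D"
    and n: "norm n = 1" and D0: "0 < D"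
  shows "emeasure lborel A \<le> ennreal (unit_ball_vol (real (DIM('a) - 1)) * (D / 2) ^ (DIM('a) - 1))"
proof -
  obtain S where S: "n \<in> S" "pairwise orthogonal S" "\<And>x. x \<in> S \<Longrightarrow> norm x = 1"
    "independent S" "card S = DIM('a)" "span S = UNIV"
    using vector_in_orthonormal_basis[OF n] by metis
  have fS: "finite S" using S(4) by (rule independent_imp_finite)
  define B where "B = S - {n}"
  have B: "finite B" "pairwise orthogonal B" "\<And>b. b \<in> B \<Longrightarrow> norm b = 1" "\<And>b. b \<in> B \<Longrightarrow> b \<bullet> n = 0"
    using S fS unfolding B_def pairwise_def orthogonal_def by auto
  obtain A' where A': "compact A'" "A' \<subseteq> slab n" "\<And>x y. x \<in> A' \<Longrightarrow> y \<in> A' \<Longrightarrow> norm (orth_part n (x - y)) \<le> D"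
     "emeasure lborel A \<le> emeasure lborel A'" "\<And>b x. b \<in> B \<Longrightarrow> x \<in> A' \<Longrightarrow> refl_along b x \<in> A'"
    using symmetrize_family[of A n D B] A D B by metis
  have "A' \<subseteq> cylinder n 0 (D / 2)"
  proof
    fix x assume x: "x \<in> A'"
    \<comment> \<open>Reflecting successively along the vectors of \<open>C\<close> subtracts twice
      the component along each of them; \<open>C = B\<close> gives the point reflection inside the
      hyperplane.\<close>
    have "x - (\<Sum>b\<in>C. (2 * (x \<bullet> b)) *\<^sub>R b) \<in> A'" if "finite C" "C \<subseteq> B" for C
      using that
    proof (induction C)
      case (insert c C)
      have "(\<Sum>b\<in>C. (2 * (x \<bullet> b)) *\<^sub>R b) \<bullet> c = 0"
        unfolding inner_sum_left
      proof (rule sum.neutral, rule ballI)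
        fix b assume "b \<in> C"
        then have "b \<bullet> c = 0" using insert B(2) by (auto simp: pairwise_def orthogonal_def)
        then show "(2 * (x \<bullet> b)) *\<^sub>R b \<bullet> c = 0" by simp
      qed
      then have "refl_along c (x - (\<Sum>b\<in>C. (2 * (x \<bullet> b)) *\<^sub>R b)) = x - (\<Sum>b\<in>insert c C. (2 * (x \<bullet> b)) *\<^sub>R b)"
        using insert by (simp add: refl_along_def inner_diff_left algebra_simps)
      then show ?case using insert A'(5)[of c "x - (\<Sum>b\<in>C. (2 * (x \<bullet> b)) *\<^sub>R b)"] by auto
    qed (use x in simp)
    then have y: "x - (\<Sum>b\<in>B. (2 * (x \<bullet> b)) *\<^sub>R b) \<in> A'" using B by auto
    have "x = (\<Sum>b\<in>S. (x \<bullet> b) *\<^sub>R b)"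
    proof -
      let ?z = "x - (\<Sum>b\<in>S. (x \<bullet> b) *\<^sub>R b)"
      have "orthogonal ?z c" if "c \<in> S" for c
      proof -
        have "(\<Sum>b\<in>S. (x \<bullet> b) *\<^sub>R b) \<bullet> c = (\<Sum>b\<in>S. if b = c then x \<bullet> c else 0)"
          unfolding inner_sum_left
        proof (rule sum.cong[OF refl])
          fix b assume "b \<in> S"
          then show "(x \<bullet> b) *\<^sub>R b \<bullet> c = (if b = c then x \<bullet> c else 0)"
            using S(2,3) that by (auto simp: pairwise_def orthogonal_def norm_eq_1)
        qed
        then show ?thesis using that fS by (simp add: orthogonal_def inner_diff_left)
      qed
      then have "orthogonal ?z y" if "y \<in> span S" for y
        using orthogonal_to_span that by blast
      then have "orthogonal ?z ?z" using S(6) by blast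
      then show ?thesis by (simp add: orthogonal_self)
    qed
    also have "\<dots> = (x \<bullet> n) *\<^sub>R n + (\<Sum>b\<in>B. (x \<bullet> b) *\<^sub>R b)"
      unfolding B_def using S(1) fS by (simp add: sum.remove)
    finally have "orth_part n x = (\<Sum>b\<in>B. (x \<bullet> b) *\<^sub>R b)"
      unfolding orth_part_def by (metis add_diff_cancel_left')
    then have 2: "(\<Sum>b\<in>B. (2 * (x \<bullet> b)) *\<^sub>R b) = 2 *\<^sub>R orth_part n x"
      by (simp add: scaleR_sum_right)
    have "orth_part n (orth_part n x) = orth_part n x"
      using n by (simp add: orth_part_def inner_diff_left norm_eq_1)
    then have "norm (2 *\<^sub>R orth_part n x) \<le> D"
      using A'(3)[OF x y] unfolding 2 by (simp add: linear_scale[OF linear_orth_part])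
    then show "x \<in> cylinder n 0 (D / 2)"
      using x A'(2) by (auto simp: cylinder_def)
  qed
  then have "emeasure lborel A' \<le> emeasure lborel (cylinder n 0 (D / 2))"
    by (intro emeasure_mono) auto
  then show ?thesis using A'(4) emeasure_cylinder[OF n, of "D/2" 0] D0 by simp
qed

section \<open>Identifying Hausdorff measure by its densities\<close>

lemma ennreal_le_of_scaled_le:
  fixes x y :: ennreal
  assumes le: "\<And>c. 0 < c \<Longrightarrow> c < 1 \<Longrightarrow> ennreal c * x \<le> y"
  shows "x \<le> y"
proof (cases "y = top")
  case False
  then obtain b where b: "y = ennreal b" "0 \<le> b" by (cases y) auto
  have "x \<noteq> top"
    using le[of "1/2"] b by (auto simp: ennreal_mult_top top_unique)
  then obtain a where a: "x = ennreal a" "0 \<le> a" by (cases x) auto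
  have "a \<le> b"
  proof (rule field_le_mult_one_interval)
    fix c :: real assume c: "0 < c" "c < 1"
    then have "ennreal (c * a) \<le> ennreal b" using le[OF c] a b by (simp add: ennreal_mult)
    then show "c * a \<le> b" using b by (simp add: ennreal_le_iff)
  qed
  then show ?thesis using a b by (simp add: ennreal_leI)
qed simp

text \<open>Mass distribution principle: if sets of small diameter carry at most 1 + \<epsilon>
  times their Hausdorff cost, then every fine covering of \<open>B\<close> costs at least the
  measure of \<open>B\<close> divided by 1 + \<epsilon>.\<close>

lemma measure_le_hausdorff_outer:
  fixes \<sigma> :: "'a::euclidean_space measure"
  assumes fin: "finite_measure \<sigma>" and sets: "sets \<sigma> = sets borel" and d: "1 \<le> d"
    and upper: "\<And>\<epsilon>. 0 < \<epsilon> \<Longrightarrow> \<exists>\<delta>>0. \<forall>K D. compact K \<longrightarrow> diameter K \<le> D \<longrightarrow> 0 < D \<longrightarrow> D \<le> \<delta> \<longrightarrow>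
       K \<inter> S \<noteq> {} \<longrightarrow> measure \<sigma> K \<le> (1 + \<epsilon>) * (unit_ball_vol (real d) * (D / 2) ^ d)"
    and B: "B \<in> sets borel" "B \<subseteq> S"
  shows "emeasure \<sigma> B \<le> hausdorff_outer d B"
proof (rule ennreal_le_of_scaled_le)
  interpret finite_measure \<sigma> by (rule fin)
  fix c :: real assume c: "0 < c" "c < 1"
  define \<epsilon> where "\<epsilon> = 1 / c - 1"
  have \<epsilon>: "0 < \<epsilon>" "c * (1 + \<epsilon>) = 1" using c by (auto simp: \<epsilon>_def field_simps)
  let ?w = "unit_ball_vol (real d)"
  obtain \<delta> where \<delta>: "0 < \<delta>" and up: "\<And>K D. compact K \<Longrightarrow> diameter K \<le> D \<Longrightarrow> 0 < D \<Longrightarrow> D \<le> \<delta> \<Longrightarrow>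
       K \<inter> S \<noteq> {} \<Longrightarrow> measure \<sigma> K \<le> (1 + \<epsilon>) * (?w * (D / 2) ^ d)"
    using upper[OF \<epsilon>(1)] by blast
  \<comment> \<open>The density bound is assumed for positive \<open>D\<close>; a set of diameter 0
    is handled by letting \<open>D\<close> tend to 0.\<close>
  have up0: "measure \<sigma> K \<le> (1 + \<epsilon>) * (?w * (diameter K / 2) ^ d)"
    if K: "compact K" "diameter K \<le> \<delta>" "K \<inter> S \<noteq> {}" for K
  proof (cases "diameter K = 0")
    case True
    have lim: "(\<lambda>k. (1 + \<epsilon>) * (?w * (\<delta> / real (Suc k) / 2) ^ d)) \<longlonglongrightarrow> (1 + \<epsilon>) * (?w * (0 / 2) ^ d)"
    proof -
      have "(\<lambda>k. \<delta> / real (Suc k)) \<longlonglongrightarrow> 0"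
        using LIMSEQ_Suc[OF lim_const_over_n[of \<delta>]] by simp
      then show ?thesis by (intro tendsto_intros) auto
    qed
    have "measure \<sigma> K \<le> (1 + \<epsilon>) * (?w * (\<delta> / real (Suc k) / 2) ^ d)" for k
      using True \<delta> K by (intro up) (auto simp: field_simps)
    then have "measure \<sigma> K \<le> (1 + \<epsilon>) * (?w * (0 / 2) ^ d)"
      by (intro LIMSEQ_le_const[OF lim]) auto
    then show ?thesis using True by simp
  next
    case False
    then have "0 < diameter K" using diameter_ge_0[OF compact_imp_bounded[OF K(1)]] by simp
    then show ?thesis using up[OF K(1) order_refl _ K(2,3)] by simp
  qed
  have "ennreal c * emeasure \<sigma> B \<le> hausdorff_pre d \<delta> B"
    unfolding hausdorff_pre_def
  proof (rule INF_greatest)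
    fix C :: "nat \<Rightarrow> 'a set"
    assume C: "C \<in> {C. B \<subseteq> (\<Union>i. C i) \<and> (\<forall>i. bounded (C i) \<and> diameter (C i) \<le> \<delta>)}"
    let ?g = "\<lambda>i. ?w * (diameter (C i) / 2) ^ d"
    have g0: "0 \<le> ?g i" for i
      using C diameter_ge_0 by (intro mult_nonneg_nonneg zero_le_power unit_ball_vol_nonneg) auto
    \<comment> \<open>Closures keep the diameter and are compact, as the density bound requires;
      members whose closure misses \<open>S\<close> contribute nothing to \<open>B\<close> and are
      dropped.\<close>
    define K where "K i = (if closure (C i) \<inter> S \<noteq> {} then closure (C i) else {})" for i
    have cK: "compact (K i)" for i using C by (auto simp: K_def)
    then have mK: "K i \<in> sets \<sigma>" for i using sets by (auto intro: borel_compact)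
    have leK: "emeasure \<sigma> (K i) \<le> ennreal (1 + \<epsilon>) * ennreal (?g i)" for i
    proof (cases "closure (C i) \<inter> S \<noteq> {}")
      case True
      have "measure \<sigma> (closure (C i)) \<le> (1 + \<epsilon>) * (?w * (diameter (closure (C i)) / 2) ^ d)"
        using C True by (intro up0) (auto simp: diameter_closure)
      then have "ennreal (measure \<sigma> (closure (C i))) \<le> ennreal ((1 + \<epsilon>) * ?g i)"
        using C by (intro ennreal_leI) (auto simp: diameter_closure)
      also have "\<dots> = ennreal (1 + \<epsilon>) * ennreal (?g i)"
        using \<epsilon> g0[of i] by (intro ennreal_mult) auto
      finally show ?thesis
        using True by (simp add: K_def emeasure_eq_measure)
    qed (simp add: K_def)
    have "B \<subseteq> (\<Union>i. K i)"
    proof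
      fix x assume x: "x \<in> B"
      then obtain i where "x \<in> C i" using C by auto
      then have "x \<in> K i" using x B closure_subset by (auto simp: K_def)
      then show "x \<in> (\<Union>i. K i)" by auto
    qed
    then have "emeasure \<sigma> B \<le> emeasure \<sigma> (\<Union>i. K i)"
      using mK by (intro emeasure_mono) auto
    also have "\<dots> \<le> (\<Sum>i. emeasure \<sigma> (K i))"
      using mK by (intro emeasure_subadditive_countably) auto
    also have "\<dots> \<le> (\<Sum>i. ennreal (1 + \<epsilon>) * ennreal (?g i))"
      by (intro suminf_le leK) auto
    also have "\<dots> = ennreal (1 + \<epsilon>) * (\<Sum>i. ennreal (?g i))" by simp
    finally have "ennreal c * emeasure \<sigma> B \<le> ennreal c * (ennreal (1 + \<epsilon>) * (\<Sum>i. ennreal (?g i)))"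
      by (intro mult_left_mono) auto
    also have "\<dots> = ennreal (c * (1 + \<epsilon>)) * (\<Sum>i. ennreal (?g i))"
      using c \<epsilon>(1) by (simp add: ennreal_mult mult.assoc)
    finally show "ennreal c * emeasure \<sigma> B \<le> (\<Sum>i. ennreal (?g i))" by (simp add: \<epsilon>(2))
  qed
  also have "\<dots> \<le> hausdorff_outer d B" using \<delta> by (rule hausdorff_pre_le_outer)
  finally show "ennreal c * emeasure \<sigma> B \<le> hausdorff_outer d B" .
qed

lemma vitali_sequence:
  fixes V S :: "'a::euclidean_space set"
  assumes V: "open V" and \<rho>: "0 < \<rho>"
  obtains A B :: "nat \<Rightarrow> 'a set" where
    "\<And>i. A i = {} \<and> B i = {} \<or> (\<exists>x r. x \<in> V \<inter> S \<and> 0 < r \<and> r \<le> \<rho> \<and> cball x r \<subseteq> V \<and> B i = cball x r \<and> A i = cball x (5 * r))"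
    "disjoint_family B" "V \<inter> S \<subseteq> (\<Union>i. A i)"
proof -
  have "\<exists>r. 0 < r \<and> r \<le> \<rho> \<and> cball x r \<subseteq> V" if "x \<in> V" for x
  proof -
    obtain e where "0 < e" "cball x e \<subseteq> V" using V \<open>x \<in> V\<close> open_contains_cball by metis
    then show ?thesis using \<rho> by (intro exI[of _ "min e \<rho>"]) auto
  qed
  then obtain r where r: "\<And>x. x \<in> V \<Longrightarrow> 0 < r x \<and> r x \<le> \<rho> \<and> cball x (r x) \<subseteq> V" by metis
  have cov: "V \<inter> S \<subseteq> (\<Union>x\<in>V \<inter> S. cball x (r x))"
  proof
    fix x assume "x \<in> V \<inter> S"
    then show "x \<in> (\<Union>x\<in>V \<inter> S. cball x (r x))" using r[of x] by (intro UN_I[of x]) auto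
  qed
  obtain C where C: "countable C" "C \<subseteq> V \<inter> S"
     "pairwise (\<lambda>i j. disjnt (cball i (r i)) (cball j (r j))) C"
     "V \<inter> S \<subseteq> (\<Union>i\<in>C. cball i (5 * r i))"
    by (rule Vitali_covering_lemma_cballs[where a="\<lambda>x. x" and r=r and B=\<rho>, OF cov]) (use r in auto)
  define I where "I = to_nat_on C ` C"
  let ?f = "from_nat_into C"
  have fI: "?f i \<in> C" if "i \<in> I" for i using that C(1) by (auto simp: I_def)
  have inj: "i = j" if "i \<in> I" "j \<in> I" "?f i = ?f j" for i j
    using that C(1) by (auto simp: I_def)
  define A where "A i = (if i \<in> I then cball (?f i) (5 * r (?f i)) else {})" for i
  define B where "B i = (if i \<in> I then cball (?f i) (r (?f i)) else {})" for i
  show thesis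
  proof
    show "A i = {} \<and> B i = {} \<or> (\<exists>x r. x \<in> V \<inter> S \<and> 0 < r \<and> r \<le> \<rho> \<and> cball x r \<subseteq> V \<and> B i = cball x r \<and> A i = cball x (5 * r))" for i
    proof (cases "i \<in> I")
      case True
      then have "?f i \<in> V \<inter> S" using fI C(2) by blast
      then show ?thesis using r[of "?f i"] True unfolding A_def B_def by auto
    qed (auto simp: A_def B_def)
    show "disjoint_family B"
      unfolding disjoint_family_on_def
    proof (intro ballI impI)
      fix i j :: nat assume "i \<noteq> j"
      show "B i \<inter> B j = {}"
      proof (cases "i \<in> I \<and> j \<in> I")
        case True
        then have "?f i \<noteq> ?f j" using inj \<open>i \<noteq> j\<close> by blast
        then have "disjnt (cball (?f i) (r (?f i))) (cball (?f j) (r (?f j)))"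
          using C(3) fI True unfolding pairwise_def by blast
        then show ?thesis using True by (auto simp: B_def disjnt_def)
      qed (auto simp: B_def)
    qed
    show "V \<inter> S \<subseteq> (\<Union>i. A i)"
    proof
      fix y assume "y \<in> V \<inter> S"
      then obtain x where x: "x \<in> C" "y \<in> cball x (5 * r x)" using C(4) by blast
      then have "y \<in> A (to_nat_on C x)" using C(1) by (auto simp: A_def I_def)
      then show "y \<in> (\<Union>i. A i)" by blast
    qed
  qed
qed

text \<open>The disjoint balls of one Vitali selection are covered at cost \<open>a\<close> times
  their measure, and finitely many of them carry a fixed fraction of the measure of
  \<open>V\<close>. What remains is open again. Iterating confines the crude estimate with fivefold
  balls to a remainder that shrinks geometrically.\<close>

lemma hausdorff_pre_open_le:
  fixes \<sigma> :: "'a::euclidean_space measure"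
  assumes fin: "finite_measure \<sigma>" and sets: "sets \<sigma> = sets borel" and d: "1 \<le> d"
    and U: "open U" "S \<in> sets borel" "emeasure \<sigma> (U - S) = 0"
    and a: "1 \<le> a" and \<delta>: "0 < \<delta>"
    and upper: "\<And>K D. compact K \<Longrightarrow> diameter K \<le> D \<Longrightarrow> 0 < D \<Longrightarrow> D \<le> \<delta> \<Longrightarrow>
       K \<inter> S \<noteq> {} \<Longrightarrow> measure \<sigma> K \<le> 2 * (unit_ball_vol (real d) * (D / 2) ^ d)"
    and lower: "\<And>x r. x \<in> S \<Longrightarrow> 0 < r \<Longrightarrow> r \<le> \<delta> \<Longrightarrow> unit_ball_vol (real d) * r ^ d \<le> a * measure \<sigma> (cball x r)"
    and V: "open V" "V \<subseteq> U"
  shows "hausdorff_pre d \<delta> (V \<inter> S) \<le> ennreal (a * measure \<sigma> V)"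
proof -
  interpret finite_measure \<sigma> by (rule fin)
  let ?w = "unit_ball_vol (real d)" and ?H = "hausdorff_pre d \<delta>" and ?m = "measure \<sigma>"
  \<comment> \<open>\<open>c\<close> is the price of covering by fivefold balls:
    \<open>5 ^ d\<close> from the dilation and \<open>a\<close> from the lower density. Radii of at
    most \<open>\<delta> / 10\<close> keep the diameters of the dilated balls within
    \<delta>.\<close>
  define c where "c = 5 ^ d * a"
  have d10: "0 < \<delta> / 10" using \<delta> by simp
  have c1: "1 \<le> c" unfolding c_def using a by (simp add: mult_ge1_I)
  \<comment> \<open>The balls chosen below carry at least the fraction 1/(4 c) of the measure: a
    factor 2 is lost by capturing only half of the mass, and another 2 in the upper density bound
    for the dilated balls.\<close>
  define q where "q = 1 - 1 / (4 * c)"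
  have q: "0 \<le> q" "q < 1" using c1 by (auto simp: q_def field_simps)
  have bor[simp]: "open X \<Longrightarrow> X \<in> sets \<sigma>" "closed X \<Longrightarrow> X \<in> sets \<sigma>" for X
    using sets by auto
  have S[simp]: "S \<in> sets \<sigma>" using U sets by simp
  have mVS: "?m (V \<inter> S) = ?m V" if V: "open V" "V \<subseteq> U" for V
  proof -
    have "emeasure \<sigma> (V - S) \<le> emeasure \<sigma> (U - S)" using V U by (intro emeasure_mono) auto
    then have "?m (V - S) = 0" using U(3) by (simp add: measure_def)
    moreover have "?m V = ?m (V \<inter> S) + ?m (V - S)"
      using V finite_measure_Union[of "V \<inter> S" "V - S"] by (simp add: Int_Diff_Un sets.Int sets.Diff Int_Diff_disjoint)
    ultimately show ?thesis by simp
  qed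
  \<comment> \<open>Stated for all open \<open>V\<close> at once, because the induction step applies
    the hypothesis to \<open>V - F\<close>.\<close>
  have main: "\<forall>V. open V \<longrightarrow> V \<subseteq> U \<longrightarrow> ?H (V \<inter> S) \<le> ennreal ((a + q ^ k * c) * ?m V)" for k
  proof (induction k)
    case k: 0
    show ?case
    proof (intro allI impI)
      fix V assume V: "open V" "V \<subseteq> U"
      obtain A B :: "nat \<Rightarrow> 'a set" where
        AB: "\<And>i. A i = {} \<and> B i = {} \<or> (\<exists>x r. x \<in> V \<inter> S \<and> 0 < r \<and> r \<le> \<delta> / 10 \<and> cball x r \<subseteq> V \<and> B i = cball x r \<and> A i = cball x (5 * r))"
        and dis: "disjoint_family B" and cov: "V \<inter> S \<subseteq> (\<Union>i. A i)"
        by (rule vitali_sequence[OF V(1) d10, of S]) (rule that, assumption+)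
      have B: "B i \<in> sets \<sigma>" "B i \<subseteq> V" for i using AB[of i] by auto
      have HA: "?H (A i) \<le> ennreal c * emeasure \<sigma> (B i)" for i
        using AB[of i]
      proof (elim disjE exE conjE)
        assume "A i = {}" then show ?thesis by (simp add: hausdorff_pre_empty[OF d \<delta>])
      next
        fix x r assume x: "x \<in> V \<inter> S" "0 < r" "r \<le> \<delta> / 10" "B i = cball x r" "A i = cball x (5 * r)"
        have "?H (A i) \<le> ennreal (?w * (diameter (A i) / 2) ^ d)"
          using x by (intro hausdorff_pre_le d \<delta>) (auto)
        also have "?w * (diameter (A i) / 2) ^ d = 5 ^ d * (?w * r ^ d)"
          using x by (simp add: power_mult_distrib)
        also have "\<dots> \<le> 5 ^ d * (a * ?m (B i))"
          using x \<delta> lower[of x r] by (intro mult_left_mono) auto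
        also have "ennreal \<dots> = ennreal c * emeasure \<sigma> (B i)"
          using c1 by (simp add: c_def emeasure_eq_measure mult.assoc flip: ennreal_mult)
        finally show ?thesis by (simp add: ennreal_leI)
      qed
      have "?H (V \<inter> S) \<le> ?H (\<Union>i. A i)" by (rule hausdorff_pre_mono[OF cov])
      also have "\<dots> \<le> (\<Sum>i. ?H (A i))" by (rule hausdorff_pre_UN[OF d \<delta>])
      also have "\<dots> \<le> (\<Sum>i. ennreal c * emeasure \<sigma> (B i))" by (intro suminf_le HA) auto
      also have "\<dots> = ennreal c * (\<Sum>i. emeasure \<sigma> (B i))" by simp
      also have "(\<Sum>i. emeasure \<sigma> (B i)) = emeasure \<sigma> (\<Union>i. B i)"
        using B dis by (intro suminf_emeasure) auto
      also have "ennreal c * \<dots> \<le> ennreal c * emeasure \<sigma> V"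
        using B V by (intro mult_left_mono emeasure_mono) auto
      also have "\<dots> = ennreal (c * ?m V)"
        using c1 by (simp add: emeasure_eq_measure flip: ennreal_mult)
      also have "\<dots> \<le> ennreal ((a + q ^ 0 * c) * ?m V)"
        using a by (intro ennreal_leI mult_right_mono) auto
      finally show "?H (V \<inter> S) \<le> ennreal ((a + q ^ 0 * c) * ?m V)" .
    qed
  next
    case (Suc k)
    show ?case
    proof (intro allI impI)
      fix V assume V: "open V" "V \<subseteq> U"
      obtain A B :: "nat \<Rightarrow> 'a set" where
        AB: "\<And>i. A i = {} \<and> B i = {} \<or> (\<exists>x r. x \<in> V \<inter> S \<and> 0 < r \<and> r \<le> \<delta> / 10 \<and> cball x r \<subseteq> V \<and> B i = cball x r \<and> A i = cball x (5 * r))"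
        and dis: "disjoint_family B" and cov: "V \<inter> S \<subseteq> (\<Union>i. A i)"
        by (rule vitali_sequence[OF V(1) d10, of S]) (rule that, assumption+)
      have B: "B i \<in> sets \<sigma>" "B i \<subseteq> V" "closed (B i)" and A: "A i \<in> sets \<sigma>" for i using AB[of i] by auto
      have mA: "?m (A i) \<le> 2 * c * ?m (B i)" for i
        using AB[of i]
      proof (elim disjE exE conjE)
        fix x r assume x: "x \<in> V \<inter> S" "0 < r" "r \<le> \<delta> / 10" "B i = cball x r" "A i = cball x (5 * r)"
        have "?m (A i) \<le> 2 * (?w * (10 * r / 2) ^ d)"
          using x by (intro upper) auto
        also have "\<dots> = 2 * 5 ^ d * (?w * r ^ d)"
          by (simp add: power_mult_distrib)
        also have "\<dots> \<le> 2 * 5 ^ d * (a * ?m (B i))"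
          using x \<delta> lower[of x r] by (intro mult_left_mono) auto
        finally show ?thesis by (simp add: c_def mult_ac)
      qed auto
      have HB: "?H (B i) \<le> ennreal (a * ?m (B i))" for i
        using AB[of i]
      proof (elim disjE exE conjE)
        assume "B i = {}" then show ?thesis by (simp add: hausdorff_pre_empty[OF d \<delta>])
      next
        fix x r assume x: "x \<in> V \<inter> S" "0 < r" "r \<le> \<delta> / 10" "B i = cball x r" "A i = cball x (5 * r)"
        have "?H (B i) \<le> ennreal (?w * (diameter (B i) / 2) ^ d)"
          using x by (intro hausdorff_pre_le d \<delta>) (auto)
        also have "?w * (diameter (B i) / 2) ^ d \<le> a * ?m (B i)"
          using x \<delta> lower[of x r] by simp
        finally show ?thesis by (simp add: ennreal_leI)
      qed
      show "?H (V \<inter> S) \<le> ennreal ((a + q ^ Suc k * c) * ?m V)"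
      proof (cases "?m V = 0")
        case True
        then show ?thesis using Suc V by (metis mult_zero_right)
      next
        case False
        then have pos: "0 < ?m V" by (simp add: zero_less_measure_iff)
        have "(\<lambda>n. ?m ((\<Union>i<n. A i) \<inter> (V \<inter> S))) \<longlonglongrightarrow> ?m (\<Union>n. (\<Union>i<n. A i) \<inter> (V \<inter> S))"
        proof (rule finite_Lim_measure_incseq)
          show "range (\<lambda>n. (\<Union>i<n. A i) \<inter> (V \<inter> S)) \<subseteq> sets \<sigma>"
            using A V by (intro image_subsetI sets.Int sets.finite_UN) auto
          show "incseq (\<lambda>n. (\<Union>i<n. A i) \<inter> (V \<inter> S))"
            unfolding incseq_def by (intro allI impI Int_mono UN_mono) auto
        qed
        also have "(\<Union>n. (\<Union>i<n. A i) \<inter> (V \<inter> S)) = V \<inter> S" using cov by fastforce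
        also have "?m (V \<inter> S) = ?m V" by (rule mVS[OF V])
        finally have "\<forall>\<^sub>F n in sequentially. ?m V / 2 < ?m ((\<Union>i<n. A i) \<inter> (V \<inter> S))"
          using pos by (intro order_tendstoD) auto
        then obtain n where n: "?m V / 2 < ?m ((\<Union>i<n. A i) \<inter> (V \<inter> S))"
          by (auto simp: eventually_sequentially)
        \<comment> \<open>A finite union of closed balls is closed, so that \<open>V - F\<close> is
          open; the union of the whole sequence need not be.\<close>
        define F where "F = (\<Union>i<n. B i)"
        have mF: "?m F = (\<Sum>i<n. ?m (B i))"
          unfolding F_def using B dis
          by (intro finite_measure_finite_Union) (auto simp: disjoint_family_on_def)
        have "?m ((\<Union>i<n. A i) \<inter> (V \<inter> S)) \<le> ?m (\<Union>i<n. A i)"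
          using A by (intro finite_measure_mono) auto
        also have "\<dots> \<le> (\<Sum>i<n. ?m (A i))"
          using A by (intro finite_measure_subadditive_finite) auto
        also have "\<dots> \<le> 2 * c * ?m F"
          unfolding mF sum_distrib_left by (intro sum_mono mA)
        finally have large: "?m V \<le> 4 * c * ?m F" using n by simp
        have cF: "closed F" unfolding F_def using B by (intro closed_UN) auto
        have FV: "F \<subseteq> V" using B by (auto simp: F_def)
        have m': "?m (V - F) = ?m V - ?m F"
          using V cF FV by (intro finite_measure_Diff) auto
        have "V \<inter> S \<subseteq> (\<Union>i<n. B i) \<union> ((V - F) \<inter> S)" by (auto simp: F_def)
        then have "?H (V \<inter> S) \<le> ?H ((\<Union>i<n. B i) \<union> ((V - F) \<inter> S))" by (rule hausdorff_pre_mono)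
        also have "\<dots> \<le> ?H (\<Union>i<n. B i) + ?H ((V - F) \<inter> S)" by (rule hausdorff_pre_Un[OF d \<delta>])
        also have "?H (\<Union>i<n. B i) \<le> (\<Sum>i<n. ?H (B i))" by (rule hausdorff_pre_finite_UN[OF d \<delta>]) simp
        also have "\<dots> \<le> (\<Sum>i<n. ennreal (a * ?m (B i)))" by (intro sum_mono HB)
        also have "\<dots> = ennreal (a * ?m F)"
          using a by (simp add: mF sum_distrib_left)
        also have "?H ((V - F) \<inter> S) \<le> ennreal ((a + q ^ k * c) * ?m (V - F))"
          using Suc V cF by auto
        also have "ennreal (a * ?m F) + \<dots> = ennreal (a * ?m F + (a + q ^ k * c) * ?m (V - F))"
          using a q c1 by (intro ennreal_plus[symmetric]) auto
        also have "\<dots> \<le> ennreal ((a + q ^ Suc k * c) * ?m V)"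
        proof (rule ennreal_leI)
          have "?m V - ?m F \<le> q * ?m V"
            using large c1 by (simp add: q_def field_simps)
          then have "q ^ k * c * (?m V - ?m F) \<le> q ^ k * c * (q * ?m V)"
            using q c1 by (intro mult_left_mono) auto
          then show "a * ?m F + (a + q ^ k * c) * ?m (V - F) \<le> (a + q ^ Suc k * c) * ?m V"
            unfolding m' by (simp add: algebra_simps)
        qed
        finally show ?thesis by (simp add: add_mono)
      qed
    qed
  qed
  have "(\<lambda>k. ennreal ((a + q ^ k * c) * ?m V)) \<longlonglongrightarrow> ennreal ((a + 0 * c) * ?m V)"
    using q by (intro tendsto_intros LIMSEQ_power_zero) auto
  then have "?H (V \<inter> S) \<le> ennreal ((a + 0 * c) * ?m V)"
    by (rule LIMSEQ_le_const) (use main V in auto)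
  then show ?thesis by simp
qed

text \<open>The lower density bounds the Hausdorff content of open pieces from above, and outer
  regularity of \<sigma> passes to Borel sets. This direction uses the upper density only as a
  doubling bound, with \<epsilon> = 1; the opposite inequality uses it for every \<epsilon>.\<close>

theorem hausdorff_outer_eq_measure:
  fixes \<sigma> :: "'a::euclidean_space measure"
  assumes fin: "finite_measure \<sigma>" and sets: "sets \<sigma> = sets borel" and d: "1 \<le> d"
    and U: "open U" "S \<in> sets borel" "S \<subseteq> U" "emeasure \<sigma> (U - S) = 0"
    and upper: "\<And>\<epsilon>. 0 < \<epsilon> \<Longrightarrow> \<exists>\<delta>>0. \<forall>K D. compact K \<longrightarrow> diameter K \<le> D \<longrightarrow> 0 < D \<longrightarrow> D \<le> \<delta> \<longrightarrow>
       K \<inter> S \<noteq> {} \<longrightarrow> measure \<sigma> K \<le> (1 + \<epsilon>) * (unit_ball_vol (real d) * (D / 2) ^ d)"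
    and lower: "\<And>c. 0 < c \<Longrightarrow> c < 1 \<Longrightarrow> \<exists>\<delta>>0. \<forall>x r. x \<in> S \<longrightarrow> 0 < r \<longrightarrow> r \<le> \<delta> \<longrightarrow>
       c * (unit_ball_vol (real d) * r ^ d) \<le> measure \<sigma> (cball x r)"
    and B: "B \<in> sets borel" "B \<subseteq> S"
  shows "hausdorff_outer d B = emeasure \<sigma> B"
proof (rule antisym)
  interpret finite_measure \<sigma> by (rule fin)
  show "emeasure \<sigma> B \<le> hausdorff_outer d B"
    by (rule measure_le_hausdorff_outer[OF fin sets d upper B])
  show "hausdorff_outer d B \<le> emeasure \<sigma> B"
  proof (rule ennreal_le_of_scaled_le)
    fix c :: real assume c: "0 < c" "c < 1"
    obtain \<delta>1 where \<delta>1: "0 < \<delta>1" and up: "\<And>K D. compact K \<Longrightarrow> diameter K \<le> D \<Longrightarrow> 0 < D \<Longrightarrow> D \<le> \<delta>1 \<Longrightarrow>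
       K \<inter> S \<noteq> {} \<Longrightarrow> measure \<sigma> K \<le> (1 + 1) * (unit_ball_vol (real d) * (D / 2) ^ d)"
      using upper[of 1] by auto
    obtain \<delta>2 where \<delta>2: "0 < \<delta>2" and lo: "\<And>x r. x \<in> S \<Longrightarrow> 0 < r \<Longrightarrow> r \<le> \<delta>2 \<Longrightarrow>
       c * (unit_ball_vol (real d) * r ^ d) \<le> measure \<sigma> (cball x r)"
      using lower[OF c] by blast
    have pre: "ennreal c * hausdorff_pre d \<delta> B \<le> emeasure \<sigma> B" if \<delta>: "0 < \<delta>" for \<delta>
    proof -
      define m where "m = min \<delta> (min \<delta>1 \<delta>2)"
      have m: "0 < m" "m \<le> \<delta>" "m \<le> \<delta>1" "m \<le> \<delta>2" using \<delta> \<delta>1 \<delta>2 by (auto simp: m_def)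
      have "ennreal c * hausdorff_pre d m B \<le> emeasure \<sigma> V" if V: "open V" "B \<subseteq> V" for V
      proof -
        have "hausdorff_pre d m B \<le> hausdorff_pre d m ((V \<inter> U) \<inter> S)"
          using V B U by (intro hausdorff_pre_mono) auto
        also have "\<dots> \<le> ennreal ((1 / c) * measure \<sigma> (V \<inter> U))"
        proof (rule hausdorff_pre_open_le[OF fin sets d U(1,2,4)])
          show "1 \<le> 1 / c" using c by simp
          fix x r assume "x \<in> S" "0 < r" "r \<le> m"
          then show "unit_ball_vol (real d) * r ^ d \<le> 1 / c * measure \<sigma> (cball x r)"
            using lo[of x r] m c by (simp add: field_simps)
        next
          fix K D assume "compact K" "diameter K \<le> D" "0 < D" "D \<le> m" "K \<inter> S \<noteq> {}"
          then show "measure \<sigma> K \<le> 2 * (unit_ball_vol (real d) * (D / 2) ^ d)"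
            using up[of K D] m by auto
        qed (use m V U in auto)
        also have "\<dots> \<le> ennreal ((1 / c) * measure \<sigma> V)"
          using c V U sets by (intro ennreal_leI mult_left_mono finite_measure_mono) auto
        finally have "ennreal c * hausdorff_pre d m B \<le> ennreal c * ennreal ((1 / c) * measure \<sigma> V)"
          by (intro mult_left_mono) auto
        also have "\<dots> = emeasure \<sigma> V"
          using c by (simp add: emeasure_eq_measure flip: ennreal_mult)
        finally show ?thesis .
      qed
      then have "ennreal c * hausdorff_pre d m B \<le> (INF V\<in>{V. B \<subseteq> V \<and> open V}. emeasure \<sigma> V)"
        by (intro INF_greatest) auto
      also have "\<dots> = emeasure \<sigma> B"
        using outer_regular[of \<sigma> B] sets B by simp
      finally have "ennreal c * hausdorff_pre d m B \<le> emeasure \<sigma> B" .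
      moreover have "ennreal c * hausdorff_pre d \<delta> B \<le> ennreal c * hausdorff_pre d m B"
        using m by (intro mult_left_mono hausdorff_pre_antimono) auto
      ultimately show ?thesis by (rule order_trans[rotated])
    qed
    then show "ennreal c * hausdorff_outer d B \<le> emeasure \<sigma> B"
      unfolding hausdorff_outer_def SUP_mult_left_ennreal by (intro SUP_least) auto
  qed
qed

section \<open>Projecting a hypersurface along a transversal direction\<close>

text \<open>The shadow of \<open>S\<close> along \<open>e\<close>, drawn in the slab: its Lebesgue
  measure is \<open>norm e\<close> times the area of the projection of \<open>S\<close> onto the
  hyperplane orthogonal to \<open>e\<close>.\<close>

definition hit :: "'a::euclidean_space \<Rightarrow> 'a set \<Rightarrow> 'a set" where
  "hit e S = {x \<in> slab e. \<exists>t. x + t *\<^sub>R e \<in> S}"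

definition transversal :: "'a::euclidean_space \<Rightarrow> 'a set \<Rightarrow> bool" where
  "transversal e S \<longleftrightarrow> (\<forall>x\<in>S. \<forall>t. x + t *\<^sub>R e \<in> S \<longrightarrow> t = 0)"

definition foot :: "'a::euclidean_space \<Rightarrow> 'a set \<Rightarrow> 'a \<Rightarrow> 'a" where
  "foot e S x = x + (THE t. x + t *\<^sub>R e \<in> S) *\<^sub>R e"

text \<open>The projection of a Borel set need not be Borel. For countable unions of compact sets
  the shadow is a countable union of closed sets, and a closed boundary intersected with an open
  ball is of this kind.\<close>

definition sigma_compact :: "'a::topological_space set \<Rightarrow> bool" where
  "sigma_compact S \<longleftrightarrow> (\<exists>K :: nat \<Rightarrow> 'a set. (\<forall>i. compact (K i)) \<and> S = (\<Union>i. K i))"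

text \<open>The flux of the constant field \<open>e\<close> through subsets of \<open>S\<close>: the
  push-forward of Lebesgue measure on the shadow to the foot points. Restriction to
  \<open>hit e S\<close> matters, since on other lines \<open>foot\<close> has no meaning.\<close>

definition proj_measure :: "'a::euclidean_space \<Rightarrow> 'a set \<Rightarrow> 'a measure" where
  "proj_measure e S = distr (restrict_space lborel (hit e S)) borel (foot e S)"

lemma transversal_unique:
  assumes "transversal e S" "x + s *\<^sub>R e \<in> S" "x + t *\<^sub>R e \<in> S"
  shows "s = t"
proof -
  have "(x + s *\<^sub>R e) + (t - s) *\<^sub>R e \<in> S" using assms(3) by (simp add: algebra_simps)
  then have "t - s = 0" using assms(1,2) unfolding transversal_def by blast
  then show ?thesis by simp
qed

lemma foot_eq:
  assumes "transversal e S" "x + t *\<^sub>R e \<in> S" shows "foot e S x = x + t *\<^sub>R e"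
proof -
  have "(THE t. x + t *\<^sub>R e \<in> S) = t"
    using assms transversal_unique by (intro the_equality) blast+
  then show ?thesis by (simp add: foot_def)
qed

text \<open>The points whose line meets \<open>K\<close> form the sum of \<open>K\<close> and
  \<open>span {e}\<close>, that is of a compact and a closed set.\<close>

lemma closed_hit: assumes "compact K" shows "closed (hit e K)"
proof -
  have "closed (\<Union>x\<in>K. \<Union>y\<in>span {e}. {x + y})"
    using assms by (intro compact_closed_sums closed_span)
  moreover have "{x. \<exists>t. x + t *\<^sub>R e \<in> K} = (\<Union>x\<in>K. \<Union>y\<in>span {e}. {x + y})"
  proof safe
    fix x t assume "x + t *\<^sub>R e \<in> K"
    then show "x \<in> (\<Union>x\<in>K. \<Union>y\<in>span {e}. {x + y})"
      by (intro UN_I[of "x + t *\<^sub>R e"] UN_I[of "- t *\<^sub>R e"]) (auto simp: span_mul span_base span_neg)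
  next
    fix x y assume "x \<in> K" "y \<in> span {e}"
    then obtain k where "y = k *\<^sub>R e" by (auto simp: span_singleton)
    then show "\<exists>t. x + y + t *\<^sub>R e \<in> K" using \<open>x \<in> K\<close> by (intro exI[of _ "-k"]) simp
  qed
  ultimately have "closed {x. \<exists>t. x + t *\<^sub>R e \<in> K}" by simp
  moreover have "hit e K = slab e \<inter> {x. \<exists>t. x + t *\<^sub>R e \<in> K}" by (auto simp: hit_def)
  ultimately show ?thesis using closed_slab by auto
qed

lemma bounded_hit: assumes "bounded S" "e \<noteq> 0" shows "bounded (hit e S)"
proof -
  obtain R where R: "\<And>x. x \<in> S \<Longrightarrow> norm x \<le> R" using assms(1) by (auto simp: bounded_iff)
  have p: "0 < e \<bullet> e" using assms(2) by simp
  have "norm x \<le> R + ((R * norm e + e \<bullet> e) / (e \<bullet> e)) * norm e" if "x \<in> hit e S" for x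
  proof -
    obtain t where t: "x + t *\<^sub>R e \<in> S" and x: "0 \<le> x \<bullet> e" "x \<bullet> e \<le> e \<bullet> e"
      using \<open>x \<in> hit e S\<close> by (auto simp: hit_def slab_def)
    have "t * (e \<bullet> e) = (x + t *\<^sub>R e) \<bullet> e - x \<bullet> e" by (simp add: inner_add_left)
    also have "\<bar>\<dots>\<bar> \<le> \<bar>(x + t *\<^sub>R e) \<bullet> e\<bar> + e \<bullet> e" using x by linarith
    also have "\<bar>(x + t *\<^sub>R e) \<bullet> e\<bar> \<le> norm (x + t *\<^sub>R e) * norm e" by (rule Cauchy_Schwarz_ineq2)
    also have "\<dots> \<le> R * norm e" using R[OF t] by (intro mult_right_mono) auto
    finally have "\<bar>t\<bar> * (e \<bullet> e) \<le> R * norm e + e \<bullet> e" using p by (simp add: abs_mult)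
    then have t': "\<bar>t\<bar> \<le> (R * norm e + e \<bullet> e) / (e \<bullet> e)" using p by (simp add: field_simps)
    have "norm x \<le> norm (x + t *\<^sub>R e) + norm (t *\<^sub>R e)" by (metis add_diff_cancel_right' norm_triangle_ineq4)
    also have "\<dots> \<le> R + ((R * norm e + e \<bullet> e) / (e \<bullet> e)) * norm e"
      using R[OF t] mult_right_mono[OF t', of "norm e"] by simp
    finally show ?thesis .
  qed
  then show ?thesis by (auto simp: bounded_iff)
qed

lemma compact_hit: "compact K \<Longrightarrow> e \<noteq> 0 \<Longrightarrow> compact (hit e K)"
  using closed_hit bounded_hit by (auto simp: compact_eq_bounded_closed)

lemma hit_UN: "hit e (\<Union>i. K i) = (\<Union>i. hit e (K i))"
  by (auto simp: hit_def)

lemma hit_borel: assumes "sigma_compact S" shows "hit e S \<in> sets borel"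
proof -
  obtain K :: "nat \<Rightarrow> 'a set" where "\<And>i. compact (K i)" "S = (\<Union>i. K i)"
    using assms by (auto simp: sigma_compact_def)
  then show ?thesis using closed_hit[of "K _" e] by (auto simp: hit_UN intro!: sets.countable_UN borel_closed)
qed

lemma sigma_compact_Int_closed:
  fixes S :: "'a::t2_space set"
  assumes "sigma_compact S" "closed C" shows "sigma_compact (S \<inter> C)"
proof -
  obtain K :: "nat \<Rightarrow> 'a set" where K: "\<And>i. compact (K i)" "S = (\<Union>i. K i)"
    using assms by (auto simp: sigma_compact_def)
  show ?thesis unfolding sigma_compact_def
    by (rule exI[of _ "\<lambda>i. K i \<inter> C"]) (use K assms in \<open>auto intro: compact_Int_closed\<close>)
qed

lemma sigma_compact_borel:
  fixes S :: "'a::euclidean_space set"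
  assumes "sigma_compact S" shows "S \<in> sets borel"
proof -
  obtain K :: "nat \<Rightarrow> 'a set" where "\<And>i. compact (K i)" "S = (\<Union>i. K i)"
    using assms by (auto simp: sigma_compact_def)
  moreover have "range K \<subseteq> sets borel" using calculation(1) by (auto intro: borel_compact)
  ultimately show ?thesis by (simp add: sets.countable_UN)
qed

lemma foot_vimage:
  assumes "transversal e S"
  shows "foot e S -` B \<inter> hit e S = hit e (S \<inter> B)"
proof (rule set_eqI)
  fix x
  show "x \<in> foot e S -` B \<inter> hit e S \<longleftrightarrow> x \<in> hit e (S \<inter> B)"
    using foot_eq[OF assms, of x] transversal_unique[OF assms] unfolding hit_def by auto
qed

text \<open>By transversality the shadows of \<open>S \<inter> V\<close> and
  \<open>S \<inter> - V\<close> are disjoint, so the preimage of an open \<open>V\<close> is the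
  difference of two shadows of sigma-compact sets.\<close>

lemma foot_measurable:
  assumes S: "sigma_compact S" and t: "transversal e S"
  shows "foot e S \<in> measurable (restrict_space lborel (hit e S)) borel"
proof (rule borel_measurableI)
  fix V :: "'a set" assume "open V"
  then have "sigma_compact (S \<inter> - V)" by (intro sigma_compact_Int_closed S) auto
  then have 1: "hit e (S \<inter> - V) \<in> sets borel" by (rule hit_borel)
  have "foot e S -` V \<inter> space (restrict_space lborel (hit e S)) = hit e S - hit e (S \<inter> - V)"
    using foot_vimage[OF t, of "- V"] by (auto simp: space_restrict_space)
  also have "\<dots> \<in> sets (restrict_space lborel (hit e S))"
    using 1 hit_borel[OF S] by (subst sets_restrict_space_iff) (auto simp: hit_def)
  finally show "foot e S -` V \<inter> space (restrict_space lborel (hit e S)) \<in> sets (restrict_space lborel (hit e S))" .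
qed

lemma sets_proj_measure [simp, measurable_cong]: "sets (proj_measure e S) = sets borel"
  by (simp add: proj_measure_def)

lemma space_proj_measure [simp]: "space (proj_measure e S) = UNIV"
  by (simp add: proj_measure_def)

lemma emeasure_proj_measure:
  assumes "sigma_compact S" "transversal e S" "B \<in> sets borel"
  shows "emeasure (proj_measure e S) B = emeasure lborel (hit e (S \<inter> B))"
proof -
  have "emeasure (proj_measure e S) B = emeasure (restrict_space lborel (hit e S)) (hit e (S \<inter> B))"
    unfolding proj_measure_def
    using assms foot_measurable foot_vimage[of e S B]
    by (subst emeasure_distr) (auto simp: space_restrict_space)
  also have "\<dots> = emeasure lborel (hit e (S \<inter> B))"
    using hit_borel[OF assms(1)] by (intro emeasure_restrict_space) (auto simp: hit_def)
  finally show ?thesis .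
qed

lemma finite_proj_measure:
  assumes "sigma_compact S" "transversal e S" "bounded S" "e \<noteq> 0"
  shows "finite_measure (proj_measure e S)"
proof
  have "emeasure (proj_measure e S) UNIV = emeasure lborel (hit e S)"
    using assms by (simp add: emeasure_proj_measure)
  also have "\<dots> < top"
    using bounded_hit[OF assms(3,4)] emeasure_bounded_finite by (auto simp: less_top)
  finally show "emeasure (proj_measure e S) (space (proj_measure e S)) \<noteq> \<infinity>" by simp
qed

lemma integral_proj_measure:
  fixes f :: "'a::euclidean_space \<Rightarrow> real"
  assumes "sigma_compact S" "transversal e S" and [measurable]: "f \<in> borel_measurable borel"
  shows "(\<integral>x. f x \<partial>proj_measure e S) = (\<integral>x. indicator (hit e S) x * f (foot e S x) \<partial>lborel)"
proof -
  have "(\<integral>x. f x \<partial>proj_measure e S) = (\<integral>x. f (foot e S x) \<partial>restrict_space lborel (hit e S))"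
    unfolding proj_measure_def using foot_measurable[OF assms(1,2)] by (intro integral_distr) auto
  also have "\<dots> = (\<integral>x. indicator (hit e S) x *\<^sub>R f (foot e S x) \<partial>lborel)"
    using hit_borel[OF assms(1)] by (intro integral_restrict_space) auto
  finally show ?thesis by simp
qed

lemma open_line:
  fixes x e :: "'a::real_normed_vector"
  assumes "open U" shows "open {t. x + t *\<^sub>R e \<in> U}"
proof -
  have "open ((\<lambda>t. x + t *\<^sub>R e) -` U)"
    by (rule open_vimage[OF assms]) (intro continuous_intros)
  then show ?thesis by (simp add: vimage_def)
qed

section \<open>A boundary patch\<close>

locale boundary_patch =
  fixes \<Omega> :: "'a::euclidean_space set" and p :: 'a and r :: real
    and \<phi> :: "'a \<Rightarrow> real" and D\<phi> :: "'a \<Rightarrow> 'a"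
  assumes open_dom: "open \<Omega>" and r_pos: "0 < r"
    and phi_deriv: "\<And>x. x \<in> ball p r \<Longrightarrow> (\<phi> has_derivative (\<lambda>h. D\<phi> x \<bullet> h)) (at x)"
    and grad_cont: "continuous_on (ball p r) D\<phi>"
    and grad_nz: "\<And>x. x \<in> ball p r \<Longrightarrow> D\<phi> x \<noteq> 0"
    and in_dom: "\<And>x. x \<in> ball p r \<Longrightarrow> x \<in> \<Omega> \<longleftrightarrow> \<phi> x < 0"
    and in_front: "\<And>x. x \<in> ball p r \<Longrightarrow> x \<in> frontier \<Omega> \<longleftrightarrow> \<phi> x = 0"
begin

definition surf :: "'a set" where "surf = frontier \<Omega> \<inter> ball p r"

text \<open>Such an \<open>e\<close> points out of the domain: \<phi> increases strictly along it,
  so a line parallel to \<open>e\<close> meets the surface at most once inside the ball.\<close>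

definition crossing :: "'a \<Rightarrow> bool" where "crossing e \<longleftrightarrow> (\<forall>x\<in>ball p r. 0 < D\<phi> x \<bullet> e)"

lemma crossing_nz: "crossing e \<Longrightarrow> e \<noteq> 0"
  using r_pos unfolding crossing_def by (metis centre_in_ball inner_zero_right less_irrefl)

lemma phi_cont: "continuous_on (ball p r) \<phi>"
  by (intro continuous_at_imp_continuous_on ballI) (use phi_deriv has_derivative_continuous in blast)

lemma phi_mvt:
  assumes "x \<in> ball p r" "y \<in> ball p r"
  shows "\<exists>z\<in>closed_segment x y. z \<in> ball p r \<and> \<phi> y - \<phi> x = D\<phi> z \<bullet> (y - x)"
proof -
  have seg: "x + t *\<^sub>R (y - x) \<in> closed_segment x y" if "t \<in> {0..1}" for t
    using that unfolding closed_segment_def by (auto intro!: exI[of _ t] simp: algebra_simps)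
  have sub: "closed_segment x y \<subseteq> ball p r"
    using assms by (intro closed_segment_subset) auto
  have "\<exists>t\<in>{0..1}. \<phi> (x + 1 *\<^sub>R (y - x)) - \<phi> (x + 0 *\<^sub>R (y - x)) = (\<lambda>h. D\<phi> (x + t *\<^sub>R (y - x)) \<bullet> (h *\<^sub>R (y - x))) (1 - 0)"
  proof (rule mvt_very_simple)
    fix t :: real assume "0 \<le> t" "t \<le> 1"
    then have "(\<phi> has_derivative (\<lambda>h. D\<phi> (x + t *\<^sub>R (y - x)) \<bullet> h)) (at (x + t *\<^sub>R (y - x)))"
      using seg[of t] sub by (intro phi_deriv) auto
    moreover have "((\<lambda>t. x + t *\<^sub>R (y - x)) has_derivative (\<lambda>h. h *\<^sub>R (y - x))) (at t within {0..1})"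
      by (auto intro!: derivative_eq_intros)
    ultimately show "((\<lambda>t. \<phi> (x + t *\<^sub>R (y - x))) has_derivative (\<lambda>h. D\<phi> (x + t *\<^sub>R (y - x)) \<bullet> (h *\<^sub>R (y - x)))) (at t within {0..1})"
      by (rule has_derivative_compose[rotated])
  qed simp
  then obtain t where t: "t \<in> {0..1}" "\<phi> y - \<phi> x = D\<phi> (x + t *\<^sub>R (y - x)) \<bullet> (y - x)" by auto
  then show ?thesis using seg[OF t(1)] sub by blast
qed

lemma phi_increasing:
  assumes e: "crossing e" and x: "x \<in> ball p r" "x + t *\<^sub>R e \<in> ball p r" and t: "0 < t"
  shows "\<phi> x < \<phi> (x + t *\<^sub>R e)"
proof -
  obtain z where z: "z \<in> ball p r" "\<phi> (x + t *\<^sub>R e) - \<phi> x = D\<phi> z \<bullet> (x + t *\<^sub>R e - x)"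
    using phi_mvt[OF x] by blast
  have "0 < D\<phi> z \<bullet> e" using e z by (auto simp: crossing_def)
  then have "0 < t * (D\<phi> z \<bullet> e)" using t by simp
  then show ?thesis using z by simp
qed

lemma transversal_surf: assumes "crossing e" shows "transversal e surf"
  unfolding transversal_def
proof (intro ballI allI impI)
  fix x t assume x: "x \<in> surf" "x + t *\<^sub>R e \<in> surf"
  then have b: "x \<in> ball p r" "x + t *\<^sub>R e \<in> ball p r" "\<phi> x = 0" "\<phi> (x + t *\<^sub>R e) = 0"
    using in_front by (auto simp: surf_def)
  show "t = 0"
  proof (rule ccontr)
    assume "t \<noteq> 0"
    then consider "0 < t" | "0 < - t" by linarith
    then show False
    proof cases
      case 1 then show ?thesis using phi_increasing[OF assms b(1,2)] b by simp
    next
      case 2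
      have "x + t *\<^sub>R e + (-t) *\<^sub>R e = x" by simp
      then show ?thesis using phi_increasing[OF assms b(2), of "-t"] b 2 by simp
    qed
  qed
qed

lemma sigma_compact_surf: "sigma_compact surf"
  unfolding sigma_compact_def
proof (intro exI conjI allI)
  let ?K = "\<lambda>i::nat. frontier \<Omega> \<inter> cball p (r - r / real (Suc i))"
  show "compact (?K i)" for i by (intro closed_Int_compact frontier_closed compact_cball)
  show "surf = (\<Union>i. ?K i)"
  proof safe
    fix x assume x: "x \<in> surf"
    then have "0 < (r - dist p x) / r" using r_pos by (simp add: surf_def)
    then obtain i where "1 / real (Suc i) < (r - dist p x) / r" using nat_approx_posE by blast
    then have "r / real (Suc i) < r - dist p x" using r_pos by (simp add: field_simps)
    then show "x \<in> (\<Union>i. ?K i)" using x by (auto simp: surf_def intro!: exI[of _ i])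
  next
    fix x i assume "x \<in> frontier \<Omega>" "x \<in> cball p (r - r / real (Suc i))"
    moreover have "0 < r / real (Suc i)" using r_pos by simp
    ultimately show "x \<in> surf" by (auto simp: surf_def simp del: of_nat_Suc)
  qed
qed

lemma bounded_surf: "bounded surf"
  unfolding surf_def by (metis bounded_ball bounded_subset inf_le2)

lemma closure_dom: "x \<in> ball p r \<Longrightarrow> \<phi> x \<le> 0 \<Longrightarrow> x \<in> closure \<Omega>"
  using in_dom[of x] in_front[of x] closure_subset[of \<Omega>] by (auto simp: frontier_def less_le)

text \<open>The divergence theorem in one transversal direction: the fundamental theorem of calculus
  on each line, where the only boundary term comes from the foot point.\<close>

lemma integral_line_derivative:
  fixes f f' :: "'a \<Rightarrow> real"
  assumes e: "crossing e" and \<rho>: "\<rho> < r"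
    and cont: "continuous_on (closure \<Omega>) f"
    and zero: "\<And>x. x \<notin> cball p \<rho> \<Longrightarrow> f x = 0"
    and der: "\<And>x. x \<in> \<Omega> \<Longrightarrow> x \<in> ball p r \<Longrightarrow> ((\<lambda>t. f (x + t *\<^sub>R e)) has_real_derivative f' x) (at 0)"
    and zero': "\<And>x. x \<notin> cball p \<rho> \<Longrightarrow> f' x = 0"
    and gm: "(\<lambda>y. indicator (\<Omega> \<inter> ball p r) y * f' y) \<in> borel_measurable borel"
    and bd: "\<And>x. x \<in> \<Omega> \<Longrightarrow> \<bar>f' x\<bar> \<le> M"
  shows "(\<integral>t. indicator (\<Omega> \<inter> ball p r) (x + t *\<^sub>R e) * f' (x + t *\<^sub>R e) \<partial>lborel)
    = (if \<exists>t. x + t *\<^sub>R e \<in> surf then f (foot e surf x) else 0)"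
proof -
  define g where "g y = indicator (\<Omega> \<inter> ball p r) y * f' y" for y
  have "g = (\<lambda>y. indicator (\<Omega> \<inter> ball p r) y * f' y)" by (simp add: g_def fun_eq_iff)
  then have [measurable]: "g \<in> borel_measurable borel" using gm by simp
  have e0: "0 < norm e" using crossing_nz[OF e] by simp
  define L where "L = (norm (x - p) + r) / norm e + 1"
  have inL: "\<bar>t\<bar> < L" if "x + t *\<^sub>R e \<in> ball p r" for t
  proof -
    have "norm (t *\<^sub>R e) \<le> norm (x - p) + norm (x + t *\<^sub>R e - p)"
      by (metis (no_types, opaque_lifting) add.commute add_diff_cancel_left' add_diff_eq diff_add_eq norm_triangle_ineq4 norm_minus_commute)
    also have "norm (x + t *\<^sub>R e - p) < r" using that by (simp add: dist_norm norm_minus_commute)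
    finally have "\<bar>t\<bar> * norm e < norm (x - p) + r" by simp
    then have "\<bar>t\<bar> < (norm (x - p) + r) / norm e" using e0 by (simp add: field_simps)
    then show ?thesis by (simp add: L_def)
  qed
  have g0: "g (x + t *\<^sub>R e) = 0" if "x + t *\<^sub>R e \<notin> ball p r \<or> 0 \<le> \<phi> (x + t *\<^sub>R e)" for t
    using that in_dom[of "x + t *\<^sub>R e"] by (auto simp: g_def indicator_def)
  have int: "integrable lborel (\<lambda>t. g (x + t *\<^sub>R e))"
  proof (rule Bochner_Integration.integrable_bound)
    show "integrable lborel (\<lambda>t. indicator {-L..L} t * \<bar>M\<bar>)"
      by (intro integrable_mult_left integrable_real_indicator) (auto simp: emeasure_lborel_Icc_eq)
    show "AE t in lborel. norm (g (x + t *\<^sub>R e)) \<le> norm (indicator {-L..L} t * \<bar>M\<bar>)"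
    proof (rule AE_I2)
      fix t show "norm (g (x + t *\<^sub>R e)) \<le> norm (indicator {-L..L} t * \<bar>M\<bar>)"
        using bd[of "x + t *\<^sub>R e"] inL[of t] by (auto simp: g_def indicator_def)
    qed
  qed measurable
  \<comment> \<open>The extension by zero is continuous because \<open>f\<close> already vanishes
    outside \<open>cball p \<rho>\<close> with \<open>\<rho> < r\<close>: the open ball and the
    complement of the smaller closed ball cover the line and overlap.\<close>
  define H where "H t = (if x + t *\<^sub>R e \<in> ball p r then f (x + t *\<^sub>R e) else 0)" for t
  \<comment> \<open>Used with \<open>T\<close> the parameter of the surface point and, on lines that
    miss the surface and have no point of positive \<phi> in the ball, with \<open>T = L\<close>,
    where \<open>H\<close> is zero.\<close>
  have FTC: "(\<integral>t. g (x + t *\<^sub>R e) \<partial>lborel) = H T"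
    if T: "-L < T" "T \<le> L" and neg: "\<And>t. t < T \<Longrightarrow> x + t *\<^sub>R e \<in> ball p r \<Longrightarrow> \<phi> (x + t *\<^sub>R e) < 0"
      and negT: "x + T *\<^sub>R e \<in> ball p r \<Longrightarrow> \<phi> (x + T *\<^sub>R e) \<le> 0"
      and gT: "\<And>t. T < t \<Longrightarrow> g (x + t *\<^sub>R e) = 0" for T
  proof -
    have "continuous_on {-L..T} H"
    proof -
      let ?N = "{-L..T} \<inter> {t. x + t *\<^sub>R e \<in> ball p r}" and ?Z = "{-L..T} \<inter> {t. x + t *\<^sub>R e \<in> - cball p \<rho>}"
      have U: "?N \<union> ?Z = {-L..T}" using \<rho> by auto
      have o: "open {t. x + t *\<^sub>R e \<in> ball p r}" "open {t. x + t *\<^sub>R e \<in> - cball p \<rho>}"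
        by (intro open_line open_ball open_Compl closed_cball)+
      have "continuous_on (?N \<union> ?Z) H"
      proof (rule continuous_on_Un_local_open)
        show "openin (top_of_set (?N \<union> ?Z)) ?N" "openin (top_of_set (?N \<union> ?Z)) ?Z"
          using o unfolding U by (auto simp: openin_open)
        have "continuous_on ?N (\<lambda>t. f (x + t *\<^sub>R e))"
        proof (rule continuous_on_compose2[OF cont])
          show "(\<lambda>t. x + t *\<^sub>R e) ` ?N \<subseteq> closure \<Omega>"
          proof clarsimp
            fix t assume t: "- L \<le> t" "t \<le> T" "dist p (x + t *\<^sub>R e) < r"
            then have "\<phi> (x + t *\<^sub>R e) \<le> 0" using neg[of t] negT by (cases "t = T") auto
            then show "x + t *\<^sub>R e \<in> closure \<Omega>" using t by (intro closure_dom) auto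
          qed
        qed (intro continuous_intros)
        then show "continuous_on ?N H"
          by (rule continuous_on_eq) (simp add: H_def)
        show "continuous_on ?Z H"
          by (rule continuous_on_eq[of _ "\<lambda>_. 0"]) (use zero in \<open>auto simp: H_def\<close>)
      qed
      then show ?thesis by (simp only: U)
    qed
    moreover have "(H has_vector_derivative g (x + t *\<^sub>R e)) (at t)" if t: "t \<in> {-L<..<T}" for t
    proof (cases "x + t *\<^sub>R e \<in> ball p r")
      case True
      let ?y = "x + t *\<^sub>R e"
      have y: "?y \<in> \<Omega>" using neg[of t] t True in_dom by auto
      have "((\<lambda>s. f (?y + s *\<^sub>R e)) has_real_derivative f' ?y) (at 0)" by (rule der[OF y True])
      then have "((\<lambda>s. f (?y + (s + - t) *\<^sub>R e)) has_real_derivative f' ?y) (at t)"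
        using DERIV_shift[of "\<lambda>s. f (?y + (s + - t) *\<^sub>R e)" "f' ?y" 0 t] by simp
      then have "((\<lambda>s. f (x + s *\<^sub>R e)) has_real_derivative f' ?y) (at t)"
        by (simp add: algebra_simps)
      then have "(H has_real_derivative f' ?y) (at t)"
      proof (rule has_field_derivative_transform_within_open)
        show "open {t. x + t *\<^sub>R e \<in> ball p r}" by (intro open_line open_ball open_Compl closed_cball)+
      qed (use True in \<open>auto simp: H_def\<close>)
      then show ?thesis using y True by (simp add: g_def has_real_derivative_iff_has_vector_derivative)
    next
      case False
      then have nc: "x + t *\<^sub>R e \<in> - cball p \<rho>" using \<rho> by auto
      have "((\<lambda>_. 0) has_real_derivative 0) (at t)" by simp
      then have "(H has_real_derivative 0) (at t)"
      proof (rule has_field_derivative_transform_within_open)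
        show "open {t. x + t *\<^sub>R e \<in> - cball p \<rho>}" by (intro open_line open_ball open_Compl closed_cball)+
      qed (use nc zero in \<open>auto simp: H_def\<close>)
      then show ?thesis using False by (simp add: g_def has_real_derivative_iff_has_vector_derivative)
    qed
    ultimately have "((\<lambda>t. g (x + t *\<^sub>R e)) has_integral (H T - H (-L))) {-L..T}"
      using T by (intro fundamental_theorem_of_calculus_interior) auto
    moreover have "H (-L) = 0" using inL[of "-L"] by (auto simp: H_def)
    ultimately have "((\<lambda>t. g (x + t *\<^sub>R e)) has_integral H T) {-L..T}" by simp
    then have "((\<lambda>t. g (x + t *\<^sub>R e)) has_integral H T) UNIV"
    proof (rule has_integral_on_superset)
      fix t assume "t \<notin> {-L..T}"
      then consider "T < t" | "t < - L" by force
      then show "g (x + t *\<^sub>R e) = 0"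
      proof cases
        case 2
        then have "x + t *\<^sub>R e \<notin> ball p r" using inL[of t] by fastforce
        then show ?thesis using g0[of t] by blast
      qed (rule gT)
    qed auto
    moreover have "((\<lambda>t. g (x + t *\<^sub>R e)) has_integral (\<integral>t. g (x + t *\<^sub>R e) \<partial>lborel)) UNIV"
      using int by (rule has_integral_integral_lborel)
    ultimately show ?thesis using has_integral_unique by blast
  qed
  have mono: "\<phi> (x + s *\<^sub>R e) < \<phi> (x + t *\<^sub>R e)" if "s < t" "x + s *\<^sub>R e \<in> ball p r" "x + t *\<^sub>R e \<in> ball p r" for s t
    using phi_increasing[OF e that(2), of "t - s"] that by (simp add: algebra_simps)
  show ?thesis
  proof (cases "\<exists>t. x + t *\<^sub>R e \<in> surf")
    case True
    then obtain T where T: "x + T *\<^sub>R e \<in> surf" by blast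
    then have b: "x + T *\<^sub>R e \<in> ball p r" "\<phi> (x + T *\<^sub>R e) = 0" using in_front by (auto simp: surf_def)
    have "(\<integral>t. g (x + t *\<^sub>R e) \<partial>lborel) = H T"
    proof (rule FTC)
      show "- L < T" "T \<le> L" using inL[OF b(1)] by auto
      fix t assume "T < t" then show "g (x + t *\<^sub>R e) = 0"
        using mono[of T t] b g0[of t] by (cases "x + t *\<^sub>R e \<in> ball p r") auto
    next
      fix t assume "t < T" "x + t *\<^sub>R e \<in> ball p r"
      then show "\<phi> (x + t *\<^sub>R e) < 0" using mono[of t T] b by auto
    qed (use b in auto)
    also have "H T = f (foot e surf x)"
      using b foot_eq[OF transversal_surf[OF e] T] by (simp add: H_def)
    finally show ?thesis using True by (simp add: g_def)
  next
    case False
    have nz: "\<phi> (x + t *\<^sub>R e) \<noteq> 0" if "x + t *\<^sub>R e \<in> ball p r" for t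
      using False that in_front by (auto simp: surf_def)
    have "(\<integral>t. g (x + t *\<^sub>R e) \<partial>lborel) = 0"
    proof (cases "\<exists>s. x + s *\<^sub>R e \<in> ball p r \<and> 0 < \<phi> (x + s *\<^sub>R e)")
      case True
      then obtain s where s: "x + s *\<^sub>R e \<in> ball p r" "0 < \<phi> (x + s *\<^sub>R e)" by blast
      \<comment> \<open>If one point of the line in the ball had positive \<phi> and another one
        negative, convexity of the ball and the intermediate value theorem would give a surface
        point between them.\<close>
      have "g (x + t *\<^sub>R e) = 0" for t
      proof (rule ccontr)
        assume "g (x + t *\<^sub>R e) \<noteq> 0"
        then have t: "x + t *\<^sub>R e \<in> ball p r" "\<phi> (x + t *\<^sub>R e) < 0" using g0[of t] by force+
        have ts: "t < s" using mono[of s t] s t by (cases "t = s") force+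
        have sub: "x + u *\<^sub>R e \<in> ball p r" if "u \<in> {t..s}" for u
        proof -
          define w where "w = (u - t) / (s - t)"
          have "w * (s - t) = u - t" using ts by (simp add: w_def)
          then have w3: "u = (1 - w) * t + w * s" by (simp add: algebra_simps)
          have w: "0 \<le> w" "w \<le> 1" using that ts by (auto simp: w_def)
          have "(1 - w) *\<^sub>R (x + t *\<^sub>R e) + w *\<^sub>R (x + s *\<^sub>R e) \<in> ball p r"
            using s t w convex_ball[of p r] by (intro convexD) auto
          moreover have "(1 - w) *\<^sub>R (x + t *\<^sub>R e) + w *\<^sub>R (x + s *\<^sub>R e) = x + u *\<^sub>R e"
            by (subst w3) (simp add: algebra_simps)
          ultimately show ?thesis by simp
        qed
        have "continuous_on {t..s} (\<lambda>u. \<phi> (x + u *\<^sub>R e))"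
          by (rule continuous_on_compose2[OF phi_cont]) (use sub in \<open>auto intro!: continuous_intros\<close>)
        then obtain u where "t \<le> u" "u \<le> s" "\<phi> (x + u *\<^sub>R e) = 0"
          using IVT'[of "\<lambda>u. \<phi> (x + u *\<^sub>R e)" t 0 s] ts s t by auto
        then show False using nz[of u] sub[of u] by auto
      qed
      then show ?thesis by simp
    next
      case F: False
      have "(\<integral>t. g (x + t *\<^sub>R e) \<partial>lborel) = H L"
      proof (rule FTC)
        have "0 \<le> (norm (x - p) + r) / norm e" using r_pos by simp
        then have "0 < L" unfolding L_def by linarith
        then show "- L < L" "L \<le> L" by auto
        fix t assume t: "L < t"
        have "x + t *\<^sub>R e \<notin> ball p r"
        proof
          assume "x + t *\<^sub>R e \<in> ball p r"
          then show False using inL[of t] t by simp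
        qed
        then show "g (x + t *\<^sub>R e) = 0" using g0[of t] by blast
      next
        fix t assume "x + t *\<^sub>R e \<in> ball p r" then show "\<phi> (x + t *\<^sub>R e) < 0" using F nz[of t] by force
      next
        assume "x + L *\<^sub>R e \<in> ball p r" then show "\<phi> (x + L *\<^sub>R e) \<le> 0" using F by force
      qed
      also have "H L = 0" using inL[of L] by (auto simp: H_def)
      finally show ?thesis .
    qed
    then show ?thesis using False by (simp add: g_def)
  qed
qed

text \<open>Fubini along lines collects the boundary terms into \<open>proj_measure e surf\<close>.
  The factor \<open>indicator (closure \<Omega>)\<close> is 1 at every foot point; it makes the
  integrand Borel, since \<open>f\<close> is known to be continuous only on the closure.\<close>

lemma integral_directional_derivative:
  fixes f f' :: "'a \<Rightarrow> real"
  assumes e: "crossing e" and \<rho>: "\<rho> < r"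
    and cont: "continuous_on (closure \<Omega>) f"
    and zero: "\<And>x. x \<notin> cball p \<rho> \<Longrightarrow> f x = 0"
    and der: "\<And>x. x \<in> \<Omega> \<Longrightarrow> x \<in> ball p r \<Longrightarrow> ((\<lambda>t. f (x + t *\<^sub>R e)) has_real_derivative f' x) (at 0)"
    and zero': "\<And>x. x \<notin> cball p \<rho> \<Longrightarrow> f' x = 0"
    and cont': "continuous_on (\<Omega> \<inter> ball p r) f'"
    and bd: "\<And>x. x \<in> \<Omega> \<Longrightarrow> \<bar>f' x\<bar> \<le> M"
  shows "(\<integral>x. indicator \<Omega> x * f' x \<partial>lborel) = (\<integral>x. indicator (closure \<Omega>) x * f x \<partial>proj_measure e surf)"
proof -
  let ?g = "\<lambda>y. indicator (\<Omega> \<inter> ball p r) y * f' y"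
  have gm: "?g \<in> borel_measurable borel"
    using borel_measurable_continuous_on_indicator[OF _ cont'] open_dom by simp
  have int: "integrable lborel ?g"
  proof (rule Bochner_Integration.integrable_bound)
    show "integrable lborel (\<lambda>x. indicator (ball p r) x * \<bar>M\<bar>)"
      by (intro integrable_mult_left integrable_real_indicator) (use emeasure_lborel_ball_finite[of p r] in \<open>auto simp: less_top\<close>)
    show "AE t in lborel. norm (?g t) \<le> norm (indicator (ball p r) t * \<bar>M\<bar>)"
      using bd by (intro AE_I2) (force simp: indicator_def)
  qed (use gm in simp)
  have fm: "(\<lambda>x. indicator (closure \<Omega>) x * f x) \<in> borel_measurable borel"
    using borel_measurable_continuous_on_indicator[OF _ cont] by simp
  have "(\<integral>x. indicator \<Omega> x * f' x \<partial>lborel) = (\<integral>x. ?g x \<partial>lborel)"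
    using zero' \<rho> by (intro Bochner_Integration.integral_cong) (force simp: indicator_def)+
  also have "\<dots> = (\<integral>x. indicator (slab e) x * (\<integral>t. ?g (x + t *\<^sub>R e) \<partial>lborel) \<partial>lborel)"
    by (rule integral_lines[OF int crossing_nz[OF e]])
  also have "\<dots> = (\<integral>x. indicator (hit e surf) x * (indicator (closure \<Omega>) (foot e surf x) * f (foot e surf x)) \<partial>lborel)"
  proof (rule Bochner_Integration.integral_cong[OF refl])
    fix x
    have "(\<integral>t. ?g (x + t *\<^sub>R e) \<partial>lborel) = (if \<exists>t. x + t *\<^sub>R e \<in> surf then f (foot e surf x) else 0)"
      by (rule integral_line_derivative[OF e \<rho> cont zero der zero' gm bd])
    moreover have "foot e surf x \<in> closure \<Omega>" if "x + t *\<^sub>R e \<in> surf" for t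
      using foot_eq[OF transversal_surf[OF e] that] that by (simp add: surf_def frontier_def)
    ultimately show "indicator (slab e) x * (\<integral>t. ?g (x + t *\<^sub>R e) \<partial>lborel) =
       indicator (hit e surf) x * (indicator (closure \<Omega>) (foot e surf x) * f (foot e surf x))"
      by (auto simp: hit_def indicator_def)
  qed
  also have "\<dots> = (\<integral>x. indicator (closure \<Omega>) x * f x \<partial>proj_measure e surf)"
    by (rule integral_proj_measure[symmetric, OF sigma_compact_surf transversal_surf[OF e] fm])
  finally show ?thesis .
qed

end

section \<open>Continuously differentiable test functions\<close>

lemma mult_fun_commute: "(\<lambda>h. h * a) = (*) (a::real)"
  by (simp add: fun_eq_iff)

definition C1 :: "('a::euclidean_space \<Rightarrow> real) \<Rightarrow> ('a \<Rightarrow> 'a) \<Rightarrow> bool" where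
  "C1 f Df \<longleftrightarrow> (\<forall>x. (f has_derivative (\<lambda>h. Df x \<bullet> h)) (at x)) \<and> continuous_on UNIV Df"

lemma C1_continuous: "C1 f Df \<Longrightarrow> continuous_on S f"
  unfolding C1_def by (meson continuous_at_imp_continuous_on has_derivative_continuous)

lemma C1_directional:
  assumes "C1 f Df" shows "((\<lambda>t. f (x + t *\<^sub>R e)) has_real_derivative (Df x \<bullet> e)) (at 0)"
proof -
  have "((\<lambda>t. x + t *\<^sub>R e) has_derivative (\<lambda>h. h *\<^sub>R e)) (at (0::real))"
    by (auto intro!: derivative_eq_intros)
  moreover have "(f has_derivative (\<lambda>h. Df x \<bullet> h)) (at (x + 0 *\<^sub>R e))"
    using assms by (simp add: C1_def)
  ultimately have "((\<lambda>t. f (x + t *\<^sub>R e)) has_derivative (\<lambda>h. Df x \<bullet> (h *\<^sub>R e))) (at 0)"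
    by (rule has_derivative_compose)
  then show ?thesis by (simp add: has_field_derivative_def mult_fun_commute)
qed

lemma C1_zero_grad:
  assumes f: "C1 f Df" and V: "open V" "x \<in> V" "\<And>y. y \<in> V \<Longrightarrow> f y = 0"
  shows "Df x = 0"
proof -
  have "((\<lambda>_. 0) has_derivative (\<lambda>h. 0)) (at x)" by simp
  then have "(f has_derivative (\<lambda>h. 0)) (at x)"
    by (rule has_derivative_transform_within_open[OF _ V(1,2)]) (simp add: V(3))
  moreover have "(f has_derivative (\<lambda>h. Df x \<bullet> h)) (at x)" using f by (simp add: C1_def)
  ultimately have "(\<lambda>h. 0) = (\<lambda>h. Df x \<bullet> h)" by (rule has_derivative_unique)
  from fun_cong[OF this, of "Df x"] have "Df x \<bullet> Df x = 0" by simp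
  then show ?thesis by simp
qed

lemma DERIV_max0_power:
  assumes n: "2 \<le> n"
  shows "((\<lambda>t. (max 0 t) ^ n) has_real_derivative (real n * (max 0 t) ^ (n - 1))) (at t)"
proof -
  consider "t < 0" | "t = 0" | "0 < t" by linarith
  then show ?thesis
  proof cases
    case 1
    have "((\<lambda>_. 0) has_real_derivative 0) (at t)" by simp
    then have "((\<lambda>t. (max 0 t) ^ n) has_real_derivative 0) (at t)"
      by (rule has_field_derivative_transform_within_open[where S="{..<0}"]) (use 1 n in auto)
    then show ?thesis using 1 n by (simp add: power_0_left)
  next
    case 3
    have "((\<lambda>t. t ^ n) has_real_derivative (real n * t ^ (n - 1))) (at t)"
      by (auto intro!: derivative_eq_intros)
    then have "((\<lambda>t. (max 0 t) ^ n) has_real_derivative (real n * t ^ (n - 1))) (at t)"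
      by (rule has_field_derivative_transform_within_open[where S="{0<..}"]) (use 3 in auto)
    then show ?thesis using 3 by simp
  next
    case 2
    have "isCont (\<lambda>h::real. (max 0 h) ^ (n - 1)) 0" by (intro continuous_intros)
    then have "((\<lambda>h::real. (max 0 h) ^ (n - 1)) \<longlongrightarrow> 0) (at 0)"
      using n by (simp add: isCont_def power_0_left split: if_splits)
    then have "((\<lambda>h::real. ((max 0 (0 + h)) ^ n - (max 0 0) ^ n) / h) \<longlongrightarrow> 0) (at 0)"
    proof (rule Lim_transform_eventually)
      show "\<forall>\<^sub>F h in at (0::real). (max 0 h) ^ (n - 1) = ((max 0 (0 + h)) ^ n - (max 0 0) ^ n) / h"
        unfolding eventually_at
      proof (intro exI[of _ 1] conjI ballI impI)
        fix h :: real assume "h \<noteq> 0 \<and> dist h 0 < 1"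
        moreover obtain m where "n = Suc (Suc m)" using n by (metis Suc_1 Suc_le_D numeral_2_eq_2 Suc_le_mono)
        ultimately show "(max 0 h) ^ (n - 1) = ((max 0 (0 + h)) ^ n - (max 0 0) ^ n) / h"
          by (cases "0 < h") (auto simp: max_def)
      qed simp
    qed
    then show ?thesis using 2 n by (simp add: DERIV_def power_0_left split: if_splits)
  qed
qed

text \<open>Squaring the positive part makes the truncated paraboloid continuously differentiable;
  for \<open>0 < s\<close> its support is the closed ball of radius \<open>s\<close>.\<close>

definition bump :: "'a::euclidean_space \<Rightarrow> real \<Rightarrow> 'a \<Rightarrow> real" where
  "bump c s x = (max 0 (s\<^sup>2 - (x - c) \<bullet> (x - c))) ^ 2"

definition bump_grad :: "'a::euclidean_space \<Rightarrow> real \<Rightarrow> 'a \<Rightarrow> 'a" where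
  "bump_grad c s x = (- 4 * max 0 (s\<^sup>2 - (x - c) \<bullet> (x - c))) *\<^sub>R (x - c)"

lemma has_derivative_max0_sq_norm:
  fixes c :: "'a::euclidean_space"
  assumes n: "2 \<le> n"
  shows "((\<lambda>x. (max 0 (a - (x - c) \<bullet> (x - c))) ^ n) has_derivative
    (\<lambda>h. ((- 2 * real n * (max 0 (a - (x - c) \<bullet> (x - c))) ^ (n - 1)) *\<^sub>R (x - c)) \<bullet> h)) (at x)"
proof -
  have 1: "((\<lambda>x. a - (x - c) \<bullet> (x - c)) has_derivative (\<lambda>h. - 2 * ((x - c) \<bullet> h))) (at x)"
    by (auto intro!: derivative_eq_intros simp: inner_commute)
  have 2: "((\<lambda>t. (max 0 t) ^ n) has_derivative (\<lambda>h. h * (real n * (max 0 (a - (x - c) \<bullet> (x - c))) ^ (n - 1))))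
     (at (a - (x - c) \<bullet> (x - c)))"
    using DERIV_max0_power[OF n] by (simp add: has_field_derivative_def mult_fun_commute)
  show ?thesis
    using has_derivative_compose[OF 1 2] by (simp add: mult_ac)
qed

lemma C1_bump: "C1 (bump c s) (bump_grad c s)"
  unfolding C1_def
proof (intro conjI allI)
  fix x
  show "(bump c s has_derivative (\<lambda>h. bump_grad c s x \<bullet> h)) (at x)"
    unfolding bump_def[abs_def] bump_grad_def
    by (rule has_derivative_eq_rhs[OF has_derivative_max0_sq_norm]) auto
  show "continuous_on UNIV (bump_grad c s)"
    unfolding bump_grad_def[abs_def] by (intro continuous_intros)
qed

lemma bump_pos_iff: "0 < s \<Longrightarrow> 0 < bump c s x \<longleftrightarrow> dist c x < s"
proof -
  assume s: "0 < s"
  have "(x - c) \<bullet> (x - c) = (dist c x)\<^sup>2" by (metis dist_norm dist_commute power2_norm_eq_inner)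
  moreover have "(dist c x)\<^sup>2 < s\<^sup>2 \<longleftrightarrow> dist c x < s"
    using s by (metis abs_of_pos abs_of_nonneg power2_less_imp_less power_strict_mono zero_le_dist less_imp_le zero_less_numeral)
  ultimately show ?thesis by (auto simp: bump_def max_def)
qed

lemma bump_nonneg: "0 \<le> bump c s x" by (simp add: bump_def)

lemma bump_eq_0: "0 < s \<Longrightarrow> x \<notin> ball c s \<Longrightarrow> bump c s x = 0"
  using bump_pos_iff[of s c x] bump_nonneg[of c s x] by auto

lemma C1_sum:
  assumes "finite I" "\<And>i. i \<in> I \<Longrightarrow> C1 (f i) (Df i)"
  shows "C1 (\<lambda>x. \<Sum>i\<in>I. f i x) (\<lambda>x. \<Sum>i\<in>I. Df i x)"
  unfolding C1_def
proof (intro conjI allI)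
  fix x
  have "((\<lambda>x. \<Sum>i\<in>I. f i x) has_derivative (\<lambda>h. \<Sum>i\<in>I. Df i x \<bullet> h)) (at x)"
    using assms by (intro has_derivative_sum) (auto simp: C1_def)
  then show "((\<lambda>x. \<Sum>i\<in>I. f i x) has_derivative (\<lambda>h. (\<Sum>i\<in>I. Df i x) \<bullet> h)) (at x)"
    by (simp add: inner_sum_left)
  show "continuous_on UNIV (\<lambda>x. \<Sum>i\<in>I. Df i x)"
    using assms by (intro continuous_intros) (auto simp: C1_def)
qed

text \<open>For nonnegative \<open>f\<close> the values lie in [0, 1) and, as \<open>c\<close>
  grows, tend to 1 wherever \<open>f\<close> is positive: a differentiable substitute for truncation
  at 1.\<close>

lemma C1_saturate:
  assumes f: "C1 f Df" and nn: "\<And>x. 0 \<le> f x" and c: "0 \<le> c"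
  shows "C1 (\<lambda>x. c * f x / (1 + c * f x)) (\<lambda>x. (c / (1 + c * f x)\<^sup>2) *\<^sub>R Df x)"
  unfolding C1_def
proof (intro conjI allI)
  have pos: "1 + c * f x \<noteq> 0" for x using nn[of x] c by (metis add_nonneg_eq_0_iff mult_nonneg_nonneg zero_le_one zero_neq_one)
  fix x
  have 1: "(f has_derivative (\<lambda>h. Df x \<bullet> h)) (at x)" using f by (simp add: C1_def)
  have "((\<lambda>t. c * t / (1 + c * t)) has_real_derivative c / (1 + c * f x)\<^sup>2) (at (f x))"
    using pos[of x] by (auto intro!: derivative_eq_intros simp: field_simps power2_eq_square)
  then have 2: "((\<lambda>t. c * t / (1 + c * t)) has_derivative (\<lambda>h. h * (c / (1 + c * f x)\<^sup>2))) (at (f x))"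
    by (simp only: has_field_derivative_def mult_fun_commute)
  show "((\<lambda>x. c * f x / (1 + c * f x)) has_derivative (\<lambda>h. (c / (1 + c * f x)\<^sup>2) *\<^sub>R Df x \<bullet> h)) (at x)"
    using has_derivative_compose[OF 1 2] by (simp add: mult.commute)
  show "continuous_on UNIV (\<lambda>x. (c / (1 + c * f x)\<^sup>2) *\<^sub>R Df x)"
    using f pos C1_continuous[OF f] by (intro continuous_intros) (auto simp: C1_def)
qed

text \<open>Lindelof writes \<open>V\<close> as a countable union of balls. Partial sums of their
  bumps vanish off \<open>V\<close> and are eventually bounded below at each point of
  \<open>V\<close>, so saturating the \<open>n\<close>-th sum with slope \<open>n\<close> gives the
  indicator in the limit.\<close>

lemma C1_approx_open:
  fixes V :: "'a::euclidean_space set"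
  assumes V: "open V"
  obtains F DF where "\<And>n::nat. C1 (F n) (DF n)" "\<And>n x. 0 \<le> F n x" "\<And>n x. F n x \<le> 1"
    "\<And>n x. x \<notin> V \<Longrightarrow> F n x = 0" "\<And>x. (\<lambda>n. F n x) \<longlonglongrightarrow> indicator V x"
proof -
  define W where "W = {(x, s). 0 < s \<and> ball x s \<subseteq> V}"
  have UV: "\<Union>((\<lambda>(x, s). ball x s) ` W) = V"
  proof
    show "V \<subseteq> \<Union>((\<lambda>(x, s). ball x s) ` W)"
    proof
      fix x assume "x \<in> V"
      then obtain s where "0 < s" "ball x s \<subseteq> V" using V open_contains_ball by blast
      then show "x \<in> \<Union>((\<lambda>(x, s). ball x s) ` W)"
        by (intro UnionI[of "ball x s"]) (auto simp: W_def)
    qed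
  qed (auto simp: W_def)
  obtain G where G: "G \<subseteq> (\<lambda>(x, s). ball x s) ` W" "countable G" "\<Union>G = \<Union>((\<lambda>(x, s). ball x s) ` W)"
    by (rule Lindelof[of "(\<lambda>(x, s). ball x s) ` W"]) auto
  obtain W' where W': "countable W'" "W' \<subseteq> W" "(\<lambda>(x, s). ball x s) ` W' = G"
    using countable_subset_image G by metis
  have cov: "(\<Union>(x, s)\<in>W'. ball x s) = V" using W'(3) G(3) UV by auto
  show thesis
  proof (cases "W' = {}")
    case True
    show ?thesis
    proof (rule that[of "\<lambda>_ _. 0" "\<lambda>_ _. 0"])
      show "(\<lambda>n. 0) \<longlonglongrightarrow> indicator V x" for x using cov True by simp
    qed (auto simp: C1_def)
  next
    case False
    define w where "w = from_nat_into W'"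
    have rw: "range w = W'" using W' False by (simp add: w_def range_from_nat_into)
    then have wW: "0 < snd (w k)" "ball (fst (w k)) (snd (w k)) \<subseteq> V" for k
    proof -
      have "w k \<in> W" using W'(2) rw by blast
      then show "0 < snd (w k)" "ball (fst (w k)) (snd (w k)) \<subseteq> V"
        by (auto simp: W_def split: prod.splits)
    qed
    define h where "h n x = (\<Sum>k<n. bump (fst (w k)) (snd (w k)) x)" for n x
    define Dh where "Dh n x = (\<Sum>k<n. bump_grad (fst (w k)) (snd (w k)) x)" for n x
    have h: "C1 (h n) (Dh n)" for n
      unfolding h_def[abs_def] Dh_def[abs_def] by (intro C1_sum C1_bump) auto
    have h0: "0 \<le> h n x" for n x unfolding h_def by (intro sum_nonneg bump_nonneg)
    define F where "F n x = real n * h n x / (1 + real n * h n x)" for n x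
    show ?thesis
    proof (rule that[of F])
      show "C1 (F n) (\<lambda>x. (real n / (1 + real n * h n x)\<^sup>2) *\<^sub>R Dh n x)" for n
        unfolding F_def[abs_def] by (rule C1_saturate[OF h h0]) simp
      show "0 \<le> F n x" and F1: "F n x \<le> 1" for n x
      proof -
        have "0 \<le> real n * h n x" using h0 by simp
        then show "0 \<le> F n x" "F n x \<le> 1" unfolding F_def by (auto simp: divide_simps)
      qed
      show z: "F n x = 0" if "x \<notin> V" for n x
      proof -
        have "bump (fst (w k)) (snd (w k)) x = 0" for k
          using wW[of k] \<open>x \<notin> V\<close> by (intro bump_eq_0) auto
        then show ?thesis by (simp add: F_def h_def)
      qed
      show "(\<lambda>n. F n x) \<longlonglongrightarrow> indicator V x" for x
      proof (cases "x \<in> V")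
        case True
        then obtain z where z: "z \<in> W'" "x \<in> ball (fst z) (snd z)"
          using cov by (auto simp: case_prod_unfold)
        then obtain k where k: "x \<in> ball (fst (w k)) (snd (w k))"
          using rw by (metis rangeE)
        define b where "b = bump (fst (w k)) (snd (w k)) x"
        have b: "0 < b" using k wW[of k] by (simp add: b_def bump_pos_iff)
        have le: "b \<le> h n x" if "k < n" for n
          unfolding h_def b_def using that by (intro member_le_sum bump_nonneg) auto
        have "(\<lambda>n. 1 - (1 / b) / real n) \<longlonglongrightarrow> 1 - 0"
          by (intro tendsto_intros lim_const_over_n)
        then have lim: "(\<lambda>n. 1 - (1 / b) / real n) \<longlonglongrightarrow> 1" by (simp only: diff_0_right)
        have "(\<lambda>n. F n x) \<longlonglongrightarrow> 1"
        proof (rule tendsto_sandwich[OF _ _ lim tendsto_const])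
          show "\<forall>\<^sub>F n in sequentially. 1 - (1 / b) / real n \<le> F n x"
            unfolding eventually_sequentially
          proof (intro exI[of _ "Suc k"] allI impI)
            fix n assume n: "Suc k \<le> n"
            have p: "0 < real n * b" "real n * b \<le> real n * h n x" using n b le[of n] by auto
            have "1 / (1 + real n * h n x) \<le> 1 / (real n * b)"
              using p by (intro frac_le) auto
            moreover have "F n x = 1 - 1 / (1 + real n * h n x)"
              using p by (simp add: F_def field_simps)
            ultimately show "1 - 1 / b / real n \<le> F n x" by (simp add: mult.commute)
          qed
          show "\<forall>\<^sub>F n in sequentially. F n x \<le> 1"
            using F1 by simp
        qed
        then show ?thesis using True by simp
      qed (use z in simp)
    qed
  qed
qed

section \<open>Comparing projections in different directions\<close>

lemma AE_proj_measure:
  assumes "sigma_compact S" "transversal e S" shows "AE x in proj_measure e S. x \<in> S"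
proof (rule AE_I[of _ _ "- S"])
  have S: "S \<in> sets borel" by (rule sigma_compact_borel[OF assms(1)])
  have "hit e (S \<inter> - S) = {}" by (auto simp: hit_def)
  then show "emeasure (proj_measure e S) (- S) = 0"
    using S assms by (simp add: emeasure_proj_measure)
  show "- S \<in> sets (proj_measure e S)" using S by simp
qed auto

context boundary_patch begin

lemma finite_proj_surf: "crossing e \<Longrightarrow> finite_measure (proj_measure e surf)"
  by (rule finite_proj_measure[OF sigma_compact_surf transversal_surf bounded_surf crossing_nz])

text \<open>The volume integral is linear in \<open>e\<close>, while on the right each direction has
  its own measure. Comparing the two sides makes flux measures additive in the direction.\<close>

lemma integral_C1_directional:
  assumes e: "crossing e" and \<rho>: "\<rho> < r" and f: "C1 f Df"
    and zero: "\<And>x. x \<notin> cball p \<rho> \<Longrightarrow> f x = 0"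
  shows "(\<integral>x. indicator \<Omega> x * (Df x \<bullet> e) \<partial>lborel) = (\<integral>x. f x \<partial>proj_measure e surf)"
proof -
  have Dz: "Df x = 0" if "x \<notin> cball p \<rho>" for x
    using C1_zero_grad[OF f, of "- cball p \<rho>" x] zero that by auto
  have "continuous_on (cball p \<rho>) (\<lambda>x. Df x \<bullet> e)"
    using f unfolding C1_def by (intro continuous_intros) (auto intro: continuous_on_subset)
  then have "bounded ((\<lambda>x. Df x \<bullet> e) ` cball p \<rho>)"
    by (intro compact_imp_bounded compact_continuous_image) auto
  then obtain M where M: "\<forall>x\<in>cball p \<rho>. \<bar>Df x \<bullet> e\<bar> \<le> M" by (auto simp: bounded_iff)
  have bd: "\<bar>Df x \<bullet> e\<bar> \<le> \<bar>M\<bar>" for x using M Dz[of x] by (cases "x \<in> cball p \<rho>") force+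
  have "(\<integral>x. indicator \<Omega> x * (Df x \<bullet> e) \<partial>lborel) = (\<integral>x. indicator (closure \<Omega>) x * f x \<partial>proj_measure e surf)"
  proof (rule integral_directional_derivative[OF e \<rho> C1_continuous[OF f] zero])
    show "((\<lambda>t. f (x + t *\<^sub>R e)) has_real_derivative Df x \<bullet> e) (at 0)" for x by (rule C1_directional[OF f])
    show "Df x \<bullet> e = 0" if "x \<notin> cball p \<rho>" for x using Dz[OF that] by simp
    show "continuous_on (\<Omega> \<inter> ball p r) (\<lambda>x. Df x \<bullet> e)"
      using f unfolding C1_def by (intro continuous_intros) (auto intro: continuous_on_subset)
    show "\<And>x. x \<in> \<Omega> \<Longrightarrow> \<bar>Df x \<bullet> e\<bar> \<le> \<bar>M\<bar>" by (rule bd)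
  qed
  also have "\<dots> = (\<integral>x. f x \<partial>proj_measure e surf)"
  proof (rule integral_cong_AE)
    show "AE x in proj_measure e surf. indicator (closure \<Omega>) x * f x = f x"
      using AE_proj_measure[OF sigma_compact_surf transversal_surf[OF e]]
      by eventually_elim (auto simp: surf_def frontier_def)
    have [measurable]: "f \<in> borel_measurable borel" using C1_continuous[OF f] by (intro borel_measurable_continuous_onI)
    show "f \<in> borel_measurable (proj_measure e surf)"
      by measurable
    have "(\<lambda>x. indicator (closure \<Omega>) x * f x) \<in> borel_measurable borel"
      using borel_measurable_continuous_on_indicator[OF _ C1_continuous[OF f], of "closure \<Omega>"] by simp
    then show "(\<lambda>x. indicator (closure \<Omega>) x * f x) \<in> borel_measurable (proj_measure e surf)"
      by (subst measurable_cong_sets[OF sets_proj_measure refl])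
  qed
  finally show ?thesis .
qed

text \<open>By additivity the fluxes of \<open>e1\<close> and \<open>w\<close> add up to
  \<open>c\<close> times that of \<open>e2\<close>, and the contribution of \<open>w\<close> is
  nonnegative because \<open>w\<close> is crossing too. Test functions converging to the indicator
  of \<open>V\<close> carry this over to measures.\<close>

lemma proj_measure_open_le:
  assumes e: "crossing e1" "crossing e2" "crossing w" and sum: "e1 + w = c *\<^sub>R e2"
    and V: "open V" "V \<subseteq> cball p \<rho>" and \<rho>: "\<rho> < r"
  shows "measure (proj_measure e1 surf) V \<le> c * measure (proj_measure e2 surf) V"
proof -
  obtain F DF where F: "\<And>n::nat. C1 (F n) (DF n)" "\<And>n x. 0 \<le> F n x" "\<And>n x. F n x \<le> 1"
    "\<And>n x. x \<notin> V \<Longrightarrow> F n x = 0" "\<And>x. (\<lambda>n. F n x) \<longlonglongrightarrow> indicator V x"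
    by (rule C1_approx_open[OF V(1)]) blast
  have Fz: "F n x = 0" if "x \<notin> cball p \<rho>" for n x using F(4) V that by blast
  have I: "(\<integral>x. indicator \<Omega> x * (DF n x \<bullet> e) \<partial>lborel) = (\<integral>x. F n x \<partial>proj_measure e surf)" if "crossing e" for e n
    by (rule integral_C1_directional[OF that \<rho> F(1) Fz])
  have Fm: "F n \<in> borel_measurable borel" for n
    using C1_continuous[OF F(1)] by (intro borel_measurable_continuous_onI)
  have lim: "(\<lambda>n. \<integral>x. F n x \<partial>proj_measure e surf) \<longlonglongrightarrow> measure (proj_measure e surf) V" if "crossing e" for e
  proof -
    interpret finite_measure "proj_measure e surf" by (rule finite_proj_surf[OF that])
    have [measurable]: "V \<in> sets borel" using V by simp
    have "(\<lambda>n. \<integral>x. F n x \<partial>proj_measure e surf) \<longlonglongrightarrow> (\<integral>x. indicator V x \<partial>proj_measure e surf)"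
      using F Fm V by (intro integral_dominated_convergence[where w="\<lambda>_. 1"]) auto
    then show ?thesis using V by simp
  qed
  have Dint: "integrable lborel (\<lambda>x. indicator \<Omega> x * (DF n x \<bullet> e))" for n e
  proof -
    have Dz: "DF n x = 0" if "x \<notin> cball p \<rho>" for x
      using C1_zero_grad[OF F(1), of "- cball p \<rho>" x n] Fz that by auto
    have c: "continuous_on UNIV (\<lambda>x. DF n x \<bullet> e)"
      using F(1)[of n] unfolding C1_def by (intro continuous_intros) auto
    have "integrable lborel (\<lambda>x. indicator (cball p \<rho>) x *\<^sub>R (DF n x \<bullet> e))"
      using c by (intro borel_integrable_compact) (auto intro: continuous_on_subset)
    then have "integrable lborel (\<lambda>x. DF n x \<bullet> e)"
      by (rule Bochner_Integration.integrable_bound)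
        (use c Dz in \<open>auto simp: indicator_def intro!: borel_measurable_continuous_onI\<close>)
    then show ?thesis using open_dom integrable_real_mult_indicator[of \<Omega> lborel "\<lambda>x. DF n x \<bullet> e"]
      by (simp add: mult.commute)
  qed
  have "(\<integral>x. F n x \<partial>proj_measure e1 surf) \<le> c * (\<integral>x. F n x \<partial>proj_measure e2 surf)" for n
  proof -
    have "(\<integral>x. F n x \<partial>proj_measure e1 surf) + (\<integral>x. F n x \<partial>proj_measure w surf)
      = (\<integral>x. indicator \<Omega> x * (DF n x \<bullet> e1) + indicator \<Omega> x * (DF n x \<bullet> w) \<partial>lborel)"
      using I[OF e(1)] I[OF e(3)] Dint by simp
    also have "\<dots> = (\<integral>x. c * (indicator \<Omega> x * (DF n x \<bullet> e2)) \<partial>lborel)"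
    proof (rule Bochner_Integration.integral_cong[OF refl])
      fix x
      have "DF n x \<bullet> e1 + DF n x \<bullet> w = c * (DF n x \<bullet> e2)"
        by (metis inner_add_right inner_scaleR_right sum)
      then show "indicator \<Omega> x * (DF n x \<bullet> e1) + indicator \<Omega> x * (DF n x \<bullet> w) = c * (indicator \<Omega> x * (DF n x \<bullet> e2))"
        by (auto simp: indicator_def)
    qed
    also have "\<dots> = c * (\<integral>x. F n x \<partial>proj_measure e2 surf)" using I[OF e(2)] by simp
    finally have "(\<integral>x. F n x \<partial>proj_measure e1 surf) + (\<integral>x. F n x \<partial>proj_measure w surf)
      = c * (\<integral>x. F n x \<partial>proj_measure e2 surf)" .
    moreover have "0 \<le> (\<integral>x. F n x \<partial>proj_measure w surf)"
      using F(2) by (intro Bochner_Integration.integral_nonneg)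
    ultimately show ?thesis by linarith
  qed
  then show ?thesis
    by (intro LIMSEQ_le[OF lim[OF e(1)] tendsto_mult_left[OF lim[OF e(2)]]]) auto
qed

text \<open>A compact set is the decreasing limit of open neighbourhoods inside a fixed smaller
  ball, and finite measures are continuous along such limits.\<close>

lemma proj_measure_compact_le:
  assumes e: "crossing e1" "crossing e2" "crossing w" and sum: "e1 + w = c *\<^sub>R e2"
    and K: "compact K" "K \<subseteq> ball p r"
  shows "measure (proj_measure e1 surf) K \<le> c * measure (proj_measure e2 surf) K"
proof (cases "K = {}")
  case False
  obtain \<rho> where \<rho>: "\<rho> < r" "K \<subseteq> ball p \<rho>"
  proof -
    obtain y where y: "y \<in> K" "\<And>x. x \<in> K \<Longrightarrow> dist p x \<le> dist p y"
      using continuous_attains_sup[OF K(1) False continuous_on_dist[OF continuous_on_const continuous_on_id], of p] by blast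
    then have "dist p y < r" using K by auto
    then show thesis using y by (intro that[of "(dist p y + r) / 2"]) force+
  qed
  define V where "V i = ball p \<rho> \<inter> {x. infdist x K < 1 / real (Suc i)}" for i
  have oV: "open (V i)" for i
    unfolding V_def by (intro open_Int open_ball open_Collect_less continuous_intros)
  have dV: "decseq V"
  proof (rule decseq_SucI)
    fix n have "1 / real (Suc (Suc n)) \<le> 1 / real (Suc n)" by (simp add: field_simps)
    then show "V (Suc n) \<subseteq> V n" unfolding V_def by auto
  qed
  have KV: "K = (\<Inter>i. V i)"
  proof
    show "K \<subseteq> (\<Inter>i. V i)" using \<rho> by (auto simp: V_def)
    show "(\<Inter>i. V i) \<subseteq> K"
    proof
      fix x assume x: "x \<in> (\<Inter>i. V i)"
      have "infdist x K = 0"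
      proof (rule ccontr)
        assume "infdist x K \<noteq> 0"
        then have "0 < infdist x K" using infdist_nonneg[of x K] by simp
        then obtain i where "1 / real (Suc i) < infdist x K" using nat_approx_posE by blast
        moreover have "infdist x K < 1 / real (Suc i)" using x by (auto simp: V_def)
        ultimately show False by simp
      qed
      then show "x \<in> K" using in_closed_iff_infdist_zero[OF compact_imp_closed[OF K(1)] False] by simp
    qed
  qed
  have lim: "(\<lambda>i. measure (proj_measure e surf) (V i)) \<longlonglongrightarrow> measure (proj_measure e surf) K" if "crossing e" for e
  proof -
    interpret finite_measure "proj_measure e surf" by (rule finite_proj_surf[OF that])
    show ?thesis unfolding KV by (rule finite_Lim_measure_decseq) (use oV dV in auto)
  qed
  have "measure (proj_measure e1 surf) (V i) \<le> c * measure (proj_measure e2 surf) (V i)" for i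
    by (rule proj_measure_open_le[OF e sum oV _ \<rho>(1)]) (auto simp: V_def)
  then show ?thesis
    by (intro LIMSEQ_le[OF lim[OF e(1)] tendsto_mult_left[OF lim[OF e(2)]]]) auto
qed simp

section \<open>The unit normal of a patch and shadows along it\<close>

definition nu :: "'a \<Rightarrow> 'a" where "nu x = D\<phi> x /\<^sub>R norm (D\<phi> x)"

lemma norm_nu: "x \<in> ball p r \<Longrightarrow> norm (nu x) = 1"
  using grad_nz by (simp add: nu_def)

lemma nu_cont: "continuous_on (ball p r) nu"
  unfolding nu_def[abs_def] using grad_nz by (intro continuous_intros grad_cont) auto

lemma grad_inner_pos_iff: "x \<in> ball p r \<Longrightarrow> 0 < D\<phi> x \<bullet> e \<longleftrightarrow> 0 < nu x \<bullet> e"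
  using grad_nz[of x] by (simp add: nu_def zero_less_mult_iff)

lemma crossing_iff_nu: "crossing e \<longleftrightarrow> (\<forall>x\<in>ball p r. 0 < nu x \<bullet> e)"
  using grad_inner_pos_iff by (auto simp: crossing_def)

text \<open>Over a point of the disc of radius \<open>c * s\<close> the normal segment of half
  length sqrt(1 - c^2) s stays in \<open>cball x s\<close> by Pythagoras. Normals within sqrt(1 -
  c^2) of \<open>n\<close> force \<phi> to be positive at its upper and negative at its lower end,
  so the intermediate value theorem puts a surface point on it.\<close>

lemma cylinder_subset_hit:
  assumes x: "x \<in> surf" and n: "norm n = 1" and s: "0 < s" "cball x s \<subseteq> ball p r"
    and c: "0 < c" "c < 1" and close: "\<And>z. z \<in> cball x s \<Longrightarrow> norm (nu z - n) < sqrt (1 - c\<^sup>2)"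
  shows "cylinder n x (c * s) \<subseteq> hit n (frontier \<Omega> \<inter> cball x s)"
proof
  let ?\<eta> = "sqrt (1 - c\<^sup>2)"
  have c2: "c\<^sup>2 < 1" using c by (simp add: power_less_one_iff abs_square_less_1)
  have \<eta>: "0 < ?\<eta>" using c2 by simp
  have nn: "n \<bullet> n = 1" using n by (simp add: norm_eq_1)
  have px: "x \<in> ball p r" "\<phi> x = 0" using x in_front by (auto simp: surf_def)
  fix y assume y: "y \<in> cylinder n x (c * s)"
  define v where "v = orth_part n (y - x)"
  have v: "norm v \<le> c * s" "v \<bullet> n = 0" using y n
    by (auto simp: cylinder_def v_def orth_part_def inner_diff_left nn)
  have norm_w: "norm (v + a *\<^sub>R n) \<le> s" if a: "\<bar>a\<bar> \<le> ?\<eta> * s" for a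
  proof -
    have "(norm (v + a *\<^sub>R n))\<^sup>2 = (norm v)\<^sup>2 + a\<^sup>2"
      unfolding power2_norm_eq_inner using v(2) by (simp add: inner_simps inner_commute nn power2_eq_square)
    also have "\<dots> \<le> (c * s)\<^sup>2 + (?\<eta> * s)\<^sup>2"
    proof (intro add_mono)
      show "(norm v)\<^sup>2 \<le> (c * s)\<^sup>2" using v(1) by (intro power_mono) auto
      show "a\<^sup>2 \<le> (?\<eta> * s)\<^sup>2" using a by (metis abs_ge_zero power2_abs power_mono)
    qed
    also have "\<dots> = s\<^sup>2" using c2 by (simp add: power_mult_distrib real_sqrt_pow2 algebra_simps)
    finally show ?thesis by (rule power2_le_imp_le) (use s in simp)
  qed
  have inb: "x + (v + a *\<^sub>R n) \<in> cball x s" if "\<bar>a\<bar> \<le> ?\<eta> * s" for a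
    using norm_w[OF that] by (metis add_diff_cancel_left' dist_commute dist_norm mem_cball)
  have est: "\<exists>z\<in>ball p r. \<phi> (x + (v + a *\<^sub>R n)) = D\<phi> z \<bullet> (v + a *\<^sub>R n) \<and> norm (nu z - n) < ?\<eta>" if a: "\<bar>a\<bar> \<le> ?\<eta> * s" for a
  proof -
    obtain z where z: "z \<in> closed_segment x (x + (v + a *\<^sub>R n))" "z \<in> ball p r"
      "\<phi> (x + (v + a *\<^sub>R n)) - \<phi> x = D\<phi> z \<bullet> (x + (v + a *\<^sub>R n) - x)"
      using phi_mvt[OF px(1), of "x + (v + a *\<^sub>R n)"] inb[OF a] s(2) by blast
    have "closed_segment x (x + (v + a *\<^sub>R n)) \<subseteq> cball x s"
      using inb[OF a] s by (intro closed_segment_subset) auto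
    then have "norm (nu z - n) < ?\<eta>" using z by (intro close) auto
    then show ?thesis using z px by auto
  qed
  have inner_est: "\<bar>nu z \<bullet> w - n \<bullet> w\<bar> < ?\<eta> * s" if "norm (nu z - n) < ?\<eta>" "norm w \<le> s" for z w
  proof -
    have "\<bar>nu z \<bullet> w - n \<bullet> w\<bar> \<le> norm (nu z - n) * norm w"
      by (metis Cauchy_Schwarz_ineq2 inner_diff_left)
    also have "\<dots> \<le> norm (nu z - n) * s" using that by (intro mult_left_mono) auto
    also have "\<dots> < ?\<eta> * s" using that s by (intro mult_strict_right_mono) auto
    finally show ?thesis .
  qed
  have \<eta>s: "0 < ?\<eta> * s" using \<eta> s by simp
  have pos: "0 < \<phi> (x + (v + (?\<eta> * s) *\<^sub>R n))"
  proof -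
    obtain z where z: "z \<in> ball p r" "\<phi> (x + (v + (?\<eta> * s) *\<^sub>R n)) = D\<phi> z \<bullet> (v + (?\<eta> * s) *\<^sub>R n)" "norm (nu z - n) < ?\<eta>"
      using est[of "?\<eta> * s"] \<eta>s by auto
    have "n \<bullet> (v + (?\<eta> * s) *\<^sub>R n) = ?\<eta> * s" using v(2) by (simp add: inner_add_right nn inner_commute)
    then have "0 < nu z \<bullet> (v + (?\<eta> * s) *\<^sub>R n)"
      using inner_est[OF z(3) norm_w[of "?\<eta> * s"]] \<eta>s by auto
    then show ?thesis using z grad_inner_pos_iff by simp
  qed
  have neg: "\<phi> (x + (v + (- ?\<eta> * s) *\<^sub>R n)) < 0"
  proof -
    let ?w = "v + (- ?\<eta> * s) *\<^sub>R n"
    obtain z where z: "z \<in> ball p r" "\<phi> (x + ?w) = D\<phi> z \<bullet> ?w" "norm (nu z - n) < ?\<eta>"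
      using est[of "- ?\<eta> * s"] \<eta>s by auto
    have "n \<bullet> ?w = - ?\<eta> * s" using v(2) by (simp add: inner_diff_right nn inner_commute)
    then have "0 < nu z \<bullet> (- ?w)"
      unfolding inner_minus_right using inner_est[OF z(3) norm_w[of "- ?\<eta> * s"]] \<eta>s by auto
    then have "0 < D\<phi> z \<bullet> (- ?w)" using z grad_inner_pos_iff by blast
    then show ?thesis using z(2) by (simp only: inner_minus_right)
  qed
  have "continuous_on {- ?\<eta> * s .. ?\<eta> * s} (\<lambda>a. \<phi> (x + (v + a *\<^sub>R n)))"
  proof (rule continuous_on_compose2[OF phi_cont])
    show "(\<lambda>a. x + (v + a *\<^sub>R n)) ` {- ?\<eta> * s .. ?\<eta> * s} \<subseteq> ball p r"
    proof (rule image_subsetI)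
      fix a assume "a \<in> {- ?\<eta> * s .. ?\<eta> * s}"
      then have "\<bar>a\<bar> \<le> ?\<eta> * s" by auto
      then show "x + (v + a *\<^sub>R n) \<in> ball p r" using inb s(2) by blast
    qed
  qed (intro continuous_intros)
  then obtain a where a: "- ?\<eta> * s \<le> a" "a \<le> ?\<eta> * s" "\<phi> (x + (v + a *\<^sub>R n)) = 0"
    using IVT'[of "\<lambda>a. \<phi> (x + (v + a *\<^sub>R n))" "- ?\<eta> * s" 0 "?\<eta> * s"] pos neg \<eta>s by auto
  then have "x + (v + a *\<^sub>R n) \<in> cball x s" by (intro inb) auto
  moreover from this have "x + (v + a *\<^sub>R n) \<in> frontier \<Omega>" using a(3) s(2) in_front by blast
  moreover have "x + (v + a *\<^sub>R n) = y + (a - (y - x) \<bullet> n) *\<^sub>R n"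
    by (simp add: v_def orth_part_def algebra_simps)
  ultimately show "y \<in> hit n (frontier \<Omega> \<inter> cball x s)"
    using y unfolding hit_def cylinder_def by auto
qed

end

section \<open>Surface measure on a patch\<close>

text \<open>Projection along \<open>n\<close> does not increase distances, so the shadow of
  \<open>K\<close> has transversal diameter at most \<open>D\<close> and the isodiametric inequality
  in the slab applies.\<close>

lemma measure_hit_le_isodiametric:
  fixes K :: "'a::euclidean_space set"
  assumes K: "compact K" "diameter K \<le> D" "0 < D" and n: "norm n = 1"
  shows "measure lborel (hit n K) \<le> unit_ball_vol (real (DIM('a) - 1)) * (D / 2) ^ (DIM('a) - 1)"
proof -
  have n0: "n \<noteq> 0" and nn: "n \<bullet> n = 1" using n by (auto simp: norm_eq_1)
  have "emeasure lborel (hit n K) \<le> ennreal (unit_ball_vol (real (DIM('a) - 1)) * (D / 2) ^ (DIM('a) - 1))"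
  proof (rule isodiametric_slab[OF compact_hit[OF K(1) n0] _ _ n K(3)])
    show "hit n K \<subseteq> slab n" by (auto simp: hit_def)
    fix x y assume "x \<in> hit n K" "y \<in> hit n K"
    then obtain s t where st: "x + s *\<^sub>R n \<in> K" "y + t *\<^sub>R n \<in> K" by (auto simp: hit_def)
    let ?v = "(x + s *\<^sub>R n) - (y + t *\<^sub>R n)"
    have "orth_part n (x - y) = orth_part n ?v"
      by (simp add: orth_part_def inner_add_left inner_diff_left nn algebra_simps)
    also have "(norm (orth_part n ?v))\<^sup>2 = (norm ?v)\<^sup>2 - (?v \<bullet> n)\<^sup>2"
      unfolding orth_part_def power2_norm_eq_inner
      by (simp add: inner_diff_left[of ?v] inner_diff_right[of _ ?v] nn inner_commute power2_eq_square)
    then have "(norm (orth_part n ?v))\<^sup>2 \<le> (norm ?v)\<^sup>2" by simp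
    then have "norm (orth_part n ?v) \<le> norm ?v" by (rule power2_le_imp_le) simp
    also have "norm ?v \<le> diameter K"
      using diameter_bounded_bound[OF compact_imp_bounded[OF K(1)] st] by (simp add: dist_norm)
    finally show "norm (orth_part n (x - y)) \<le> D" using K(2) by simp
  qed
  then show ?thesis
    using K(3) by (simp add: measure_def enn2real_leI)
qed

context boundary_patch begin

lemma subpatch:
  assumes "0 < \<delta>" "ball x \<delta> \<subseteq> ball p r" shows "boundary_patch \<Omega> x \<delta> \<phi> D\<phi>"
proof
  fix y assume "y \<in> ball x \<delta>"
  then have y: "y \<in> ball p r" using assms(2) by blast
  show "(\<phi> has_derivative (\<lambda>h. D\<phi> y \<bullet> h)) (at y)" "D\<phi> y \<noteq> 0" "y \<in> \<Omega> \<longleftrightarrow> \<phi> y < 0" "y \<in> frontier \<Omega> \<longleftrightarrow> \<phi> y = 0"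
    using phi_deriv[OF y] grad_nz[OF y] in_dom[OF y] in_front[OF y] by auto
qed (use assms open_dom grad_cont continuous_on_subset in blast)+

lemma measure_proj_eq_hit:
  assumes e: "crossing e" and K: "K \<in> sets borel" "K \<subseteq> ball p r"
  shows "measure (proj_measure e surf) K = measure lborel (hit e (frontier \<Omega> \<inter> K))"
proof -
  have "surf \<inter> K = frontier \<Omega> \<inter> K" using K by (auto simp: surf_def)
  then show ?thesis
    using emeasure_proj_measure[OF sigma_compact_surf transversal_surf[OF e] K(1)] by (simp add: measure_def)
qed

text \<open>On a small ball the patch is a patch in its own right, so directions can be compared
  that are transversal only there, such as the normal at its centre.\<close>

lemma hit_compare:
  assumes x: "0 < \<delta>" "ball x \<delta> \<subseteq> ball p r"
    and e: "\<And>z. z \<in> ball x \<delta> \<Longrightarrow> 0 < nu z \<bullet> e1" "\<And>z. z \<in> ball x \<delta> \<Longrightarrow> 0 < nu z \<bullet> e2"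
      "\<And>z. z \<in> ball x \<delta> \<Longrightarrow> 0 < nu z \<bullet> w" and sum: "e1 + w = c *\<^sub>R e2"
    and K: "compact K" "K \<subseteq> ball x \<delta>"
  shows "measure lborel (hit e1 (frontier \<Omega> \<inter> K)) \<le> c * measure lborel (hit e2 (frontier \<Omega> \<inter> K))"
proof -
  interpret sub: boundary_patch \<Omega> x \<delta> \<phi> D\<phi> by (rule subpatch[OF x])
  have cr: "sub.crossing e1" "sub.crossing e2" "sub.crossing w"
    unfolding sub.crossing_iff_nu using e by auto
  show ?thesis
    using sub.proj_measure_compact_le[OF cr sum K] sub.measure_proj_eq_hit[OF cr(1)] sub.measure_proj_eq_hit[OF cr(2)] K
    by (simp add: borel_compact)
qed

text \<open>The projections of a small piece of the surface along the normal \<^term>\<open>nu x\<close> and along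
  \<^term>\<open>e\<close> differ by the factor \<^term>\<open>nu x \<bullet> e\<close>.  No area formula is needed: flux is additive
  in the direction, so this follows by writing one direction as a positive combination of the
  other one and a third transversal direction.\<close>

lemma local_estimates:
  assumes e: "crossing e" and \<rho>: "\<rho> < r1" "r1 < r" and \<theta>: "0 < \<theta>" "\<And>x. x \<in> cball p r1 \<Longrightarrow> \<theta> < nu x \<bullet> e"
    and c: "0 < c" "c < 1"
  obtains \<delta> where "0 < \<delta>"
    "\<And>x y. x \<in> ball p \<rho> \<Longrightarrow> y \<in> cball x \<delta> \<Longrightarrow> y \<in> ball p r1 \<and> \<bar>nu y \<bullet> e - nu x \<bullet> e\<bar> \<le> \<theta>"
    "\<And>x K. x \<in> ball p \<rho> \<Longrightarrow> compact K \<Longrightarrow> K \<subseteq> cball x \<delta> \<Longrightarrow>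
       measure lborel (hit e (frontier \<Omega> \<inter> K)) \<le> (nu x \<bullet> e + \<theta>) * measure lborel (hit (nu x) (frontier \<Omega> \<inter> K))"
    "\<And>x K. x \<in> ball p \<rho> \<Longrightarrow> compact K \<Longrightarrow> K \<subseteq> cball x \<delta> \<Longrightarrow>
       (nu x \<bullet> e - \<theta>) * measure lborel (hit (nu x) (frontier \<Omega> \<inter> K)) \<le> measure lborel (hit e (frontier \<Omega> \<inter> K))"
    "\<And>x s. x \<in> frontier \<Omega> \<Longrightarrow> x \<in> ball p \<rho> \<Longrightarrow> 0 < s \<Longrightarrow> s \<le> \<delta> \<Longrightarrow>
       unit_ball_vol (real (DIM('a) - 1)) * (c * s) ^ (DIM('a) - 1) \<le> measure lborel (hit (nu x) (frontier \<Omega> \<inter> cball x s))"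
proof -
  let ?\<eta> = "sqrt (1 - c\<^sup>2)"
  have "c\<^sup>2 < 1" using c by (simp add: abs_square_less_1)
  then have \<eta>: "0 < ?\<eta>" by simp
  \<comment> \<open>The auxiliary directions below have norm at most \<open>3 * norm e\<close> and
    inner product \<theta> with \<open>nu x\<close>; a variation of the normal below
    \<open>\<theta> / (4 * (norm e + 1))\<close> keeps them transversal. The second term of the
    minimum serves \<open>cylinder_subset_hit\<close>.\<close>
  define \<tau> where "\<tau> = min (\<theta> / (4 * (norm e + 1))) ?\<eta>"
  have \<tau>: "0 < \<tau>" "\<tau> \<le> ?\<eta>" using \<theta> \<eta> by (auto simp: \<tau>_def add_nonneg_pos)
  have \<tau>4: "\<tau> * (4 * (norm e + 1)) \<le> \<theta>"
  proof -
    have "\<tau> \<le> \<theta> / (4 * (norm e + 1))" by (simp add: \<tau>_def)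
    then show ?thesis by (simp add: pos_le_divide_eq add_nonneg_pos)
  qed
  have "continuous_on (cball p r1) nu" using nu_cont \<rho> by (rule_tac continuous_on_subset) auto
  then have "uniformly_continuous_on (cball p r1) nu" by (rule compact_uniformly_continuous) simp
  then obtain \<delta>0 where \<delta>0: "0 < \<delta>0" "\<And>x y. x \<in> cball p r1 \<Longrightarrow> y \<in> cball p r1 \<Longrightarrow> dist y x < \<delta>0 \<Longrightarrow> dist (nu y) (nu x) < \<tau>"
    using \<tau>(1) unfolding uniformly_continuous_on_def by blast
  define \<delta>1 where "\<delta>1 = min \<delta>0 (r1 - \<rho>)"
  have \<delta>1: "0 < \<delta>1" "\<delta>1 \<le> \<delta>0" "\<delta>1 \<le> r1 - \<rho>" using \<delta>0 \<rho> by (auto simp: \<delta>1_def)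
  have inb: "y \<in> ball p r1" if "x \<in> ball p \<rho>" "y \<in> ball x \<delta>1" for x y
    using that \<delta>1(3) dist_triangle[of p y x] by auto
  have close: "norm (nu y - nu x) < \<tau>" if "x \<in> ball p \<rho>" "y \<in> ball x \<delta>1" for x y
    using \<delta>0(2)[of x y] inb[OF that] that \<delta>1 \<rho> by (auto simp: dist_norm norm_minus_commute)
  have inner_close: "nu x \<bullet> w - \<tau> * norm w \<le> nu y \<bullet> w" if "x \<in> ball p \<rho>" "y \<in> ball x \<delta>1" for x y w
  proof -
    have "\<bar>(nu y - nu x) \<bullet> w\<bar> \<le> norm (nu y - nu x) * norm w" by (rule Cauchy_Schwarz_ineq2)
    also have "\<dots> \<le> \<tau> * norm w" using close[OF that] by (intro mult_right_mono) auto
    finally show ?thesis by (simp add: inner_diff_left abs_le_iff)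
  qed
  have sub: "ball x \<delta>1 \<subseteq> ball p r" if "x \<in> ball p \<rho>" for x using inb[OF that] \<rho> by fastforce
  have pos: "\<theta> < nu x \<bullet> e" "nu x \<bullet> e \<le> norm e" "norm (nu x) = 1" "nu x \<bullet> nu x = 1" if x: "x \<in> ball p \<rho>" for x
  proof -
    show "\<theta> < nu x \<bullet> e" using \<theta>(2)[of x] x \<rho> by auto
    show n: "norm (nu x) = 1" using x \<rho> by (intro norm_nu) auto
    then show "nu x \<bullet> nu x = 1" by (simp add: norm_eq_1)
    show "nu x \<bullet> e \<le> norm e" using norm_cauchy_schwarz[of "nu x" e] n by simp
  qed
  have e_pos: "0 < nu z \<bullet> e" if "x \<in> ball p \<rho>" "z \<in> ball x \<delta>1" for x z
    using e sub[OF that(1)] that(2) unfolding crossing_iff_nu by blast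
  have n_pos: "0 < nu z \<bullet> nu x" if x: "x \<in> ball p \<rho>" and z: "z \<in> ball x \<delta>1" for x z
  proof -
    have "\<tau> * 4 \<le> \<tau> * (4 * (norm e + 1))" using \<tau> by (intro mult_left_mono) auto
    also have "\<dots> \<le> norm e" using \<tau>4 pos[OF x] by linarith
    finally have "\<tau> * (4 * (norm e + 1)) < (norm e + 1)" using \<tau>4 pos[OF x] by linarith
    then have "\<tau> * 4 < 1" using mult_less_cancel_right_pos[of "norm e + 1" "\<tau> * 4" 1] by (simp add: mult_ac add_nonneg_pos)
    then show ?thesis using inner_close[OF x z, of "nu x"] pos[OF x] by simp
  qed
  have \<tau>3: "\<tau> * (3 * norm e) < \<tau> * (4 * (norm e + 1))"
  proof (rule mult_strict_left_mono[OF _ \<tau>(1)])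
    show "3 * norm e < 4 * (norm e + 1)" unfolding distrib_left using norm_ge_zero[of e] by linarith
  qed
  \<comment> \<open>Adding \<open>e\<close> to this vector gives
    \<open>(nu x \<bullet> e + \<theta>) *\<^sub>R nu x\<close>, and its inner product with
    \<open>nu x\<close> is \<theta>: the margin in the estimate is what makes the third direction
    transversal near \<open>x\<close>.\<close>
  have w1: "0 < nu z \<bullet> ((nu x \<bullet> e + \<theta>) *\<^sub>R nu x - e)" if x: "x \<in> ball p \<rho>" and z: "z \<in> ball x \<delta>1" for x z
  proof -
    let ?w = "(nu x \<bullet> e + \<theta>) *\<^sub>R nu x - e"
    have "nu x \<bullet> ?w = \<theta>" by (simp add: inner_diff_right pos(4)[OF x])
    moreover have "norm ?w \<le> 3 * norm e"
      using norm_triangle_ineq4[of "(nu x \<bullet> e + \<theta>) *\<^sub>R nu x" e] pos[OF x] \<theta>(1) by simp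
    then have "\<tau> * norm ?w \<le> \<tau> * (3 * norm e)" using \<tau> by (intro mult_left_mono) auto
    ultimately show ?thesis using inner_close[OF x z, of ?w] \<tau>4 \<tau>3 by linarith
  qed
  have w2: "0 < nu z \<bullet> (e - (nu x \<bullet> e - \<theta>) *\<^sub>R nu x)" if x: "x \<in> ball p \<rho>" and z: "z \<in> ball x \<delta>1" for x z
  proof -
    let ?w = "e - (nu x \<bullet> e - \<theta>) *\<^sub>R nu x"
    have "nu x \<bullet> ?w = \<theta>" by (simp add: inner_diff_right pos(4)[OF x])
    moreover have "norm ?w \<le> 3 * norm e"
      using norm_triangle_ineq4[of e "(nu x \<bullet> e - \<theta>) *\<^sub>R nu x"] pos[OF x] \<theta>(1) by simp
    then have "\<tau> * norm ?w \<le> \<tau> * (3 * norm e)" using \<tau> by (intro mult_left_mono) auto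
    ultimately show ?thesis using inner_close[OF x z, of ?w] \<tau>4 \<tau>3 by linarith
  qed
  show ?thesis
  proof (rule that[of "\<delta>1 / 2"])
    show "0 < \<delta>1 / 2" using \<delta>1 by simp
    have cb: "cball x (\<delta>1 / 2) \<subseteq> ball x \<delta>1" for x :: 'a using \<delta>1 by auto
    fix x assume x: "x \<in> ball p \<rho>"
    {
      fix y assume "y \<in> cball x (\<delta>1 / 2)"
      then have y: "y \<in> ball x \<delta>1" using cb by blast
      have "\<tau> * norm e \<le> \<tau> * (3 * norm e)" using \<tau> by (intro mult_left_mono) auto
      then have "\<tau> * norm e \<le> \<tau> * (4 * (norm e + 1))" using \<tau>3 by linarith
      then show "y \<in> ball p r1 \<and> \<bar>nu y \<bullet> e - nu x \<bullet> e\<bar> \<le> \<theta>"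
        using inb[OF x y] inner_close[OF x y, of e] inner_close[OF x y, of "-e"] \<tau>4 by auto
    }
    {
      fix K assume "compact K" "K \<subseteq> cball x (\<delta>1 / 2)"
      then have K: "compact K" "K \<subseteq> ball x \<delta>1" using cb by blast+
      show "measure lborel (hit e (frontier \<Omega> \<inter> K)) \<le> (nu x \<bullet> e + \<theta>) * measure lborel (hit (nu x) (frontier \<Omega> \<inter> K))"
        by (rule hit_compare[OF \<delta>1(1) sub[OF x] e_pos[OF x] n_pos[OF x] w1[OF x] _ K]) auto
      let ?a = "nu x \<bullet> e - \<theta>"
      have a: "0 < ?a" using pos[OF x] by simp
      have "measure lborel (hit (nu x) (frontier \<Omega> \<inter> K)) \<le> (1 / ?a) * measure lborel (hit e (frontier \<Omega> \<inter> K))"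
      proof (rule hit_compare[OF \<delta>1(1) sub[OF x] n_pos[OF x] e_pos[OF x] _ _ K])
        show "0 < nu z \<bullet> ((1 / ?a) *\<^sub>R (e - ?a *\<^sub>R nu x))" if "z \<in> ball x \<delta>1" for z
          using w2[OF x that] a by simp
        show "nu x + (1 / ?a) *\<^sub>R (e - ?a *\<^sub>R nu x) = (1 / ?a) *\<^sub>R e"
          using a by (simp add: scaleR_diff_right)
      qed auto
      then show "?a * measure lborel (hit (nu x) (frontier \<Omega> \<inter> K)) \<le> measure lborel (hit e (frontier \<Omega> \<inter> K))"
        using a by (simp add: field_simps)
    }
    {
      fix s assume xf: "x \<in> frontier \<Omega>" and s: "0 < s" "s \<le> \<delta>1 / 2"
      have sb: "cball x s \<subseteq> ball x \<delta>1" using s \<delta>1 by auto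
      have xs: "x \<in> surf" using xf x \<rho> by (auto simp: surf_def)
      have "cylinder (nu x) x (c * s) \<subseteq> hit (nu x) (frontier \<Omega> \<inter> cball x s)"
      proof (rule cylinder_subset_hit[OF xs pos(3)[OF x] s(1) _ c])
        show "cball x s \<subseteq> ball p r" using sb sub[OF x] by blast
        fix z assume "z \<in> cball x s"
        then show "norm (nu z - nu x) < ?\<eta>" using close[OF x, of z] sb \<tau>(2) by (meson less_le_trans subsetD)
      qed
      moreover have "compact (hit (nu x) (frontier \<Omega> \<inter> cball x s))"
        using pos(3)[OF x] by (intro compact_hit closed_Int_compact frontier_closed) auto
      ultimately have "measure lborel (cylinder (nu x) x (c * s)) \<le> measure lborel (hit (nu x) (frontier \<Omega> \<inter> cball x s))"
        using emeasure_bounded_finite compact_imp_bounded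
        by (intro measure_mono_fmeasurable) (auto simp: fmeasurable_def borel_compact)
      moreover have "measure lborel (cylinder (nu x) x (c * s)) = unit_ball_vol (real (DIM('a) - 1)) * (c * s) ^ (DIM('a) - 1)"
        using emeasure_cylinder[OF pos(3)[OF x], of "c * s" x] c s
        by (simp add: measure_def)
      ultimately show "unit_ball_vol (real (DIM('a) - 1)) * (c * s) ^ (DIM('a) - 1) \<le> measure lborel (hit (nu x) (frontier \<Omega> \<inter> cball x s))"
        by simp
    }
  qed
qed

text \<open>Dividing by \<open>nu x \<bullet> e\<close> turns the flux of \<open>e\<close> into
  area. The cutoff radius is meant to be below \<open>r\<close>: transversality is uniform on
  compact balls but may degenerate at the edge of the patch, and the density has to be
  bounded.\<close>

definition surf_density :: "real \<Rightarrow> 'a \<Rightarrow> 'a \<Rightarrow> real" where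
  "surf_density r1 e x = (if x \<in> cball p r1 then 1 / (nu x \<bullet> e) else 0)"

definition surf_measure :: "real \<Rightarrow> 'a \<Rightarrow> 'a measure" where
  "surf_measure r1 e = density (proj_measure e surf) (\<lambda>x. ennreal (surf_density r1 e x))"

lemma sets_surf_measure [simp, measurable_cong]: "sets (surf_measure r1 e) = sets borel"
  by (simp add: surf_measure_def)

lemma nu_inner_lower:
  assumes e: "crossing e" and r1: "r1 < r"
  obtains c where "0 < c" "\<And>x. x \<in> cball p r1 \<Longrightarrow> c < nu x \<bullet> e"
proof (cases "cball p r1 = {}")
  case True
  then show ?thesis using that[of 1] by auto
next
  case False
  have "continuous_on (cball p r1) (\<lambda>x. nu x \<bullet> e)"
    using r1 by (intro continuous_intros continuous_on_subset[OF nu_cont]) auto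
  then obtain y where y: "y \<in> cball p r1" "\<forall>x\<in>cball p r1. nu y \<bullet> e \<le> nu x \<bullet> e"
    using continuous_attains_inf[OF compact_cball False] by blast
  have "y \<in> ball p r" using y r1 by auto
  then have "0 < nu y \<bullet> e" using e unfolding crossing_iff_nu by blast
  then show ?thesis using y by (intro that[of "(nu y \<bullet> e) / 2"]) force+
qed

lemma surf_density_borel:
  assumes e: "crossing e" and r1: "r1 < r"
  shows "surf_density r1 e \<in> borel_measurable borel"
proof -
  have "continuous_on (cball p r1) (\<lambda>x. 1 / (nu x \<bullet> e))"
  proof (intro continuous_intros continuous_on_subset[OF nu_cont] ballI)
    show "cball p r1 \<subseteq> ball p r" using r1 by auto
    fix x assume "x \<in> cball p r1"
    then have "x \<in> ball p r" using r1 by auto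
    then show "nu x \<bullet> e \<noteq> 0" using e unfolding crossing_iff_nu by fastforce
  qed
  from borel_measurable_continuous_on_indicator[OF _ this]
  have "(\<lambda>x. indicator (cball p r1) x *\<^sub>R (1 / (nu x \<bullet> e))) \<in> borel_measurable borel" by simp
  also have "(\<lambda>x. indicator (cball p r1) x *\<^sub>R (1 / (nu x \<bullet> e))) = surf_density r1 e"
    by (auto simp: surf_density_def indicator_def fun_eq_iff)
  finally show ?thesis .
qed

lemma surf_density_nonneg: assumes "crossing e" "r1 < r" shows "0 \<le> surf_density r1 e x"
proof (cases "x \<in> cball p r1")
  case True
  then have "x \<in> ball p r" using assms(2) by auto
  then have "0 < nu x \<bullet> e" using assms(1) unfolding crossing_iff_nu by blast
  then show ?thesis by (simp add: surf_density_def)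
qed (simp add: surf_density_def)

lemma emeasure_surf_measure:
  assumes e: "crossing e" "r1 < r" and K: "K \<in> sets borel"
  shows "emeasure (surf_measure r1 e) K = (\<integral>\<^sup>+x. ennreal (surf_density r1 e x) * indicator K x \<partial>proj_measure e surf)"
  unfolding surf_measure_def using K surf_density_borel[OF e]
  by (intro emeasure_density) auto

lemma emeasure_surf_measure_le:
  assumes e: "crossing e" "r1 < r" and K: "K \<in> sets borel" and b: "0 \<le> b" "\<And>x. x \<in> K \<Longrightarrow> surf_density r1 e x \<le> b"
  shows "emeasure (surf_measure r1 e) K \<le> ennreal b * emeasure (proj_measure e surf) K"
proof -
  have "emeasure (surf_measure r1 e) K \<le> (\<integral>\<^sup>+x. ennreal b * indicator K x \<partial>proj_measure e surf)"
    unfolding emeasure_surf_measure[OF e K] using b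
    by (intro nn_integral_mono) (auto simp: indicator_def intro: ennreal_leI)
  also have "\<dots> = ennreal b * emeasure (proj_measure e surf) K" using K by (simp add: nn_integral_cmult_indicator)
  finally show ?thesis .
qed

lemma emeasure_surf_measure_ge:
  assumes e: "crossing e" "r1 < r" and K: "K \<in> sets borel" and b: "\<And>x. x \<in> K \<Longrightarrow> b \<le> surf_density r1 e x"
  shows "ennreal b * emeasure (proj_measure e surf) K \<le> emeasure (surf_measure r1 e) K"
proof -
  have "ennreal b * emeasure (proj_measure e surf) K = (\<integral>\<^sup>+x. ennreal b * indicator K x \<partial>proj_measure e surf)"
    using K by (simp add: nn_integral_cmult_indicator)
  also have "\<dots> \<le> emeasure (surf_measure r1 e) K"
    unfolding emeasure_surf_measure[OF e K] using b
    by (intro nn_integral_mono) (auto simp: indicator_def intro: ennreal_leI)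
  finally show ?thesis .
qed

lemma finite_surf_measure:
  assumes e: "crossing e" "r1 < r" shows "finite_measure (surf_measure r1 e)"
proof
  interpret finite_measure "proj_measure e surf" by (rule finite_proj_surf[OF e(1)])
  obtain c where c: "0 < c" "\<And>x. x \<in> cball p r1 \<Longrightarrow> c < nu x \<bullet> e" by (rule nu_inner_lower[OF e]) blast
  have "surf_density r1 e x \<le> 1 / c" for x
    using c(1) c(2)[of x] by (auto simp: surf_density_def intro!: frac_le)
  then have "emeasure (surf_measure r1 e) UNIV \<le> ennreal (1 / c) * emeasure (proj_measure e surf) UNIV"
    using c by (intro emeasure_surf_measure_le[OF e]) auto
  also have "\<dots> < top" using emeasure_eq_measure[of UNIV] by (simp add: ennreal_mult_less_top)
  finally show "emeasure (surf_measure r1 e) (space (surf_measure r1 e)) \<noteq> \<infinity>"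
    by (simp add: surf_measure_def)
qed

text \<open>Near \<open>x\<close> the quantity \<open>nu x \<bullet> e\<close> varies by at most
  \<theta>, so the surface measure of a small set equals the measure of its shadow along
  \<open>nu x\<close> up to a factor close to one. The isodiametric inequality bounds that shadow
  from above, and for balls the inscribed cylinder bounds it from below. Centres lie in
  \<open>ball p \<rho>\<close>, their neighbourhoods in \<open>ball p r1\<close>.\<close>

theorem hausdorff_eq_surf_measure:
  assumes d: "2 \<le> DIM('a)" and e: "crossing e" and \<rho>: "\<rho> < r1" "r1 < r"
    and B: "B \<in> sets borel" "B \<subseteq> frontier \<Omega> \<inter> ball p \<rho>"
  shows "emeasure (hausdorff_measure (DIM('a) - 1)) B = emeasure (surf_measure r1 e) B"
proof -
  let ?d = "DIM('a) - 1" and ?\<sigma> = "surf_measure r1 e" and ?S = "frontier \<Omega> \<inter> ball p \<rho>"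
  let ?w = "unit_ball_vol (real (DIM('a) - 1))"
  let ?m = "\<lambda>K. measure (proj_measure e surf) K" and ?h = "\<lambda>n K. measure lborel (hit n (frontier \<Omega> \<inter> K))"
  have d1: "1 \<le> ?d" using d by simp
  interpret \<sigma>: finite_measure ?\<sigma> by (rule finite_surf_measure[OF e \<rho>(2)])
  interpret pm: finite_measure "proj_measure e surf" by (rule finite_proj_surf[OF e])
  have er: "crossing e" "r1 < r" using e \<rho> by auto
  obtain c0 where c0: "0 < c0" "\<And>x. x \<in> cball p r1 \<Longrightarrow> c0 < nu x \<bullet> e" by (rule nu_inner_lower[OF er]) blast
  have "hausdorff_outer ?d B = emeasure ?\<sigma> B"
  proof (rule hausdorff_outer_eq_measure[OF \<sigma>.finite_measure_axioms sets_surf_measure d1 open_ball _ _ _ _ _ B])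
    show "?S \<in> sets borel" by (intro sets.Int) (auto simp: borel_closed)
    have "emeasure ?\<sigma> (ball p \<rho> - ?S) = (\<integral>\<^sup>+x. ennreal (surf_density r1 e x) * indicator (ball p \<rho> - ?S) x \<partial>proj_measure e surf)"
      by (rule emeasure_surf_measure[OF er]) (auto simp: borel_closed)
    also have "\<dots> = (\<integral>\<^sup>+x. 0 \<partial>proj_measure e surf)"
    proof (rule nn_integral_cong_AE)
      show "AE x in proj_measure e surf. ennreal (surf_density r1 e x) * indicator (ball p \<rho> - ?S) x = 0"
        using AE_proj_measure[OF sigma_compact_surf transversal_surf[OF e]]
        by eventually_elim (auto simp: surf_def indicator_def)
    qed
    finally show "emeasure ?\<sigma> (ball p \<rho> - ?S) = 0" by simp
  next
    fix \<epsilon> :: real assume \<epsilon>: "0 < \<epsilon>"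
    \<comment> \<open>Chosen so that (\<beta> + \<theta>)/(\<beta> - \<theta>) \<le> 1 + \<epsilon>
      for every \<beta> > c0.\<close>
    define \<theta> where "\<theta> = min (c0 / 2) (\<epsilon> * c0 / (2 + \<epsilon>))"
    have \<theta>: "0 < \<theta>" "\<theta> < c0" using c0 \<epsilon> by (auto simp: \<theta>_def)
    have \<theta>2: "\<theta> * (2 + \<epsilon>) \<le> \<epsilon> * c0"
    proof -
      have "\<theta> \<le> \<epsilon> * c0 / (2 + \<epsilon>)" by (simp add: \<theta>_def)
      then show ?thesis using \<epsilon> by (simp add: pos_le_divide_eq)
    qed
    have \<theta>lt: "\<theta> < nu x \<bullet> e" if "x \<in> cball p r1" for x using c0(2)[OF that] \<theta> by simp
    obtain \<delta> where \<delta>: "0 < \<delta>"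
      "\<And>x y. x \<in> ball p \<rho> \<Longrightarrow> y \<in> cball x \<delta> \<Longrightarrow> y \<in> ball p r1 \<and> \<bar>nu y \<bullet> e - nu x \<bullet> e\<bar> \<le> \<theta>"
      "\<And>x K. x \<in> ball p \<rho> \<Longrightarrow> compact K \<Longrightarrow> K \<subseteq> cball x \<delta> \<Longrightarrow> ?h e K \<le> (nu x \<bullet> e + \<theta>) * ?h (nu x) K"
      by (rule local_estimates[OF e \<rho> \<theta>(1) \<theta>lt, of "1/2"]) auto
    show "\<exists>\<delta>>0. \<forall>K D. compact K \<longrightarrow> diameter K \<le> D \<longrightarrow> 0 < D \<longrightarrow> D \<le> \<delta> \<longrightarrow>
       K \<inter> ?S \<noteq> {} \<longrightarrow> measure ?\<sigma> K \<le> (1 + \<epsilon>) * (?w * (D / 2) ^ ?d)"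
    proof (intro exI[of _ \<delta>] conjI allI impI)
      fix K D assume K: "compact K" "diameter K \<le> D" "0 < D" "D \<le> \<delta>" "K \<inter> ?S \<noteq> {}"
      then obtain x where x: "x \<in> K" "x \<in> ?S" by blast
      then have xb: "x \<in> ball p \<rho>" by blast
      have Kb: "K \<in> sets borel" using K by (simp add: borel_compact)
      have Kx: "K \<subseteq> cball x \<delta>"
        using diameter_bounded_bound[OF compact_imp_bounded[OF K(1)] x(1)] K by force
      let ?\<beta> = "nu x \<bullet> e"
      have \<beta>: "c0 < ?\<beta>" using c0(2)[of x] xb \<rho> by auto
      have a: "0 < ?\<beta> - \<theta>" using \<beta> \<theta> by simp
      have "surf_density r1 e y \<le> 1 / (?\<beta> - \<theta>)" if "y \<in> K" for y
      proof -
        have "y \<in> ball p r1" "\<bar>nu y \<bullet> e - ?\<beta>\<bar> \<le> \<theta>" using \<delta>(2)[OF xb, of y] Kx \<open>y \<in> K\<close> by auto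
        then show ?thesis using a by (auto simp: surf_density_def intro!: frac_le)
      qed
      then have "emeasure ?\<sigma> K \<le> ennreal (1 / (?\<beta> - \<theta>)) * emeasure (proj_measure e surf) K"
        using a by (intro emeasure_surf_measure_le[OF er Kb]) auto
      then have "measure ?\<sigma> K \<le> (1 / (?\<beta> - \<theta>)) * ?m K"
        using a by (simp add: \<sigma>.emeasure_eq_measure pm.emeasure_eq_measure ennreal_le_iff flip: ennreal_mult)
      also have "?m K = ?h e K"
      proof (rule measure_proj_eq_hit[OF e Kb])
        show "K \<subseteq> ball p r" using \<delta>(2)[OF xb] Kx \<rho> by force
      qed
      also have "\<dots> \<le> (?\<beta> + \<theta>) * ?h (nu x) K" by (rule \<delta>(3)[OF xb K(1) Kx])
      also have "?h (nu x) K \<le> ?w * (D / 2) ^ ?d"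
      proof (rule measure_hit_le_isodiametric)
        show "compact (frontier \<Omega> \<inter> K)" using K by (intro closed_Int_compact frontier_closed)
        show "diameter (frontier \<Omega> \<inter> K) \<le> D"
          using diameter_subset[of "frontier \<Omega> \<inter> K" K] compact_imp_bounded[OF K(1)] K(2) by auto
        show "norm (nu x) = 1" using xb \<rho> by (intro norm_nu) auto
      qed (rule K(3))
      finally have "measure ?\<sigma> K \<le> (1 / (?\<beta> - \<theta>)) * ((?\<beta> + \<theta>) * (?w * (D / 2) ^ ?d))"
        using a \<theta> by (simp add: mult_left_mono divide_right_mono)
      also have "\<dots> = ((?\<beta> + \<theta>) / (?\<beta> - \<theta>)) * (?w * (D / 2) ^ ?d)" by simp
      also have "\<dots> \<le> (1 + \<epsilon>) * (?w * (D / 2) ^ ?d)"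
      proof (rule mult_right_mono)
        have "\<epsilon> * c0 \<le> \<epsilon> * ?\<beta>" using \<beta> \<epsilon> by (intro mult_left_mono) auto
        then have "?\<beta> + \<theta> \<le> (1 + \<epsilon>) * (?\<beta> - \<theta>)" using \<theta>2 by (simp add: algebra_simps)
        then show "(?\<beta> + \<theta>) / (?\<beta> - \<theta>) \<le> 1 + \<epsilon>" using a by (simp add: pos_divide_le_eq)
        show "0 \<le> ?w * (D / 2) ^ ?d" using K(3) by (intro mult_nonneg_nonneg unit_ball_vol_nonneg) auto
      qed
      finally show "measure ?\<sigma> K \<le> (1 + \<epsilon>) * (?w * (D / 2) ^ ?d)" .
    qed (rule \<delta>(1))
  next
    fix c :: real assume c: "0 < c" "c < 1"
    \<comment> \<open>The loss \<open>c\<close> is split into two equal factors: one pays for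
      replacing the direction \<open>e\<close> by \<open>nu x\<close>, the other,
      \<open>c' ^ (DIM('a) - 1)\<close>, for the smaller radius of the inscribed cylinder.\<close>
    define q where "q = sqrt c"
    have q: "0 < q" "q < 1" "q * q = c" using c by (auto simp: q_def)
    define c' where "c' = root ?d q"
    have c': "0 < c'" "c' < 1" "c' ^ ?d = q"
      using q d1 by (auto simp: c'_def real_root_pow_pos)
    define \<theta> where "\<theta> = min (c0 / 2) (c0 * (1 - q) / (1 + q))"
    have \<theta>: "0 < \<theta>" "\<theta> < c0" using c0 q by (auto simp: \<theta>_def)
    have \<theta>2: "\<theta> * (1 + q) \<le> c0 * (1 - q)"
    proof -
      have "\<theta> \<le> c0 * (1 - q) / (1 + q)" by (simp add: \<theta>_def)
      then show ?thesis using q by (simp add: pos_le_divide_eq)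
    qed
    have \<theta>lt: "\<theta> < nu x \<bullet> e" if "x \<in> cball p r1" for x using c0(2)[OF that] \<theta> by simp
    obtain \<delta> where \<delta>: "0 < \<delta>"
      "\<And>x y. x \<in> ball p \<rho> \<Longrightarrow> y \<in> cball x \<delta> \<Longrightarrow> y \<in> ball p r1 \<and> \<bar>nu y \<bullet> e - nu x \<bullet> e\<bar> \<le> \<theta>"
      "\<And>x K. x \<in> ball p \<rho> \<Longrightarrow> compact K \<Longrightarrow> K \<subseteq> cball x \<delta> \<Longrightarrow> (nu x \<bullet> e - \<theta>) * ?h (nu x) K \<le> ?h e K"
      "\<And>x s. x \<in> frontier \<Omega> \<Longrightarrow> x \<in> ball p \<rho> \<Longrightarrow> 0 < s \<Longrightarrow> s \<le> \<delta> \<Longrightarrow>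
        ?w * (c' * s) ^ ?d \<le> ?h (nu x) (cball x s)"
      by (rule local_estimates[OF e \<rho> \<theta>(1) \<theta>lt c'(1,2)]) auto
    show "\<exists>\<delta>>0. \<forall>x s. x \<in> ?S \<longrightarrow> 0 < s \<longrightarrow> s \<le> \<delta> \<longrightarrow> c * (?w * s ^ ?d) \<le> measure ?\<sigma> (cball x s)"
    proof (intro exI[of _ \<delta>] conjI allI impI)
      fix x s assume x: "x \<in> ?S" and s: "0 < s" "s \<le> \<delta>"
      then have xb: "x \<in> ball p \<rho>" and xf: "x \<in> frontier \<Omega>" by auto
      let ?K = "cball x s"
      have Kx: "?K \<subseteq> cball x \<delta>" using s by auto
      let ?\<beta> = "nu x \<bullet> e"
      have \<beta>: "c0 < ?\<beta>" using c0(2)[of x] xb \<rho> by auto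
      have a: "0 < ?\<beta> - \<theta>" "0 < ?\<beta> + \<theta>" using \<beta> \<theta> by auto
      have "1 / (?\<beta> + \<theta>) \<le> surf_density r1 e y" if "y \<in> ?K" for y
      proof -
        have y: "y \<in> ball p r1" "\<bar>nu y \<bullet> e - ?\<beta>\<bar> \<le> \<theta>" using \<delta>(2)[OF xb, of y] Kx \<open>y \<in> ?K\<close> by auto
        then have "0 < nu y \<bullet> e" using a by linarith
        then show ?thesis using y by (auto simp: surf_density_def intro!: frac_le)
      qed
      then have "ennreal (1 / (?\<beta> + \<theta>)) * emeasure (proj_measure e surf) ?K \<le> emeasure ?\<sigma> ?K"
        by (intro emeasure_surf_measure_ge[OF er]) auto
      then have 1: "(1 / (?\<beta> + \<theta>)) * ?m ?K \<le> measure ?\<sigma> ?K"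
        using a by (simp add: \<sigma>.emeasure_eq_measure pm.emeasure_eq_measure ennreal_le_iff flip: ennreal_mult)
      have 2: "?m ?K = ?h e ?K"
      proof (rule measure_proj_eq_hit[OF e])
        show "?K \<subseteq> ball p r" using \<delta>(2)[OF xb] Kx \<rho> by force
      qed simp
      have "q * (?\<beta> + \<theta>) \<le> ?\<beta> - \<theta>"
      proof -
        have "c0 * (1 - q) \<le> ?\<beta> * (1 - q)" using \<beta> q by (intro mult_right_mono) auto
        then show ?thesis using \<theta>2 by (simp add: algebra_simps)
      qed
      then have 3: "q \<le> (?\<beta> - \<theta>) / (?\<beta> + \<theta>)" using a by (simp add: pos_le_divide_eq)
      have w0: "0 \<le> ?w * (c' * s) ^ ?d" using c' s by (intro mult_nonneg_nonneg unit_ball_vol_nonneg) auto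
      have "c * (?w * s ^ ?d) = q * (?w * (c' * s) ^ ?d)"
      proof -
        have "(c' * s) ^ ?d = q * s ^ ?d" by (simp only: power_mult_distrib c'(3))
        then show ?thesis by (simp add: q(3)[symmetric])
      qed
      also have "\<dots> \<le> ((?\<beta> - \<theta>) / (?\<beta> + \<theta>)) * (?w * (c' * s) ^ ?d)"
        by (rule mult_right_mono[OF 3 w0])
      also have "\<dots> \<le> ((?\<beta> - \<theta>) / (?\<beta> + \<theta>)) * ?h (nu x) ?K"
        using a by (intro mult_left_mono \<delta>(4)[OF xf xb s]) auto
      also have "\<dots> = (1 / (?\<beta> + \<theta>)) * ((?\<beta> - \<theta>) * ?h (nu x) ?K)" by simp
      also have "\<dots> \<le> (1 / (?\<beta> + \<theta>)) * ?h e ?K"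
        using a by (intro mult_left_mono \<delta>(3)[OF xb compact_cball Kx]) auto
      also have "\<dots> \<le> measure ?\<sigma> ?K" using 1 2 by simp
      finally show "c * (?w * s ^ ?d) \<le> measure ?\<sigma> ?K" .
    qed (rule \<delta>(1))
  qed auto
  then show ?thesis by (simp only: emeasure_hausdorff_measure[OF d1 B(1)])
qed

end

section \<open>The divergence theorem on a patch\<close>

lemma borel_indicator_continuous:
  fixes f :: "'a::euclidean_space \<Rightarrow> real"
  assumes "S \<in> sets borel" "continuous_on S f"
  shows "(\<lambda>x. indicator S x * f x) \<in> borel_measurable borel"
  using borel_measurable_continuous_on_indicator[OF assms] by simp

lemma integrable_compact_indicator:
  fixes f :: "'a::euclidean_space \<Rightarrow> real"
  assumes M: "sets M = sets borel" "emeasure M K < top" and K: "compact K" and f: "continuous_on K f"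
  shows "integrable M (\<lambda>x. indicator K x * f x)"
proof -
  obtain B where B: "\<forall>x\<in>K. \<bar>f x\<bar> \<le> B"
    using compact_imp_bounded[OF compact_continuous_image[OF f K]] by (auto simp: bounded_iff)
  have Kb: "K \<in> sets borel" using K by (rule borel_compact)
  show ?thesis
  proof (rule Bochner_Integration.integrable_bound)
    show "integrable M (\<lambda>x. indicator K x * \<bar>B\<bar>)"
      using M Kb by (intro integrable_mult_left integrable_real_indicator) auto
    show "(\<lambda>x. indicator K x * f x) \<in> borel_measurable M"
      using borel_indicator_continuous[OF Kb f] by (simp cong: measurable_cong_sets add: M(1))
    show "AE x in M. norm (indicator K x * f x) \<le> norm (indicator K x * \<bar>B\<bar>)"
      using B by (intro AE_I2) (auto simp: indicator_def)
  qed
qed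

context boundary_patch begin

abbreviation hausd :: "'a measure" where "hausd \<equiv> hausdorff_measure (DIM('a) - 1)"

lemma finite_hausdorff_patch:
  assumes d: "2 \<le> DIM('a)" and e: "crossing e" and \<rho>: "\<rho> < r"
  shows "emeasure hausd (frontier \<Omega> \<inter> ball p \<rho>) < top"
proof -
  let ?r1 = "(\<rho> + r) / 2"
  have r1: "\<rho> < ?r1" "?r1 < r" using \<rho> by auto
  interpret finite_measure "surf_measure ?r1 e" by (rule finite_surf_measure[OF e r1(2)])
  have "frontier \<Omega> \<inter> ball p \<rho> \<in> sets borel" by (intro sets.Int) (auto simp: borel_closed)
  then have "emeasure hausd (frontier \<Omega> \<inter> ball p \<rho>) = emeasure (surf_measure ?r1 e) (frontier \<Omega> \<inter> ball p \<rho>)"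
    by (rule hausdorff_eq_surf_measure[OF d e r1]) simp
  then show ?thesis by (simp add: emeasure_eq_measure)
qed

lemma integral_proj_eq_surface:
  assumes d: "2 \<le> DIM('a)" and e: "crossing e" and \<rho>: "\<rho> < r"
    and f: "f \<in> borel_measurable borel" and zero: "\<And>x. x \<notin> ball p \<rho> \<Longrightarrow> f x = 0"
  shows "(\<integral>x. f x \<partial>proj_measure e surf) = (\<integral>x. indicator (frontier \<Omega>) x * (f x * (nu x \<bullet> e)) \<partial>hausd)"
proof -
  let ?r1 = "(\<rho> + r) / 2"
  have r1: "\<rho> < ?r1" "?r1 < r" using \<rho> by auto
  let ?\<sigma> = "surf_measure ?r1 e" and ?S = "frontier \<Omega> \<inter> ball p \<rho>"
  have S: "?S \<in> sets borel" by (intro sets.Int) (auto simp: borel_closed)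
  let ?F = "\<lambda>x. f x * (indicator (ball p \<rho>) x * (nu x \<bullet> e))"
  have F: "?F \<in> borel_measurable borel"
    using f \<rho> by (intro borel_measurable_times borel_indicator_continuous continuous_intros continuous_on_subset[OF nu_cont]) auto
  have iS: "(\<lambda>x. indicator ?S x :: real) \<in> borel_measurable borel" by (rule borel_measurable_indicator[OF S])
  have mb: "g \<in> borel_measurable M" if "g \<in> borel_measurable borel" "sets M = sets borel"
    for M :: "'a measure" and g :: "'a \<Rightarrow> real"
    using that by (simp cong: measurable_cong_sets)
  \<comment> \<open>The two measures are known to agree only on subsets of the patch, so both are
    restricted by the density \<open>indicator ?S\<close> before integrals are exchanged. Afterwards
    the density \<open>1 / (nu x \<bullet> e)\<close> cancels against the factor in the
    integrand.\<close>
  have dens: "density hausd (\<lambda>x. ennreal (indicator ?S x)) = density ?\<sigma> (\<lambda>x. ennreal (indicator ?S x))"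
  proof (rule measure_eqI)
    fix A assume "A \<in> sets (density hausd (\<lambda>x. ennreal (indicator ?S x)))"
    then have A: "A \<in> sets borel" by simp
    have "emeasure hausd (?S \<inter> A) = emeasure ?\<sigma> (?S \<inter> A)"
      using S A by (intro hausdorff_eq_surf_measure[OF d e r1]) auto
    then show "emeasure (density hausd (\<lambda>x. ennreal (indicator ?S x))) A = emeasure (density ?\<sigma> (\<lambda>x. ennreal (indicator ?S x))) A"
      unfolding ennreal_indicator using S A by (simp add: emeasure_restricted)
  qed simp
  have "(\<integral>x. indicator (frontier \<Omega>) x * (f x * (nu x \<bullet> e)) \<partial>hausd) = (\<integral>x. indicator ?S x *\<^sub>R ?F x \<partial>hausd)"
    using zero by (intro Bochner_Integration.integral_cong) (auto simp: indicator_def)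
  also have "\<dots> = (\<integral>x. ?F x \<partial>density hausd (\<lambda>x. ennreal (indicator ?S x)))"
    by (intro integral_density[symmetric] mb[OF F] mb[OF iS]) auto
  also have "\<dots> = (\<integral>x. indicator ?S x *\<^sub>R ?F x \<partial>?\<sigma>)"
    unfolding dens by (intro integral_density mb[OF F] mb[OF iS]) auto
  also have "\<dots> = (\<integral>x. surf_density ?r1 e x *\<^sub>R (indicator ?S x *\<^sub>R ?F x) \<partial>proj_measure e surf)"
    unfolding surf_measure_def
    using surf_density_nonneg[OF e r1(2)]
    by (intro integral_density mb[OF surf_density_borel[OF e r1(2)]] mb[OF borel_measurable_scaleR[OF iS F]]) auto
  also have "\<dots> = (\<integral>x. f x \<partial>proj_measure e surf)"
  proof (rule integral_cong_AE)
    have [measurable]: "?S \<in> sets borel" "?F \<in> borel_measurable borel" "f \<in> borel_measurable borel"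
      "surf_density ?r1 e \<in> borel_measurable borel" using S F f surf_density_borel[OF e r1(2)] by auto
    show "(\<lambda>x. surf_density ?r1 e x *\<^sub>R (indicator ?S x *\<^sub>R ?F x)) \<in> borel_measurable (proj_measure e surf)"
      "f \<in> borel_measurable (proj_measure e surf)" by measurable
    show "AE x in proj_measure e surf. surf_density ?r1 e x *\<^sub>R (indicator ?S x *\<^sub>R ?F x) = f x"
      using AE_proj_measure[OF sigma_compact_surf transversal_surf[OF e]]
    proof eventually_elim
      fix x assume x: "x \<in> surf"
      show "surf_density ?r1 e x *\<^sub>R (indicator ?S x *\<^sub>R ?F x) = f x"
      proof (cases "x \<in> ball p \<rho>")
        case True
        then have "x \<in> ball p r" "x \<in> cball p ?r1" using r1 by auto
        moreover from this have "0 < nu x \<bullet> e" using e unfolding crossing_iff_nu by blast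
        ultimately show ?thesis using True x by (simp add: surf_density_def surf_def)
      qed (use zero in simp)
    qed
  qed
  finally show ?thesis by simp
qed

lemma integral_gradient_crossing:
  assumes d: "2 \<le> DIM('a)" and e: "crossing e" and \<rho>: "\<rho> < r"
    and cont: "continuous_on (closure \<Omega>) f"
    and zero: "\<And>x. x \<notin> cball p \<rho> \<Longrightarrow> f x = 0"
    and der: "\<And>x. x \<in> \<Omega> \<Longrightarrow> x \<in> ball p r \<Longrightarrow> (f has_derivative (\<lambda>h. G x \<bullet> h)) (at x)"
    and zero': "\<And>x. x \<notin> cball p \<rho> \<Longrightarrow> G x = 0"
    and cont': "continuous_on (\<Omega> \<inter> ball p r) G"
    and bd: "\<And>x. x \<in> \<Omega> \<Longrightarrow> norm (G x) \<le> M"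
  shows "(\<integral>x. indicator \<Omega> x * (G x \<bullet> e) \<partial>lborel) = (\<integral>x. indicator (frontier \<Omega>) x * (f x * (nu x \<bullet> e)) \<partial>hausd)"
proof -
  let ?\<rho> = "(\<rho> + r) / 2"
  have \<rho>': "\<rho> < ?\<rho>" "?\<rho> < r" using \<rho> by auto
  have "(\<integral>x. indicator \<Omega> x * (G x \<bullet> e) \<partial>lborel) = (\<integral>x. indicator (closure \<Omega>) x * f x \<partial>proj_measure e surf)"
  proof (rule integral_directional_derivative[OF e \<rho> cont zero])
    show "((\<lambda>t. f (x + t *\<^sub>R e)) has_real_derivative G x \<bullet> e) (at 0)" if "x \<in> \<Omega>" "x \<in> ball p r" for x
    proof -
      have "((\<lambda>t. x + t *\<^sub>R e) has_derivative (\<lambda>h. h *\<^sub>R e)) (at (0::real))"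
        by (auto intro!: derivative_eq_intros)
      moreover have "(f has_derivative (\<lambda>h. G x \<bullet> h)) (at (x + 0 *\<^sub>R e))"
        using der[OF that] by simp
      ultimately have "((\<lambda>t. f (x + t *\<^sub>R e)) has_derivative (\<lambda>h. G x \<bullet> (h *\<^sub>R e))) (at 0)"
        by (rule has_derivative_compose)
      then show ?thesis by (simp add: has_field_derivative_def mult_fun_commute)
    qed
    show "G x \<bullet> e = 0" if "x \<notin> cball p \<rho>" for x using zero'[OF that] by simp
    show "continuous_on (\<Omega> \<inter> ball p r) (\<lambda>x. G x \<bullet> e)" by (intro continuous_intros cont')
    show "\<bar>G x \<bullet> e\<bar> \<le> M * norm e" if "x \<in> \<Omega>" for x
      using Cauchy_Schwarz_ineq2[of "G x" e] mult_right_mono[OF bd[OF that], of "norm e"] by simp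
  qed
  also have "\<dots> = (\<integral>x. indicator (frontier \<Omega>) x * ((indicator (closure \<Omega>) x * f x) * (nu x \<bullet> e)) \<partial>hausd)"
  proof (rule integral_proj_eq_surface[OF d e \<rho>'(2) borel_indicator_continuous[OF _ cont]])
    fix x assume "x \<notin> ball p ?\<rho>"
    then have "x \<notin> cball p \<rho>" using \<rho>' by auto
    then show "indicator (closure \<Omega>) x * f x = 0" using zero by simp
  qed simp
  also have "\<dots> = (\<integral>x. indicator (frontier \<Omega>) x * (f x * (nu x \<bullet> e)) \<partial>hausd)"
    by (intro Bochner_Integration.integral_cong) (auto simp: indicator_def frontier_def)
  finally show ?thesis .
qed

lemma integrable_surface:
  assumes d: "2 \<le> DIM('a)" and e: "crossing e" and \<rho>: "\<rho> < r"
    and cont: "continuous_on (frontier \<Omega> \<inter> cball p \<rho>) f"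
    and zero: "\<And>x. x \<notin> cball p \<rho> \<Longrightarrow> f x = 0"
  shows "integrable hausd (\<lambda>x. indicator (frontier \<Omega>) x * (f x * (nu x \<bullet> b)))"
proof -
  let ?\<rho> = "(\<rho> + r) / 2"
  have \<rho>': "\<rho> < ?\<rho>" "?\<rho> < r" using \<rho> by auto
  have "emeasure hausd (frontier \<Omega> \<inter> cball p \<rho>) \<le> emeasure hausd (frontier \<Omega> \<inter> ball p ?\<rho>)"
    using \<rho>' by (intro emeasure_mono) (auto simp: borel_closed)
  also have "\<dots> < top" by (rule finite_hausdorff_patch[OF d e \<rho>'(2)])
  finally have "integrable hausd (\<lambda>x. indicator (frontier \<Omega> \<inter> cball p \<rho>) x * (f x * (nu x \<bullet> b)))"
    using \<rho> by (intro integrable_compact_indicator closed_Int_compact frontier_closed compact_cball continuous_intros cont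
      continuous_on_subset[OF nu_cont]) auto
  also have "(\<lambda>x. indicator (frontier \<Omega> \<inter> cball p \<rho>) x * (f x * (nu x \<bullet> b))) = (\<lambda>x. indicator (frontier \<Omega>) x * (f x * (nu x \<bullet> b)))"
    using zero by (auto simp: fun_eq_iff indicator_def)
  finally show ?thesis .
qed

text \<open>On a slightly smaller ball \<open>e + \<eta> *\<^sub>R b\<close> is still crossing for
  small \<eta>, and both sides are linear in the direction, so the identity for an arbitrary
  \<open>b\<close> is a difference of two known ones.\<close>

lemma integral_gradient:
  assumes d: "2 \<le> DIM('a)" and e: "crossing e" and \<rho>: "\<rho> < r"
    and cont: "continuous_on (closure \<Omega>) f"
    and zero: "\<And>x. x \<notin> cball p \<rho> \<Longrightarrow> f x = 0"
    and der: "\<And>x. x \<in> \<Omega> \<Longrightarrow> x \<in> ball p r \<Longrightarrow> (f has_derivative (\<lambda>h. G x \<bullet> h)) (at x)"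
    and zero': "\<And>x. x \<notin> cball p \<rho> \<Longrightarrow> G x = 0"
    and cont': "continuous_on (\<Omega> \<inter> ball p r) G"
    and bd: "\<And>x. x \<in> \<Omega> \<Longrightarrow> norm (G x) \<le> M"
  shows "(\<integral>x. indicator \<Omega> x * (G x \<bullet> b) \<partial>lborel) = (\<integral>x. indicator (frontier \<Omega>) x * (f x * (nu x \<bullet> b)) \<partial>hausd)"
    and "integrable lborel (\<lambda>x. indicator \<Omega> x * (G x \<bullet> b))"
proof -
  have int: "integrable lborel (\<lambda>x. indicator \<Omega> x * (G x \<bullet> b))" for b
  proof (rule Bochner_Integration.integrable_bound)
    show "integrable lborel (\<lambda>x. indicator (ball p r) x * (\<bar>M\<bar> * norm b))"
      by (intro integrable_mult_left integrable_real_indicator)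
        (use emeasure_lborel_ball_finite[of p r] in \<open>auto simp: less_top\<close>)
    have eq: "(\<lambda>x. indicator \<Omega> x * (G x \<bullet> b)) = (\<lambda>x. indicator (\<Omega> \<inter> ball p r) x * (G x \<bullet> b))"
    proof
      fix x
      show "indicator \<Omega> x * (G x \<bullet> b) = indicator (\<Omega> \<inter> ball p r) x * (G x \<bullet> b)"
        using zero'[of x] \<rho> by (cases "x \<in> ball p r") (auto simp: indicator_def)
    qed
    show "(\<lambda>x. indicator \<Omega> x * (G x \<bullet> b)) \<in> borel_measurable lborel"
    proof -
      have "continuous_on (\<Omega> \<inter> ball p r) (\<lambda>x. G x \<bullet> b)" by (intro continuous_intros cont')
      moreover have "\<Omega> \<inter> ball p r \<in> sets borel" using open_dom by simp
      ultimately show ?thesis unfolding eq using borel_indicator_continuous by simp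
    qed
    show "AE x in lborel. norm (indicator \<Omega> x * (G x \<bullet> b)) \<le> norm (indicator (ball p r) x * (\<bar>M\<bar> * norm b))"
    proof (rule AE_I2)
      fix x
      have "\<bar>G x \<bullet> b\<bar> \<le> \<bar>M\<bar> * norm b" if "x \<in> \<Omega>"
        using Cauchy_Schwarz_ineq2[of "G x" b] mult_right_mono[OF bd[OF that], of "norm b"]
        by (smt (verit) mult_right_mono norm_ge_zero)
      then show "norm (indicator \<Omega> x * (G x \<bullet> b)) \<le> norm (indicator (ball p r) x * (\<bar>M\<bar> * norm b))"
        using zero'[of x] \<rho> by (cases "x \<in> ball p r") (auto simp: indicator_def abs_mult)
    qed
  qed
  show "integrable lborel (\<lambda>x. indicator \<Omega> x * (G x \<bullet> b))" by (rule int)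
  define r1 where "r1 = max (r / 2) ((\<rho> + r) / 2)"
  have r1: "0 < r1" "\<rho> < r1" "r1 < r" using r_pos \<rho> by (auto simp: r1_def less_max_iff_disj)
  have sb: "ball p r1 \<subseteq> ball p r" using r1 by auto
  interpret sub: boundary_patch \<Omega> p r1 \<phi> D\<phi> by (rule subpatch[OF r1(1) sb])
  obtain c where c: "0 < c" "\<And>x. x \<in> cball p r1 \<Longrightarrow> c < nu x \<bullet> e" by (rule nu_inner_lower[OF e r1(3)]) blast
  define \<eta> where "\<eta> = c / (norm b + 1)"
  have \<eta>: "0 < \<eta>" "\<eta> * norm b \<le> c"
  proof -
    show "0 < \<eta>" using c by (simp add: \<eta>_def add_nonneg_pos)
    have "\<eta> * norm b \<le> \<eta> * (norm b + 1)" using \<open>0 < \<eta>\<close> by simp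
    also have "\<dots> = c" by (simp add: \<eta>_def add_nonneg_eq_0_iff)
    finally show "\<eta> * norm b \<le> c" .
  qed
  have cr1: "sub.crossing e" using e sb unfolding crossing_def sub.crossing_def by blast
  have cr2: "sub.crossing (e + \<eta> *\<^sub>R b)"
    unfolding sub.crossing_iff_nu
  proof
    fix x assume x: "x \<in> ball p r1"
    have "\<bar>nu x \<bullet> b\<bar> \<le> norm b"
      using Cauchy_Schwarz_ineq2[of "nu x" b] norm_nu[of x] x sb by auto
    then have "\<eta> * \<bar>nu x \<bullet> b\<bar> \<le> \<eta> * norm b" using \<eta>(1) by (intro mult_left_mono) auto
    then have "\<eta> * \<bar>nu x \<bullet> b\<bar> \<le> c" using \<eta>(2) by linarith
    then have "\<bar>\<eta> * (nu x \<bullet> b)\<bar> \<le> c" using \<eta>(1) by (simp add: abs_mult)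
    moreover have "c < nu x \<bullet> e" using x by (intro c) auto
    ultimately show "0 < nu x \<bullet> (e + \<eta> *\<^sub>R b)" by (simp add: inner_add_right)
  qed
  have der1: "(f has_derivative (\<lambda>h. G x \<bullet> h)) (at x)" if "x \<in> \<Omega>" "x \<in> ball p r1" for x
    using der that sb by blast
  have cont1: "continuous_on (\<Omega> \<inter> ball p r1) G" using cont' sb by (rule_tac continuous_on_subset) auto
  have I: "(\<integral>x. indicator \<Omega> x * (G x \<bullet> a) \<partial>lborel) = (\<integral>x. indicator (frontier \<Omega>) x * (f x * (nu x \<bullet> a)) \<partial>hausd)"
    if "sub.crossing a" for a
    by (rule sub.integral_gradient_crossing[OF d that r1(2) cont zero der1 zero' cont1 bd])
  have Hint: "integrable hausd (\<lambda>x. indicator (frontier \<Omega>) x * (f x * (nu x \<bullet> a)))" for a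
    by (rule integrable_surface[OF d e \<rho> _ zero]) (use cont in \<open>auto simp: frontier_def intro: continuous_on_subset\<close>)
  have "(\<integral>x. indicator \<Omega> x * (G x \<bullet> (e + \<eta> *\<^sub>R b)) \<partial>lborel) = (\<integral>x. indicator \<Omega> x * (G x \<bullet> e) + \<eta> * (indicator \<Omega> x * (G x \<bullet> b)) \<partial>lborel)"
    by (intro Bochner_Integration.integral_cong) (auto simp: inner_add_right algebra_simps)
  also have "\<dots> = (\<integral>x. indicator \<Omega> x * (G x \<bullet> e) \<partial>lborel) + \<eta> * (\<integral>x. indicator \<Omega> x * (G x \<bullet> b) \<partial>lborel)"
    using int by simp
  finally have 1: "(\<integral>x. indicator \<Omega> x * (G x \<bullet> (e + \<eta> *\<^sub>R b)) \<partial>lborel) = \<dots>" .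
  have "(\<integral>x. indicator (frontier \<Omega>) x * (f x * (nu x \<bullet> (e + \<eta> *\<^sub>R b))) \<partial>hausd)
     = (\<integral>x. indicator (frontier \<Omega>) x * (f x * (nu x \<bullet> e)) + \<eta> * (indicator (frontier \<Omega>) x * (f x * (nu x \<bullet> b))) \<partial>hausd)"
    by (intro Bochner_Integration.integral_cong) (auto simp: inner_add_right algebra_simps)
  also have "\<dots> = (\<integral>x. indicator (frontier \<Omega>) x * (f x * (nu x \<bullet> e)) \<partial>hausd) + \<eta> * (\<integral>x. indicator (frontier \<Omega>) x * (f x * (nu x \<bullet> b)) \<partial>hausd)"
    using Hint by simp
  finally show "(\<integral>x. indicator \<Omega> x * (G x \<bullet> b) \<partial>lborel) = (\<integral>x. indicator (frontier \<Omega>) x * (f x * (nu x \<bullet> b)) \<partial>hausd)"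
    using 1 I[OF cr1] I[OF cr2] \<eta>(1) by simp
qed

end

text \<open>The values extend continuously to the closure, whereas the derivative is continuous only
  inside and carries no bound: the regularity of a field built from second derivatives of
  \<open>u\<close>.\<close>

definition C1_field :: "'a::euclidean_space set \<Rightarrow> ('a \<Rightarrow> 'a) \<Rightarrow> ('a \<Rightarrow> 'a \<Rightarrow> 'a) \<Rightarrow> bool" where
  "C1_field \<Omega> F F' \<longleftrightarrow> continuous_on (closure \<Omega>) F \<and>
     (\<forall>x\<in>\<Omega>. (F has_derivative F' x) (at x)) \<and> (\<forall>h. continuous_on \<Omega> (\<lambda>x. F' x h))"

text \<open>For the derivative of a vector field this is its divergence.\<close>

definition trace_of :: "('a::euclidean_space \<Rightarrow> 'a) \<Rightarrow> real" where
  "trace_of L = (\<Sum>b\<in>Basis. L b \<bullet> b)"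

text \<open>The transpose of \<open>L\<close> applied to \<open>b\<close>; for the derivative of a
  field this is the gradient of the component along \<open>b\<close>.\<close>

definition row :: "('a::euclidean_space \<Rightarrow> 'a) \<Rightarrow> 'a \<Rightarrow> 'a" where
  "row L b = (\<Sum>i\<in>Basis. (L i \<bullet> b) *\<^sub>R i)"

lemma inner_row: assumes "linear L" shows "row L b \<bullet> h = L h \<bullet> b"
proof -
  have "L h = L (\<Sum>i\<in>Basis. (h \<bullet> i) *\<^sub>R i)" by (simp add: euclidean_representation)
  also have "\<dots> = (\<Sum>i\<in>Basis. (h \<bullet> i) *\<^sub>R L i)" by (simp add: linear_sum[OF assms] linear_scale[OF assms])
  finally have "L h \<bullet> b = (\<Sum>i\<in>Basis. (h \<bullet> i) * (L i \<bullet> b))" by (simp add: inner_sum_left)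
  also have "\<dots> = row L b \<bullet> h"
    unfolding row_def inner_sum_left by (intro sum.cong refl) (simp add: inner_commute[of h])
  finally show ?thesis ..
qed

lemma sum_row: "(\<Sum>b\<in>Basis. row L b \<bullet> b) = trace_of L"
  unfolding row_def trace_of_def
  by (intro sum.cong refl) (simp add: inner_sum_left inner_Basis if_distrib cong: if_cong)

lemma C1_fieldD:
  assumes "C1_field \<Omega> F F'"
  shows "continuous_on (closure \<Omega>) F" "\<And>x. x \<in> \<Omega> \<Longrightarrow> (F has_derivative F' x) (at x)"
    "\<And>h. continuous_on \<Omega> (\<lambda>x. F' x h)" "\<And>x. x \<in> \<Omega> \<Longrightarrow> linear (F' x)"
  using assms by (auto simp: C1_field_def intro: has_derivative_linear)

lemma C1_field_row_continuous:
  assumes "C1_field \<Omega> F F'" shows "continuous_on \<Omega> (\<lambda>x. row (F' x) b)"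
  unfolding row_def by (intro continuous_intros C1_fieldD[OF assms])

lemma C1_field_trace_continuous:
  assumes "C1_field \<Omega> F F'" shows "continuous_on \<Omega> (\<lambda>x. trace_of (F' x))"
  unfolding trace_of_def by (intro continuous_intros C1_fieldD[OF assms])

lemma product_component_derivative:
  fixes F :: "'a::euclidean_space \<Rightarrow> 'a" and x c :: 'a
  assumes \<zeta>: "(\<zeta> has_derivative (\<lambda>h. Z \<bullet> h)) (at x)" and F: "(F has_derivative L) (at (x - c))"
  shows "((\<lambda>x. \<zeta> x * (F (x - c) \<bullet> b)) has_derivative (\<lambda>h. ((F (x - c) \<bullet> b) *\<^sub>R Z + \<zeta> x *\<^sub>R row L b) \<bullet> h)) (at x)"
proof -
  have L: "linear L" using F by (rule has_derivative_linear)
  have "((\<lambda>x. x - c) has_derivative (\<lambda>h. h)) (at x)" by (auto intro!: derivative_eq_intros)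
  from has_derivative_compose[OF this F] have "((\<lambda>x. F (x - c)) has_derivative L) (at x)" by simp
  then have "((\<lambda>x. F (x - c) \<bullet> b) has_derivative (\<lambda>h. L h \<bullet> b)) (at x)" by (rule has_derivative_inner_left)
  from has_derivative_mult[OF \<zeta> this] show ?thesis
    by (rule has_derivative_eq_rhs) (auto simp: inner_add_left inner_row[OF L] mult.commute)
qed

lemma sum_Basis_product:
  fixes y Z :: "'a::euclidean_space"
  shows "(\<Sum>b\<in>Basis. ((y \<bullet> b) *\<^sub>R Z + c *\<^sub>R row L b) \<bullet> b) = Z \<bullet> y + c * trace_of L"
proof -
  have "(\<Sum>b\<in>Basis. ((y \<bullet> b) *\<^sub>R Z + c *\<^sub>R row L b) \<bullet> b) = (\<Sum>b\<in>Basis. (Z \<bullet> b) * (y \<bullet> b)) + c * (\<Sum>b\<in>Basis. row L b \<bullet> b)"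
    by (simp add: inner_add_left sum.distrib sum_distrib_left mult.commute)
  then show ?thesis by (simp add: sum_row euclidean_inner[of Z y])
qed

context boundary_patch begin

text \<open>\<phi> is at most 0 on the closure and decreases strictly along \<open>- e\<close>, so
  even boundary points move into the open domain as long as the step stays inside the ball.\<close>

lemma shift_into_domain:
  assumes e: "crossing e" and x: "x \<in> closure \<Omega>" "x \<in> ball p \<rho>" and s: "0 < s" "s * norm e < r - \<rho>"
  shows "x - s *\<^sub>R e \<in> \<Omega>"
proof -
  have n: "dist x (x - s *\<^sub>R e) = s * norm e" using s by (simp add: dist_norm)
  have sn: "0 \<le> s * norm e" using s by simp
  have xr: "x \<in> ball p r" using x sn s(2) by auto
  have yr: "x - s *\<^sub>R e \<in> ball p r" using dist_triangle[of p "x - s *\<^sub>R e" x] n x s(2) by auto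
  have "\<phi> x \<le> 0"
  proof (cases "x \<in> \<Omega>")
    case False
    then have "x \<in> frontier \<Omega>" using x open_dom by (simp add: frontier_def interior_open)
    then show ?thesis using in_front[OF xr] by simp
  qed (use in_dom[OF xr] in simp)
  moreover have "\<phi> (x - s *\<^sub>R e) < \<phi> x"
    using phi_increasing[OF e yr, of s] xr s by simp
  ultimately show ?thesis using in_dom[OF yr] by simp
qed

text \<open>The inward shift by \<open>c\<close> evaluates the field at points of \<Omega> even for
  boundary points of the patch, so the components of the shifted field have gradients continuous up
  to the boundary. \<open>integral_gradient\<close> applies to each of them, and summing over
  \<open>Basis\<close> gives the divergence.\<close>

lemma shifted_divergence:
  assumes d: "2 \<le> DIM('a)" and e: "crossing e" and bnd: "bounded \<Omega>"
    and F: "C1_field \<Omega> F F'" and \<zeta>: "C1 \<zeta> Z" and zero: "\<And>x. x \<notin> cball p \<rho> \<Longrightarrow> \<zeta> x = 0"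
    and \<rho>: "\<rho> < \<rho>2" "0 < \<rho>2" "\<rho>2 < r" and s: "0 < s" "s * norm e < r - \<rho>2"
  defines "c \<equiv> s *\<^sub>R e"
  shows "(\<integral>x. indicator \<Omega> x * (Z x \<bullet> F (x - c) + \<zeta> x * trace_of (F' (x - c))) \<partial>lborel)
      = (\<integral>x. indicator (frontier \<Omega>) x * (\<zeta> x * (F (x - c) \<bullet> nu x)) \<partial>hausd)"
    and "integrable lborel (\<lambda>x. indicator \<Omega> x * (Z x \<bullet> F (x - c) + \<zeta> x * trace_of (F' (x - c))))"
    and "integrable hausd (\<lambda>x. indicator (frontier \<Omega>) x * (\<zeta> x * (F (x - c) \<bullet> nu x)))"
proof -
  have sb: "ball p \<rho>2 \<subseteq> ball p r" using \<rho> by auto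
  interpret sub: boundary_patch \<Omega> p \<rho>2 \<phi> D\<phi> by (rule subpatch[OF \<rho>(2) sb])
  have cr: "sub.crossing e" using e sb unfolding crossing_def sub.crossing_def by blast
  have sh: "x - c \<in> \<Omega>" if "x \<in> closure \<Omega>" "x \<in> ball p \<rho>2" for x
    unfolding c_def by (rule shift_into_domain[OF e that s])
  have Zz: "Z x = 0" if "x \<notin> cball p \<rho>" for x
    using C1_zero_grad[OF \<zeta>, of "- cball p \<rho>" x] zero that by auto
  define f where "f b x = \<zeta> x * (F (x - c) \<bullet> b)" for b x
  define G where "G b x = (F (x - c) \<bullet> b) *\<^sub>R Z x + \<zeta> x *\<^sub>R row (F' (x - c)) b" for b x
  have f0: "f b x = 0" and G0: "G b x = 0" if "x \<notin> cball p \<rho>" for b x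
    using zero[OF that] Zz[OF that] by (auto simp: f_def G_def)
  let ?A = "closure \<Omega> \<inter> ball p \<rho>2" and ?B = "closure \<Omega> \<inter> - cball p \<rho>"
  have shA: "(\<lambda>x. x - c) ` ?A \<subseteq> \<Omega>" using sh by auto
  have cA: "continuous_on ?A (\<lambda>x. F (x - c))"
    by (rule continuous_on_compose2[OF C1_fieldD(1)[OF F]])
      (use shA closure_subset in \<open>auto intro!: continuous_intros\<close>)
  have cR: "continuous_on ?A (\<lambda>x. row (F' (x - c)) b)" for b
    by (rule continuous_on_compose2[OF C1_field_row_continuous[OF F]])
      (use shA in \<open>auto intro!: continuous_intros\<close>)
  have c\<zeta>: "continuous_on S \<zeta>" for S by (rule C1_continuous[OF \<zeta>])
  have cZ: "continuous_on S Z" for S using \<zeta> unfolding C1_def by (auto intro: continuous_on_subset)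
  have cG: "continuous_on ?A (G b)" for b
    unfolding G_def by (intro continuous_intros cA cR c\<zeta> cZ)
  have cont: "continuous_on (closure \<Omega>) (f b)" for b
  proof -
    have U: "?A \<union> ?B = closure \<Omega>" using \<rho> by auto
    have "continuous_on (?A \<union> ?B) (f b)"
    proof (rule continuous_on_Un_local_open)
      show "openin (top_of_set (?A \<union> ?B)) ?A" "openin (top_of_set (?A \<union> ?B)) ?B"
        unfolding U by (auto simp: openin_open)
      show "continuous_on ?A (f b)" unfolding f_def by (intro continuous_intros cA c\<zeta>)
      show "continuous_on ?B (f b)"
        by (rule continuous_on_eq[of _ "\<lambda>_. 0"]) (use f0 in auto)
    qed
    then show ?thesis by (simp only: U)
  qed
  have "\<exists>M. \<forall>x\<in>\<Omega>. norm (G b x) \<le> M" for b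
  proof -
    have "compact (closure \<Omega> \<inter> cball p \<rho>)" using bnd by (intro compact_Int_closed) auto
    moreover have "continuous_on (closure \<Omega> \<inter> cball p \<rho>) (G b)"
      by (rule continuous_on_subset[OF cG]) (use \<rho> in auto)
    ultimately have "bounded (G b ` (closure \<Omega> \<inter> cball p \<rho>))"
      by (intro compact_imp_bounded compact_continuous_image)
    then obtain M where "\<forall>x\<in>closure \<Omega> \<inter> cball p \<rho>. norm (G b x) \<le> M" by (auto simp: bounded_iff)
    then have "norm (G b x) \<le> \<bar>M\<bar>" if "x \<in> \<Omega>" for x
    proof (cases "x \<in> cball p \<rho>")
      case True
      then have "x \<in> closure \<Omega> \<inter> cball p \<rho>" using that closure_subset by blast
      then have "norm (G b x) \<le> M" using \<open>\<forall>x\<in>closure \<Omega> \<inter> cball p \<rho>. norm (G b x) \<le> M\<close> by blast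
      then show ?thesis by linarith
    qed (use G0 in simp)
    then show ?thesis by blast
  qed
  then have "\<forall>b. \<exists>M. \<forall>x\<in>\<Omega>. norm (G b x) \<le> M" by blast
  then obtain M where "\<forall>b. \<forall>x\<in>\<Omega>. norm (G b x) \<le> M b" by (rule choice[THEN exE])
  then have M: "\<And>b x. x \<in> \<Omega> \<Longrightarrow> norm (G b x) \<le> M b" by blast
  have der: "(f b has_derivative (\<lambda>h. G b x \<bullet> h)) (at x)" if x: "x \<in> \<Omega>" "x \<in> ball p \<rho>2" for b x
  proof -
    have "x - c \<in> \<Omega>" using x closure_subset by (intro sh) auto
    from C1_fieldD(2)[OF F this] have "(F has_derivative F' (x - c)) (at (x - c))" .
    moreover have "(\<zeta> has_derivative (\<lambda>h. Z x \<bullet> h)) (at x)" using \<zeta> by (simp add: C1_def)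
    ultimately show ?thesis unfolding f_def[abs_def] G_def by (rule product_component_derivative[rotated])
  qed
  have cG': "continuous_on (\<Omega> \<inter> ball p \<rho>2) (G b)" for b
    by (rule continuous_on_subset[OF cG]) (use closure_subset in auto)
  note I = sub.integral_gradient[OF d cr \<rho>(1) cont f0 der G0 cG' M]
  have H: "integrable hausd (\<lambda>x. indicator (frontier \<Omega>) x * (f b x * (nu x \<bullet> b)))" for b
    by (rule sub.integrable_surface[OF d cr \<rho>(1) _ f0])
      (use cont in \<open>auto simp: frontier_def intro: continuous_on_subset\<close>)
  have s1: "indicator \<Omega> x * (Z x \<bullet> F (x - c) + \<zeta> x * trace_of (F' (x - c))) = (\<Sum>b\<in>Basis. indicator \<Omega> x * (G b x \<bullet> b))" for x
    unfolding sum_distrib_left[symmetric] G_def by (simp only: sum_Basis_product)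
  have s2: "indicator (frontier \<Omega>) x * (\<zeta> x * (F (x - c) \<bullet> nu x)) = (\<Sum>b\<in>Basis. indicator (frontier \<Omega>) x * (f b x * (nu x \<bullet> b)))" for x
    unfolding f_def by (subst euclidean_inner) (simp add: sum_distrib_left mult_ac)
  show "integrable lborel (\<lambda>x. indicator \<Omega> x * (Z x \<bullet> F (x - c) + \<zeta> x * trace_of (F' (x - c))))"
    unfolding s1 by (intro Bochner_Integration.integrable_sum I(2))
  show "integrable hausd (\<lambda>x. indicator (frontier \<Omega>) x * (\<zeta> x * (F (x - c) \<bullet> nu x)))"
    unfolding s2 by (intro Bochner_Integration.integrable_sum H)
  show "(\<integral>x. indicator \<Omega> x * (Z x \<bullet> F (x - c) + \<zeta> x * trace_of (F' (x - c))) \<partial>lborel)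
      = (\<integral>x. indicator (frontier \<Omega>) x * (\<zeta> x * (F (x - c) \<bullet> nu x)) \<partial>hausd)"
  proof -
    have "(\<integral>x. (\<Sum>b\<in>Basis. indicator \<Omega> x * (G b x \<bullet> b)) \<partial>lborel) = (\<Sum>b\<in>Basis. \<integral>x. indicator \<Omega> x * (G b x \<bullet> b) \<partial>lborel)"
      by (rule Bochner_Integration.integral_sum) (rule I(2))
    also have "\<dots> = (\<Sum>b\<in>Basis. \<integral>x. indicator (frontier \<Omega>) x * (f b x * (nu x \<bullet> b)) \<partial>hausd)"
      by (intro sum.cong refl I(1))
    also have "\<dots> = (\<integral>x. (\<Sum>b\<in>Basis. indicator (frontier \<Omega>) x * (f b x * (nu x \<bullet> b))) \<partial>hausd)"
      by (rule Bochner_Integration.integral_sum[symmetric]) (rule H)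
    finally show ?thesis unfolding s1 s2 .
  qed
qed

text \<open>The field need not be differentiable up to the boundary: shift it inwards along
  \<^term>\<open>e\<close> and let the shift tend to zero, using only that the divergence is bounded.\<close>

theorem patch_divergence:
  assumes d: "2 \<le> DIM('a)" and e: "crossing e" and \<rho>: "\<rho> < r" and bnd: "bounded \<Omega>"
    and F: "C1_field \<Omega> F F'" and bd: "\<And>x. x \<in> \<Omega> \<Longrightarrow> \<bar>trace_of (F' x)\<bar> \<le> M"
    and \<zeta>: "C1 \<zeta> Z" and zero: "\<And>x. x \<notin> cball p \<rho> \<Longrightarrow> \<zeta> x = 0"
  shows "(\<integral>x. indicator \<Omega> x * (Z x \<bullet> F x + \<zeta> x * trace_of (F' x)) \<partial>lborel)
      = (\<integral>x. indicator (frontier \<Omega>) x * (\<zeta> x * (F x \<bullet> nu x)) \<partial>hausd)"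
proof -
  define \<rho>2 where "\<rho>2 = max (r / 2) ((\<rho> + r) / 2)"
  have \<rho>2: "\<rho> < \<rho>2" "0 < \<rho>2" "\<rho>2 < r" using r_pos \<rho> by (auto simp: \<rho>2_def less_max_iff_disj)
  have e1: "0 < norm e + 1" by (simp add: add_nonneg_pos)
  define s0 where "s0 = (r - \<rho>2) / (norm e + 1)"
  have s0: "0 < s0" "s0 * norm e < r - \<rho>2"
  proof -
    show "0 < s0" using \<rho>2 e1 by (simp add: s0_def)
    have "s0 * norm e < s0 * (norm e + 1)" using \<open>0 < s0\<close> by simp
    also have "\<dots> = r - \<rho>2" using e1 by (simp add: s0_def)
    finally show "s0 * norm e < r - \<rho>2" .
  qed
  define s where "s k = s0 / real (Suc k)" for k
  have s: "0 < s k" "s k * norm e < r - \<rho>2" for k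
  proof -
    show "0 < s k" using s0 by (simp add: s_def)
    have "s k \<le> s0" using s0 by (simp add: s_def field_simps)
    then have "s k * norm e \<le> s0 * norm e" by (intro mult_right_mono) auto
    then show "s k * norm e < r - \<rho>2" using s0 by simp
  qed
  have s_lim: "s \<longlonglongrightarrow> 0"
    unfolding s_def using LIMSEQ_Suc[OF lim_const_over_n[of s0]] by simp
  have x_lim: "(\<lambda>k. x - s k *\<^sub>R e) \<longlonglongrightarrow> x" for x
    using tendsto_diff[OF tendsto_const tendsto_scaleR[OF s_lim tendsto_const], of x e] by simp
  have sh: "x - s k *\<^sub>R e \<in> \<Omega>" if "x \<in> closure \<Omega>" "x \<in> cball p \<rho>" for x k
    using that \<rho>2 by (intro shift_into_domain[OF e _ _ s]) auto
  note S = shifted_divergence[OF d e bnd F \<zeta> zero \<rho>2 s]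
  have Zz: "Z x = 0" if "x \<notin> cball p \<rho>" for x
    using C1_zero_grad[OF \<zeta>, of "- cball p \<rho>" x] zero that by auto
  have "compact (closure \<Omega>)" using bnd by auto
  then have "bounded (F ` closure \<Omega>)"
    by (intro compact_imp_bounded compact_continuous_image C1_fieldD(1)[OF F])
  then obtain BF where BF: "\<forall>x\<in>closure \<Omega>. norm (F x) \<le> BF" by (auto simp: bounded_iff)
  have cZ: "continuous_on (cball p \<rho>) Z" using \<zeta> unfolding C1_def by (auto intro: continuous_on_subset)
  obtain BZ where BZ: "\<forall>x\<in>cball p \<rho>. norm (Z x) \<le> BZ"
    using compact_imp_bounded[OF compact_continuous_image[OF cZ compact_cball]] by (auto simp: bounded_iff)
  obtain B\<zeta> where B\<zeta>: "\<forall>x\<in>cball p \<rho>. \<bar>\<zeta> x\<bar> \<le> B\<zeta>"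
    using compact_imp_bounded[OF compact_continuous_image[OF C1_continuous[OF \<zeta>] compact_cball[of p \<rho>]]] by (auto simp: bounded_iff)
  let ?l = "\<lambda>x. indicator \<Omega> x * (Z x \<bullet> F x + \<zeta> x * trace_of (F' x))"
  let ?lk = "\<lambda>k x. indicator \<Omega> x * (Z x \<bullet> F (x - s k *\<^sub>R e) + \<zeta> x * trace_of (F' (x - s k *\<^sub>R e)))"
  let ?r = "\<lambda>x. indicator (frontier \<Omega>) x * (\<zeta> x * (F x \<bullet> nu x))"
  let ?rk = "\<lambda>k x. indicator (frontier \<Omega>) x * (\<zeta> x * (F (x - s k *\<^sub>R e) \<bullet> nu x))"
  have limF: "(\<lambda>k. F (x - s k *\<^sub>R e)) \<longlonglongrightarrow> F x" if "x \<in> closure \<Omega>" "x \<in> cball p \<rho>" for x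
    using that sh[OF that] closure_subset
    by (intro continuous_on_tendsto_compose[OF C1_fieldD(1)[OF F] x_lim]) (auto intro!: always_eventually)
  have liml: "(\<lambda>k. ?lk k x) \<longlonglongrightarrow> ?l x" for x
  proof (cases "x \<in> \<Omega> \<and> x \<in> cball p \<rho>")
    case True
    then have xc: "x \<in> closure \<Omega>" "x \<in> cball p \<rho>" using closure_subset by auto
    have "(\<lambda>k. trace_of (F' (x - s k *\<^sub>R e))) \<longlonglongrightarrow> trace_of (F' x)"
      using True sh[OF xc]
      by (intro continuous_on_tendsto_compose[OF C1_field_trace_continuous[OF F] x_lim]) (auto intro!: always_eventually)
    then show ?thesis by (intro tendsto_intros limF xc)
  qed (use zero Zz in \<open>auto simp: indicator_def\<close>)
  have limr: "(\<lambda>k. ?rk k x) \<longlonglongrightarrow> ?r x" for x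
  proof (cases "x \<in> frontier \<Omega> \<and> x \<in> cball p \<rho>")
    case True
    then have xc: "x \<in> closure \<Omega>" "x \<in> cball p \<rho>" by (auto simp: frontier_def)
    then show ?thesis by (intro tendsto_intros limF)
  qed (use zero in \<open>auto simp: indicator_def\<close>)
  have ml: "?lk k \<in> borel_measurable lborel" for k using S(2)[of k] by (rule borel_measurable_integrable)
  have mr: "?rk k \<in> borel_measurable hausd" for k using S(3)[of k] by (rule borel_measurable_integrable)
  \<comment> \<open>Dominated convergence: the shifted points lie in \<Omega> whenever the cutoff is
    nonzero there, and in \<Omega> the divergence is bounded by \<open>M\<close> although single
    derivatives need not be.\<close>
  have L: "(\<lambda>k. \<integral>x. ?lk k x \<partial>lborel) \<longlonglongrightarrow> (\<integral>x. ?l x \<partial>lborel)"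
  proof (rule integral_dominated_convergence[where w="\<lambda>x. indicator (ball p r) x * (\<bar>BZ\<bar> * \<bar>BF\<bar> + \<bar>B\<zeta>\<bar> * \<bar>M\<bar>)"])
    show "?l \<in> borel_measurable lborel" by (rule borel_measurable_LIMSEQ_real[OF liml ml])
    show "integrable lborel (\<lambda>x. indicator (ball p r) x * (\<bar>BZ\<bar> * \<bar>BF\<bar> + \<bar>B\<zeta>\<bar> * \<bar>M\<bar>))"
      by (intro integrable_mult_left integrable_real_indicator)
        (use emeasure_lborel_ball_finite[of p r] in \<open>auto simp: less_top\<close>)
    show "AE x in lborel. norm (?lk k x) \<le> indicator (ball p r) x * (\<bar>BZ\<bar> * \<bar>BF\<bar> + \<bar>B\<zeta>\<bar> * \<bar>M\<bar>)" for k
    proof (rule AE_I2)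
      fix x
      show "norm (?lk k x) \<le> indicator (ball p r) x * (\<bar>BZ\<bar> * \<bar>BF\<bar> + \<bar>B\<zeta>\<bar> * \<bar>M\<bar>)"
      proof (cases "x \<in> \<Omega> \<and> x \<in> cball p \<rho>")
        case True
        let ?y = "x - s k *\<^sub>R e"
        have y: "?y \<in> \<Omega>" using True closure_subset by (intro sh) auto
        have "\<bar>Z x \<bullet> F ?y\<bar> \<le> norm (Z x) * norm (F ?y)" by (rule Cauchy_Schwarz_ineq2)
        also have "\<dots> \<le> \<bar>BZ\<bar> * \<bar>BF\<bar>"
          using BZ BF True y closure_subset by (intro mult_mono) force+
        finally have 1: "\<bar>Z x \<bullet> F ?y\<bar> \<le> \<bar>BZ\<bar> * \<bar>BF\<bar>" .
        have 2: "\<bar>\<zeta> x * trace_of (F' ?y)\<bar> \<le> \<bar>B\<zeta>\<bar> * \<bar>M\<bar>"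
          unfolding abs_mult using B\<zeta> bd[OF y] True by (intro mult_mono) force+
        have "\<bar>Z x \<bullet> F ?y + \<zeta> x * trace_of (F' ?y)\<bar> \<le> \<bar>BZ\<bar> * \<bar>BF\<bar> + \<bar>B\<zeta>\<bar> * \<bar>M\<bar>"
          using 1 2 by linarith
        moreover have "x \<in> ball p r" using True \<rho> by auto
        ultimately show ?thesis using True by simp
      next
        case False
        then show ?thesis using zero[of x] Zz[of x] by (cases "x \<in> \<Omega>") auto
      qed
    qed
  qed (use liml ml in auto)
  \<comment> \<open>Here the majorant is a constant on the patch, integrable because its Hausdorff
    measure is finite by \<open>finite_hausdorff_patch\<close>.\<close>
  have R: "(\<lambda>k. \<integral>x. ?rk k x \<partial>hausd) \<longlonglongrightarrow> (\<integral>x. ?r x \<partial>hausd)"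
  proof (rule integral_dominated_convergence[where w="\<lambda>x. indicator (frontier \<Omega> \<inter> ball p \<rho>2) x * (\<bar>B\<zeta>\<bar> * \<bar>BF\<bar>)"])
    show "?r \<in> borel_measurable hausd" by (rule borel_measurable_LIMSEQ_real[OF limr mr])
    show "integrable hausd (\<lambda>x. indicator (frontier \<Omega> \<inter> ball p \<rho>2) x * (\<bar>B\<zeta>\<bar> * \<bar>BF\<bar>))"
    proof (intro integrable_mult_left integrable_real_indicator)
      show "frontier \<Omega> \<inter> ball p \<rho>2 \<in> sets hausd" by (auto simp: borel_closed intro!: sets.Int)
      show "emeasure hausd (frontier \<Omega> \<inter> ball p \<rho>2) < \<infinity>"
        using finite_hausdorff_patch[OF d e \<rho>2(3)] by simp
    qed
    show "AE x in hausd. norm (?rk k x) \<le> indicator (frontier \<Omega> \<inter> ball p \<rho>2) x * (\<bar>B\<zeta>\<bar> * \<bar>BF\<bar>)" for k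
    proof (rule AE_I2)
      fix x
      show "norm (?rk k x) \<le> indicator (frontier \<Omega> \<inter> ball p \<rho>2) x * (\<bar>B\<zeta>\<bar> * \<bar>BF\<bar>)"
      proof (cases "x \<in> frontier \<Omega> \<and> x \<in> cball p \<rho>")
        case True
        let ?y = "x - s k *\<^sub>R e"
        have y: "?y \<in> \<Omega>" using True by (intro sh) (auto simp: frontier_def)
        have xr: "x \<in> ball p \<rho>2" "x \<in> ball p r" using True \<rho>2 by auto
        have "\<bar>F ?y \<bullet> nu x\<bar> \<le> norm (F ?y) * norm (nu x)" by (rule Cauchy_Schwarz_ineq2)
        also have "\<dots> \<le> \<bar>BF\<bar>"
          using BF y closure_subset norm_nu[OF xr(2)] by force
        finally have "\<bar>\<zeta> x * (F ?y \<bullet> nu x)\<bar> \<le> \<bar>B\<zeta>\<bar> * \<bar>BF\<bar>"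
          unfolding abs_mult using B\<zeta> True by (intro mult_mono) force+
        then show ?thesis using True xr by simp
      next
        case False
        then show ?thesis using zero[of x] by (cases "x \<in> frontier \<Omega>") auto
      qed
    qed
  qed (use limr mr in auto)
  have "(\<lambda>k. \<integral>x. ?lk k x \<partial>lborel) = (\<lambda>k. \<integral>x. ?rk k x \<partial>hausd)" using S(1) by blast
  then show ?thesis using L R LIMSEQ_unique by auto
qed

end

section \<open>The divergence theorem\<close>

definition normal_patches :: "'a::euclidean_space set \<Rightarrow> ('a \<Rightarrow> 'a) \<Rightarrow> bool" where
  "normal_patches \<Omega> \<nu> \<longleftrightarrow> (\<forall>p\<in>frontier \<Omega>. \<exists>r \<phi> D\<phi>. boundary_patch \<Omega> p r \<phi> D\<phi> \<and>
     (\<forall>x\<in>frontier \<Omega> \<inter> ball p r. \<nu> x = D\<phi> x /\<^sub>R norm (D\<phi> x)))"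

lemma integral_C1_compact_support:
  fixes g :: "'a::euclidean_space \<Rightarrow> real"
  assumes g: "C1 g G" and zero: "\<And>x. x \<notin> cball p \<rho> \<Longrightarrow> g x = 0" and e: "e \<noteq> 0"
  shows "(\<integral>x. G x \<bullet> e \<partial>lborel) = 0" and "integrable lborel (\<lambda>x. G x \<bullet> e)"
proof -
  have Gz: "G x = 0" if "x \<notin> cball p \<rho>" for x
    using C1_zero_grad[OF g, of "- cball p \<rho>" x] zero that by auto
  have c: "continuous_on UNIV (\<lambda>x. G x \<bullet> e)"
    using g unfolding C1_def by (intro continuous_intros) auto
  have "integrable lborel (\<lambda>x. indicator (cball p \<rho>) x *\<^sub>R (G x \<bullet> e))"
    using c by (intro borel_integrable_compact) (auto intro: continuous_on_subset)
  also have "(\<lambda>x. indicator (cball p \<rho>) x *\<^sub>R (G x \<bullet> e)) = (\<lambda>x. G x \<bullet> e)"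
    using Gz by (auto simp: indicator_def fun_eq_iff)
  finally show int: "integrable lborel (\<lambda>x. G x \<bullet> e)" .
  have line: "(\<integral>t. G (x + t *\<^sub>R e) \<bullet> e \<partial>lborel) = 0" for x
  proof -
    have e0: "0 < norm e" using e by simp
    define L where "L = (norm (x - p) + \<bar>\<rho>\<bar>) / norm e + 1"
    have L1: "0 < L"
    proof -
      have "0 \<le> (norm (x - p) + \<bar>\<rho>\<bar>) / norm e" by simp
      then show ?thesis unfolding L_def by linarith
    qed
    have out: "x + t *\<^sub>R e \<notin> cball p \<rho>" if t: "L \<le> \<bar>t\<bar>" for t
    proof
      assume a: "x + t *\<^sub>R e \<in> cball p \<rho>"
      have "norm (t *\<^sub>R e) \<le> norm (x - p) + norm (x + t *\<^sub>R e - p)"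
        by (metis (no_types, opaque_lifting) add.commute add_diff_cancel_left' add_diff_eq diff_add_eq norm_triangle_ineq4 norm_minus_commute)
      also have "norm (x + t *\<^sub>R e - p) \<le> \<rho>" using a by (simp add: dist_norm norm_minus_commute)
      finally have "\<bar>t\<bar> * norm e \<le> norm (x - p) + \<bar>\<rho>\<bar>" by simp
      then have "\<bar>t\<bar> \<le> (norm (x - p) + \<bar>\<rho>\<bar>) / norm e" using e0 by (simp add: field_simps)
      then show False using t by (simp add: L_def)
    qed
    let ?h = "\<lambda>t. g (x + t *\<^sub>R e)" and ?h' = "\<lambda>t. G (x + t *\<^sub>R e) \<bullet> e"
    have der: "(?h has_real_derivative ?h' t) (at t)" for t
    proof -
      have "((\<lambda>s. g ((x + t *\<^sub>R e) + s *\<^sub>R e)) has_real_derivative ?h' t) (at 0)"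
        by (rule C1_directional[OF g])
      then have "((\<lambda>s. g ((x + t *\<^sub>R e) + (s + - t) *\<^sub>R e)) has_real_derivative ?h' t) (at t)"
        using DERIV_shift[of "\<lambda>s. g ((x + t *\<^sub>R e) + (s + - t) *\<^sub>R e)" "?h' t" 0 t] by simp
      then show ?thesis by (simp add: algebra_simps)
    qed
    have "(?h' has_integral (?h L - ?h (-L))) {-L..L}"
      using L1 der by (intro fundamental_theorem_of_calculus) (auto simp: has_real_derivative_iff_has_vector_derivative
          intro: has_vector_derivative_at_within)
    then have "(?h' has_integral 0) {-L..L}" using zero out[of L] out[of "-L"] L1 by simp
    then have 1: "(?h' has_integral 0) UNIV"
    proof (rule has_integral_on_superset)
      fix t assume "t \<notin> {-L..L}"
      then have "L \<le> \<bar>t\<bar>" by auto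
      then show "?h' t = 0" using Gz[OF out] by simp
    qed auto
    have ch: "continuous_on UNIV ?h'"
    proof -
      have "continuous_on UNIV G" using g by (simp add: C1_def)
      then have "continuous_on UNIV (\<lambda>t. G (x + t *\<^sub>R e))"
        by (rule continuous_on_compose2) (intro continuous_intros, simp)
      then show ?thesis by (intro continuous_intros)
    qed
    have "integrable lborel (\<lambda>t. indicator {-L..L} t *\<^sub>R ?h' t)"
      using ch by (intro borel_integrable_compact) (auto intro: continuous_on_subset)
    also have "(\<lambda>t. indicator {-L..L} t *\<^sub>R ?h' t) = ?h'"
    proof
      fix t show "indicator {-L..L} t *\<^sub>R ?h' t = ?h' t"
      proof (cases "t \<in> {-L..L}")
        case False
        then have "L \<le> \<bar>t\<bar>" by auto
        then show ?thesis using Gz[OF out] by simp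
      qed simp
    qed
    finally have "(?h' has_integral (\<integral>t. ?h' t \<partial>lborel)) UNIV" by (rule has_integral_integral_lborel)
    then show ?thesis using 1 has_integral_unique by blast
  qed
  show "(\<integral>x. G x \<bullet> e \<partial>lborel) = 0"
    by (subst integral_lines[OF int e]) (simp add: line)
qed

text \<open>The field lives on \<Omega>, but its product with a cutoff supported in a closed ball
  inside \<Omega> is C1 on the whole space after extension by zero.\<close>

lemma interior_divergence:
  assumes bnd: "open \<Omega>" and cb: "cball p \<rho> \<subseteq> \<Omega>" and F: "C1_field \<Omega> F F'"
    and \<zeta>: "C1 \<zeta> Z" and zero: "\<And>x. x \<notin> cball p \<rho> \<Longrightarrow> \<zeta> x = 0"
  shows "(\<integral>x. indicator \<Omega> x * (Z x \<bullet> F x + \<zeta> x * trace_of (F' x)) \<partial>lborel) = 0"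
proof -
  have Zz: "Z x = 0" if "x \<notin> cball p \<rho>" for x
    using C1_zero_grad[OF \<zeta>, of "- cball p \<rho>" x] zero that by auto
  define f where "f b x = \<zeta> x * (F (x - 0) \<bullet> b)" for b x
  define G where "G b x = (F (x - 0) \<bullet> b) *\<^sub>R Z x + \<zeta> x *\<^sub>R row (F' x) b" for b x
  have f0: "f b x = 0" and G0: "G b x = 0" if "x \<notin> cball p \<rho>" for b x
    using zero[OF that] Zz[OF that] by (auto simp: f_def G_def)
  have C: "C1 (f b) (G b)" for b
    unfolding C1_def
  proof (intro conjI allI)
    fix x
    show "(f b has_derivative (\<lambda>h. G b x \<bullet> h)) (at x)"
    proof (cases "x \<in> \<Omega>")
      case True
      have "(F has_derivative F' x) (at (x - 0))" using C1_fieldD(2)[OF F True] by simp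
      moreover have "(\<zeta> has_derivative (\<lambda>h. Z x \<bullet> h)) (at x)" using \<zeta> by (simp add: C1_def)
      ultimately show ?thesis unfolding f_def[abs_def] G_def by (rule product_component_derivative[rotated])
    next
      case False
      then have nx: "x \<in> - cball p \<rho>" using cb by blast
      have "((\<lambda>_. 0) has_derivative (\<lambda>h. 0)) (at x)" by simp
      then have "(f b has_derivative (\<lambda>h. 0)) (at x)"
        by (rule has_derivative_transform_within_open[OF _ _ nx]) (use f0 in auto)
      then show ?thesis using G0[of x b] nx by simp
    qed
    have "continuous_on (\<Omega> \<union> - cball p \<rho>) (G b)"
    proof (rule continuous_on_open_Un[OF bnd])
      have "continuous_on \<Omega> F" using C1_fieldD(1)[OF F] closure_subset by (rule continuous_on_subset)
      moreover have "continuous_on \<Omega> Z" using \<zeta> unfolding C1_def by (auto intro: continuous_on_subset)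
      ultimately show "continuous_on \<Omega> (G b)"
        unfolding G_def using C1_continuous[OF \<zeta>] C1_field_row_continuous[OF F] by (auto intro!: continuous_intros)
      show "continuous_on (- cball p \<rho>) (G b)"
        by (rule continuous_on_eq[of _ "\<lambda>_. 0"]) (use G0 in auto)
    qed auto
    moreover have "\<Omega> \<union> - cball p \<rho> = UNIV" using cb by auto
    ultimately show "continuous_on UNIV (G b)" by simp
  qed
  have eq: "indicator \<Omega> x * (Z x \<bullet> F x + \<zeta> x * trace_of (F' x)) = (\<Sum>b\<in>Basis. G b x \<bullet> b)" for x
  proof -
    have "(\<Sum>b\<in>Basis. G b x \<bullet> b) = Z x \<bullet> F x + \<zeta> x * trace_of (F' x)"
      unfolding G_def by (simp only: sum_Basis_product diff_0_right)
    moreover have "x \<notin> cball p \<rho>" if "x \<notin> \<Omega>" using cb that by blast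
    ultimately show ?thesis using zero[of x] Zz[of x] by (cases "x \<in> \<Omega>") simp_all
  qed
  have "(\<integral>x. (\<Sum>b\<in>Basis. G b x \<bullet> b) \<partial>lborel) = (\<Sum>b\<in>Basis. \<integral>x. G b x \<bullet> b \<partial>lborel)"
    using integral_C1_compact_support(2)[OF C f0] nonzero_Basis by (intro Bochner_Integration.integral_sum) blast
  also have "\<dots> = 0"
    using integral_C1_compact_support(1)[OF C f0] nonzero_Basis by (intro sum.neutral) blast
  finally show ?thesis unfolding eq .
qed

text \<open>The gradient of \<phi> at \<open>p\<close> is transversal near \<open>p\<close> by
  continuity. The radius is found before field and cutoff, so a finite cover chosen from such balls
  still serves a field that is built from the cover.\<close>

lemma boundary_divergence:
  fixes \<Omega> :: "'a::euclidean_space set"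
  assumes d: "2 \<le> DIM('a)" and bnd: "bounded \<Omega>" and \<nu>: "normal_patches \<Omega> \<nu>" and p: "p \<in> frontier \<Omega>"
  obtains \<rho> where "0 < \<rho>" "continuous_on (frontier \<Omega> \<inter> ball p \<rho>) \<nu>"
    "emeasure (hausdorff_measure (DIM('a) - 1)) (frontier \<Omega> \<inter> ball p \<rho>) < top"
    "\<And>F F' M \<zeta> Z. C1_field \<Omega> F F' \<Longrightarrow> (\<And>x. x \<in> \<Omega> \<Longrightarrow> \<bar>trace_of (F' x)\<bar> \<le> M) \<Longrightarrow> C1 \<zeta> Z \<Longrightarrow>
       (\<And>x. x \<notin> cball p \<rho> \<Longrightarrow> \<zeta> x = 0) \<Longrightarrow>
       (\<integral>x. indicator \<Omega> x * (Z x \<bullet> F x + \<zeta> x * trace_of (F' x)) \<partial>lborel)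
       = (\<integral>x. indicator (frontier \<Omega>) x * (\<zeta> x * (F x \<bullet> \<nu> x)) \<partial>hausdorff_measure (DIM('a) - 1))"
proof -
  obtain r \<phi> D\<phi> where P: "boundary_patch \<Omega> p r \<phi> D\<phi>"
    and \<nu>_eq: "\<And>x. x \<in> frontier \<Omega> \<Longrightarrow> x \<in> ball p r \<Longrightarrow> \<nu> x = D\<phi> x /\<^sub>R norm (D\<phi> x)"
    using \<nu> p unfolding normal_patches_def by blast
  interpret big: boundary_patch \<Omega> p r \<phi> D\<phi> by (rule P)
  define e where "e = D\<phi> p"
  have pb: "p \<in> ball p r" using big.r_pos by simp
  have "continuous_on (ball p r) (\<lambda>x. D\<phi> x \<bullet> e)" by (intro continuous_intros big.grad_cont)
  then have "isCont (\<lambda>x. D\<phi> x \<bullet> e) p" using pb by (simp add: continuous_on_eq_continuous_at)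
  moreover have "0 < D\<phi> p \<bullet> e" using big.grad_nz[OF pb] by (simp add: e_def)
  ultimately obtain s where s': "0 < s" "\<And>x. dist x p < s \<Longrightarrow> dist (D\<phi> x \<bullet> e) (D\<phi> p \<bullet> e) < D\<phi> p \<bullet> e"
    unfolding continuous_at_eps_delta by blast
  have s: "0 < s" "\<And>x. dist x p < s \<Longrightarrow> 0 < D\<phi> x \<bullet> e"
    using s' by (force simp: dist_real_def)+
  define r' where "r' = min s r"
  have r': "0 < r'" "ball p r' \<subseteq> ball p r" using s big.r_pos by (auto simp: r'_def)
  interpret boundary_patch \<Omega> p r' \<phi> D\<phi> by (rule big.subpatch[OF r'])
  have cr: "crossing e" unfolding crossing_def using s by (auto simp: r'_def dist_commute)
  have \<nu>_nu: "\<nu> x = nu x" if "x \<in> frontier \<Omega>" "x \<in> ball p r'" for x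
    using \<nu>_eq[of x] that r' by (auto simp: nu_def)
  have hr: "r' / 2 < r'" using r' by simp
  show thesis
  proof (rule that[of "r' / 2"])
    show "0 < r' / 2" using r' by simp
    have "continuous_on (frontier \<Omega> \<inter> ball p (r' / 2)) nu"
      using hr by (intro continuous_on_subset[OF nu_cont]) auto
    then show "continuous_on (frontier \<Omega> \<inter> ball p (r' / 2)) \<nu>"
      by (rule continuous_on_eq) (use \<nu>_nu hr in auto)
    show "emeasure (hausdorff_measure (DIM('a) - 1)) (frontier \<Omega> \<inter> ball p (r' / 2)) < top"
      by (rule finite_hausdorff_patch[OF d cr hr])
    fix F F' M \<zeta> Z
    assume F: "C1_field \<Omega> F F'" "\<And>x. x \<in> \<Omega> \<Longrightarrow> \<bar>trace_of (F' x)\<bar> \<le> M" and \<zeta>: "C1 \<zeta> Z"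
      and zero: "\<And>x. x \<notin> cball p (r' / 2) \<Longrightarrow> \<zeta> x = 0"
    have "(\<integral>x. indicator \<Omega> x * (Z x \<bullet> F x + \<zeta> x * trace_of (F' x)) \<partial>lborel)
       = (\<integral>x. indicator (frontier \<Omega>) x * (\<zeta> x * (F x \<bullet> nu x)) \<partial>hausd)"
      by (rule patch_divergence[OF d cr hr bnd F \<zeta> zero])
    also have "\<dots> = (\<integral>x. indicator (frontier \<Omega>) x * (\<zeta> x * (F x \<bullet> \<nu> x)) \<partial>hausd)"
    proof (rule Bochner_Integration.integral_cong[OF refl])
      fix x
      show "indicator (frontier \<Omega>) x * (\<zeta> x * (F x \<bullet> nu x)) = indicator (frontier \<Omega>) x * (\<zeta> x * (F x \<bullet> \<nu> x))"
      proof (cases "x \<in> frontier \<Omega> \<and> x \<in> cball p (r' / 2)")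
        case True
        then have "\<nu> x = nu x" using hr by (intro \<nu>_nu) auto
        then show ?thesis by simp
      qed (use zero in auto)
    qed
    finally show "(\<integral>x. indicator \<Omega> x * (Z x \<bullet> F x + \<zeta> x * trace_of (F' x)) \<partial>lborel)
       = (\<integral>x. indicator (frontier \<Omega>) x * (\<zeta> x * (F x \<bullet> \<nu> x)) \<partial>hausd)" .
  qed
qed

text \<open>Locally \<nu> is the normalized gradient of a defining function; its continuity is what
  makes the boundary integrands integrable.\<close>

lemma normal_continuous:
  fixes \<Omega> :: "'a::euclidean_space set"
  assumes d: "2 \<le> DIM('a)" and bnd: "bounded \<Omega>" and \<nu>: "normal_patches \<Omega> \<nu>"
  shows "continuous_on (frontier \<Omega>) \<nu>"
  unfolding continuous_on_eq_continuous_within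
proof
  fix p assume p: "p \<in> frontier \<Omega>"
  obtain \<rho> where \<rho>: "0 < \<rho>" "continuous_on (frontier \<Omega> \<inter> ball p \<rho>) \<nu>"
    by (rule boundary_divergence[OF d bnd \<nu> p]) blast
  then have "continuous (at p within frontier \<Omega> \<inter> ball p \<rho>) \<nu>"
    using p by (simp add: continuous_on_eq_continuous_within)
  moreover have "at p within frontier \<Omega> \<inter> ball p \<rho> = at p within frontier \<Omega>"
    using \<rho>(1) by (intro at_within_nhd[of p "ball p \<rho>"]) auto
  ultimately show "continuous (at p within frontier \<Omega>) \<nu>" by simp
qed

lemma finite_hausdorff_frontier:
  fixes \<Omega> :: "'a::euclidean_space set"
  assumes d: "2 \<le> DIM('a)" and bnd: "bounded \<Omega>" and \<nu>: "normal_patches \<Omega> \<nu>"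
  shows "emeasure (hausdorff_measure (DIM('a) - 1)) (frontier \<Omega>) < top"
proof -
  let ?H = "hausdorff_measure (DIM('a) - 1) :: 'a measure"
  have "\<exists>\<rho>>0. emeasure ?H (frontier \<Omega> \<inter> ball p \<rho>) < top" if "p \<in> frontier \<Omega>" for p
    by (rule boundary_divergence[OF d bnd \<nu> that]) blast
  then obtain \<rho> where \<rho>: "\<And>p. p \<in> frontier \<Omega> \<Longrightarrow> 0 < \<rho> p" "\<And>p. p \<in> frontier \<Omega> \<Longrightarrow> emeasure ?H (frontier \<Omega> \<inter> ball p (\<rho> p)) < top"
    by metis
  have "compact (frontier \<Omega>)" using bnd by (simp add: compact_frontier_bounded)
  moreover have "frontier \<Omega> \<subseteq> (\<Union>p\<in>frontier \<Omega>. ball p (\<rho> p))" using \<rho>(1) by fastforce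
  ultimately obtain T where T: "T \<subseteq> frontier \<Omega>" "finite T" "frontier \<Omega> \<subseteq> (\<Union>p\<in>T. ball p (\<rho> p))"
    using compactE_image[of "frontier \<Omega>" "frontier \<Omega>" "\<lambda>p. ball p (\<rho> p)"] by (metis open_ball)
  have b: "frontier \<Omega> \<inter> ball p (\<rho> p) \<in> sets ?H" for p
    by (auto simp: borel_closed intro!: sets.Int)
  have "emeasure ?H (frontier \<Omega>) \<le> emeasure ?H (\<Union>p\<in>T. frontier \<Omega> \<inter> ball p (\<rho> p))"
    using T b by (intro emeasure_mono sets.finite_UN) auto
  also have "\<dots> \<le> (\<Sum>p\<in>T. emeasure ?H (frontier \<Omega> \<inter> ball p (\<rho> p)))"
    using T b by (intro emeasure_subadditive_finite) auto
  also have "\<dots> < top" using T \<rho>(2) by (simp add: subset_iff)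
  finally show ?thesis .
qed

lemma integrable_frontier:
  fixes \<Omega> :: "'a::euclidean_space set" and f :: "'a \<Rightarrow> real"
  assumes d: "2 \<le> DIM('a)" and bnd: "bounded \<Omega>" and \<nu>: "normal_patches \<Omega> \<nu>" and f: "continuous_on (frontier \<Omega>) f"
  shows "integrable (hausdorff_measure (DIM('a) - 1)) (\<lambda>x. indicator (frontier \<Omega>) x * f x)"
  by (rule integrable_compact_indicator[OF sets_hausdorff_measure finite_hausdorff_frontier[OF d bnd \<nu>]
      compact_frontier_bounded[OF bnd] f])

lemma integrable_bounded_open:
  fixes f :: "'a::euclidean_space \<Rightarrow> real"
  assumes \<Omega>: "open \<Omega>" "bounded \<Omega>" and f: "continuous_on \<Omega> f" and B: "\<And>x. x \<in> \<Omega> \<Longrightarrow> \<bar>f x\<bar> \<le> B"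
  shows "integrable lborel (\<lambda>x. indicator \<Omega> x * f x)"
proof (rule Bochner_Integration.integrable_bound)
  have "emeasure lborel \<Omega> < \<infinity>" by (rule emeasure_bounded_finite[OF \<Omega>(2)])
  then show "integrable lborel (\<lambda>x. indicator \<Omega> x * \<bar>B\<bar>)"
    using \<Omega> by (intro integrable_mult_left integrable_real_indicator) auto
  show "(\<lambda>x. indicator \<Omega> x * f x) \<in> borel_measurable lborel"
    using borel_indicator_continuous[OF _ f] \<Omega> by simp
  show "AE x in lborel. norm (indicator \<Omega> x * f x) \<le> norm (indicator \<Omega> x * \<bar>B\<bar>)"
  proof (rule AE_I2)
    fix x show "norm (indicator \<Omega> x * f x) \<le> norm (indicator \<Omega> x * \<bar>B\<bar>)"
      using B[of x] by (cases "x \<in> \<Omega>") auto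
  qed
qed

text \<open>Instead of normalizing the partition of unity, the field is divided by the sum
  \<open>s\<close> of the bumps, which is positive on the closure. The local identities for
  \<open>K = F / s\<close> with cutoffs \<open>b p\<close> then add up to the identity for
  \<open>F\<close>.\<close>

theorem divergence_theorem:
  fixes \<Omega> :: "'a::euclidean_space set"
  assumes d: "2 \<le> DIM('a)" and \<Omega>: "open \<Omega>" "bounded \<Omega>" and \<nu>: "normal_patches \<Omega> \<nu>"
    and F: "C1_field \<Omega> F F'" and bd: "\<And>x. x \<in> \<Omega> \<Longrightarrow> \<bar>trace_of (F' x)\<bar> \<le> M"
  shows "(\<integral>x. indicator \<Omega> x * trace_of (F' x) \<partial>lborel)
       = (\<integral>x. indicator (frontier \<Omega>) x * (F x \<bullet> \<nu> x) \<partial>hausdorff_measure (DIM('a) - 1))"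
proof -
  let ?H = "hausdorff_measure (DIM('a) - 1) :: 'a measure"
  \<comment> \<open>Quantified over all fields, because the cover must be fixed before
    \<open>K\<close> is built from it.\<close>
  define loc where "loc p \<rho> \<longleftrightarrow> (\<forall>F F' M \<zeta> Z. C1_field \<Omega> F F' \<longrightarrow> (\<forall>x\<in>\<Omega>. \<bar>trace_of (F' x)\<bar> \<le> M) \<longrightarrow> C1 \<zeta> Z \<longrightarrow>
       (\<forall>x. x \<notin> cball p \<rho> \<longrightarrow> \<zeta> x = 0) \<longrightarrow>
       (\<integral>x. indicator \<Omega> x * (Z x \<bullet> F x + \<zeta> x * trace_of (F' x)) \<partial>lborel)
       = (\<integral>x. indicator (frontier \<Omega>) x * (\<zeta> x * (F x \<bullet> \<nu> x)) \<partial>?H))" for p \<rho>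
  have "\<exists>\<rho>>0. loc p \<rho>" if p: "p \<in> closure \<Omega>" for p
  proof (cases "p \<in> \<Omega>")
    case True
    then obtain \<rho> where \<rho>: "0 < \<rho>" "cball p \<rho> \<subseteq> \<Omega>" using \<Omega>(1) open_contains_cball by blast
    have "loc p \<rho>"
      unfolding loc_def
    proof (intro allI impI)
      fix F F' M \<zeta> Z
      assume F: "C1_field \<Omega> F F'" and \<zeta>: "C1 \<zeta> Z" "\<forall>x. x \<notin> cball p \<rho> \<longrightarrow> \<zeta> x = 0"
      have "indicator (frontier \<Omega>) x * (\<zeta> x * (F x \<bullet> \<nu> x)) = 0" for x
      proof (cases "x \<in> frontier \<Omega>")
        case True
        then have "x \<notin> \<Omega>" using \<Omega>(1) by (simp add: frontier_def interior_open)
        then have "x \<notin> cball p \<rho>" using \<rho>(2) by blast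
        then show ?thesis using \<zeta>(2) by simp
      qed simp
      then have "(\<lambda>x. indicator (frontier \<Omega>) x * (\<zeta> x * (F x \<bullet> \<nu> x))) = (\<lambda>_. 0)" by (rule ext)
      then have "(\<integral>x. indicator (frontier \<Omega>) x * (\<zeta> x * (F x \<bullet> \<nu> x)) \<partial>?H) = 0"
        by (simp only: Bochner_Integration.integral_zero)
      moreover have "(\<integral>x. indicator \<Omega> x * (Z x \<bullet> F x + \<zeta> x * trace_of (F' x)) \<partial>lborel) = 0"
        by (rule interior_divergence[OF \<Omega>(1) \<rho>(2) F \<zeta>(1)]) (use \<zeta>(2) in blast)
      ultimately show "(\<integral>x. indicator \<Omega> x * (Z x \<bullet> F x + \<zeta> x * trace_of (F' x)) \<partial>lborel)
       = (\<integral>x. indicator (frontier \<Omega>) x * (\<zeta> x * (F x \<bullet> \<nu> x)) \<partial>?H)" by simp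
    qed
    then show ?thesis using \<rho> by blast
  next
    case False
    then have "p \<in> frontier \<Omega>" using p \<Omega> by (simp add: frontier_def interior_open)
    then show ?thesis
      by (rule boundary_divergence[OF d \<Omega>(2) \<nu>]) (rule exI, rule conjI, assumption, unfold loc_def, blast)
  qed
  then obtain \<rho> where \<rho>: "\<And>p. p \<in> closure \<Omega> \<Longrightarrow> 0 < \<rho> p" "\<And>p. p \<in> closure \<Omega> \<Longrightarrow> loc p (\<rho> p)"
    by metis
  have comp: "compact (closure \<Omega>)" using \<Omega> by auto
  moreover have "closure \<Omega> \<subseteq> (\<Union>p\<in>closure \<Omega>. ball p (\<rho> p))" using \<rho>(1) by fastforce
  ultimately obtain T where T: "T \<subseteq> closure \<Omega>" "finite T" "closure \<Omega> \<subseteq> (\<Union>p\<in>T. ball p (\<rho> p))"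
    using compactE_image[of "closure \<Omega>" "closure \<Omega>" "\<lambda>p. ball p (\<rho> p)"] by (metis open_ball)
  define b where "b p = bump p (\<rho> p)" for p
  define B where "B p = bump_grad p (\<rho> p)" for p
  have C1b: "C1 (b p) (B p)" for p unfolding b_def B_def by (rule C1_bump)
  define s where "s x = (\<Sum>p\<in>T. b p x)" for x
  define S where "S x = (\<Sum>p\<in>T. B p x)" for x
  have C1s: "C1 s S" unfolding s_def[abs_def] S_def[abs_def] by (intro C1_sum T C1b)
  have cs: "continuous_on A s" for A by (rule C1_continuous[OF C1s])
  have cS: "continuous_on A S" for A using C1s unfolding C1_def by (auto intro: continuous_on_subset)
  have s_pos: "0 < s x" if x: "x \<in> closure \<Omega>" for x
  proof -
    obtain p where p: "p \<in> T" "x \<in> ball p (\<rho> p)" using T x by blast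
    then have "0 < b p x" using \<rho>(1)[of p] T by (auto simp: b_def bump_pos_iff)
    also have "\<dots> \<le> s x" unfolding s_def using p T by (intro member_le_sum) (auto simp: b_def bump_nonneg)
    finally show ?thesis .
  qed
  have s_nz: "s x \<noteq> 0" if "x \<in> closure \<Omega>" for x using s_pos[OF that] by simp
  define K where "K x = (1 / s x) *\<^sub>R F x" for x
  define K' where "K' x h = (1 / s x) *\<^sub>R F' x h - ((S x \<bullet> h) / (s x)\<^sup>2) *\<^sub>R F x" for x h
  have \<Omega>c: "x \<in> closure \<Omega>" if "x \<in> \<Omega>" for x using that closure_subset by blast
  have K: "C1_field \<Omega> K K'"
    unfolding C1_field_def
  proof (intro conjI ballI allI)
    show "continuous_on (closure \<Omega>) K"
      unfolding K_def using s_nz by (intro continuous_intros cs C1_fieldD(1)[OF F]) auto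
    have cF: "continuous_on \<Omega> F" using C1_fieldD(1)[OF F] closure_subset by (rule continuous_on_subset)
    fix h
    show "continuous_on \<Omega> (\<lambda>x. K' x h)"
      unfolding K'_def using s_nz \<Omega>c by (intro continuous_intros cs cS cF C1_fieldD(3)[OF F]) auto
  next
    fix x assume x: "x \<in> \<Omega>"
    have "(s has_derivative (\<lambda>h. S x \<bullet> h)) (at x)" using C1s by (simp add: C1_def)
    moreover have "((\<lambda>t. 1 / t) has_derivative (\<lambda>h. h * (- 1 / (s x)\<^sup>2))) (at (s x))"
      using s_nz[OF \<Omega>c[OF x]] by (auto intro!: derivative_eq_intros simp: power2_eq_square field_simps)
    ultimately have "((\<lambda>x. 1 / s x) has_derivative (\<lambda>h. (S x \<bullet> h) * (- 1 / (s x)\<^sup>2))) (at x)"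
      by (rule has_derivative_compose)
    from has_derivative_scaleR[OF this C1_fieldD(2)[OF F x]]
    show "(K has_derivative K' x) (at x)"
      unfolding K_def[abs_def] by (rule has_derivative_eq_rhs) (auto simp: K'_def fun_eq_iff)
  qed
  have trK: "trace_of (K' x) = trace_of (F' x) / s x - (S x \<bullet> F x) / (s x)\<^sup>2" for x
  proof -
    have "trace_of (K' x) = (\<Sum>i\<in>Basis. (F' x i \<bullet> i) / s x - ((S x \<bullet> i) * (F x \<bullet> i)) / (s x)\<^sup>2)"
      unfolding trace_of_def K'_def by (intro sum.cong) (auto simp: inner_diff_left)
    also have "\<dots> = trace_of (F' x) / s x - (S x \<bullet> F x) / (s x)\<^sup>2"
      by (subst euclidean_inner[of "S x"]) (simp add: sum_subtractf trace_of_def sum_divide_distrib)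
    finally show ?thesis .
  qed
  obtain BF where BF: "\<And>x. x \<in> closure \<Omega> \<Longrightarrow> \<bar>(S x \<bullet> F x) / (s x)\<^sup>2\<bar> \<le> BF"
  proof -
    have "continuous_on (closure \<Omega>) (\<lambda>x. (S x \<bullet> F x) / (s x)\<^sup>2)"
      using s_nz by (intro continuous_intros cs cS C1_fieldD(1)[OF F]) auto
    from compact_imp_bounded[OF compact_continuous_image[OF this comp]]
    obtain a where a: "\<forall>x\<in>closure \<Omega>. norm ((S x \<bullet> F x) / (s x)\<^sup>2) \<le> a"
      unfolding bounded_iff by blast
    show thesis by (rule that[of a]) (use a in \<open>simp only: real_norm_def\<close>)
  qed
  obtain Bs where Bs: "\<And>x. x \<in> closure \<Omega> \<Longrightarrow> \<bar>1 / s x\<bar> \<le> Bs"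
  proof -
    have "continuous_on (closure \<Omega>) (\<lambda>x. 1 / s x)"
      using s_nz by (intro continuous_intros cs) auto
    from compact_imp_bounded[OF compact_continuous_image[OF this comp]]
    obtain a where a: "\<forall>x\<in>closure \<Omega>. norm (1 / s x) \<le> a"
      unfolding bounded_iff by blast
    show thesis by (rule that[of a]) (use a in \<open>simp only: real_norm_def\<close>)
  qed
  have bdK: "\<bar>trace_of (K' x)\<bar> \<le> \<bar>M\<bar> * \<bar>Bs\<bar> + BF" if x: "x \<in> \<Omega>" for x
  proof -
    have "\<bar>trace_of (F' x) * (1 / s x)\<bar> \<le> \<bar>M\<bar> * \<bar>Bs\<bar>"
      unfolding abs_mult using bd[OF x] Bs[OF \<Omega>c[OF x]] by (intro mult_mono) linarith+
    moreover have "trace_of (K' x) = trace_of (F' x) * (1 / s x) - (S x \<bullet> F x) / (s x)\<^sup>2"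
      unfolding trK by simp
    ultimately show ?thesis using BF[OF \<Omega>c[OF x]] by linarith
  qed
  have loc: "(\<integral>x. indicator \<Omega> x * (B p x \<bullet> K x + b p x * trace_of (K' x)) \<partial>lborel)
       = (\<integral>x. indicator (frontier \<Omega>) x * (b p x * (K x \<bullet> \<nu> x)) \<partial>?H)" if p: "p \<in> T" for p
  proof -
    have pc: "p \<in> closure \<Omega>" using p T by blast
    have "b p x = 0" if "x \<notin> cball p (\<rho> p)" for x
      unfolding b_def using \<rho>(1)[OF pc] that by (intro bump_eq_0) auto
    then show ?thesis using \<rho>(2)[OF pc, unfolded loc_def, rule_format, OF K _ C1b] bdK by blast
  qed
  have cK: "continuous_on (closure \<Omega>) K" using K by (rule C1_fieldD)
  have fc: "frontier \<Omega> \<subseteq> closure \<Omega>" by (simp add: frontier_def)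
  have c\<nu>: "continuous_on (frontier \<Omega>) \<nu>" by (rule normal_continuous[OF d \<Omega>(2) \<nu>])
  have intR: "integrable ?H (\<lambda>x. indicator (frontier \<Omega>) x * (b p x * (K x \<bullet> \<nu> x)))" for p
    by (intro integrable_frontier[OF d \<Omega>(2) \<nu>] continuous_intros c\<nu> continuous_on_subset[OF cK fc] C1_continuous[OF C1b])
  have intL: "integrable lborel (\<lambda>x. indicator \<Omega> x * (B p x \<bullet> K x + b p x * trace_of (K' x)))" for p
  proof -
    have cB: "continuous_on A (B p)" for A using C1b[of p] unfolding C1_def by (auto intro: continuous_on_subset)
    have cb: "continuous_on A (b p)" for A by (rule C1_continuous[OF C1b])
    have "continuous_on (closure \<Omega>) (\<lambda>x. B p x \<bullet> K x)" by (intro continuous_intros cB cK)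
    from compact_imp_bounded[OF compact_continuous_image[OF this comp]]
    obtain M1 where M1: "\<forall>x\<in>closure \<Omega>. \<bar>B p x \<bullet> K x\<bar> \<le> M1" by (auto simp: bounded_iff)
    from compact_imp_bounded[OF compact_continuous_image[OF cb[of "closure \<Omega>"] comp]]
    obtain M2 where M2: "\<forall>x\<in>closure \<Omega>. \<bar>b p x\<bar> \<le> M2" by (auto simp: bounded_iff)
    show ?thesis
    proof (rule integrable_bounded_open[OF \<Omega>])
      show "continuous_on \<Omega> (\<lambda>x. B p x \<bullet> K x + b p x * trace_of (K' x))"
        by (intro continuous_intros cB cb C1_field_trace_continuous[OF K] continuous_on_subset[OF cK closure_subset])
      fix x assume x: "x \<in> \<Omega>"
      have "\<bar>b p x * trace_of (K' x)\<bar> \<le> \<bar>M2\<bar> * (\<bar>M\<bar> * \<bar>Bs\<bar> + BF)"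
        unfolding abs_mult using M2 \<Omega>c[OF x] bdK[OF x] by (intro mult_mono) force+
      moreover have "\<bar>B p x \<bullet> K x\<bar> \<le> M1" using M1 \<Omega>c[OF x] by blast
      ultimately show "\<bar>B p x \<bullet> K x + b p x * trace_of (K' x)\<bar> \<le> M1 + \<bar>M2\<bar> * (\<bar>M\<bar> * \<bar>Bs\<bar> + BF)"
        by linarith
    qed
  qed
  have "(\<integral>x. indicator \<Omega> x * trace_of (F' x) \<partial>lborel)
      = (\<integral>x. (\<Sum>p\<in>T. indicator \<Omega> x * (B p x \<bullet> K x + b p x * trace_of (K' x))) \<partial>lborel)"
  proof (rule Bochner_Integration.integral_cong[OF refl])
    fix x
    \<comment> \<open>On \<Omega> the expression
      \<open>S x \<bullet> K x + s x * trace_of (K' x)\<close> is the divergence of the product of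
      \<open>s\<close> and \<open>K\<close>, which is \<open>F\<close>.\<close>
    have "(\<Sum>p\<in>T. indicator \<Omega> x * (B p x \<bullet> K x + b p x * trace_of (K' x)))
        = indicator \<Omega> x * (S x \<bullet> K x + s x * trace_of (K' x))"
      by (simp add: sum_distrib_left[symmetric] sum.distrib S_def s_def inner_sum_left sum_distrib_right)
    also have "\<dots> = indicator \<Omega> x * trace_of (F' x)"
    proof (cases "x \<in> \<Omega>")
      case True
      then show ?thesis using s_nz[OF \<Omega>c] unfolding trK
        by (simp add: K_def field_simps power2_eq_square)
    qed simp
    finally show "indicator \<Omega> x * trace_of (F' x) = (\<Sum>p\<in>T. indicator \<Omega> x * (B p x \<bullet> K x + b p x * trace_of (K' x)))" ..
  qed
  also have "\<dots> = (\<Sum>p\<in>T. \<integral>x. indicator \<Omega> x * (B p x \<bullet> K x + b p x * trace_of (K' x)) \<partial>lborel)"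
    by (rule Bochner_Integration.integral_sum) (rule intL)
  also have "\<dots> = (\<Sum>p\<in>T. \<integral>x. indicator (frontier \<Omega>) x * (b p x * (K x \<bullet> \<nu> x)) \<partial>?H)"
    by (intro sum.cong refl loc)
  also have "\<dots> = (\<integral>x. (\<Sum>p\<in>T. indicator (frontier \<Omega>) x * (b p x * (K x \<bullet> \<nu> x))) \<partial>?H)"
    by (rule Bochner_Integration.integral_sum[symmetric]) (rule intR)
  also have "\<dots> = (\<integral>x. indicator (frontier \<Omega>) x * (F x \<bullet> \<nu> x) \<partial>?H)"
  proof (rule Bochner_Integration.integral_cong[OF refl])
    fix x
    have "(\<Sum>p\<in>T. indicator (frontier \<Omega>) x * (b p x * (K x \<bullet> \<nu> x))) = indicator (frontier \<Omega>) x * (s x * (K x \<bullet> \<nu> x))"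
      by (simp add: sum_distrib_left[symmetric] s_def sum_distrib_right)
    also have "\<dots> = indicator (frontier \<Omega>) x * (F x \<bullet> \<nu> x)"
      using s_nz[of x] fc by (cases "x \<in> frontier \<Omega>") (auto simp: K_def)
    finally show "(\<Sum>p\<in>T. indicator (frontier \<Omega>) x * (b p x * (K x \<bullet> \<nu> x))) = indicator (frontier \<Omega>) x * (F x \<bullet> \<nu> x)" .
  qed
  finally show ?thesis .
qed

section \<open>Interior regularity for the Poisson equation with constant right-hand side\<close>

text \<open>The mean value theorem in direction \<open>k\<close> reduces the second difference to a
  difference of \<open>Dw\<close> at two nearby points, which the first order expansion of
  \<open>Dw\<close> at \<open>x\<close> evaluates.\<close>

lemma second_difference_limit:
  fixes w :: "'a::euclidean_space \<Rightarrow> real"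
  assumes \<Omega>: "open \<Omega>" "x \<in> \<Omega>" and w: "\<And>y. y \<in> \<Omega> \<Longrightarrow> (w has_derivative (\<lambda>h. Dw y \<bullet> h)) (at y)"
    and L: "(Dw has_derivative L) (at x)"
  shows "((\<lambda>t. (w (x + t *\<^sub>R k + t *\<^sub>R l) - w (x + t *\<^sub>R k) - w (x + t *\<^sub>R l) + w x) / t\<^sup>2) \<longlongrightarrow> L l \<bullet> k) (at_right 0)"
proof (rule tendstoI)
  fix \<epsilon> :: real assume \<epsilon>: "0 < \<epsilon>"
  have lin: "linear L" using L by (rule has_derivative_linear)
  let ?C = "norm k + norm l + 1"
  have C: "0 < ?C" by (simp add: add_nonneg_pos)
  \<comment> \<open>Each of the two remainders is at most \<epsilon>' t C with C = norm k + norm l +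
    1, so after pairing with \<open>k\<close> the total error is at most t \<epsilon> / 2.\<close>
  define \<epsilon>' where "\<epsilon>' = \<epsilon> / (4 * ?C * ?C)"
  have \<epsilon>': "0 < \<epsilon>'" using \<epsilon> C by (simp add: \<epsilon>'_def)
  obtain d1 where d1: "0 < d1" "ball x d1 \<subseteq> \<Omega>" using \<Omega> open_contains_ball by blast
  obtain d2 where d2: "0 < d2" "\<And>y. norm (y - x) < d2 \<Longrightarrow> norm (Dw y - Dw x - L (y - x)) \<le> \<epsilon>' * norm (y - x)"
    using L \<epsilon>' unfolding has_derivative_at_alt by blast
  define d where "d = min d1 d2 / ?C"
  have d: "0 < d" "d * ?C \<le> d1" "d * ?C \<le> d2"
  proof -
    show "0 < d" using d1 d2 C by (simp add: d_def)
    have "d * ?C = min d1 d2" using C by (simp add: d_def)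
    then show "d * ?C \<le> d1" "d * ?C \<le> d2" by auto
  qed
  have est: "dist ((w (x + t *\<^sub>R k + t *\<^sub>R l) - w (x + t *\<^sub>R k) - w (x + t *\<^sub>R l) + w x) / t\<^sup>2) (L l \<bullet> k) < \<epsilon>"
    if t: "0 < t" "t < d" for t
  proof -
    have nb: "norm (a *\<^sub>R k + b *\<^sub>R l) \<le> t * ?C" "norm (a *\<^sub>R k + b *\<^sub>R l) < d1" "norm (a *\<^sub>R k + b *\<^sub>R l) < d2"
      if "0 \<le> a" "a \<le> t" "0 \<le> b" "b \<le> t" for a b
    proof -
      have "norm (a *\<^sub>R k + b *\<^sub>R l) \<le> a * norm k + b * norm l"
        using norm_triangle_ineq[of "a *\<^sub>R k" "b *\<^sub>R l"] that by simp
      also have "\<dots> \<le> t * norm k + t * norm l" using that by (intro add_mono mult_right_mono) auto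
      also have "\<dots> \<le> t * ?C" using t by (simp add: algebra_simps)
      finally show 1: "norm (a *\<^sub>R k + b *\<^sub>R l) \<le> t * ?C" .
      have "t * ?C < d * ?C" using t C by (intro mult_strict_right_mono) auto
      then show "norm (a *\<^sub>R k + b *\<^sub>R l) < d1" "norm (a *\<^sub>R k + b *\<^sub>R l) < d2" using 1 d by auto
    qed
    have in\<Omega>: "x + (a *\<^sub>R k + b *\<^sub>R l) \<in> \<Omega>" if "0 \<le> a" "a \<le> t" "0 \<le> b" "b \<le> t" for a b
    proof -
      have "dist x (x + (a *\<^sub>R k + b *\<^sub>R l)) = norm (a *\<^sub>R k + b *\<^sub>R l)" by (metis add_diff_cancel_left' dist_commute dist_norm)
      then show ?thesis using nb(2)[OF that] d1(2) by (metis mem_ball subsetD)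
    qed
    define g where "g s = w (x + (s *\<^sub>R k + t *\<^sub>R l)) - w (x + (s *\<^sub>R k + 0 *\<^sub>R l))" for s
    define g' where "g' s = Dw (x + (s *\<^sub>R k + t *\<^sub>R l)) \<bullet> k - Dw (x + (s *\<^sub>R k + 0 *\<^sub>R l)) \<bullet> k" for s
    have wd: "((\<lambda>s. w (x + (s *\<^sub>R k + b *\<^sub>R l))) has_derivative (\<lambda>h. Dw (x + (s *\<^sub>R k + b *\<^sub>R l)) \<bullet> (h *\<^sub>R k))) (at s)"
      if "0 \<le> s" "s \<le> t" "0 \<le> b" "b \<le> t" for s b
    proof -
      have "((\<lambda>s. x + (s *\<^sub>R k + b *\<^sub>R l)) has_derivative (\<lambda>h. h *\<^sub>R k)) (at s)"
        by (auto intro!: derivative_eq_intros)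
      from has_derivative_compose[OF this w[OF in\<Omega>[OF that]]] show ?thesis .
    qed
    have "\<exists>s\<in>{0..t}. g t - g 0 = (\<lambda>h. h * g' s) (t - 0)"
    proof (rule mvt_very_simple)
      fix s assume s: "0 \<le> s" "s \<le> t"
      have "(g has_derivative (\<lambda>h. Dw (x + (s *\<^sub>R k + t *\<^sub>R l)) \<bullet> (h *\<^sub>R k) - Dw (x + (s *\<^sub>R k + 0 *\<^sub>R l)) \<bullet> (h *\<^sub>R k))) (at s)"
        unfolding g_def[abs_def] by (intro has_derivative_diff wd) (use s t in auto)
      then have "(g has_derivative (\<lambda>h. h * g' s)) (at s)"
        by (rule has_derivative_eq_rhs) (auto simp: g'_def fun_eq_iff algebra_simps)
      then show "(g has_derivative (\<lambda>h. h * g' s)) (at s within {0..t})" by (rule has_derivative_at_withinI)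
    qed (use t in simp)
    then obtain s where s: "0 \<le> s" "s \<le> t" "g t - g 0 = t * g' s" by auto
    define rem where "rem v = Dw (x + v) - Dw x - L v" for v
    have rem: "norm (rem (s *\<^sub>R k + b *\<^sub>R l)) \<le> \<epsilon>' * (t * ?C)" if "0 \<le> b" "b \<le> t" for b
    proof -
      have "norm (rem (s *\<^sub>R k + b *\<^sub>R l)) \<le> \<epsilon>' * norm (s *\<^sub>R k + b *\<^sub>R l)"
        using d2(2)[of "x + (s *\<^sub>R k + b *\<^sub>R l)"] nb(3)[OF s(1,2) that] by (simp add: rem_def)
      also have "\<dots> \<le> \<epsilon>' * (t * ?C)" using nb(1)[OF s(1,2) that] \<epsilon>' by (intro mult_left_mono) auto
      finally show ?thesis .
    qed
    have "g' s = (rem (s *\<^sub>R k + t *\<^sub>R l) - rem (s *\<^sub>R k + 0 *\<^sub>R l) + t *\<^sub>R L l) \<bullet> k"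
      by (simp add: g'_def rem_def linear_add[OF lin] linear_scale[OF lin] algebra_simps)
    then have "g' s - t * (L l \<bullet> k) = (rem (s *\<^sub>R k + t *\<^sub>R l) - rem (s *\<^sub>R k + 0 *\<^sub>R l)) \<bullet> k"
      by (simp add: inner_add_left)
    then have "\<bar>g' s - t * (L l \<bullet> k)\<bar> \<le> norm (rem (s *\<^sub>R k + t *\<^sub>R l) - rem (s *\<^sub>R k + 0 *\<^sub>R l)) * norm k"
      using Cauchy_Schwarz_ineq2 by simp
    also have "\<dots> \<le> (2 * (\<epsilon>' * (t * ?C))) * ?C"
    proof (rule mult_mono)
      show "norm (rem (s *\<^sub>R k + t *\<^sub>R l) - rem (s *\<^sub>R k + 0 *\<^sub>R l)) \<le> 2 * (\<epsilon>' * (t * ?C))"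
        using norm_triangle_ineq4[of "rem (s *\<^sub>R k + t *\<^sub>R l)" "rem (s *\<^sub>R k + 0 *\<^sub>R l)"] rem[of t] rem[of 0] t by simp
    qed (use \<epsilon>' t C in auto)
    also have "\<dots> = t * (\<epsilon>' * (4 * ?C * ?C)) / 2"
    proof -
      have "(2 * (\<epsilon>' * (t * c))) * c = t * (\<epsilon>' * (4 * c * c)) / 2" for c by (simp add: algebra_simps)
      then show ?thesis by blast
    qed
    also have "\<epsilon>' * (4 * ?C * ?C) = \<epsilon>" using C by (simp add: \<epsilon>'_def)
    also have "t * \<epsilon> / 2 = t * (\<epsilon> / 2)" by simp
    finally have 1: "\<bar>g' s - t * (L l \<bullet> k)\<bar> \<le> t * (\<epsilon> / 2)" .
    have "(w (x + t *\<^sub>R k + t *\<^sub>R l) - w (x + t *\<^sub>R k) - w (x + t *\<^sub>R l) + w x) / t\<^sup>2 = g' s / t"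
      using s(3) t by (simp add: g_def add.assoc power2_eq_square field_simps)
    then have "\<bar>(w (x + t *\<^sub>R k + t *\<^sub>R l) - w (x + t *\<^sub>R k) - w (x + t *\<^sub>R l) + w x) / t\<^sup>2 - L l \<bullet> k\<bar> = \<bar>g' s - t * (L l \<bullet> k)\<bar> / t"
    proof -
      have "g' s / t - L l \<bullet> k = (g' s - t * (L l \<bullet> k)) / t" using t by (simp add: field_simps)
      then show ?thesis using t unfolding \<open>_ = g' s / t\<close> by (simp add: abs_divide)
    qed
    also have "\<dots> \<le> \<epsilon> / 2" using 1 t by (simp add: pos_divide_le_eq mult.commute)
    finally show ?thesis using \<epsilon> by (simp add: dist_real_def)
  qed
  show "\<forall>\<^sub>F t in at_right 0. dist ((w (x + t *\<^sub>R k + t *\<^sub>R l) - w (x + t *\<^sub>R k) - w (x + t *\<^sub>R l) + w x) / t\<^sup>2) (L l \<bullet> k) < \<epsilon>"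
    unfolding eventually_at_right_field using est d(1) by blast
qed

text \<open>The second difference does not change when \<open>k\<close> and \<open>l\<close> are
  exchanged, so the two limits coincide.\<close>

lemma second_derivative_symmetric:
  fixes w :: "'a::euclidean_space \<Rightarrow> real"
  assumes \<Omega>: "open \<Omega>" "x \<in> \<Omega>" and w: "\<And>y. y \<in> \<Omega> \<Longrightarrow> (w has_derivative (\<lambda>h. Dw y \<bullet> h)) (at y)"
    and L: "(Dw has_derivative L) (at x)"
  shows "L k \<bullet> l = L l \<bullet> k"
proof -
  have "((\<lambda>t. (w (x + t *\<^sub>R k + t *\<^sub>R l) - w (x + t *\<^sub>R k) - w (x + t *\<^sub>R l) + w x) / t\<^sup>2) \<longlongrightarrow> L l \<bullet> k) (at_right 0)"
    by (rule second_difference_limit[OF assms])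
  moreover have "((\<lambda>t. (w (x + t *\<^sub>R k + t *\<^sub>R l) - w (x + t *\<^sub>R k) - w (x + t *\<^sub>R l) + w x) / t\<^sup>2) \<longlongrightarrow> L k \<bullet> l) (at_right 0)"
  proof -
    have "(\<lambda>t. (w (x + t *\<^sub>R k + t *\<^sub>R l) - w (x + t *\<^sub>R k) - w (x + t *\<^sub>R l) + w x) / t\<^sup>2)
        = (\<lambda>t. (w (x + t *\<^sub>R l + t *\<^sub>R k) - w (x + t *\<^sub>R l) - w (x + t *\<^sub>R k) + w x) / t\<^sup>2)"
    proof
      fix t
      have comm: "x + t *\<^sub>R k + t *\<^sub>R l = x + t *\<^sub>R l + t *\<^sub>R k" by (simp add: ac_simps)
      show "(w (x + t *\<^sub>R k + t *\<^sub>R l) - w (x + t *\<^sub>R k) - w (x + t *\<^sub>R l) + w x) / t\<^sup>2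
        = (w (x + t *\<^sub>R l + t *\<^sub>R k) - w (x + t *\<^sub>R l) - w (x + t *\<^sub>R k) + w x) / t\<^sup>2" unfolding comm by simp
    qed
    then show ?thesis using second_difference_limit[OF assms, of l k] by simp
  qed
  ultimately show ?thesis by (intro tendsto_unique[OF trivial_limit_at_right_real])
qed

text \<open>A box, because the rules for differentiating parameter integrals are stated over
  \<open>cbox\<close>; the weights vanish outside the unit ball, which it contains.\<close>

abbreviation (input) ubox :: "'a::euclidean_space set" where "ubox \<equiv> cbox (- One) One"

lemma cball_subset_ubox: "cball 0 1 \<subseteq> (ubox :: 'a::euclidean_space set)"
proof
  fix x :: 'a assume x: "x \<in> cball 0 1"
  have "\<bar>x \<bullet> i\<bar> \<le> 1" if "i \<in> Basis" for i
    using Basis_le_norm[OF that, of x] x by simp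
  then show "x \<in> ubox" by (auto simp: mem_box abs_le_iff)
qed

lemma norm_ubox: assumes "x \<in> (ubox :: 'a::euclidean_space set)" shows "norm x < real DIM('a) + 1"
proof -
  have "norm x \<le> (\<Sum>b\<in>Basis. \<bar>x \<bullet> b\<bar>)" by (rule norm_le_l1)
  also have "\<dots> \<le> (\<Sum>b\<in>(Basis::'a set). 1)"
    using assms by (intro sum_mono) (auto simp: mem_box abs_le_iff)
  finally show ?thesis by simp
qed

lemma integral_ubox:
  fixes f :: "'a::euclidean_space \<Rightarrow> real"
  assumes f: "continuous_on ubox f" and zero: "\<And>z. z \<notin> cball 0 1 \<Longrightarrow> f z = 0" and V: "cball 0 1 \<subseteq> V"
  shows "integral ubox f = (\<integral>z. indicator V z * f z \<partial>lborel)"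
proof -
  have "set_integrable lborel ubox f"
    unfolding set_integrable_def using f by (intro borel_integrable_compact) auto
  then have "integral ubox f = (LINT z:ubox|lborel. f z)" by (simp add: set_borel_integral_eq_integral(2))
  also have "\<dots> = (\<integral>z. indicator V z * f z \<partial>lborel)"
    unfolding set_lebesgue_integral_def
  proof (rule Bochner_Integration.integral_cong[OF refl])
    fix z show "indicator ubox z *\<^sub>R f z = indicator V z * f z"
      using zero[of z] V cball_subset_ubox by (cases "z \<in> cball 0 1") (auto simp: indicator_def subset_iff)
  qed
  finally show ?thesis .
qed

text \<open>Up to the factor -6 this is the potential of \<open>bump 0 1 z *\<^sub>R z\<close>:
  raising the exponent from 2 to 3 exhibits the radially weighted field as a gradient.\<close>

lemma C1_cubic: "C1 (\<lambda>z. (max 0 (1 - (z - 0) \<bullet> (z - 0))) ^ 3) (\<lambda>z::'a::euclidean_space. (- 6 * bump 0 1 z) *\<^sub>R z)"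
  unfolding C1_def
proof (intro conjI allI)
  fix x :: 'a
  show "((\<lambda>z. (max 0 (1 - (z - 0) \<bullet> (z - 0))) ^ 3) has_derivative (\<lambda>h. ((- 6 * bump 0 1 x) *\<^sub>R x) \<bullet> h)) (at x)"
    by (rule has_derivative_eq_rhs[OF has_derivative_max0_sq_norm]) (auto simp: bump_def)
  show "continuous_on UNIV (\<lambda>z::'a. (- 6 * bump 0 1 z) *\<^sub>R z)"
    unfolding bump_def by (intro continuous_intros)
qed

lemma bump_unit_zero: "z \<notin> cball 0 1 \<Longrightarrow> bump 0 1 z = 0" "z \<notin> cball 0 1 \<Longrightarrow> (max 0 (1 - (z - 0) \<bullet> (z - 0))) ^ 3 = 0"
proof -
  assume z: "z \<notin> cball 0 1"
  then show "bump 0 1 z = 0" by (intro bump_eq_0) auto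
  then show "(max 0 (1 - (z - 0) \<bullet> (z - 0))) ^ 3 = 0" by (simp add: bump_def)
qed

lemma continuous_bump: "continuous_on S (bump c s)"
  by (rule C1_continuous[OF C1_bump])

lemma continuous_bump_grad: "continuous_on S (bump_grad c s)"
  using C1_bump[of c s] unfolding C1_def by (auto intro: continuous_on_subset)

lemma integral_bump_pos: "0 < integral ubox (bump (0::'a::euclidean_space) 1)"
proof -
  have nn: "0 \<le> integral ubox (bump (0::'a) 1)"
    by (intro Henstock_Kurzweil_Integration.integral_nonneg integrable_continuous continuous_bump bump_nonneg)
  have "integral ubox (bump (0::'a) 1) \<noteq> 0"
  proof
    assume 0: "integral ubox (bump (0::'a) 1) = 0"
    have "(bump (0::'a) 1 has_integral 0) ubox"
      using integrable_integral[OF integrable_continuous[OF continuous_bump]] 0 by metis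
    have "bump (0::'a) 1 0 = 0"
      by (rule has_integral_0_cbox_imp_0[OF continuous_bump bump_nonneg \<open>(bump (0::'a) 1 has_integral 0) ubox\<close>])
        (auto simp: box_ne_empty mem_box)
    then show False by (simp add: bump_def)
  qed
  then show ?thesis using nn by simp
qed

section \<open>Mean values and differentiability of the Hessian\<close>

locale poisson =
  fixes \<Omega> :: "'a::euclidean_space set" and u :: "'a \<Rightarrow> real" and Du :: "'a \<Rightarrow> 'a"
    and H :: "'a \<Rightarrow> 'a \<Rightarrow> 'a" and N :: real
  assumes op: "open \<Omega>"
    and u_der: "\<And>x. x \<in> \<Omega> \<Longrightarrow> (u has_derivative (\<lambda>h. Du x \<bullet> h)) (at x)"
    and Du_der: "\<And>x. x \<in> \<Omega> \<Longrightarrow> (Du has_derivative H x) (at x)"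
    and H_cont: "\<And>h. continuous_on \<Omega> (\<lambda>x. H x h)"
    and lap: "\<And>x. x \<in> \<Omega> \<Longrightarrow> trace_of (H x) = N"
begin

lemma u_cont: "continuous_on \<Omega> u"
  by (intro continuous_at_imp_continuous_on ballI) (use u_der has_derivative_continuous in blast)

lemma Du_cont: "continuous_on \<Omega> Du"
  by (intro continuous_at_imp_continuous_on ballI) (use Du_der has_derivative_continuous in blast)

lemma H_linear: "x \<in> \<Omega> \<Longrightarrow> linear (H x)"
  using Du_der by (rule has_derivative_linear)

lemma H_sym: "x \<in> \<Omega> \<Longrightarrow> H x k \<bullet> l = H x l \<bullet> k"
  by (rule second_derivative_symmetric[OF op _ u_der Du_der])

text \<open>The bound \<open>real DIM('a) + 1\<close> exceeds the norm of every point of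
  \<open>ubox\<close> by \<open>norm_ubox\<close>, so all points that enter the means lie in
  \<Omega>.\<close>

definition admissible :: "'a \<Rightarrow> real \<Rightarrow> bool" where
  "admissible x0 s \<longleftrightarrow> 0 < s \<and> (\<forall>x\<in>ball x0 s. \<forall>z. norm z \<le> real DIM('a) + 1 \<longrightarrow> (\<forall>r\<in>{0..s}. x + r *\<^sub>R z \<in> \<Omega>))"

lemma admissible_exists: assumes "x0 \<in> \<Omega>" shows "\<exists>s. admissible x0 s"
proof -
  obtain e where e: "0 < e" "ball x0 e \<subseteq> \<Omega>" using assms op open_contains_ball by blast
  let ?B = "real DIM('a) + 2"
  define s where "s = e / ?B"
  have s: "0 < s" "s * ?B = e" using e by (auto simp: s_def)
  have "x + r *\<^sub>R z \<in> \<Omega>" if x: "x \<in> ball x0 s" and z: "norm z \<le> real DIM('a) + 1" and r: "r \<in> {0..s}" for x z r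
  proof -
    have "dist x0 (x + r *\<^sub>R z) \<le> dist x0 x + dist x (x + r *\<^sub>R z)" by (rule dist_triangle)
    also have "dist x (x + r *\<^sub>R z) = r * norm z" using r by (simp add: dist_norm)
    also have "r * norm z \<le> s * (real DIM('a) + 1)" using r z by (intro mult_mono) auto
    also have "dist x0 x < s" using x by simp
    finally have "dist x0 (x + r *\<^sub>R z) < s * ?B" by (simp add: algebra_simps)
    then show ?thesis using e s by auto
  qed
  then show ?thesis using s by (auto simp: admissible_def)
qed

lemma admissible_in:
  assumes "admissible x0 s" "x \<in> ball x0 s" "z \<in> ubox" "0 \<le> r" "r \<le> s" shows "x + r *\<^sub>R z \<in> \<Omega>"
  using assms norm_ubox[OF assms(3)] by (auto simp: admissible_def)

lemma admissible_sub:
  assumes "admissible x0 s" "x \<in> ball x0 s" shows "x \<in> \<Omega>"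
proof -
  have "x + 0 *\<^sub>R 0 \<in> \<Omega>" using assms unfolding admissible_def by (metis atLeastAtMost_iff less_eq_real_def norm_zero of_nat_0_le_iff add_nonneg_nonneg zero_le_one)
  then show ?thesis by simp
qed

lemma compose_cont:
  assumes a: "admissible x0 s" "x \<in> ball x0 s" "0 \<le> r" "r \<le> s" and g: "continuous_on \<Omega> g"
  shows "continuous_on ubox (\<lambda>z. g (x + r *\<^sub>R z))"
  by (rule continuous_on_compose2[OF g]) (use admissible_in[OF a(1,2) _ a(3,4)] in \<open>auto intro!: continuous_intros\<close>)

lemma shifted_field:
  fixes g :: "'a \<Rightarrow> 'a"
  assumes a: "admissible x0 s" "x \<in> ball x0 s" "0 \<le> r" "r \<le> s"
    and g: "\<And>y. y \<in> \<Omega> \<Longrightarrow> (g has_derivative g' y) (at y)" "\<And>h. continuous_on \<Omega> (\<lambda>y. g' y h)"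
  shows "C1_field (ball 0 (real DIM('a) + 1)) (\<lambda>z. g (x + r *\<^sub>R z)) (\<lambda>z h. g' (x + r *\<^sub>R z) (r *\<^sub>R h))"
proof -
  have B: "0 < real DIM('a) + 1" by simp
  have in\<Omega>: "x + r *\<^sub>R z \<in> \<Omega>" if "z \<in> cball 0 (real DIM('a) + 1)" for z :: 'a
    using that a by (auto simp: admissible_def)
  have gc: "continuous_on \<Omega> g"
    by (intro continuous_at_imp_continuous_on ballI) (use g(1) has_derivative_continuous in blast)
  show ?thesis
    unfolding C1_field_def closure_ball[OF B]
  proof (intro conjI ballI allI)
    show "continuous_on (cball 0 (real DIM('a) + 1)) (\<lambda>z. g (x + r *\<^sub>R z))"
      by (rule continuous_on_compose2[OF gc]) (use in\<Omega> in \<open>auto intro!: continuous_intros\<close>)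
    fix h
    have "linear (g' y)" if "y \<in> \<Omega>" for y using g(1)[OF that] by (rule has_derivative_linear)
    have "continuous_on (ball 0 (real DIM('a) + 1)) (\<lambda>z. g' (x + r *\<^sub>R z) (r *\<^sub>R h))"
      by (rule continuous_on_compose2[OF g(2)]) (use in\<Omega> in \<open>auto intro!: continuous_intros\<close>)
    then show "continuous_on (ball 0 (real DIM('a) + 1)) (\<lambda>z. g' (x + r *\<^sub>R z) (r *\<^sub>R h))" .
  next
    fix z :: 'a assume "z \<in> ball 0 (real DIM('a) + 1)"
    then have "x + r *\<^sub>R z \<in> \<Omega>" by (intro in\<Omega>) auto
    from g(1)[OF this] have "(g has_derivative g' (x + r *\<^sub>R z)) (at (x + r *\<^sub>R z))" .
    moreover have "((\<lambda>z. x + r *\<^sub>R z) has_derivative (\<lambda>h. r *\<^sub>R h)) (at z)" by (auto intro!: derivative_eq_intros)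
    ultimately show "((\<lambda>z. g (x + r *\<^sub>R z)) has_derivative (\<lambda>h. g' (x + r *\<^sub>R z) (r *\<^sub>R h))) (at z)"
      by (rule has_derivative_compose[rotated])
  qed
qed

lemma cball_unit_subset: "cball 0 1 \<subseteq> ball (0::'a) (real DIM('a) + 1)"
proof -
  have "1 < real DIM('a) + 1" by simp
  then show ?thesis by (intro cball_subset_ball_iff[THEN iffD2]) auto
qed

text \<open>The radial derivative of the mean with weight \<^term>\<open>bump 0 1\<close>: since
  \<^term>\<open>bump 0 1 z *\<^sub>R z\<close> is a multiple of the gradient of a compactly supported function,
  integration by parts turns it into an integral of the Laplacian.\<close>

lemma radial_derivative:
  assumes a: "admissible x0 s" "x \<in> ball x0 s" "0 \<le> r" "r \<le> s"
  shows "integral ubox (\<lambda>z. bump 0 1 z * (Du (x + r *\<^sub>R z) \<bullet> z))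
     = r * (N / 6 * integral ubox (\<lambda>z::'a. (max 0 (1 - (z - 0) \<bullet> (z - 0))) ^ 3))"
proof -
  let ?\<Phi> = "\<lambda>z::'a. (max 0 (1 - (z - 0) \<bullet> (z - 0))) ^ 3"
  let ?V = "ball (0::'a) (real DIM('a) + 1)"
  let ?F' = "\<lambda>z h. H (x + r *\<^sub>R z) (r *\<^sub>R h)"
  \<comment> \<open>The divergence of the cubic weight times \<open>Du (x + r *\<^sub>R z)\<close>:
    the gradient of the weight gives the first term, the chain rule and the constant Laplacian the
    second.\<close>
  let ?f = "\<lambda>z. (-6) * (bump 0 1 z * (Du (x + r *\<^sub>R z) \<bullet> z)) + (r * N) * ?\<Phi> z"
  have in\<Omega>: "x + r *\<^sub>R z \<in> \<Omega>" if "z \<in> ?V" for z using that a by (auto simp: admissible_def)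
  have F: "C1_field ?V (\<lambda>z. Du (x + r *\<^sub>R z)) ?F'" by (rule shifted_field[OF a Du_der H_cont])
  have tr: "trace_of (?F' z) = r * N" if "z \<in> ?V" for z
  proof -
    have "trace_of (?F' z) = r * trace_of (H (x + r *\<^sub>R z))"
      unfolding trace_of_def by (simp add: linear_scale[OF H_linear[OF in\<Omega>[OF that]]] sum_distrib_left)
    then show ?thesis using lap[OF in\<Omega>[OF that]] by simp
  qed
  have c1: "continuous_on ubox (\<lambda>z. bump 0 1 z * (Du (x + r *\<^sub>R z) \<bullet> z))"
    by (intro continuous_intros continuous_bump compose_cont[OF a Du_cont])
  have c2: "continuous_on ubox ?\<Phi>" by (rule C1_continuous[OF C1_cubic])
  have "integral ubox ?f = (\<integral>z. indicator ?V z * ?f z \<partial>lborel)"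
  proof (rule integral_ubox[OF _ _ cball_unit_subset])
    show "continuous_on ubox ?f"
      by (rule continuous_on_add[OF continuous_on_mult[OF continuous_on_const c1] continuous_on_mult[OF continuous_on_const c2]])
    fix z :: 'a assume z: "z \<notin> cball 0 1"
    show "?f z = 0" by (simp only: bump_unit_zero[OF z])
  qed
  also have "\<dots> = (\<integral>z. indicator ?V z * (((- 6 * bump 0 1 z) *\<^sub>R z) \<bullet> Du (x + r *\<^sub>R z) + ?\<Phi> z * trace_of (?F' z)) \<partial>lborel)"
  proof (rule Bochner_Integration.integral_cong[OF refl])
    fix z
    show "indicator ?V z * ?f z = indicator ?V z * (((- 6 * bump 0 1 z) *\<^sub>R z) \<bullet> Du (x + r *\<^sub>R z) + ?\<Phi> z * trace_of (?F' z))"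
    proof (cases "z \<in> ?V")
      case True
      show ?thesis unfolding tr[OF True] by (simp add: inner_commute[of z "Du (x + r *\<^sub>R z)"])
    qed simp
  qed
  also have "\<dots> = 0"
    by (rule interior_divergence[OF open_ball cball_unit_subset F C1_cubic]) (rule bump_unit_zero)
  finally have "integral ubox ?f = 0" .
  moreover have "integral ubox ?f = (-6) * integral ubox (\<lambda>z. bump 0 1 z * (Du (x + r *\<^sub>R z) \<bullet> z)) + (r * N) * integral ubox ?\<Phi>"
  proof -
    have "integral ubox ?f = integral ubox (\<lambda>z. (-6) * (bump 0 1 z * (Du (x + r *\<^sub>R z) \<bullet> z))) + integral ubox (\<lambda>z. (r * N) * ?\<Phi> z)"
      by (rule Henstock_Kurzweil_Integration.integral_add[OF integrable_continuous[OF continuous_on_mult[OF continuous_on_const c1]]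
            integrable_continuous[OF continuous_on_mult[OF continuous_on_const c2]]])
    then show ?thesis by (simp only: Henstock_Kurzweil_Integration.integral_mult_right)
  qed
  ultimately show ?thesis by linarith
qed

text \<open>By \<open>radial_derivative\<close> the weighted mean at radius \<open>r\<close> changes
  at rate \<open>r * ?K\<close>, the same for every centre because the Laplacian is constant. At
  radius \<open>s\<close> it therefore differs from a multiple of \<open>u\<close> by a constant
  independent of the centre.\<close>

lemma mean_value:
  assumes a: "admissible x0 s"
  obtains c where "\<And>x. x \<in> ball x0 s \<Longrightarrow>
    integral ubox (bump (0::'a) 1) * u x + c = integral ubox (\<lambda>z. bump 0 1 z * u (x + s *\<^sub>R z))"
proof
  fix x assume x: "x \<in> ball x0 s"
  let ?K = "N / 6 * integral ubox (\<lambda>z::'a. (max 0 (1 - (z - 0) \<bullet> (z - 0))) ^ 3)"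
  have s: "0 < s" using a by (simp add: admissible_def)
  let ?F = "\<lambda>r. integral ubox (\<lambda>z. bump 0 1 z * u (x + r *\<^sub>R z))"
  have F: "(?F has_field_derivative r * ?K) (at r within {0..s})" if r: "r \<in> {0..s}" for r
  proof -
    have "(?F has_field_derivative integral ubox (\<lambda>z. bump 0 1 z * (Du (x + r *\<^sub>R z) \<bullet> z))) (at r within {0..s})"
    proof (rule leibniz_rule_field_derivative[where fx="\<lambda>r z. bump 0 1 z * (Du (x + r *\<^sub>R z) \<bullet> z)", OF _ _ _ r])
      fix r z assume r: "r \<in> {0..s}" and z: "z \<in> (ubox :: 'a set)"
      have "((\<lambda>r. x + r *\<^sub>R z) has_derivative (\<lambda>h. h *\<^sub>R z)) (at r)" by (auto intro!: derivative_eq_intros)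
      from has_derivative_compose[OF this u_der[OF admissible_in[OF a x z]]]
      have "((\<lambda>r. u (x + r *\<^sub>R z)) has_derivative (\<lambda>h. Du (x + r *\<^sub>R z) \<bullet> (h *\<^sub>R z))) (at r)" using r by simp
      then have "((\<lambda>r. u (x + r *\<^sub>R z)) has_field_derivative (Du (x + r *\<^sub>R z) \<bullet> z)) (at r)"
        by (simp add: has_field_derivative_def mult_fun_commute)
      then have "((\<lambda>r. u (x + r *\<^sub>R z)) has_field_derivative (Du (x + r *\<^sub>R z) \<bullet> z)) (at r within {0..s})"
        by (rule has_field_derivative_at_within)
      then show "((\<lambda>r. bump 0 1 z * u (x + r *\<^sub>R z)) has_field_derivative bump 0 1 z * (Du (x + r *\<^sub>R z) \<bullet> z)) (at r within {0..s})"
        by (rule DERIV_cmult)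
    next
      fix r assume "r \<in> {0..s}"
      then show "(\<lambda>z. bump 0 1 z * u (x + r *\<^sub>R z)) integrable_on ubox"
        by (intro integrable_continuous continuous_intros continuous_bump compose_cont[OF a x _ _ u_cont]) auto
    next
      have "continuous_on ({0..s} \<times> ubox) (\<lambda>p. Du (x + fst p *\<^sub>R snd p))"
        by (rule continuous_on_compose2[OF Du_cont]) (use admissible_in[OF a x] in \<open>auto intro!: continuous_intros\<close>)
      moreover have "continuous_on ({0..s} \<times> ubox) (\<lambda>p. bump 0 1 (snd p :: 'a))"
        by (rule continuous_on_compose2[OF continuous_bump[of UNIV]]) (auto intro!: continuous_intros)
      ultimately show "continuous_on ({0..s} \<times> ubox) (\<lambda>(r, z). bump 0 1 z * (Du (x + r *\<^sub>R z) \<bullet> z))"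
        unfolding case_prod_unfold by (intro continuous_intros)
    qed (rule convex_closed_interval[where a=0 and b=s, simplified] | simp)+
    then show ?thesis using r by (simp add: radial_derivative[OF a x])
  qed
  have "((\<lambda>r. ?F r - r\<^sup>2 / 2 * ?K) has_field_derivative 0) (at r within {0..s})" if r: "r \<in> {0..s}" for r
    using F[OF r] by (auto intro!: derivative_eq_intros)
  then obtain c where c: "\<And>r. r \<in> {0..s} \<Longrightarrow> ?F r - r\<^sup>2 / 2 * ?K = c"
    using has_field_derivative_zero_constant[of "{0..s}" "\<lambda>r. ?F r - r\<^sup>2 / 2 * ?K"] by auto
  have "?F s - s\<^sup>2 / 2 * ?K = ?F 0 - 0\<^sup>2 / 2 * ?K" using c[of s] c[of 0] s by simp
  then show "integral ubox (bump (0::'a) 1) * u x + s\<^sup>2 / 2 * ?K = integral ubox (\<lambda>z. bump 0 1 z * u (x + s *\<^sub>R z))"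
    by simp
qed

text \<open>Differentiation under the integral sign transfers the mean value identity from
  \<open>g\<close> to its directional derivative and discards \<open>c\<close>; it is applied to
  \<open>u\<close> and then to the components of \<open>Du\<close>.\<close>

lemma mean_value_derivative:
  fixes g g' :: "'a \<Rightarrow> real"
  assumes a: "admissible x0 s"
    and g: "\<And>y. y \<in> \<Omega> \<Longrightarrow> ((\<lambda>t. g (y + t *\<^sub>R k)) has_real_derivative g' y) (at 0)"
    and gc: "continuous_on \<Omega> g" and g'c: "continuous_on \<Omega> g'"
    and mv: "\<And>x. x \<in> ball x0 s \<Longrightarrow> E * g x + c = integral ubox (\<lambda>z. bump 0 1 z * g (x + s *\<^sub>R z))"
    and x: "x \<in> ball x0 s"
  shows "E * g' x = integral ubox (\<lambda>z. bump 0 1 z * g' (x + s *\<^sub>R z))"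
proof -
  have s: "0 < s" using a by (simp add: admissible_def)
  have "open {t. x + t *\<^sub>R k \<in> ball x0 s}" by (intro open_line open_ball)
  moreover have "0 \<in> {t. x + t *\<^sub>R k \<in> ball x0 s}" using x by simp
  ultimately obtain \<tau> where \<tau>: "0 < \<tau>" "cball 0 \<tau> \<subseteq> {t. x + t *\<^sub>R k \<in> ball x0 s}"
    using open_contains_cball by blast
  let ?U = "{-\<tau>..\<tau>}"
  have U: "x + t *\<^sub>R k \<in> ball x0 s" if "t \<in> ?U" for t
    using \<tau>(2) that by (auto simp: subset_iff dist_real_def abs_le_iff)
  have der: "((\<lambda>t. g (y + t *\<^sub>R k)) has_real_derivative g' (y + t *\<^sub>R k)) (at t)" if "y + t *\<^sub>R k \<in> \<Omega>" for y t
  proof -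
    have "((\<lambda>h. g ((y + t *\<^sub>R k) + h *\<^sub>R k)) has_real_derivative g' (y + t *\<^sub>R k)) (at 0)" by (rule g[OF that])
    then have "((\<lambda>h. g ((y + t *\<^sub>R k) + (h + - t) *\<^sub>R k)) has_real_derivative g' (y + t *\<^sub>R k)) (at t)"
      using DERIV_shift[of "\<lambda>h. g ((y + t *\<^sub>R k) + (h + - t) *\<^sub>R k)" "g' (y + t *\<^sub>R k)" 0 t] by simp
    then show ?thesis by (simp add: algebra_simps)
  qed
  have 0: "0 \<in> ?U" using \<tau> by simp
  have sw: "x + t *\<^sub>R k + s *\<^sub>R z = (x + s *\<^sub>R z) + t *\<^sub>R k" for t z by (simp add: ac_simps)
  have in\<Omega>: "(x + s *\<^sub>R z) + t *\<^sub>R k \<in> \<Omega>" if "t \<in> ?U" "z \<in> ubox" for t z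
    using admissible_in[OF a U[OF that(1)] that(2), of s] s by (simp add: ac_simps)
  have L1: "((\<lambda>t. integral ubox (\<lambda>z. bump 0 1 z * g ((x + s *\<^sub>R z) + t *\<^sub>R k))) has_field_derivative
     integral ubox (\<lambda>z. bump 0 1 z * g' ((x + s *\<^sub>R z) + 0 *\<^sub>R k))) (at 0 within ?U)"
  proof (rule leibniz_rule_field_derivative[where fx="\<lambda>t z. bump 0 1 z * g' ((x + s *\<^sub>R z) + t *\<^sub>R k)", OF _ _ _ 0])
    fix t z assume t: "t \<in> ?U" "z \<in> (ubox :: 'a set)"
    show "((\<lambda>t. bump 0 1 z * g ((x + s *\<^sub>R z) + t *\<^sub>R k)) has_field_derivative bump 0 1 z * g' ((x + s *\<^sub>R z) + t *\<^sub>R k)) (at t within ?U)"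
      by (rule DERIV_cmult[OF has_field_derivative_at_within[OF der[OF in\<Omega>[OF t]]]])
  next
    fix t assume t: "t \<in> ?U"
    have "continuous_on ubox (\<lambda>z. g (x + t *\<^sub>R k + s *\<^sub>R z))" using s by (intro compose_cont[OF a U[OF t] _ _ gc]) auto
    then show "(\<lambda>z. bump 0 1 z * g ((x + s *\<^sub>R z) + t *\<^sub>R k)) integrable_on ubox"
      unfolding sw by (intro integrable_continuous continuous_intros continuous_bump)
  next
    have "continuous_on (?U \<times> ubox) (\<lambda>p. g' ((x + s *\<^sub>R snd p) + fst p *\<^sub>R k))"
      by (rule continuous_on_compose2[OF g'c]) (use in\<Omega> in \<open>auto intro!: continuous_intros\<close>)
    moreover have "continuous_on (?U \<times> ubox) (\<lambda>p. bump 0 1 (snd p :: 'a))"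
      by (rule continuous_on_compose2[OF continuous_bump[of UNIV]]) (auto intro!: continuous_intros)
    ultimately show "continuous_on (?U \<times> ubox) (\<lambda>(t, z). bump 0 1 z * g' ((x + s *\<^sub>R z) + t *\<^sub>R k))"
      unfolding case_prod_unfold by (intro continuous_intros)
  qed simp
  have "0 \<in> interior ?U" using \<tau> by (simp add: interior_atLeastAtMost_real)
  then have aw: "at 0 within ?U = at 0" by (rule at_within_interior)
  have 1: "((\<lambda>t. integral ubox (\<lambda>z. bump 0 1 z * g ((x + s *\<^sub>R z) + t *\<^sub>R k))) has_field_derivative
     integral ubox (\<lambda>z. bump 0 1 z * g' (x + s *\<^sub>R z))) (at 0)"
    using L1 unfolding aw by (simp only: scaleR_zero_left add_0_right)
  have "((\<lambda>t. E * g (x + t *\<^sub>R k) + c) has_field_derivative (E * g' x + 0)) (at 0)"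
    by (rule DERIV_add[OF DERIV_cmult[OF g[OF admissible_sub[OF a x]]] DERIV_const])
  then have "((\<lambda>t. integral ubox (\<lambda>z. bump 0 1 z * g ((x + s *\<^sub>R z) + t *\<^sub>R k))) has_field_derivative (E * g' x + 0)) (at 0)"
  proof (rule has_field_derivative_transform_within_open)
    show "open {t. x + t *\<^sub>R k \<in> ball x0 s}" by (intro open_line open_ball)
    show "0 \<in> {t. x + t *\<^sub>R k \<in> ball x0 s}" using x by simp
    fix t assume "t \<in> {t. x + t *\<^sub>R k \<in> ball x0 s}"
    then show "E * g (x + t *\<^sub>R k) + c = integral ubox (\<lambda>z. bump 0 1 z * g ((x + s *\<^sub>R z) + t *\<^sub>R k))"
      using mv[of "x + t *\<^sub>R k"] by (simp add: sw)
  qed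
  from DERIV_unique[OF this 1] show ?thesis by simp
qed

text \<open>The divergence theorem for the field \<open>(Du \<bullet> l) *\<^sub>R k\<close> against
  the bump; the factor \<open>1 / s\<close> comes from the chain rule in
  \<open>x + s *\<^sub>R z\<close>.\<close>

lemma mean_value_parts:
  assumes a: "admissible x0 s" "x \<in> ball x0 s"
  shows "integral ubox (\<lambda>z. bump 0 1 z * (H (x + s *\<^sub>R z) k \<bullet> l))
     = - (1 / s) * integral ubox (\<lambda>z. (bump_grad 0 1 z \<bullet> k) * (Du (x + s *\<^sub>R z) \<bullet> l))"
proof -
  let ?V = "ball (0::'a) (real DIM('a) + 1)"
  have s: "0 < s" "0 \<le> s" "s \<le> s" using a by (auto simp: admissible_def)
  let ?F' = "\<lambda>z h. (H (x + s *\<^sub>R z) (s *\<^sub>R h) \<bullet> l) *\<^sub>R k"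
  let ?f = "\<lambda>z. (bump_grad 0 1 z \<bullet> k) * (Du (x + s *\<^sub>R z) \<bullet> l) + s * (bump 0 1 z * (H (x + s *\<^sub>R z) k \<bullet> l))"
  have in\<Omega>: "x + s *\<^sub>R z \<in> \<Omega>" if "z \<in> ?V" for z using that a by (auto simp: admissible_def)
  have F: "C1_field ?V (\<lambda>z. (Du (x + s *\<^sub>R z) \<bullet> l) *\<^sub>R k) ?F'"
  proof (rule shifted_field[OF a s(2,3), of "\<lambda>y. (Du y \<bullet> l) *\<^sub>R k" "\<lambda>y h. (H y h \<bullet> l) *\<^sub>R k"])
    show "((\<lambda>y. (Du y \<bullet> l) *\<^sub>R k) has_derivative (\<lambda>h. (H y h \<bullet> l) *\<^sub>R k)) (at y)" if "y \<in> \<Omega>" for y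
      by (intro has_derivative_scaleR_left has_derivative_inner_left Du_der that)
    show "continuous_on \<Omega> (\<lambda>y. (H y h \<bullet> l) *\<^sub>R k)" for h by (intro continuous_intros H_cont)
  qed
  have tr: "trace_of (?F' z) = s * (H (x + s *\<^sub>R z) k \<bullet> l)" if "z \<in> ?V" for z
  proof -
    have lin: "linear (H (x + s *\<^sub>R z))" by (rule H_linear[OF in\<Omega>[OF that]])
    have "trace_of (?F' z) = (\<Sum>b\<in>Basis. s * (H (x + s *\<^sub>R z) b \<bullet> l) * (k \<bullet> b))"
      unfolding trace_of_def by (simp add: linear_scale[OF lin])
    also have "\<dots> = s * (row (H (x + s *\<^sub>R z)) l \<bullet> k)"
      unfolding row_def inner_sum_left sum_distrib_left by (intro sum.cong refl) (simp add: inner_commute[of k])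
    finally show ?thesis by (simp add: inner_row[OF lin])
  qed
  have bg0: "bump_grad 0 1 z = 0" if "z \<notin> cball 0 1" for z :: 'a
    using C1_zero_grad[OF C1_bump, of "- cball 0 1" z 0 1] bump_unit_zero(1) that by auto
  have c1: "continuous_on ubox (\<lambda>z. (bump_grad 0 1 z \<bullet> k) * (Du (x + s *\<^sub>R z) \<bullet> l))"
    by (intro continuous_intros continuous_bump_grad compose_cont[OF a s(2,3) Du_cont])
  have c2: "continuous_on ubox (\<lambda>z. bump 0 1 z * (H (x + s *\<^sub>R z) k \<bullet> l))"
    by (intro continuous_intros continuous_bump compose_cont[OF a s(2,3) H_cont])
  have "integral ubox ?f = (\<integral>z. indicator ?V z * ?f z \<partial>lborel)"
  proof (rule integral_ubox[OF _ _ cball_unit_subset])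
    show "continuous_on ubox ?f" by (rule continuous_on_add[OF c1 continuous_on_mult[OF continuous_on_const c2]])
    fix z :: 'a assume z: "z \<notin> cball 0 1"
    show "?f z = 0" by (simp add: bump_unit_zero(1)[OF z] bg0[OF z])
  qed
  also have "\<dots> = (\<integral>z. indicator ?V z * (bump_grad 0 1 z \<bullet> ((Du (x + s *\<^sub>R z) \<bullet> l) *\<^sub>R k) + bump 0 1 z * trace_of (?F' z)) \<partial>lborel)"
  proof (rule Bochner_Integration.integral_cong[OF refl])
    fix z
    show "indicator ?V z * ?f z = indicator ?V z * (bump_grad 0 1 z \<bullet> ((Du (x + s *\<^sub>R z) \<bullet> l) *\<^sub>R k) + bump 0 1 z * trace_of (?F' z))"
    proof (cases "z \<in> ?V")
      case True
      show ?thesis unfolding tr[OF True] by simp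
    qed simp
  qed
  also have "\<dots> = 0"
    by (rule interior_divergence[OF open_ball cball_unit_subset F C1_bump]) (rule bump_unit_zero)
  finally have "integral ubox ?f = 0" .
  moreover have "integral ubox ?f = integral ubox (\<lambda>z. (bump_grad 0 1 z \<bullet> k) * (Du (x + s *\<^sub>R z) \<bullet> l)) + s * integral ubox (\<lambda>z. bump 0 1 z * (H (x + s *\<^sub>R z) k \<bullet> l))"
  proof -
    have "integral ubox ?f = integral ubox (\<lambda>z. (bump_grad 0 1 z \<bullet> k) * (Du (x + s *\<^sub>R z) \<bullet> l))
        + integral ubox (\<lambda>z. s * (bump 0 1 z * (H (x + s *\<^sub>R z) k \<bullet> l)))"
      by (rule Henstock_Kurzweil_Integration.integral_add[OF integrable_continuous[OF c1]
            integrable_continuous[OF continuous_on_mult[OF continuous_on_const c2]]])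
    then show ?thesis by (simp only: Henstock_Kurzweil_Integration.integral_mult_right)
  qed
  ultimately have "s * integral ubox (\<lambda>z. bump 0 1 z * (H (x + s *\<^sub>R z) k \<bullet> l))
     = - integral ubox (\<lambda>z. (bump_grad 0 1 z \<bullet> k) * (Du (x + s *\<^sub>R z) \<bullet> l))" by linarith
  then show ?thesis using s by (simp add: field_simps)
qed

text \<open>Two passes through \<open>mean_value_derivative\<close> give the mean value identity for
  the Hessian, and integration by parts leaves only \<open>Du\<close> on the right, one order less
  than on the left. This gain is what makes the Hessian differentiable.\<close>

lemma hessian_representation:
  assumes a: "admissible x0 s" "x \<in> ball x0 s"
  shows "integral ubox (bump (0::'a) 1) * (H x k \<bullet> l)
     = - (1 / s) * integral ubox (\<lambda>z. (bump_grad 0 1 z \<bullet> k) * (Du (x + s *\<^sub>R z) \<bullet> l))"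
proof -
  let ?E = "integral ubox (bump (0::'a) 1)"
  have line: "((\<lambda>t. y + t *\<^sub>R k) has_derivative (\<lambda>h. h *\<^sub>R k)) (at (0::real))" for y k :: 'a
    by (auto intro!: derivative_eq_intros)
  obtain c where c: "\<And>x. x \<in> ball x0 s \<Longrightarrow> ?E * u x + c = integral ubox (\<lambda>z. bump 0 1 z * u (x + s *\<^sub>R z))"
    by (rule mean_value[OF a(1)]) blast
  have 1: "?E * (Du x \<bullet> l) = integral ubox (\<lambda>z. bump 0 1 z * (Du (x + s *\<^sub>R z) \<bullet> l))" if "x \<in> ball x0 s" for x
  proof (rule mean_value_derivative[OF a(1) _ u_cont _ c that])
    fix y assume "y \<in> \<Omega>"
    then have "(u has_derivative (\<lambda>h. Du y \<bullet> h)) (at (y + 0 *\<^sub>R l))" using u_der by simp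
    from has_derivative_compose[OF line this]
    show "((\<lambda>t. u (y + t *\<^sub>R l)) has_real_derivative Du y \<bullet> l) (at 0)"
      by (simp add: has_field_derivative_def mult_fun_commute)
  qed (auto intro!: continuous_intros Du_cont)
  have "?E * (H x k \<bullet> l) = integral ubox (\<lambda>z. bump 0 1 z * (H (x + s *\<^sub>R z) k \<bullet> l))"
  proof (rule mean_value_derivative[OF a(1) _ _ _ _ a(2), where g="\<lambda>y. Du y \<bullet> l" and c=0])
    fix y assume y: "y \<in> \<Omega>"
    then have "((\<lambda>y. Du y \<bullet> l) has_derivative (\<lambda>h. H y h \<bullet> l)) (at (y + 0 *\<^sub>R k))"
      using Du_der by (auto intro!: has_derivative_inner_left)
    from has_derivative_compose[OF line this]
    show "((\<lambda>t. Du (y + t *\<^sub>R k) \<bullet> l) has_real_derivative H y k \<bullet> l) (at 0)"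
      by (simp add: has_field_derivative_def mult_fun_commute linear_scale[OF H_linear[OF y]])
  next
    fix x assume "x \<in> ball x0 s"
    then show "?E * (Du x \<bullet> l) + 0 = integral ubox (\<lambda>z. bump 0 1 z * (Du (x + s *\<^sub>R z) \<bullet> l))" using 1 by simp
  qed (auto intro!: continuous_intros Du_cont H_cont)
  then show ?thesis using mean_value_parts[OF a] by simp
qed

text \<open>In the integral representation the derivative with respect to \<open>x\<close> falls on
  \<open>Du\<close>, whose derivative \<open>H\<close> is continuous.\<close>

lemma hessian_C1_local:
  assumes a: "admissible x0 s"
  obtains G where "\<And>x. x \<in> ball x0 s \<Longrightarrow> ((\<lambda>x. H x k \<bullet> l) has_derivative G x) (at x)"
    "\<And>h. continuous_on (ball x0 s) (\<lambda>x. G x h)"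
proof -
  let ?E = "integral ubox (bump (0::'a) 1)"
  have E: "0 < ?E" by (rule integral_bump_pos)
  have s: "0 < s" "0 \<le> s" "s \<le> s" using a by (auto simp: admissible_def)
  let ?U = "ball x0 s"
  \<comment> \<open>The Leibniz rule takes derivatives as bounded linear maps. \<open>row\<close>
    writes \<open>h \<mapsto> H (x + s *\<^sub>R z) h \<bullet> l\<close> as an inner product with a
    vector, so \<open>blinfun_inner_right\<close> yields a map depending continuously on both
    variables.\<close>
  let ?fx = "\<lambda>x z. blinfun_inner_right ((bump_grad 0 1 z \<bullet> k) *\<^sub>R row (H (x + s *\<^sub>R z)) l)"
  let ?J = "\<lambda>x. integral ubox (\<lambda>z. (bump_grad 0 1 z \<bullet> k) * (Du (x + s *\<^sub>R z) \<bullet> l))"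
  have in\<Omega>: "x + s *\<^sub>R z \<in> \<Omega>" if "x \<in> ?U" "z \<in> ubox" for x z by (rule admissible_in[OF a that s(2,3)])
  have rowc: "continuous_on \<Omega> (\<lambda>y. row (H y) l)" unfolding row_def by (intro continuous_intros H_cont)
  have fxc: "continuous_on (?U \<times> ubox) (\<lambda>(x, z). ?fx x z)"
  proof -
    have "continuous_on (?U \<times> ubox) (\<lambda>p. row (H (fst p + s *\<^sub>R snd p)) l)"
      by (rule continuous_on_compose2[OF rowc]) (use in\<Omega> in \<open>auto intro!: continuous_intros\<close>)
    moreover have "continuous_on (?U \<times> ubox) (\<lambda>p. bump_grad 0 1 (snd p :: 'a))"
      by (rule continuous_on_compose2[OF continuous_bump_grad[of UNIV]]) (auto intro!: continuous_intros)
    ultimately show ?thesis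
      unfolding case_prod_unfold
      by (intro bounded_linear.continuous_on[OF bounded_linear_blinfun_inner_right] continuous_intros)
  qed
  have J: "(?J has_derivative blinfun_apply (integral ubox (?fx x))) (at x within ?U)" if x: "x \<in> ?U" for x
  proof (rule leibniz_rule[OF _ _ fxc x convex_ball])
    fix x z assume x: "x \<in> ?U" and z: "z \<in> (ubox :: 'a set)"
    have y: "x + s *\<^sub>R z \<in> \<Omega>" by (rule in\<Omega>[OF x z])
    have "((\<lambda>x. x + s *\<^sub>R z) has_derivative (\<lambda>h. h)) (at x)" by (auto intro!: derivative_eq_intros)
    from has_derivative_compose[OF this Du_der[OF y]]
    have "((\<lambda>x. Du (x + s *\<^sub>R z)) has_derivative (\<lambda>h. H (x + s *\<^sub>R z) h)) (at x)" .
    then have "((\<lambda>x. (bump_grad 0 1 z \<bullet> k) * (Du (x + s *\<^sub>R z) \<bullet> l)) has_derivative (\<lambda>h. (bump_grad 0 1 z \<bullet> k) * (H (x + s *\<^sub>R z) h \<bullet> l))) (at x)"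
      by (intro has_derivative_mult_right has_derivative_inner_left)
    then have "((\<lambda>x. (bump_grad 0 1 z \<bullet> k) * (Du (x + s *\<^sub>R z) \<bullet> l)) has_derivative blinfun_apply (?fx x z)) (at x)"
      by (rule has_derivative_eq_rhs) (auto simp: fun_eq_iff inner_row[OF H_linear[OF y]])
    then show "((\<lambda>x. (bump_grad 0 1 z \<bullet> k) * (Du (x + s *\<^sub>R z) \<bullet> l)) has_derivative blinfun_apply (?fx x z)) (at x within ?U)"
      by (rule has_derivative_at_withinI)
  next
    fix x assume x: "x \<in> ?U"
    show "(\<lambda>z. (bump_grad 0 1 z \<bullet> k) * (Du (x + s *\<^sub>R z) \<bullet> l)) integrable_on ubox"
      by (intro integrable_continuous continuous_intros continuous_bump_grad compose_cont[OF a x s(2,3) Du_cont])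
  qed
  define G where "G x h = (- (1 / s) / ?E) * blinfun_apply (integral ubox (?fx x)) h" for x h
  have rep: "H x k \<bullet> l = (- (1 / s) / ?E) * ?J x" if "x \<in> ?U" for x
  proof -
    have "H x k \<bullet> l = (?E * (H x k \<bullet> l)) / ?E" using E by simp
    also have "\<dots> = (- (1 / s) * ?J x) / ?E" by (simp only: hessian_representation[OF a that])
    finally show ?thesis by simp
  qed
  show thesis
  proof (rule that[of G])
    fix x assume x: "x \<in> ?U"
    have "(?J has_derivative blinfun_apply (integral ubox (?fx x))) (at x)"
      using J[OF x] at_within_open[OF x open_ball] by simp
    then have "((\<lambda>x. (- (1 / s) / ?E) * ?J x) has_derivative G x) (at x)"
      unfolding G_def[abs_def] by (rule has_derivative_mult_right)
    then show "((\<lambda>x. H x k \<bullet> l) has_derivative G x) (at x)"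
      by (rule has_derivative_transform_within_open[OF _ open_ball x]) (use rep in simp)
  next
    fix h
    have "continuous_on ?U (\<lambda>x. integral ubox (?fx x))" by (rule integral_continuous_on_param[OF fxc])
    then show "continuous_on ?U (\<lambda>x. G x h)" unfolding G_def by (intro continuous_intros)
  qed
qed

end

section \<open>Third derivatives and the divergence of D^2u Du\<close>

context poisson begin

text \<open>The derivative of \<open>H y k\<close> in direction \<open>h\<close>, assembled from
  scalar components because regularity was obtained for \<open>H y k \<bullet> l\<close>. Using
  \<open>frechet_derivative\<close> gives one function for all of \<Omega>, so the local results fit
  together.\<close>

definition T :: "'a \<Rightarrow> 'a \<Rightarrow> 'a \<Rightarrow> 'a" where
  "T x k h = (\<Sum>l\<in>Basis. frechet_derivative (\<lambda>y. H y k \<bullet> l) (at x) h *\<^sub>R l)"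

lemma T_inner: "l \<in> Basis \<Longrightarrow> T x k h \<bullet> l = frechet_derivative (\<lambda>y. H y k \<bullet> l) (at x) h"
  unfolding T_def by (simp add: inner_sum_left inner_Basis if_distrib cong: if_cong)

lemma hessian_C1:
  assumes "x \<in> \<Omega>"
  shows "((\<lambda>y. H y k) has_derivative T x k) (at x)"
    and "\<exists>s>0. ball x s \<subseteq> \<Omega> \<and> (\<forall>h. continuous_on (ball x s) (\<lambda>y. T y k h))"
proof -
  obtain s where s: "admissible x s" using admissible_exists[OF assms] by blast
  then have s0: "0 < s" by (simp add: admissible_def)
  have "\<exists>G. (\<forall>y\<in>ball x s. ((\<lambda>y. H y k \<bullet> l) has_derivative G y) (at y)) \<and> (\<forall>h. continuous_on (ball x s) (\<lambda>y. G y h))" for l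
    by (rule hessian_C1_local[OF s, of k l]) blast
  then obtain G where G: "\<And>l y. y \<in> ball x s \<Longrightarrow> ((\<lambda>y. H y k \<bullet> l) has_derivative G l y) (at y)"
    "\<And>l h. continuous_on (ball x s) (\<lambda>y. G l y h)" by metis
  have fd: "frechet_derivative (\<lambda>y. H y k \<bullet> l) (at y) = G l y" if "y \<in> ball x s" for l y
    using frechet_derivative_at[OF G(1)[OF that]] by simp
  show "((\<lambda>y. H y k) has_derivative T x k) (at x)"
    unfolding has_derivative_componentwise_within[of _ "T x k"]
    using G(1)[of x] fd[of x] s0 by (simp add: T_inner)
  have "continuous_on (ball x s) (\<lambda>y. T y k h)" for h
  proof -
    have "continuous_on (ball x s) (\<lambda>y. \<Sum>l\<in>Basis. G l y h *\<^sub>R l)" by (intro continuous_intros G(2))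
    then show ?thesis by (rule continuous_on_eq) (simp add: T_def fd)
  qed
  moreover have "ball x s \<subseteq> \<Omega>" using admissible_sub[OF s] by blast
  ultimately show "\<exists>s>0. ball x s \<subseteq> \<Omega> \<and> (\<forall>h. continuous_on (ball x s) (\<lambda>y. T y k h))"
    using s0 by blast
qed

lemma T_cont: "continuous_on \<Omega> (\<lambda>y. T y k h)"
proof (rule continuous_at_imp_continuous_on, rule ballI)
  fix x assume "x \<in> \<Omega>"
  then obtain s where "0 < s" "continuous_on (ball x s) (\<lambda>y. T y k h)" using hessian_C1(2) by blast
  then show "isCont (\<lambda>y. T y k h) x" by (simp add: continuous_on_eq_continuous_at)
qed

text \<open>By symmetry of the Hessian, \<open>H y k\<close> is the gradient of
  \<open>Du y \<bullet> k\<close>, so the symmetry of second derivatives applies to that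
  function.\<close>

lemma T_sym1:
  assumes x: "x \<in> \<Omega>" shows "T x k h \<bullet> l = T x k l \<bullet> h"
proof (rule second_derivative_symmetric[OF op x _ hessian_C1(1)[OF x]])
  fix y assume y: "y \<in> \<Omega>"
  have "((\<lambda>y. Du y \<bullet> k) has_derivative (\<lambda>h. H y h \<bullet> k)) (at y)"
    by (intro has_derivative_inner_left Du_der y)
  then show "((\<lambda>y. Du y \<bullet> k) has_derivative (\<lambda>h. H y k \<bullet> h)) (at y)"
    by (simp only: H_sym[OF y, of _ k])
qed

lemma T_sym2:
  assumes x: "x \<in> \<Omega>" shows "T x k h \<bullet> l = T x l h \<bullet> k"
proof -
  have 1: "((\<lambda>y. H y k \<bullet> l) has_derivative (\<lambda>h. T x k h \<bullet> l)) (at x)"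
    by (intro has_derivative_inner_left hessian_C1(1) x)
  have "((\<lambda>y. H y l \<bullet> k) has_derivative (\<lambda>h. T x l h \<bullet> k)) (at x)"
    by (intro has_derivative_inner_left hessian_C1(1) x)
  then have "((\<lambda>y. H y k \<bullet> l) has_derivative (\<lambda>h. T x l h \<bullet> k)) (at x)"
    by (rule has_derivative_transform_within_open[OF _ op x]) (simp add: H_sym)
  from has_derivative_unique[OF 1 this] show ?thesis by metis
qed

text \<open>\<open>T\<close> is symmetric in all three slots, so this trace is the derivative in
  direction \<open>k\<close> of the Laplacian, which is constant.\<close>

lemma T_trace:
  assumes x: "x \<in> \<Omega>" shows "trace_of (T x k) = 0"
proof -
  have "((\<lambda>y. trace_of (H y)) has_derivative (\<lambda>h. \<Sum>b\<in>Basis. T x b h \<bullet> b)) (at x)"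
    unfolding trace_of_def by (intro has_derivative_sum has_derivative_inner_left hessian_C1(1) x)
  moreover have "((\<lambda>y. trace_of (H y)) has_derivative (\<lambda>h. 0)) (at x)"
    by (rule has_derivative_transform_within_open[OF _ op x, where f="\<lambda>_. N"]) (auto simp: lap)
  ultimately have "(\<lambda>h. \<Sum>b\<in>Basis. T x b h \<bullet> b) = (\<lambda>h. 0)" by (rule has_derivative_unique)
  then have "(\<Sum>b\<in>Basis. T x b k \<bullet> b) = 0" by metis
  moreover have "T x k b \<bullet> b = T x b k \<bullet> b" for b
    using T_sym2[OF x, of k b b] T_sym1[OF x, of b b k] by simp
  ultimately show ?thesis by (simp add: trace_of_def)
qed

text \<open>The trace of the square of the Hessian, hence by symmetry its squared Frobenius norm; in
  this form it comes directly out of the product rule.\<close>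

definition hess_sq :: "'a \<Rightarrow> real" where
  "hess_sq x = (\<Sum>b\<in>Basis. \<Sum>k\<in>Basis. (H x b \<bullet> k) * (H x k \<bullet> b))"

definition dHDu :: "'a \<Rightarrow> 'a \<Rightarrow> 'a" where
  "dHDu x h = (\<Sum>k\<in>Basis. (H x h \<bullet> k) *\<^sub>R H x k + (Du x \<bullet> k) *\<^sub>R T x k h)"

lemma H_expand: "x \<in> \<Omega> \<Longrightarrow> H x y = (\<Sum>k\<in>Basis. (y \<bullet> k) *\<^sub>R H x k)"
proof -
  assume x: "x \<in> \<Omega>"
  have "H x y = H x (\<Sum>k\<in>Basis. (y \<bullet> k) *\<^sub>R k)" by (simp add: euclidean_representation)
  also have "\<dots> = (\<Sum>k\<in>Basis. (y \<bullet> k) *\<^sub>R H x k)"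
    by (simp add: linear_sum[OF H_linear[OF x]] linear_scale[OF H_linear[OF x]])
  finally show ?thesis .
qed

lemma HDu_derivative:
  assumes x: "x \<in> \<Omega>" shows "((\<lambda>y. H y (Du y)) has_derivative dHDu x) (at x)"
proof -
  have "((\<lambda>y. \<Sum>k\<in>Basis. (Du y \<bullet> k) *\<^sub>R H y k) has_derivative
     (\<lambda>h. \<Sum>k\<in>Basis. (Du x \<bullet> k) *\<^sub>R T x k h + (H x h \<bullet> k) *\<^sub>R H x k)) (at x)"
    by (intro has_derivative_sum has_derivative_scaleR has_derivative_inner_left Du_der hessian_C1(1) x)
  then have "((\<lambda>y. \<Sum>k\<in>Basis. (Du y \<bullet> k) *\<^sub>R H y k) has_derivative dHDu x) (at x)"
    by (rule has_derivative_eq_rhs) (auto simp: dHDu_def fun_eq_iff add.commute)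
  then show ?thesis
    by (rule has_derivative_transform_within_open[OF _ op x]) (simp add: H_expand)
qed

text \<open>The third derivatives enter only through traces of \<open>T\<close> and drop out. What
  is left are second derivatives, which extend continuously to the closure in the
  application.\<close>

lemma dHDu_trace:
  assumes x: "x \<in> \<Omega>" shows "trace_of (dHDu x) = hess_sq x"
proof -
  have "trace_of (dHDu x) = (\<Sum>b\<in>Basis. \<Sum>k\<in>Basis. (H x b \<bullet> k) * (H x k \<bullet> b)) + (\<Sum>b\<in>Basis. \<Sum>k\<in>Basis. (Du x \<bullet> k) * (T x k b \<bullet> b))"
    unfolding trace_of_def dHDu_def by (simp add: inner_sum_left inner_add_left sum.distrib)
  also have "(\<Sum>b\<in>Basis. \<Sum>k\<in>Basis. (Du x \<bullet> k) * (T x k b \<bullet> b)) = (\<Sum>k\<in>Basis. (Du x \<bullet> k) * trace_of (T x k))"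
    unfolding trace_of_def sum_distrib_left by (rule sum.swap)
  finally show ?thesis by (simp add: T_trace[OF x] hess_sq_def)
qed

lemma dHDu_cont: "continuous_on \<Omega> (\<lambda>x. dHDu x h)"
  unfolding dHDu_def by (intro continuous_intros H_cont Du_cont T_cont)

end

section \<open>The integral identity\<close>

lemma trace_of_add: "trace_of (\<lambda>h. L h + M h) = trace_of L + trace_of M"
  by (simp add: trace_of_def inner_add_left sum.distrib)

lemma trace_of_diff: "trace_of (\<lambda>h. L h - M h) = trace_of L - trace_of M"
  by (simp add: trace_of_def inner_diff_left sum_subtractf)

lemma trace_of_scaleR: "trace_of (\<lambda>h. c *\<^sub>R L h) = c * trace_of L"
  by (simp add: trace_of_def sum_distrib_left)

lemma trace_of_rank_one:
  assumes "linear f" shows "trace_of (\<lambda>h. f h *\<^sub>R y) = f y"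
proof -
  have "f y = f (\<Sum>b\<in>Basis. (y \<bullet> b) *\<^sub>R b)" by (simp add: euclidean_representation)
  also have "\<dots> = (\<Sum>b\<in>Basis. (y \<bullet> b) * f b)"
    by (simp add: linear_sum[OF assms] linear_scale[OF assms])
  finally show ?thesis by (simp add: trace_of_def mult.commute)
qed

text \<open>\<open>F'\<close> may be unbounded near the boundary, but its trace is \<open>g\<close>,
  which contains no third derivatives and is continuous on the closure. This provides the bound that
  \<open>divergence_theorem\<close> asks for.\<close>

theorem flux_identity:
  fixes \<Omega> :: "'a::euclidean_space set" and ubar :: real
  assumes d: "2 \<le> DIM('a)" and bnd: "bounded \<Omega>" and \<nu>: "normal_patches \<Omega> \<nu>"
    and U: "poisson \<Omega> u Du H N" and V: "poisson \<Omega> v Dv K N"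
    and cu: "continuous_on (closure \<Omega>) u" "continuous_on (closure \<Omega>) Du" "\<And>h. continuous_on (closure \<Omega>) (\<lambda>x. H x h)"
    and cv: "continuous_on (closure \<Omega>) Dv" "\<And>h. continuous_on (closure \<Omega>) (\<lambda>x. K x h)"
    and lin: "\<And>x. linear (H x)" "\<And>x. linear (K x)"
  defines "F \<equiv> \<lambda>x. (ubar - u x) *\<^sub>R (H x (Du x) - Du x) + (1/2 * (Du x \<bullet> Du x)) *\<^sub>R (Du x + Dv x)
      - (Dv x \<bullet> Du x) *\<^sub>R Du x + (N * (ubar - u x)) *\<^sub>R (Du x - Dv x)"
    and "g \<equiv> \<lambda>x. (ubar - u x) * (poisson.hess_sq H x - N) + (Du x - K x (Du x)) \<bullet> Du x"
  shows "(\<integral>x. indicator \<Omega> x * g x \<partial>lborel) = (\<integral>x. indicator (frontier \<Omega>) x * (F x \<bullet> \<nu> x) \<partial>hausdorff_measure (DIM('a) - 1))"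
proof -
  interpret u: poisson \<Omega> u Du H N by (rule U)
  interpret v: poisson \<Omega> v Dv K N by (rule V)
  \<comment> \<open>The product rule, kept as a sum of scalar multiples of linear maps and of
    rank-one maps, so that the trace rules evaluate it term by term.\<close>
  define F' where "F' x h = ((ubar - u x) *\<^sub>R (u.dHDu x h - H x h) - (Du x \<bullet> h) *\<^sub>R (H x (Du x) - Du x))
     + ((1/2 * (Du x \<bullet> Du x)) *\<^sub>R (H x h + K x h) + (H x h \<bullet> Du x) *\<^sub>R (Du x + Dv x))
     - ((Dv x \<bullet> Du x) *\<^sub>R H x h + (K x h \<bullet> Du x + H x h \<bullet> Dv x) *\<^sub>R Du x)
     + ((N * (ubar - u x)) *\<^sub>R (H x h - K x h) - (N * (Du x \<bullet> h)) *\<^sub>R (Du x - Dv x))" for x h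
  have expand: "L y = (\<Sum>k\<in>Basis. (y \<bullet> k) *\<^sub>R L k)" if "linear L" for L :: "'a \<Rightarrow> 'a" and y
  proof -
    have "L y = L (\<Sum>k\<in>Basis. (y \<bullet> k) *\<^sub>R k)" by (simp add: euclidean_representation)
    also have "\<dots> = (\<Sum>k\<in>Basis. (y \<bullet> k) *\<^sub>R L k)"
      by (simp add: linear_sum[OF that] linear_scale[OF that])
    finally show ?thesis .
  qed
  have cHDu: "continuous_on (closure \<Omega>) (\<lambda>x. H x (Du x))"
  proof -
    have "H x (Du x) = (\<Sum>k\<in>Basis. (Du x \<bullet> k) *\<^sub>R H x k)" for x by (rule expand[OF lin(1)])
    then show ?thesis by (simp only:) (intro continuous_intros cu)
  qed
  have cKDu: "continuous_on (closure \<Omega>) (\<lambda>x. K x (Du x))"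
  proof -
    have "K x (Du x) = (\<Sum>k\<in>Basis. (Du x \<bullet> k) *\<^sub>R K x k)" for x by (rule expand[OF lin(2)])
    then show ?thesis by (simp only:) (intro continuous_intros cu cv)
  qed
  have cF: "continuous_on (closure \<Omega>) F" unfolding F_def by (intro continuous_intros cu cv cHDu)
  have sub: "continuous_on \<Omega> f" if "continuous_on (closure \<Omega>) f" for f :: "'a \<Rightarrow> 'a"
    using that closure_subset by (rule continuous_on_subset)
  have field: "C1_field \<Omega> F F'"
    unfolding C1_field_def
  proof (intro conjI ballI allI cF)
    fix x assume x: "x \<in> \<Omega>"
    note ud = u.u_der[OF x] and Dud = u.Du_der[OF x] and Dvd = v.Du_der[OF x] and HD = u.HDu_derivative[OF x]
    have w: "((\<lambda>x. ubar - u x) has_derivative (\<lambda>h. - (Du x \<bullet> h))) (at x)"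
      using has_derivative_diff[OF has_derivative_const ud, of ubar] by simp
    have 1: "((\<lambda>x. (ubar - u x) *\<^sub>R (H x (Du x) - Du x)) has_derivative
       (\<lambda>h. (ubar - u x) *\<^sub>R (u.dHDu x h - H x h) + (- (Du x \<bullet> h)) *\<^sub>R (H x (Du x) - Du x))) (at x)"
      by (rule has_derivative_scaleR[OF w has_derivative_diff[OF HD Dud]])
    have 2: "((\<lambda>x. (1/2 * (Du x \<bullet> Du x)) *\<^sub>R (Du x + Dv x)) has_derivative
       (\<lambda>h. (1/2 * (Du x \<bullet> Du x)) *\<^sub>R (H x h + K x h) + (1/2 * (Du x \<bullet> H x h + H x h \<bullet> Du x)) *\<^sub>R (Du x + Dv x))) (at x)"
      by (rule has_derivative_scaleR[OF has_derivative_mult_right[OF has_derivative_inner[OF Dud Dud]] has_derivative_add[OF Dud Dvd]])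
    have 3: "((\<lambda>x. (Dv x \<bullet> Du x) *\<^sub>R Du x) has_derivative
       (\<lambda>h. (Dv x \<bullet> Du x) *\<^sub>R H x h + (Dv x \<bullet> H x h + K x h \<bullet> Du x) *\<^sub>R Du x)) (at x)"
      by (rule has_derivative_scaleR[OF has_derivative_inner[OF Dvd Dud] Dud])
    have 4: "((\<lambda>x. (N * (ubar - u x)) *\<^sub>R (Du x - Dv x)) has_derivative
       (\<lambda>h. (N * (ubar - u x)) *\<^sub>R (H x h - K x h) + (N * - (Du x \<bullet> h)) *\<^sub>R (Du x - Dv x))) (at x)"
      by (rule has_derivative_scaleR[OF has_derivative_mult_right[OF w] has_derivative_diff[OF Dud Dvd]])
    have "(F has_derivative (\<lambda>h. ((ubar - u x) *\<^sub>R (u.dHDu x h - H x h) + (- (Du x \<bullet> h)) *\<^sub>R (H x (Du x) - Du x))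
       + ((1/2 * (Du x \<bullet> Du x)) *\<^sub>R (H x h + K x h) + (1/2 * (Du x \<bullet> H x h + H x h \<bullet> Du x)) *\<^sub>R (Du x + Dv x))
       - ((Dv x \<bullet> Du x) *\<^sub>R H x h + (Dv x \<bullet> H x h + K x h \<bullet> Du x) *\<^sub>R Du x)
       + ((N * (ubar - u x)) *\<^sub>R (H x h - K x h) + (N * - (Du x \<bullet> h)) *\<^sub>R (Du x - Dv x)))) (at x)"
      unfolding F_def by (rule has_derivative_add[OF has_derivative_diff[OF has_derivative_add[OF 1 2] 3] 4])
    moreover have "Du x \<bullet> H x h = H x h \<bullet> Du x" "Dv x \<bullet> H x h = H x h \<bullet> Dv x" for h by (rule inner_commute)+
    ultimately show "(F has_derivative F' x) (at x)"
      by (rule_tac has_derivative_eq_rhs) (auto simp: F'_def fun_eq_iff add.commute)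
  next
    fix h
    show "continuous_on \<Omega> (\<lambda>x. F' x h)"
      unfolding F'_def
      by (intro continuous_intros u.u_cont u.Du_cont v.Du_cont u.H_cont v.H_cont u.dHDu_cont sub[OF cHDu])
  qed
  have tr: "trace_of (F' x) = g x" if x: "x \<in> \<Omega>" for x
  proof -
    have li: "linear (\<lambda>h. Du x \<bullet> h)" "linear (\<lambda>h. N * (Du x \<bullet> h))" "linear (\<lambda>h. H x h \<bullet> Du x)"
      "linear (\<lambda>h. K x h \<bullet> Du x + H x h \<bullet> Dv x)"
      by (auto intro!: linearI simp: inner_add_right linear_add[OF lin(1)] linear_add[OF lin(2)]
          linear_scale[OF lin(1)] linear_scale[OF lin(2)] inner_add_left algebra_simps)
    have "trace_of (F' x) = ((ubar - u x) * (u.hess_sq x - N) - Du x \<bullet> (H x (Du x) - Du x))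
     + ((1/2 * (Du x \<bullet> Du x)) * (N + N) + H x (Du x + Dv x) \<bullet> Du x)
     - ((Dv x \<bullet> Du x) * N + (K x (Du x) \<bullet> Du x + H x (Du x) \<bullet> Dv x))
     + ((N * (ubar - u x)) * (N - N) - N * (Du x \<bullet> (Du x - Dv x)))"
      unfolding F'_def trace_of_add trace_of_diff trace_of_scaleR
        trace_of_rank_one[OF li(1)] trace_of_rank_one[OF li(2)] trace_of_rank_one[OF li(3)] trace_of_rank_one[OF li(4)]
        u.dHDu_trace[OF x] u.lap[OF x] v.lap[OF x] ..
    \<comment> \<open>Symmetry of the Hessian of \<open>u\<close> brings the mixed term into the
      form that cancels against the one coming from
      \<open>(Dv x \<bullet> Du x) *\<^sub>R Du x\<close>.\<close>
    also have "H x (Du x + Dv x) \<bullet> Du x = H x (Du x) \<bullet> Du x + H x (Du x) \<bullet> Dv x"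
      using u.H_sym[OF x, of "Dv x" "Du x"] by (simp add: linear_add[OF lin(1)] inner_add_left)
    finally show ?thesis
      unfolding g_def by (simp add: inner_diff_left inner_diff_right inner_commute algebra_simps)
  qed
  have cg: "continuous_on (closure \<Omega>) g"
    unfolding g_def u.hess_sq_def by (intro continuous_intros cu cv cKDu)
  have "compact (closure \<Omega>)" using bnd by auto
  from compact_imp_bounded[OF compact_continuous_image[OF cg this]]
  obtain M where M: "\<forall>x\<in>closure \<Omega>. \<bar>g x\<bar> \<le> M" by (auto simp: bounded_iff)
  have "(\<integral>x. indicator \<Omega> x * trace_of (F' x) \<partial>lborel)
     = (\<integral>x. indicator (frontier \<Omega>) x * (F x \<bullet> \<nu> x) \<partial>hausdorff_measure (DIM('a) - 1))"
  proof (rule divergence_theorem[OF d u.op bnd \<nu> field])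
    fix x assume x: "x \<in> \<Omega>"
    show "\<bar>trace_of (F' x)\<bar> \<le> M" unfolding tr[OF x] using M x closure_subset by blast
  qed
  moreover have "(\<integral>x. indicator \<Omega> x * trace_of (F' x) \<partial>lborel) = (\<integral>x. indicator \<Omega> x * g x \<partial>lborel)"
    by (intro Bochner_Integration.integral_cong refl) (auto simp: indicator_def tr)
  ultimately show ?thesis by simp
qed

section \<open>Coordinates and the operators of the statement\<close>

lemma sum_Basis_cart:
  fixes f :: "real^'n \<Rightarrow> real"
  shows "(\<Sum>b\<in>Basis. f b) = (\<Sum>i\<in>UNIV. f (axis i 1))"
proof -
  have B: "(Basis :: (real^'n) set) = (\<lambda>i. axis i 1) ` UNIV" by (auto simp: Basis_vec_def)
  have I: "inj (\<lambda>i :: 'n. axis i (1::real))" by (simp add: inj_on_def axis_eq_axis)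
  show ?thesis unfolding B sum.reindex[OF I] by (simp add: o_def)
qed

lemma partial_deriv_eq:
  assumes "(f has_derivative (\<lambda>h. G \<bullet> h)) (at x)" shows "partial_deriv f i x = G \<bullet> axis i 1"
proof -
  have "((\<lambda>t. x + t *\<^sub>R axis i 1) has_derivative (\<lambda>h. h *\<^sub>R axis i 1)) (at (0::real))"
    by (auto intro!: derivative_eq_intros)
  moreover have "(f has_derivative (\<lambda>h. G \<bullet> h)) (at (x + 0 *\<^sub>R axis i 1))" using assms by simp
  ultimately have "((\<lambda>t. f (x + t *\<^sub>R axis i 1)) has_derivative (\<lambda>h. G \<bullet> (h *\<^sub>R axis i 1))) (at 0)"
    by (rule has_derivative_compose)
  then have "((\<lambda>t. f (x + t *\<^sub>R axis i 1)) has_field_derivative (G \<bullet> axis i 1)) (at 0)"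
    by (simp add: has_field_derivative_def mult_fun_commute)
  then show ?thesis unfolding partial_deriv_def by (rule DERIV_imp_deriv)
qed

text \<open>The inner partial derivative has to be identified with a component of the gradient on a
  neighbourhood of \<open>x\<close> before it can be differentiated again; openness of \<Omega>
  provides the neighbourhood.\<close>

lemma laplacian_eq_trace:
  fixes f :: "real^'n \<Rightarrow> real"
  assumes \<Omega>: "open \<Omega>" "x \<in> \<Omega>" and f: "\<And>y. y \<in> \<Omega> \<Longrightarrow> (f has_derivative (\<lambda>h. G y \<bullet> h)) (at y)"
    and G: "(G has_derivative L) (at x)"
  shows "laplacian f x = trace_of L"
proof -
  have L: "linear L" using G by (rule has_derivative_linear)
  have "partial_deriv (partial_deriv f i) i x = L (axis i 1) \<bullet> axis i 1" for i
  proof -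
    have "((\<lambda>y. G y \<bullet> axis i 1) has_derivative (\<lambda>h. L h \<bullet> axis i 1)) (at x)"
      by (intro has_derivative_inner_left G)
    then have "(partial_deriv f i has_derivative (\<lambda>h. L h \<bullet> axis i 1)) (at x)"
      by (rule has_derivative_transform_within_open[OF _ \<Omega>]) (simp add: partial_deriv_eq[OF f])
    then have "(partial_deriv f i has_derivative (\<lambda>h. row L (axis i 1) \<bullet> h)) (at x)"
      by (simp only: inner_row[OF L])
    from partial_deriv_eq[OF this] show ?thesis by (simp only: inner_row[OF L])
  qed
  then show ?thesis by (simp add: laplacian_def trace_of_def sum_Basis_cart)
qed

lemma normal_patches_if_exterior_unit_normal:
  fixes \<Omega> :: "(real^'n) set"
  assumes "open \<Omega>" "exterior_unit_normal \<Omega> \<nu>" shows "normal_patches \<Omega> \<nu>"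
  unfolding normal_patches_def
proof
  fix p assume "p \<in> frontier \<Omega>"
  then obtain r \<phi> D\<phi> where l: "local_defining_function \<Omega> p r \<phi> D\<phi>"
    and n: "\<forall>x\<in>frontier \<Omega> \<inter> ball p r. \<nu> x = D\<phi> x /\<^sub>R norm (D\<phi> x)"
    using assms(2) unfolding exterior_unit_normal_def by blast
  obtain D2 where C: "C2_on (ball p r) \<phi> D\<phi> D2" using l unfolding local_defining_function_def by blast
  have "boundary_patch \<Omega> p r \<phi> D\<phi>"
  proof
    show "continuous_on (ball p r) D\<phi>"
      by (intro continuous_at_imp_continuous_on ballI)
        (use C has_derivative_continuous in \<open>unfold C2_on_def, blast\<close>)
  qed (use l C assms(1) in \<open>auto simp: local_defining_function_def C2_on_def\<close>)
  then show "\<exists>r \<phi> D\<phi>. boundary_patch \<Omega> p r \<phi> D\<phi> \<and> (\<forall>x\<in>frontier \<Omega> \<inter> ball p r. \<nu> x = D\<phi> x /\<^sub>R norm (D\<phi> x))"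
    using n by blast
qed

lemma continuous_on_matrix_vector:
  fixes A :: "'a::topological_space \<Rightarrow> real^'n^'m"
  assumes "continuous_on S A" "continuous_on S f" shows "continuous_on S (\<lambda>x. A x *v f x)"
  unfolding matrix_vector_mult_def using assms by (intro continuous_intros)

lemma poisson_if_C2_closure:
  fixes \<Omega> :: "(real^'n) set"
  assumes \<Omega>: "open \<Omega>" and u: "C2_closure \<Omega> u Du D2u" and lap: "\<forall>x\<in>\<Omega>. laplacian u x = N"
  shows "poisson \<Omega> u Du (\<lambda>x. (*v) (D2u x)) N"
proof
  show ud: "(u has_derivative (\<lambda>h. Du x \<bullet> h)) (at x)" and Dud: "(Du has_derivative (*v) (D2u x)) (at x)" if "x \<in> \<Omega>" for x
    using u that by (auto simp: C2_closure_def C2_on_def)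
  show "continuous_on \<Omega> (\<lambda>x. D2u x *v h)" for h
    using u by (intro continuous_on_matrix_vector) (auto simp: C2_closure_def C2_on_def)
  show "trace_of ((*v) (D2u x)) = N" if "x \<in> \<Omega>" for x
    using laplacian_eq_trace[OF \<Omega> that ud Dud[OF that]] lap that by simp
qed (rule \<Omega>)

lemma integral_open_eq_lborel:
  fixes f :: "'a::euclidean_space \<Rightarrow> real"
  assumes "integrable lborel (\<lambda>x. indicator \<Omega> x * f x)"
  shows "integral \<Omega> f = (\<integral>x. indicator \<Omega> x * f x \<partial>lborel)"
proof -
  have "set_integrable lborel \<Omega> f" using assms by (simp add: set_integrable_def)
  then show ?thesis using set_borel_integral_eq_integral(2)[of \<Omega> f] by (simp add: set_lebesgue_integral_def)
qed

theorem theorem3p1: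
  fixes \<Omega> :: "(real^'n) set"
    and u v :: "real^'n \<Rightarrow> real"
    and Du Dv :: "real^'n \<Rightarrow> real^'n"
    and D2u D2v :: "real^'n \<Rightarrow> real^'n^'n"
    and \<nu> :: "real^'n \<Rightarrow> real^'n"
  assumes N2: "CARD('n) \<ge> 2"
    and dom: "open \<Omega>" "connected \<Omega>" "bounded \<Omega>" "\<Omega> \<noteq> {}"
    and bdry: "C2_boundary \<Omega>"
    and normal: "exterior_unit_normal \<Omega> \<nu>"
    and u: "C2_closure \<Omega> u Du D2u"
    and v: "C2_closure \<Omega> v Dv D2v"
    and lap_u: "\<forall>x\<in>\<Omega>. laplacian u x = real CARD('n)"
    and lap_v: "\<forall>x\<in>\<Omega>. laplacian v x = real CARD('n)"
  shows
    "let N = real CARD('n); \<Gamma> = frontier \<Omega>;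
         ubar = (SUP x\<in>closure \<Omega>. u x);
         P = (\<lambda>x. (1/2) * (norm (Du x))\<^sup>2 + (ubar - u x));
         u\<^sub>\<nu> = (\<lambda>x. Du x \<bullet> \<nu> x); v\<^sub>\<nu> = (\<lambda>x. Dv x \<bullet> \<nu> x)
     in integral \<Omega> (\<lambda>x. (ubar - u x) * laplacian P x)
        + integral \<Omega> (\<lambda>x. ((mat 1 - D2v x) *v Du x) \<bullet> Du x)
      = surface_integral \<Gamma> (\<lambda>x. (ubar - u x) * ((D2u x *v Du x) \<bullet> \<nu> x))
        + (1/2) * surface_integral \<Gamma> (\<lambda>x. (norm (Du x))\<^sup>2 * (u\<^sub>\<nu> x + v\<^sub>\<nu> x))
        - surface_integral \<Gamma> (\<lambda>x. (Dv x \<bullet> Du x) * u\<^sub>\<nu> x)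
        - surface_integral \<Gamma> (\<lambda>x. (ubar - u x) * u\<^sub>\<nu> x)
        + N * surface_integral \<Gamma> (\<lambda>x. (ubar - u x) * (u\<^sub>\<nu> x - v\<^sub>\<nu> x))"
proof -
  define N where "N = real CARD('n)"
  define ubar where "ubar = (SUP x\<in>closure \<Omega>. u x)"
  define P where "P = (\<lambda>x. (1/2) * (norm (Du x))\<^sup>2 + (ubar - u x))"
  let ?H = "hausdorff_measure (CARD('n) - 1) :: (real^'n) measure"
  have d: "2 \<le> DIM(real^'n)" using N2 by simp
  have \<nu>: "normal_patches \<Omega> \<nu>" by (rule normal_patches_if_exterior_unit_normal[OF dom(1) normal])
  have U: "poisson \<Omega> u Du (\<lambda>x. (*v) (D2u x)) N" unfolding N_def by (rule poisson_if_C2_closure[OF dom(1) u lap_u])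
  have V: "poisson \<Omega> v Dv (\<lambda>x. (*v) (D2v x)) N" unfolding N_def by (rule poisson_if_C2_closure[OF dom(1) v lap_v])
  interpret u: poisson \<Omega> u Du "\<lambda>x. (*v) (D2u x)" N by (rule U)
  have cu: "continuous_on (closure \<Omega>) u" "continuous_on (closure \<Omega>) Du" "continuous_on (closure \<Omega>) D2u"
    and cv: "continuous_on (closure \<Omega>) Dv" "continuous_on (closure \<Omega>) D2v"
    using u v by (auto simp: C2_closure_def)
  let ?hs = "\<lambda>x. u.hess_sq x - N"
  let ?q = "\<lambda>x. (Du x - D2v x *v Du x) \<bullet> Du x"
  \<comment> \<open>On \<Omega> the gradient of \<open>P\<close> is
    \<open>D2u y *v Du y - Du y\<close>. Its divergence is |D^2u|^2 minus the Laplacian N of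
    \<open>u\<close>, and N equals (Delta u)^2 / N.\<close>
  have lapP: "laplacian P x = ?hs x" if x: "x \<in> \<Omega>" for x
  proof -
    have "laplacian P x = trace_of (\<lambda>h. u.dHDu x h - D2u x *v h)"
    proof (rule laplacian_eq_trace[OF dom(1) x, where G="\<lambda>y. D2u y *v Du y - Du y"])
      fix y assume y: "y \<in> \<Omega>"
      have "((\<lambda>y. 1/2 * (Du y \<bullet> Du y) + (ubar - u y)) has_derivative
         (\<lambda>h. 1/2 * (Du y \<bullet> (D2u y *v h) + (D2u y *v h) \<bullet> Du y) + (0 - Du y \<bullet> h))) (at y)"
        by (intro has_derivative_add has_derivative_mult_right has_derivative_inner has_derivative_diff has_derivative_const
            u.Du_der u.u_der y)
      moreover have "(D2u y *v h) \<bullet> Du y = (D2u y *v Du y) \<bullet> h" for h by (rule u.H_sym[OF y])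
      ultimately show "(P has_derivative (\<lambda>h. (D2u y *v Du y - Du y) \<bullet> h)) (at y)"
        unfolding P_def power2_norm_eq_inner
        by (rule_tac has_derivative_eq_rhs) (auto simp: inner_diff_left inner_commute[of "Du y"] fun_eq_iff)
    next
      show "((\<lambda>y. D2u y *v Du y - Du y) has_derivative (\<lambda>h. u.dHDu x h - D2u x *v h)) (at x)"
        by (intro has_derivative_diff u.HDu_derivative u.Du_der x)
    qed
    then show ?thesis by (simp add: trace_of_diff u.dHDu_trace[OF x] u.lap[OF x])
  qed
  have bounded_int: "integrable lborel (\<lambda>x. indicator \<Omega> x * f x)" if f: "continuous_on (closure \<Omega>) f" for f :: "real^'n \<Rightarrow> real"
  proof -
    have "compact (closure \<Omega>)" using dom by auto
    from compact_imp_bounded[OF compact_continuous_image[OF f this]]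
    obtain M where M: "\<forall>x\<in>closure \<Omega>. \<bar>f x\<bar> \<le> M" by (auto simp: bounded_iff)
    show ?thesis
      using M closure_subset by (intro integrable_bounded_open[OF dom(1,3) continuous_on_subset[OF f closure_subset]]) blast
  qed
  have cM: "continuous_on (closure \<Omega>) (\<lambda>x. D2u x *v f x)" "continuous_on (closure \<Omega>) (\<lambda>x. D2v x *v f x)"
    if "continuous_on (closure \<Omega>) f" for f
    using that cu cv by (auto intro: continuous_on_matrix_vector)
  have c1: "continuous_on (closure \<Omega>) (\<lambda>x. (ubar - u x) * ?hs x)"
    unfolding u.hess_sq_def by (intro continuous_intros cu cM)
  have c2: "continuous_on (closure \<Omega>) ?q" by (intro continuous_intros cu cM)
  \<comment> \<open>\<open>integral\<close> is the Henstock-Kurzweil integral. On the bounded set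
    \<Omega> the integrand agrees with a function continuous on the closure, so the value is a
    Lebesgue integral.\<close>
  have "integral \<Omega> (\<lambda>x. (ubar - u x) * laplacian P x) = integral \<Omega> (\<lambda>x. (ubar - u x) * ?hs x)"
    by (intro Henstock_Kurzweil_Integration.integral_cong) (simp add: lapP)
  also have "\<dots> = (\<integral>x. indicator \<Omega> x * ((ubar - u x) * ?hs x) \<partial>lborel)"
    by (rule integral_open_eq_lborel[OF bounded_int[OF c1]])
  finally have L1: "integral \<Omega> (\<lambda>x. (ubar - u x) * laplacian P x) = \<dots>" .
  have "((mat 1 - D2v x) *v Du x) \<bullet> Du x = ?q x" for x
    by (simp add: matrix_vector_mult_diff_rdistrib)
  then have L2: "integral \<Omega> (\<lambda>x. ((mat 1 - D2v x) *v Du x) \<bullet> Du x) = (\<integral>x. indicator \<Omega> x * ?q x \<partial>lborel)"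
    using integral_open_eq_lborel[OF bounded_int[OF c2]] by simp
  let ?F = "\<lambda>x. (ubar - u x) *\<^sub>R (D2u x *v Du x - Du x) + (1/2 * (Du x \<bullet> Du x)) *\<^sub>R (Du x + Dv x)
      - (Dv x \<bullet> Du x) *\<^sub>R Du x + (N * (ubar - u x)) *\<^sub>R (Du x - Dv x)"
  have flux: "(\<integral>x. indicator \<Omega> x * ((ubar - u x) * ?hs x + ?q x) \<partial>lborel)
      = (\<integral>x. indicator (frontier \<Omega>) x * (?F x \<bullet> \<nu> x) \<partial>hausdorff_measure (DIM(real^'n) - 1))"
    by (rule flux_identity[OF d dom(3) \<nu> U V cu(1,2) cM(1) cv(1) cM(2)]) (auto intro: matrix_vector_mul_linear)
  have S: "surface_integral (frontier \<Omega>) f = (\<integral>x. indicator (frontier \<Omega>) x * f x \<partial>?H)" for f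
    by (simp add: surface_integral_def set_lebesgue_integral_def)
  define f1 where "f1 x = (ubar - u x) * ((D2u x *v Du x) \<bullet> \<nu> x)" for x
  define f2 where "f2 x = (norm (Du x))\<^sup>2 * (Du x \<bullet> \<nu> x + Dv x \<bullet> \<nu> x)" for x
  define f3 where "f3 x = (Dv x \<bullet> Du x) * (Du x \<bullet> \<nu> x)" for x
  define f4 where "f4 x = (ubar - u x) * (Du x \<bullet> \<nu> x)" for x
  define f5 where "f5 x = (ubar - u x) * (Du x \<bullet> \<nu> x - Dv x \<bullet> \<nu> x)" for x
  have fc: "frontier \<Omega> \<subseteq> closure \<Omega>" by (simp add: frontier_def)
  note cf = continuous_on_subset[OF _ fc]
  note cs = cf[OF cu(1)] cf[OF cu(2)] cf[OF cv(1)] cf[OF cM(1)[OF cu(2)]] normal_continuous[OF d dom(3) \<nu>]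
  have I: "integrable ?H (\<lambda>x. indicator (frontier \<Omega>) x * f x)" if "continuous_on (frontier \<Omega>) f" for f :: "real^'n \<Rightarrow> real"
    using integrable_frontier[OF d dom(3) \<nu> that] by simp
  \<comment> \<open>Each integrand is continuous on the compact boundary, which has finite Hausdorff
    measure. Integrability of all five is what permits splitting the flux, since the integral of a
    non-integrable function is 0 by convention.\<close>
  have i: "integrable ?H (\<lambda>x. indicator (frontier \<Omega>) x * f1 x)" "integrable ?H (\<lambda>x. indicator (frontier \<Omega>) x * f2 x)"
    "integrable ?H (\<lambda>x. indicator (frontier \<Omega>) x * f3 x)" "integrable ?H (\<lambda>x. indicator (frontier \<Omega>) x * f4 x)"
    "integrable ?H (\<lambda>x. indicator (frontier \<Omega>) x * f5 x)"
    unfolding f1_def f2_def f3_def f4_def f5_def by (intro I continuous_intros cs)+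
  have pt: "indicator (frontier \<Omega>) x * (?F x \<bullet> \<nu> x) = indicator (frontier \<Omega>) x * f1 x + 1/2 * (indicator (frontier \<Omega>) x * f2 x)
      - indicator (frontier \<Omega>) x * f3 x - indicator (frontier \<Omega>) x * f4 x + N * (indicator (frontier \<Omega>) x * f5 x)" for x
    unfolding f1_def f2_def f3_def f4_def f5_def power2_norm_eq_inner
    by (simp add: inner_add_left inner_diff_left algebra_simps)
  have "(\<integral>x. indicator (frontier \<Omega>) x * (?F x \<bullet> \<nu> x) \<partial>?H)
     = surface_integral (frontier \<Omega>) f1 + 1/2 * surface_integral (frontier \<Omega>) f2 - surface_integral (frontier \<Omega>) f3
       - surface_integral (frontier \<Omega>) f4 + N * surface_integral (frontier \<Omega>) f5"
    unfolding pt S using i by simp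
  moreover have "(\<integral>x. indicator \<Omega> x * ((ubar - u x) * ?hs x + ?q x) \<partial>lborel)
     = (\<integral>x. indicator \<Omega> x * ((ubar - u x) * ?hs x) \<partial>lborel) + (\<integral>x. indicator \<Omega> x * ?q x \<partial>lborel)"
    unfolding distrib_left by (rule Bochner_Integration.integral_add[OF bounded_int[OF c1] bounded_int[OF c2]])
  ultimately have "integral \<Omega> (\<lambda>x. (ubar - u x) * laplacian P x) + integral \<Omega> (\<lambda>x. ((mat 1 - D2v x) *v Du x) \<bullet> Du x)
     = surface_integral (frontier \<Omega>) f1 + 1/2 * surface_integral (frontier \<Omega>) f2 - surface_integral (frontier \<Omega>) f3
       - surface_integral (frontier \<Omega>) f4 + N * surface_integral (frontier \<Omega>) f5"
    using flux L1 L2 by simp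
  then show ?thesis
    unfolding Let_def P_def ubar_def N_def f1_def[abs_def] f2_def[abs_def] f3_def[abs_def] f4_def[abs_def] f5_def[abs_def] .
qed

end
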